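(* For $g=3$, the degree of the second projection $\pi_2$ for the bad component of $T_p(V)$ is $p+1$.
   Context: $K=\mathbb Q(\sqrt{-\Delta})$ is an imaginary quadratic field of class number $1$, $p$ is an odd prime inert in $K$, $g=3$, $(\mathfrak r,\mathfrak s)=(2,1)$, and $N$ is a level prime to $p$ all of whose prime divisors split in $K$. $X$ is (an irreducible component of) the Siegel modular variety of genus $3$ and level $N$, attached to $G=GSp_{6}$, the standard $h_X$, and the standard level subgroup $\mathcal K=\mathcal K_N\subset G(\mathbb A_f)$ (defined as for $\Gamma_0(N)$ in genus one, with $3\times 3$ blocks). Let $E=\mathrm{diag}(1,1,-1)$ and let $G_V=GU(2,1)$ be the group over $\mathbb Q$ of matrices $\mathfrak g=h+k\sqrt{-\Delta}$ with $\mathfrak gE\bar{\mathfrak g}^t=\lambda E$, embedded in $G$ by $\alpha(\mathfrak g)=\begin{pmatrix} h& kE\\ -\Delta Ek& EhE\end{pmatrix}$. $V\subset X$ is the (irreducible) Shimura subvariety attached to $G_V$, the standard $h_V$ and $\mathcal K_V=\mathcal K\cap\alpha(G_V(\mathbb A_f))$; its points parametrize abelian threefolds with multiplication by $O_K$. $T_p$ is the Hecke correspondence on $X$ of the double coset of $\mathrm{diag}(1,1,1,p,p,p)$: for $t\in X$ with abelian threefold $A_t$, the points of $T_p(t)$ correspond to the quotients $A_t/W$, $W$ running over the $3$-dimensional $\mathbb F_p$-subspaces of the $p$-torsion $(A_t)_p$ isotropic for the Riemann form. For $t\in V$, $(A_t)_p$ is a module over $O_K/p=\mathbb F_{p^2}$.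 The bad component of $T_p(V)$ is the component containing, for generic $t\in V$, the points of $T_p(t)$ corresponding to those $W$ with $\dim_{\mathbb F_p}(\mathbb F_{p^2}W)=4$. The restriction of $T_p$ to $V$ is a linear combination $\sum_i\rho_i T_{V,i}$ of distinct irreducible correspondences $T_{V,i}$ between $V$ and subvarieties $V_i\subset X$ (the irreducible components of $T_p(V)$). $\Gamma_{V,i}\subset V\times V_i$ is the graph of $T_{V,i}$ and $\pi_1:\Gamma_{V,i}\to V$, $\pi_2:\Gamma_{V,i}\to V_i$ are the projections. *)

theory Defs
  imports
    "HOL-Analysis.Analysis"
    "HOL-Computational_Algebra.Computational_Algebra"
    "HOL-Algebra.Ideal_Product"
begin

section \<open>The imaginary quadratic field\<close>

definition sqrt_neg :: "nat \<Rightarrow> complex" where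
  "sqrt_neg \<Delta> = \<i> * complex_of_real (sqrt (real \<Delta>))"

definition imag_quad_field :: "nat \<Rightarrow> complex set" where
  "imag_quad_field \<Delta> = {of_rat a + of_rat b * sqrt_neg \<Delta> |a b. True}"

definition ring_of_integers :: "nat \<Rightarrow> complex ring" where
  "ring_of_integers \<Delta> =
     \<lparr>carrier = {x \<in> imag_quad_field \<Delta>. algebraic_int x},
      monoid.mult = (*), one = 1, zero = 0, add = (+)\<rparr>"

definition nonzero_ideals :: "nat \<Rightarrow> complex set set" where
  "nonzero_ideals \<Delta> = {I. ideal I (ring_of_integers \<Delta>) \<and> I \<noteq> {0}}"

definition ideal_equiv :: "nat \<Rightarrow> (complex set \<times> complex set) set" where
  "ideal_equiv \<Delta> =
     {(I, J). I \<in> nonzero_ideals \<Delta> \<and> J \<in> nonzero_ideals \<Delta> \<and>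
        (\<exists>a \<in> carrier (ring_of_integers \<Delta>) - {0}. \<exists>b \<in> carrier (ring_of_integers \<Delta>) - {0}.
           (*) a ` I = (*) b ` J)}"

definition class_number :: "nat \<Rightarrow> nat" where
  "class_number \<Delta> = card (nonzero_ideals \<Delta> // ideal_equiv \<Delta>)"

definition inert_in :: "nat \<Rightarrow> nat \<Rightarrow> bool" where
  "inert_in \<Delta> p \<longleftrightarrow>
     primeideal (cgenideal (ring_of_integers \<Delta>) (of_nat p)) (ring_of_integers \<Delta>)"

definition splits_in :: "nat \<Rightarrow> nat \<Rightarrow> bool" where
  "splits_in \<Delta> l \<longleftrightarrow>
     (\<exists>P Q. primeideal P (ring_of_integers \<Delta>) \<and> primeideal Q (ring_of_integers \<Delta>) \<and> P \<noteq> Q \<and>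
        ideal_prod (ring_of_integers \<Delta>) P Q = cgenideal (ring_of_integers \<Delta>) (of_nat l))"


section \<open>Analytic subsets\<close>

class cscale =
  fixes cscale :: "complex \<Rightarrow> 'a \<Rightarrow> 'a"

instantiation complex :: cscale
begin
definition "cscale_complex c (z::complex) = c * z"
instance ..
end

instantiation vec :: (cscale, finite) cscale
begin
definition "cscale_vec c (x::'a^'b) = (\<chi> i. cscale c (x $ i))"
instance ..
end

instantiation prod :: (cscale, cscale) cscale
begin
definition "cscale_prod c (x::'a \<times> 'b) = (cscale c (fst x), cscale c (snd x))"
instance ..
end

text \<open>Holomorphy in several variables: complex-linear Frechet derivative at every point.\<close>

definition holomorphic_several ::
    "('a::{real_normed_vector,cscale} \<Rightarrow> complex) \<Rightarrow> 'a set \<Rightarrow> bool" where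
  "holomorphic_several f U \<longleftrightarrow>
     (\<forall>z\<in>U. \<exists>D. (f has_derivative D) (at z) \<and> (\<forall>c v. D (cscale c v) = c * D v))"

text \<open>
  Here \<open>M\<close> will be the Siegel upper half space (or its square), which is open in the complex
  subspace of symmetric matrices.  Taking the local equations on open sets of the space of all
  matrices gives the same subsets of \<open>M\<close> as taking them on open sets of \<open>M\<close>.  As the condition
  is imposed at all points of \<open>M\<close>, analytic subsets are closed in \<open>M\<close>.
\<close>

definition analytic_subset :: "'a::{real_normed_vector,cscale} set \<Rightarrow> 'a set \<Rightarrow> bool" where
  "analytic_subset M S \<longleftrightarrow> S \<subseteq> M \<and>
     (\<forall>z\<in>M. \<exists>U F. open U \<and> z \<in> U \<and> finite F \<and> (\<forall>f\<in>F. holomorphic_several f U) \<and>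
        S \<inter> U = {w \<in> M \<inter> U. \<forall>f\<in>F. f w = 0})"

text \<open>In the next three definitions \<open>cl\<close> is the predicate selecting the analytic subsets.\<close>

definition irreducible_set :: "('a set \<Rightarrow> bool) \<Rightarrow> 'a set \<Rightarrow> bool" where
  "irreducible_set cl S \<longleftrightarrow> cl S \<and> S \<noteq> {} \<and>
     (\<forall>A B. cl A \<longrightarrow> cl B \<longrightarrow> S = A \<union> B \<longrightarrow> S = A \<or> S = B)"

definition irreducible_component :: "('a set \<Rightarrow> bool) \<Rightarrow> 'a set \<Rightarrow> 'a set \<Rightarrow> bool" where
  "irreducible_component cl T S \<longleftrightarrow> S \<subseteq> T \<and> irreducible_set cl S \<and>
     (\<forall>S'. irreducible_set cl S' \<longrightarrow> S \<subseteq> S' \<longrightarrow> S' \<subseteq> T \<longrightarrow> S' = S)"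

text \<open>To be used for irreducible \<open>Y\<close> only.\<close>

definition generically :: "('a set \<Rightarrow> bool) \<Rightarrow> 'a set \<Rightarrow> ('a \<Rightarrow> bool) \<Rightarrow> bool" where
  "generically cl Y P \<longleftrightarrow> (\<exists>S. cl S \<and> S \<subset> Y \<and> (\<forall>y \<in> Y - S. P y))"

text \<open>
  The degree of a dominant, generically finite map \<open>f\<close> from \<open>G\<close> to an irreducible complex
  variety \<open>Y\<close>: the number of points of the general fibre.
\<close>

definition has_map_degree ::
    "('b set \<Rightarrow> bool) \<Rightarrow> ('a \<Rightarrow> 'b) \<Rightarrow> 'a set \<Rightarrow> 'b set \<Rightarrow> nat \<Rightarrow> bool" where
  "has_map_degree cl f G Y d \<longleftrightarrow> f ` G \<subseteq> Y \<and>
     generically cl Y (\<lambda>y. finite {x \<in> G. f x = y} \<and> card {x \<in> G. f x = y} = d)"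


section \<open>The Siegel modular variety of genus 3\<close>

type_synonym cmat3 = "complex^3^3"
type_synonym rmat3 = "real^3^3"
type_synonym rmat6 = "real^(3 + 3)^(3 + 3)"

definition blocks :: "rmat3 \<Rightarrow> rmat3 \<Rightarrow> rmat3 \<Rightarrow> rmat3 \<Rightarrow> rmat6" where
  "blocks A B C D =
     (\<chi> i j. case i of
        Inl i' \<Rightarrow> (case j of Inl j' \<Rightarrow> A $ i' $ j' | Inr j' \<Rightarrow> B $ i' $ j')
      | Inr i' \<Rightarrow> (case j of Inl j' \<Rightarrow> C $ i' $ j' | Inr j' \<Rightarrow> D $ i' $ j'))"

definition blockA :: "rmat6 \<Rightarrow> rmat3" where "blockA M = (\<chi> i j. M $ Inl i $ Inl j)"
definition blockB :: "rmat6 \<Rightarrow> rmat3" where "blockB M = (\<chi> i j. M $ Inl i $ Inr j)"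
definition blockC :: "rmat6 \<Rightarrow> rmat3" where "blockC M = (\<chi> i j. M $ Inr i $ Inl j)"
definition blockD :: "rmat6 \<Rightarrow> rmat3" where "blockD M = (\<chi> i j. M $ Inr i $ Inr j)"

definition symp_form :: rmat6 where
  "symp_form = blocks 0 (mat 1) (- mat 1) 0"

definition GSp_mult :: "rmat6 \<Rightarrow> real \<Rightarrow> bool" where
  "GSp_mult M c \<longleftrightarrow> c \<noteq> 0 \<and> M ** symp_form ** transpose M = c *\<^sub>R symp_form"

text \<open>
  The intersection of \<open>K\<^sub>N\<close> (integral adelic matrices with lower left block divisible by \<open>N\<close>)
  with the rational matrices of positive multiplier.  Such a multiplier is a positive unit at
  all primes, hence 1.
\<close>

definition Gamma0 :: "nat \<Rightarrow> rmat6 set" where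
  "Gamma0 N =
     {M. GSp_mult M 1 \<and> (\<forall>i j. M $ i $ j \<in> \<int>) \<and>
         (\<forall>i j. \<exists>c::int. blockC M $ i $ j = of_nat N * of_int c)}"

definition siegel_space :: "cmat3 set" where
  "siegel_space = {Z. transpose Z = Z \<and> (\<forall>x. x \<noteq> 0 \<longrightarrow> x \<bullet> (map_matrix Im Z *v x) > 0)}"

definition cblock :: "rmat3 \<Rightarrow> cmat3" where
  "cblock A = map_matrix complex_of_real A"

definition aut_factor :: "rmat6 \<Rightarrow> cmat3 \<Rightarrow> cmat3" where
  "aut_factor M Z = cblock (blockC M) ** Z + cblock (blockD M)"

definition siegel_act :: "rmat6 \<Rightarrow> cmat3 \<Rightarrow> cmat3" where
  "siegel_act M Z = (cblock (blockA M) ** Z + cblock (blockB M)) ** matrix_inv (aut_factor M Z)"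

text \<open>
  Points of the quotient of the Siegel space by \<open>Gamma0 N\<close> are the orbits.  This quotient is the
  set of complex points of the (connected) Siegel variety of level \<open>K\<^sub>N\<close>.
\<close>

definition siegel_pt :: "nat \<Rightarrow> cmat3 \<Rightarrow> cmat3 set" where
  "siegel_pt N Z = (\<lambda>M. siegel_act M Z) ` Gamma0 N"

definition siegel_var :: "nat \<Rightarrow> cmat3 set set" where
  "siegel_var N = siegel_pt N ` siegel_space"

definition analytic_X :: "nat \<Rightarrow> cmat3 set set \<Rightarrow> bool" where
  "analytic_X N S \<longleftrightarrow> S \<subseteq> siegel_var N \<and>
     analytic_subset siegel_space {Z \<in> siegel_space. siegel_pt N Z \<in> S}"

definition analytic_XX :: "nat \<Rightarrow> (cmat3 set \<times> cmat3 set) set \<Rightarrow> bool" where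
  "analytic_XX N S \<longleftrightarrow> S \<subseteq> siegel_var N \<times> siegel_var N \<and>
     analytic_subset (siegel_space \<times> siegel_space)
       {(Z, Z'). Z \<in> siegel_space \<and> Z' \<in> siegel_space \<and> (siegel_pt N Z, siegel_pt N Z') \<in> S}"


section \<open>The Shimura subvariety of GU(2,1)\<close>

definition Emat :: rmat3 where
  "Emat = (\<chi> i j. if i = j then (if i = 3 then -1 else 1) else 0)"

text \<open>
  Real points of \<open>G\<^sub>V\<close>: as the real scalar extension of \<open>K\<close> is the field of complex numbers,
  these are complex matrices \<open>g = h + k sqrt(-\<Delta>)\<close> with \<open>h\<close>, \<open>k\<close> real.
\<close>

definition GV_real :: "cmat3 set" where
  "GV_real = {g. \<exists>c::real. c \<noteq> 0 \<and>
     g ** cblock Emat ** transpose (map_matrix cnj g) = c *\<^sub>R cblock Emat}"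

definition alpha :: "nat \<Rightarrow> cmat3 \<Rightarrow> rmat6" where
  "alpha \<Delta> g =
     (let h = map_matrix Re g;
          k = (1 / sqrt (real \<Delta>)) *\<^sub>R map_matrix Im g
      in blocks h (k ** Emat) (- (real \<Delta> *\<^sub>R (Emat ** k))) (Emat ** h ** Emat))"

text \<open>
  The standard \<open>h\<^sub>V\<close> is the conjugacy class of \<open>z \<mapsto> diag(z, z, cnj z)\<close>.  For \<open>z = x + \<i> y\<close> the
  image under \<open>alpha\<close> has blocks \<open>x\<close>, \<open>y / sqrt \<Delta>\<close>, \<open>- y sqrt \<Delta>\<close>, \<open>x\<close>, whose fixed point in the
  Siegel space is the scalar matrix \<open>\<i> / sqrt \<Delta>\<close>.  The conjugacy class thus becomes the orbit of
  this point under the real points of \<open>G\<^sub>V\<close> (which form a connected group, the signature being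
  (2,1)).
\<close>

definition hV :: "nat \<Rightarrow> cmat3 set" where
  "hV \<Delta> = (\<lambda>g. siegel_act (alpha \<Delta> g) (mat (\<i> / complex_of_real (sqrt (real \<Delta>))))) ` GV_real"

definition shimura_V :: "nat \<Rightarrow> nat \<Rightarrow> cmat3 set set" where
  "shimura_V N \<Delta> = siegel_pt N ` hV \<Delta>"


section \<open>The Hecke correspondence\<close>

definition hecke_matrices :: "nat \<Rightarrow> nat \<Rightarrow> rmat6 set" where
  "hecke_matrices N p =
     {M1 ** blocks (mat 1) 0 0 (mat (real p)) ** M2 |M1 M2. M1 \<in> Gamma0 N \<and> M2 \<in> Gamma0 N}"

definition hecke_T :: "nat \<Rightarrow> nat \<Rightarrow> cmat3 set \<Rightarrow> cmat3 set set" where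
  "hecke_T N p t =
     {siegel_pt N (siegel_act M Z) |M Z.
        M \<in> hecke_matrices N p \<and> Z \<in> siegel_space \<and> siegel_pt N Z = t}"

definition hecke_image_V :: "nat \<Rightarrow> nat \<Rightarrow> nat \<Rightarrow> cmat3 set set" where
  "hecke_image_V N \<Delta> p = (\<Union>t \<in> shimura_V N \<Delta>. hecke_T N p t)"

definition hecke_graph_V :: "nat \<Rightarrow> nat \<Rightarrow> nat \<Rightarrow> (cmat3 set \<times> cmat3 set) set" where
  "hecke_graph_V N \<Delta> p = {(t, u). t \<in> shimura_V N \<Delta> \<and> u \<in> hecke_T N p t}"

text \<open>
  The abelian threefold at \<open>Z\<close> is the quotient of complex 3-space by the lattice below.  Subgroups
  of it are represented throughout by their inverse images in complex 3-space, i.e.\ by additive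
  subgroups containing the lattice.
\<close>

definition period_lattice :: "cmat3 \<Rightarrow> (complex^3) set" where
  "period_lattice Z =
     {Z *v (\<chi> i. of_int (m $ i)) + (\<chi> i. of_int (n $ i)) |(m::int^3) (n::int^3). True}"

text \<open>
  For \<open>M\<close> in \<open>hecke_matrices N p\<close>, multiplication by \<open>p\<close> times the inverse of the transposed
  automorphy factor maps the lattice of \<open>Z\<close> into that of \<open>siegel_act M Z\<close>, hence induces an isogeny
  from the abelian threefold at \<open>Z\<close> to the one at \<open>siegel_act M Z\<close>.  Its kernel is the subspace
  \<open>W\<close> of the \<open>p\<close>-torsion for which the target is the quotient by \<open>W\<close>.
\<close>

definition hecke_kernel :: "nat \<Rightarrow> rmat6 \<Rightarrow> cmat3 \<Rightarrow> (complex^3) set" where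
  "hecke_kernel p M Z =
     {x. of_nat p *s (matrix_inv (transpose (aut_factor M Z)) *v x)
           \<in> period_lattice (siegel_act M Z)}"

text \<open>
  The endomorphism \<open>sqrt(-\<Delta>)\<close> of the abelian threefold at a point \<open>Z\<close> of \<open>hV\<close>, as a linear map:
  \<open>alpha\<close> of the central element \<open>sqrt(-\<Delta>)\<close> fixes \<open>Z\<close>, and its transposed automorphy factor maps
  the lattice of \<open>Z\<close> to itself.
\<close>

definition sqrt_neg_action :: "nat \<Rightarrow> cmat3 \<Rightarrow> complex^3 \<Rightarrow> complex^3" where
  "sqrt_neg_action \<Delta> Z x = transpose (aut_factor (alpha \<Delta> (mat (sqrt_neg \<Delta>))) Z) *v x"

text \<open>
  The subspace generated by \<open>W\<close> over the integers of \<open>K\<close> modulo \<open>p\<close>: for odd \<open>p\<close> that ring consists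
  of the classes of \<open>a + b sqrt(-\<Delta>)\<close> with integers \<open>a\<close>, \<open>b\<close>.
\<close>

definition OK_span :: "nat \<Rightarrow> cmat3 \<Rightarrow> (complex^3) set \<Rightarrow> (complex^3) set" where
  "OK_span \<Delta> Z W = {x + sqrt_neg_action \<Delta> Z y |x y. x \<in> W \<and> y \<in> W}"

text \<open>
  The dimension over the prime field of a subspace of the \<open>p\<close>-torsion, i.e.\ the least size of a
  spanning set modulo the lattice.
\<close>

definition torsion_dim :: "cmat3 \<Rightarrow> (complex^3) set \<Rightarrow> nat" where
  "torsion_dim Z W =
     (LEAST n. \<exists>S. finite S \<and> card S = n \<and>
        W = {l + (\<Sum>s\<in>S. of_int (c s) *s s) |l (c :: complex^3 \<Rightarrow> int). l \<in> period_lattice Z})"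

text \<open>
  The points \<open>u\<close> of the image of \<open>t\<close> that correspond to some \<open>W\<close> generating a subspace of dimension
  4.
\<close>

definition bad_point :: "nat \<Rightarrow> nat \<Rightarrow> nat \<Rightarrow> cmat3 set \<Rightarrow> cmat3 set \<Rightarrow> bool" where
  "bad_point N \<Delta> p t u \<longleftrightarrow>
     (\<exists>Z \<in> hV \<Delta>. \<exists>M \<in> hecke_matrices N p.
        siegel_pt N Z = t \<and> siegel_pt N (siegel_act M Z) = u \<and>
        torsion_dim Z (OK_span \<Delta> Z (hecke_kernel p M Z)) = 4)"

text \<open>
  Irreducible components are taken over the complex numbers.  A bad component is required to
  contain some, not all, of the points attached to such \<open>W\<close>: if \<open>L\<close> is the largest subspace of
  \<open>W\<close> stable under \<open>sqrt(-\<Delta>)\<close>, the hermitian norms of the vectors in \<open>W\<close> outside \<open>L\<close> lie in one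
  class modulo squares of the prime field.  This class is invariant under the integral points of
  \<open>G\<^sub>V\<close> with multiplier 1, and both classes occur, so these points are spread over more than one
  complex component.
\<close>

definition bad_component :: "nat \<Rightarrow> nat \<Rightarrow> nat \<Rightarrow> cmat3 set set \<Rightarrow> bool" where
  "bad_component N \<Delta> p Y \<longleftrightarrow>
     irreducible_component (analytic_X N) (hecke_image_V N \<Delta> p) Y \<and>
     generically (analytic_X N) (shimura_V N \<Delta>) (\<lambda>t. \<exists>u \<in> Y. bad_point N \<Delta> p t u)"

definition graph_over ::
    "nat \<Rightarrow> nat \<Rightarrow> nat \<Rightarrow> cmat3 set set \<Rightarrow> (cmat3 set \<times> cmat3 set) set \<Rightarrow> bool" where
  "graph_over N \<Delta> p Y G \<longleftrightarrow>
     irreducible_component (analytic_XX N) (hecke_graph_V N \<Delta> p) G \<and> snd ` G = Y"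

end

theory Submission imports Defs "HOL-Complex_Analysis.Complex_Analysis"
begin

text \<open>
  Integral row vectors carry the whole argument.  The isomorphism \<open>perm Z\<close> identifies them with the
  period lattice of \<open>Z\<close>; the Riemann form becomes the standard symplectic form \<open>om\<close>, multiplication by
  \<open>sqrt(-\<Delta>)\<close> becomes right multiplication by \<open>J = Jm \<Delta>\<close>, and the subspace \<open>W\<close> of a Hecke matrix \<open>M\<close>
  becomes the lattice \<open>lat M\<close> spanned by the rows of \<open>M\<close>, taken modulo \<open>p\<close>.

  The space \<open>hV \<Delta>\<close> is the fixed locus of \<open>J\<close> in the Siegel space (\<open>hV_eq\<close>) and a
  holomorphic image of a two-dimensional ball.  The image of \<open>V\<close> under \<open>T\<^sub>p\<close> is the union of the pieces
  \<open>full_piece N \<Delta> M\<close>, the images of \<open>hV \<Delta>\<close> under the Hecke matrices \<open>M\<close>.  There are finitely many of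
  them, each is irreducible by the identity theorem, and none is properly contained in another; so
  they are exactly the components, and the same holds for the graph (\<open>hecke_image_components\<close>,
  \<open>hecke_graph_components\<close>).  All comparisons of pieces use one principle: if the ball is covered by
  fixed loci of integral matrices of bounded multiplier, this family is locally finite
  (\<open>proper_discontinuity\<close>), so that one of the loci contains the ball (\<open>Vset_cover\<close>); and if a conjugate
  of \<open>J\<close> by \<open>g\<close> fixes the ball pointwise, then \<open>g\<close> commutes with \<open>J\<close> (\<open>normalizer_commutes\<close>).

  If \<open>W\<close> generates a subspace of dimension 4 over the integers of \<open>K\<close>, then \<open>lat M\<close>
  contains a vector \<open>y\<close>, nonzero modulo \<open>p\<close>, together with \<open>y v* J\<close>; this is \<open>bad_stable_vector\<close>.  By the principle
  above a bad component is the piece of some \<open>M\<close> with such a vector, and the property passes to all \<open>M\<close>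
  with the same piece (\<open>bad_component_stable\<close>, \<open>stable_vector_transfer\<close>).  An explicit matrix shows that
  bad components exist (\<open>bad_component_exists\<close>).

  Let \<open>Z\<close> be a point of the ball without additional endomorphisms of bounded degree.  The
  points of the graph of \<open>M\<close> above the class of \<open>M Z\<close> come from the points \<open>g Z\<close>, where \<open>g\<close> commutes with
  \<open>J\<close> and \<open>M g\<close> lies in \<open>\<Gamma> M\<close>.  Two such points of \<open>V\<close> agree if and only if the lattices \<open>lat g\<close> do, because
  elements of norm one of \<open>K\<close> that are integral away from the inert prime \<open>p\<close> are integral.  So the
  degree is the number of these lattices (\<open>fibre_description\<close>).  They are stable under \<open>J\<close>, self-dual, and
  lie between \<open>lat M\<close> and \<open>(1/p) lat M\<close>.  Such a lattice contains \<open>lat M + (lat M) J\<close> and is contained in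
  its dual, which is \<open>1/p\<close> times the largest sublattice of \<open>lat M\<close> stable under \<open>J\<close>.  For bad \<open>M\<close> the
  quotient of these two lattices is a hyperbolic plane for a hermitian form over the field with
  \<open>p\<^sup>2\<close> elements.  The lattices correspond to its isotropic lines, of which there are \<open>p + 1\<close>.  All of
  these lines occur: they are permuted transitively by hermitian transvections, and these can be
  chosen congruent to 1 modulo \<open>N\<close>, as \<open>N\<close> is prime to \<open>p\<close> (\<open>card_lattices\<close>).
\<close>

(* the dollar sign selects the entries of vectors and matrices throughout *)
no_notation fps_nth (infixl "$" 75)

abbreviation cm :: "real^'n^'m \<Rightarrow> complex^'n^'m" where
  "cm \<equiv> map_matrix complex_of_real"

lemma sum_UNIV_sum:
  fixes f :: "'a::finite + 'b::finite \<Rightarrow> 'c::comm_monoid_add"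
  shows "(\<Sum>i\<in>UNIV. f i) = (\<Sum>i\<in>UNIV. f (Inl i)) + (\<Sum>i\<in>UNIV. f (Inr i))"
  by (simp add: UNIV_Plus_UNIV[symmetric] sum.Plus del: UNIV_Plus_UNIV)

lemma sum_type_all: "(\<forall>i::'a+'b. P i) \<longleftrightarrow> (\<forall>i. P (Inl i)) \<and> (\<forall>i. P (Inr i))"
  by (metis sum.exhaust)

lemma scaleR_mmult_left: "(c *\<^sub>R A) ** B = c *\<^sub>R (A ** (B::'a::real_algebra_1^'n^'m))"
  by (simp add: matrix_matrix_mult_def vec_eq_iff scaleR_sum_right)
lemma scaleR_mmult_right: "A ** (c *\<^sub>R B) = c *\<^sub>R (A ** (B::'a::real_algebra_1^'n^'m))"
  by (simp add: matrix_matrix_mult_def vec_eq_iff scaleR_sum_right)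
lemma minus_mmult_left: "(- A) ** B = - (A ** (B::'a::ring_1^'n^'m))"
  by (simp add: matrix_matrix_mult_def vec_eq_iff sum_negf)
lemma minus_mmult_right: "A ** (- B) = - (A ** (B::'a::ring_1^'n^'m))"
  by (simp add: matrix_matrix_mult_def vec_eq_iff sum_negf)
lemma diff_mmult_left: "(A - C) ** B = A ** B - C ** (B::'a::ring_1^'n^'m)"
  by (simp add: matrix_matrix_mult_def vec_eq_iff sum_subtractf algebra_simps)
lemma diff_mmult_right: "B ** (A - C) = B ** A - B ** (C::'a::ring_1^'n^'m)"
  by (simp add: matrix_matrix_mult_def vec_eq_iff sum_subtractf algebra_simps)
lemma add_mmult_left: "(A + C) ** B = A ** B + C ** (B::'a::semiring_1^'n^'m)"
  by (simp add: matrix_matrix_mult_def vec_eq_iff sum.distrib algebra_simps)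
lemma zero_mmult_left [simp]: "0 ** B = (0::'a::semiring_1^'n^'m)"
  by (simp add: matrix_matrix_mult_def vec_eq_iff)
lemma zero_mmult_right [simp]: "B ** 0 = (0::'a::semiring_1^'n^'m)"
  by (simp add: matrix_matrix_mult_def vec_eq_iff)
lemmas mmult_simps = scaleR_mmult_left scaleR_mmult_right minus_mmult_left minus_mmult_right
  diff_mmult_left diff_mmult_right matrix_add_ldistrib add_mmult_left

lemma transpose_arith [simp]:
  "transpose (A + B) = transpose A + transpose (B::'a::ab_group_add^'n^'m)"
  "transpose (- A) = - transpose A"
  "transpose (A - B) = transpose A - transpose B"
  "transpose (0::'a^'n^'m) = 0"
  by (simp_all add: transpose_def vec_eq_iff)
lemma transpose_scaleR [simp]: "transpose (c *\<^sub>R A) = c *\<^sub>R transpose (A::'a::real_vector^'n^'m)"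
  by (simp add: transpose_def vec_eq_iff)

lemma cm_mult: "cm (A ** B) = cm A ** cm B"
  by (simp add: matrix_matrix_mult_def vec_eq_iff)
lemma cm_arith [simp]: "cm (A + B) = cm A + cm B" "cm (- A) = - cm A" "cm (A - B) = cm A - cm B"
  "cm (c *\<^sub>R A) = c *\<^sub>R cm A" "cm 0 = 0" "cm (mat r) = mat (complex_of_real r)"
  "cm (transpose A) = transpose (cm A)"
  by (simp_all add: vec_eq_iff mat_def transpose_def scaleR_conv_of_real[where 'a=complex])
section \<open>Block matrices and symplectic similitudes\<close>

lemma blocks_sel [simp]: "blockA (blocks A B C D) = A" "blockB (blocks A B C D) = B"
  "blockC (blocks A B C D) = C" "blockD (blocks A B C D) = D"
  by (simp_all add: blockA_def blockB_def blockC_def blockD_def blocks_def vec_eq_iff)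

lemma blocks_nth [simp]: "blocks A B C D $ Inl i $ Inl j = A $ i $ j"
  "blocks A B C D $ Inl i $ Inr j = B $ i $ j"
  "blocks A B C D $ Inr i $ Inl j = C $ i $ j"
  "blocks A B C D $ Inr i $ Inr j = D $ i $ j"
  by (simp_all add: blocks_def)

lemma blocks_eqI: "blockA M = blockA M' \<Longrightarrow> blockB M = blockB M' \<Longrightarrow> blockC M = blockC M' \<Longrightarrow>
   blockD M = blockD M' \<Longrightarrow> M = M'"
  by (simp add: blockA_def blockB_def blockC_def blockD_def vec_eq_iff sum_type_all)

lemma block_mult:
  "blockA (M ** M') = blockA M ** blockA M' + blockB M ** blockC M'"
  "blockB (M ** M') = blockA M ** blockB M' + blockB M ** blockD M'"
  "blockC (M ** M') = blockC M ** blockA M' + blockD M ** blockC M'"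
  "blockD (M ** M') = blockC M ** blockB M' + blockD M ** blockD M'"
  by (simp_all add: blockA_def blockB_def blockC_def blockD_def vec_eq_iff matrix_matrix_mult_def
      sum_UNIV_sum)

lemma blocks_mult: "blocks A B C D ** blocks A' B' C' D' =
   blocks (A ** A' + B ** C') (A ** B' + B ** D') (C ** A' + D ** C') (C ** B' + D ** D')"
  by (rule blocks_eqI) (simp_all add: block_mult)

lemma block_arith [simp]:
  "blockA (M + M') = blockA M + blockA M'" "blockB (M + M') = blockB M + blockB M'"
  "blockC (M + M') = blockC M + blockC M'" "blockD (M + M') = blockD M + blockD M'"
  "blockA (c *\<^sub>R M) = c *\<^sub>R blockA M" "blockB (c *\<^sub>R M) = c *\<^sub>R blockB M"
  "blockC (c *\<^sub>R M) = c *\<^sub>R blockC M" "blockD (c *\<^sub>R M) = c *\<^sub>R blockD M"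
  "blockA (- M) = - blockA M" "blockB (- M) = - blockB M"
  "blockC (- M) = - blockC M" "blockD (- M) = - blockD M"
  "blockA (mat r) = mat r" "blockB (mat r) = 0" "blockC (mat r) = 0" "blockD (mat r) = mat r"
  "blockA (transpose M) = transpose (blockA M)" "blockB (transpose M) = transpose (blockC M)"
  "blockC (transpose M) = transpose (blockB M)" "blockD (transpose M) = transpose (blockD M)"
  by (simp_all add: blockA_def blockB_def blockC_def blockD_def vec_eq_iff mat_def transpose_def)

lemma symp_form_sel [simp]: "blockA symp_form = 0" "blockB symp_form = mat 1"
  "blockC symp_form = - mat 1" "blockD symp_form = 0"
  by (simp_all add: symp_form_def)

text \<open>
  The adjoint for the symplectic form.  It inverts a symplectic similitude up to the multiplier, and
  unlike the inverse it keeps integral matrices integral.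
\<close>
definition adj :: "rmat6 \<Rightarrow> rmat6" where
  "adj M = blocks (transpose (blockD M)) (- transpose (blockB M))
                  (- transpose (blockC M)) (transpose (blockA M))"

lemma adj_sel [simp]: "blockA (adj M) = transpose (blockD M)" "blockB (adj M) = - transpose (blockB M)"
  "blockC (adj M) = - transpose (blockC M)" "blockD (adj M) = transpose (blockA M)"
  by (simp_all add: adj_def)

lemma adj_conv_form: "adj M = - (symp_form ** transpose M ** symp_form)"
  by (rule blocks_eqI) (simp_all add: block_mult mmult_simps)

lemma symp_form_square: "symp_form ** symp_form = - mat 1"
  by (rule blocks_eqI) (simp_all add: block_mult mmult_simps)

lemma adj_mult: "adj (M ** M') = adj M' ** adj M"
  by (rule blocks_eqI) (simp_all add: block_mult mmult_simps matrix_transpose_mul)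

lemma adj_adj [simp]: "adj (adj M) = M"
  by (rule blocks_eqI) simp_all

lemma adj_scaleR [simp]: "adj (c *\<^sub>R M) = c *\<^sub>R adj M"
  by (rule blocks_eqI) simp_all

lemma adj_mat [simp]: "adj (mat r) = mat r"
  by (rule blocks_eqI) simp_all

definition psim :: "real \<Rightarrow> rmat6 \<Rightarrow> bool" where
  "psim c M \<longleftrightarrow> c > 0 \<and> M ** adj M = c *\<^sub>R mat 1"

lemma GSp_mult_psim: "c > 0 \<Longrightarrow> GSp_mult M c \<longleftrightarrow> psim c M"
proof -
  assume c: "c > 0"
  have "M ** adj M = - (M ** symp_form ** transpose M) ** symp_form"
    by (simp add: adj_conv_form mmult_simps matrix_mul_assoc)
  moreover have "X = c *\<^sub>R symp_form \<longleftrightarrow> - X ** symp_form = c *\<^sub>R mat 1" for X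
  proof
    assume "X = c *\<^sub>R symp_form" then show "- X ** symp_form = c *\<^sub>R mat 1"
      by (simp add: mmult_simps symp_form_square)
  next
    assume "- X ** symp_form = c *\<^sub>R mat 1"
    then have "- X ** symp_form ** symp_form = c *\<^sub>R symp_form" by (simp add: mmult_simps)
    then show "X = c *\<^sub>R symp_form"
      by (simp add: mmult_simps symp_form_square matrix_mul_assoc[symmetric])
  qed
  ultimately show ?thesis using c by (simp add: GSp_mult_def psim_def)
qed

lemma psim_left: assumes "psim c M" shows "adj M ** M = c *\<^sub>R mat 1"
proof -
  have "M ** ((1/c) *\<^sub>R adj M) = mat 1" using assms by (simp add: psim_def mmult_simps)
  then have "((1/c) *\<^sub>R adj M) ** M = mat 1" by (simp add: matrix_left_right_inverse)
  then have "c *\<^sub>R (((1/c) *\<^sub>R adj M) ** M) = c *\<^sub>R mat 1" by simp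
  then show ?thesis using assms by (simp add: psim_def mmult_simps)
qed

lemma psim_right: "psim c M \<Longrightarrow> M ** adj M = c *\<^sub>R mat 1"
  and psim_pos: "psim c M \<Longrightarrow> c > 0"
  by (simp_all add: psim_def)

lemma psim_adj [simp]: "psim c (adj M) \<longleftrightarrow> psim c M"
  using psim_left[of c M] psim_left[of c "adj M"] by (auto simp: psim_def)

lemma psim_mult: assumes "psim c M" "psim d M'" shows "psim (c * d) (M ** M')"
proof -
  have "(M ** M') ** adj (M ** M') = M ** (M' ** adj M') ** adj M"
    by (simp add: adj_mult matrix_mul_assoc)
  then show ?thesis using assms by (simp add: psim_def mmult_simps)
qed

lemma psim_mat1 [simp]: "psim 1 (mat 1)"
  by (simp add: psim_def)

lemma psim_scaleR: assumes "psim c M" "r \<noteq> 0" shows "psim (r * r * c) (r *\<^sub>R M)"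
  using assms by (auto simp: psim_def mmult_simps zero_less_mult_iff)

lemma psim_form: assumes "psim c M" shows "transpose M ** symp_form ** M = c *\<^sub>R symp_form"
proof -
  have "symp_form ** (adj M ** M) = c *\<^sub>R symp_form" by (simp add: psim_left[OF assms] mmult_simps)
  moreover have "symp_form ** (adj M ** M) = (- symp_form ** symp_form) ** transpose M ** symp_form ** M"
    by (simp add: adj_conv_form mmult_simps matrix_mul_assoc)
  ultimately show ?thesis by (simp add: mmult_simps symp_form_square)
qed

section \<open>The action on the Siegel space\<close>

definition ctr :: "complex^'n^'m \<Rightarrow> complex^'m^'n" where "ctr A = transpose (map_matrix cnj A)"

lemma ctr_mult: "ctr (A ** B) = ctr B ** ctr A"
  by (simp add: ctr_def matrix_matrix_mult_def transpose_def vec_eq_iff mult.commute)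

lemma ctr_cm: "ctr (cm A) = cm (transpose A)"
  by (simp add: ctr_def transpose_def vec_eq_iff)

definition cdot :: "complex^'n \<Rightarrow> complex^'n \<Rightarrow> complex" where
  "cdot x y = (\<Sum>i\<in>UNIV. cnj (x $ i) * y $ i)"

lemma cdot_ctr: "cdot x (ctr A *v y) = cdot (A *v x) y"
  unfolding cdot_def ctr_def matrix_vector_mult_def transpose_def
  by (simp add: sum_distrib_left sum_distrib_right, subst sum.swap) (simp add: mult_ac)

lemma cdot_commute: "cdot y x = cnj (cdot x y)"
  by (simp add: cdot_def mult.commute)

lemma cdot_arith: "cdot x (y + z) = cdot x y + cdot x z" "cdot x (y - z) = cdot x y - cdot x z"
  "cdot x (- y) = - cdot x y" "cdot x 0 = 0" "cdot 0 x = 0" "cdot x (r *\<^sub>R y) = r *\<^sub>R cdot x y"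
  "cdot x (c *s y) = c * cdot x y" "cdot (c *s x) y = cnj c * cdot x y"
  "cdot (x + z) y = cdot x y + cdot z y" "cdot (x - z) y = cdot x y - cdot z y" "cdot (-x) y = - cdot x y"
  by (simp_all add: cdot_def sum.distrib sum_subtractf sum_negf algebra_simps scaleR_sum_right
      sum_distrib_left vector_scalar_mult_def)

text \<open>
  The imaginary part of the hermitian form of \<open>Z\<close>; by \<open>siegel_iff\<close> it is positive definite
  exactly on the Siegel space.
\<close>
definition hpos :: "cmat3 \<Rightarrow> complex^3 \<Rightarrow> real" where "hpos Z x = Im (cdot x (Z *v x))"

lemma hpos_diff: "cdot x ((ctr Z - Z) *v x) = - 2 * \<i> * complex_of_real (hpos Z x)"
proof -
  have "cdot x ((ctr Z - Z) *v x) = cdot (Z *v x) x - cdot x (Z *v x)"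
    by (simp add: matrix_vector_mult_diff_rdistrib cdot_arith cdot_ctr)
  also have "cdot (Z *v x) x = cnj (cdot x (Z *v x))" by (rule cdot_commute)
  finally show ?thesis by (simp add: hpos_def complex_eq_iff)
qed

lemma hpos_split:
  assumes "transpose Z = Z"
  shows "hpos Z x = (\<chi> i. Re (x $ i)) \<bullet> (map_matrix Im Z *v (\<chi> i. Re (x $ i)))
                  + (\<chi> i. Im (x $ i)) \<bullet> (map_matrix Im Z *v (\<chi> i. Im (x $ i)))"
proof -
  have s: "Z $ i $ j = Z $ j $ i" for i j
    using arg_cong[OF assms, of "\<lambda>A. A $ j $ i"] by (simp add: transpose_def)
  define T where "T = (\<Sum>i\<in>UNIV. \<Sum>j\<in>UNIV. (Re (x $ i) * Im (x $ j) - Im (x $ i) * Re (x $ j)) * Re (Z $ i $ j))"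
  have "T = (\<Sum>j\<in>UNIV. \<Sum>i\<in>UNIV. (Re (x $ i) * Im (x $ j) - Im (x $ i) * Re (x $ j)) * Re (Z $ i $ j))"
    unfolding T_def by (rule sum.swap)
  also have "\<dots> = - T" unfolding T_def sum_negf[symmetric]
    by (intro sum.cong refl) (simp add: s algebra_simps)
  finally have T: "T = 0" by simp
  have "hpos Z x = (\<Sum>i\<in>UNIV. \<Sum>j\<in>UNIV. Re (x $ i) * (Im (Z $ i $ j) * Re (x $ j)))
      + (\<Sum>i\<in>UNIV. \<Sum>j\<in>UNIV. Im (x $ i) * (Im (Z $ i $ j) * Im (x $ j))) + T"
    unfolding T_def sum.distrib[symmetric] hpos_def cdot_def matrix_vector_mult_def
    by (simp add: sum_distrib_left) (intro sum.cong refl, simp add: algebra_simps)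
  then show ?thesis
    by (simp add: T inner_vec_def matrix_vector_mult_def sum_distrib_left)
qed

lemma siegel_iff: "Z \<in> siegel_space \<longleftrightarrow> transpose Z = Z \<and> (\<forall>x. x \<noteq> 0 \<longrightarrow> hpos Z x > 0)"
proof
  assume Z: "Z \<in> siegel_space"
  then have t: "transpose Z = Z" and p: "\<And>x. x \<noteq> 0 \<Longrightarrow> x \<bullet> (map_matrix Im Z *v x) > 0"
    by (auto simp: siegel_space_def)
  have p0: "x \<bullet> (map_matrix Im Z *v x) \<ge> 0" for x using p[of x] by (cases "x = 0") auto
  have "hpos Z x > 0" if "x \<noteq> 0" for x
  proof -
    have "(\<chi> i. Re (x $ i)) \<noteq> 0 \<or> (\<chi> i. Im (x $ i)) \<noteq> 0"
      using that by (simp add: vec_eq_iff complex_eq_iff) blast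
    then show ?thesis unfolding hpos_split[OF t] using p p0
      by (meson add_nonneg_pos add_pos_nonneg)
  qed
  with t show "transpose Z = Z \<and> (\<forall>x. x \<noteq> 0 \<longrightarrow> hpos Z x > 0)" by blast
next
  assume a: "transpose Z = Z \<and> (\<forall>x. x \<noteq> 0 \<longrightarrow> hpos Z x > 0)"
  have "x \<bullet> (map_matrix Im Z *v x) > 0" if "x \<noteq> 0" for x
  proof -
    define y where "y = (\<chi> i. complex_of_real (x $ i))"
    have "y \<noteq> 0" using that by (auto simp: y_def vec_eq_iff)
    then have "hpos Z y > 0" using a by blast
    moreover have "(\<chi> i. Re (y $ i)) = x" "(\<chi> i. Im (y $ i)) = 0" by (simp_all add: y_def vec_eq_iff)
    ultimately show ?thesis using hpos_split[of Z y] a by simp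
  qed
  then show "Z \<in> siegel_space" using a by (simp add: siegel_space_def)
qed

text \<open>
  The matrix \<open>Z\<close> stacked on the identity.  The action becomes multiplication from the left, up
  to the automorphy factor on the right (\<open>moves_col\<close>).
\<close>
definition colm :: "cmat3 \<Rightarrow> complex^3^(3+3)" where
  "colm Z = (\<chi> i. case i of Inl a \<Rightarrow> Z $ a | Inr a \<Rightarrow> mat 1 $ a)"

definition upm :: "complex^3^(3+3) \<Rightarrow> cmat3" where "upm X = (\<chi> i. X $ Inl i)"
definition lom :: "complex^3^(3+3) \<Rightarrow> cmat3" where "lom X = (\<chi> i. X $ Inr i)"

lemma colm_sel [simp]: "upm (colm Z) = Z" "lom (colm Z) = mat 1"
  by (simp_all add: upm_def lom_def colm_def vec_eq_iff)

lemma up_lo_mult [simp]: "upm (X ** Q) = upm X ** Q" "lom (X ** Q) = lom X ** Q"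
  by (simp_all add: upm_def lom_def matrix_matrix_mult_def vec_eq_iff)

lemma up_lo_eqI: "upm X = upm Y \<Longrightarrow> lom X = lom Y \<Longrightarrow> X = Y"
  by (simp add: upm_def lom_def vec_eq_iff sum_type_all)

lemma up_lo_col: "upm (cm M ** colm Z) = cblock (blockA M) ** Z + cblock (blockB M)"
  "lom (cm M ** colm Z) = aut_factor M Z"
  by (simp_all add: upm_def lom_def aut_factor_def cblock_def colm_def blockA_def blockB_def blockC_def
      blockD_def matrix_matrix_mult_def vec_eq_iff sum_UNIV_sum mat_def if_distrib[of "\<lambda>x. _ * x"] cong: if_cong)

text \<open>
  The equation saying that \<open>M\<close> maps \<open>Z\<close> to \<open>Z'\<close>, with its denominator cleared: it is
  polynomial in \<open>Z\<close> and \<open>Z'\<close>, and it does not change when \<open>M\<close> is multiplied by a scalar.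
\<close>
definition moves :: "rmat6 \<Rightarrow> cmat3 \<Rightarrow> cmat3 \<Rightarrow> bool" where
  "moves M Z Z' \<longleftrightarrow> cblock (blockA M) ** Z + cblock (blockB M) = Z' ** aut_factor M Z"

lemma moves_col: "moves M Z Z' \<longleftrightarrow> cm M ** colm Z = colm Z' ** aut_factor M Z"
proof
  assume "moves M Z Z'" then show "cm M ** colm Z = colm Z' ** aut_factor M Z"
    by (intro up_lo_eqI) (simp_all add: up_lo_col moves_def)
next
  assume "cm M ** colm Z = colm Z' ** aut_factor M Z"
  from arg_cong[OF this, of upm] show "moves M Z Z'" by (simp add: up_lo_col moves_def)
qed

lemma moves_comp:
  assumes "moves M Z Z'" "moves M' Z' Z''"
  shows "moves (M' ** M) Z Z''" "aut_factor (M' ** M) Z = aut_factor M' Z' ** aut_factor M Z"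
proof -
  have e: "cm (M' ** M) ** colm Z = colm Z'' ** (aut_factor M' Z' ** aut_factor M Z)"
  proof -
    have "cm (M' ** M) ** colm Z = cm M' ** (cm M ** colm Z)" by (simp add: cm_mult matrix_mul_assoc)
    also have "\<dots> = (cm M' ** colm Z') ** aut_factor M Z"
      using assms(1) by (simp add: moves_col matrix_mul_assoc)
    also have "\<dots> = colm Z'' ** (aut_factor M' Z' ** aut_factor M Z)"
      using assms(2) by (simp add: moves_col matrix_mul_assoc)
    finally show ?thesis .
  qed
  from arg_cong[OF e, of lom] show f: "aut_factor (M' ** M) Z = aut_factor M' Z' ** aut_factor M Z"
    by (simp add: up_lo_col)
  show "moves (M' ** M) Z Z''" using e f by (simp add: moves_col)
qed

lemma aut_factor_scaleR: "aut_factor (c *\<^sub>R M) Z = c *\<^sub>R aut_factor M Z"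
  by (simp add: aut_factor_def cblock_def mmult_simps scaleR_add_right)

lemma moves_scaleR: "c \<noteq> 0 \<Longrightarrow> moves (c *\<^sub>R M) Z Z' \<longleftrightarrow> moves M Z Z'"
  unfolding moves_def aut_factor_scaleR
  by (simp add: cblock_def mmult_simps flip: scaleR_add_right)

lemma aut_factor_mat1 [simp]: "aut_factor (mat 1) Z = mat 1"
  by (simp add: aut_factor_def cblock_def)

lemma moves_mat1 [simp]: "moves (mat 1) Z Z' \<longleftrightarrow> Z = Z'"
  by (simp add: moves_def cblock_def)

lemma form_mult_col: "cm symp_form ** X = (\<chi> i. case i of Inl a \<Rightarrow> lom X $ a | Inr a \<Rightarrow> - upm X $ a)"
  by (simp add: matrix_matrix_mult_def vec_eq_iff sum_type_all sum_UNIV_sum upm_def lom_def symp_form_def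
      mat_def if_distrib[of "\<lambda>x. x * _"] if_distrib[of complex_of_real] sum_negf cong: if_cong)

lemma form_col: "ctr X ** cm symp_form ** X = ctr (upm X) ** lom X - ctr (lom X) ** upm X"
  "transpose X ** cm symp_form ** X = transpose (upm X) ** lom X - transpose (lom X) ** upm X"
  unfolding matrix_mul_assoc[symmetric] form_mult_col
  by (simp_all add: ctr_def upm_def lom_def matrix_matrix_mult_def vec_eq_iff sum_UNIV_sum transpose_def sum_negf)

lemma ctr_mat1 [simp]: "ctr (mat 1) = mat 1"
  by (simp add: ctr_def vec_eq_iff transpose_def mat_def)

text \<open>
  The identity that defines similitudes, evaluated on the columns of \<open>colm Z\<close>.  Invertibility of the
  automorphy factor and both properties of the image point, symmetry and positivity, follow from it.
\<close>
lemma psim_form_col: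
  fixes Z :: cmat3
  assumes "psim c M"
  defines "P \<equiv> upm (cm M ** colm Z)" and "Q \<equiv> aut_factor M Z"
  shows "ctr P ** Q - ctr Q ** P = c *\<^sub>R (ctr Z - Z)"
    "transpose P ** Q - transpose Q ** P = c *\<^sub>R (transpose Z - Z)"
proof -
  let ?X = "cm M ** colm Z"
  have m: "cm (transpose M) ** cm symp_form ** cm M = c *\<^sub>R cm symp_form"
    using arg_cong[OF psim_form[OF assms(1)], of cm] by (simp add: cm_mult)
  have "ctr ?X ** cm symp_form ** ?X = ctr (colm Z) ** (cm (transpose M) ** cm symp_form ** cm M) ** colm Z"
    by (simp add: ctr_mult ctr_cm matrix_mul_assoc)
  also have "\<dots> = c *\<^sub>R (ctr (colm Z) ** cm symp_form ** colm Z)"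
    by (simp only: m) (simp add: mmult_simps)
  finally show "ctr P ** Q - ctr Q ** P = c *\<^sub>R (ctr Z - Z)"
    by (simp add: form_col up_lo_col P_def Q_def)
  have "transpose ?X ** cm symp_form ** ?X
      = transpose (colm Z) ** (cm (transpose M) ** cm symp_form ** cm M) ** colm Z"
    by (simp add: matrix_transpose_mul matrix_mul_assoc)
  also have "\<dots> = c *\<^sub>R (transpose (colm Z) ** cm symp_form ** colm Z)"
    by (simp only: m) (simp add: mmult_simps)
  finally show "transpose P ** Q - transpose Q ** P = c *\<^sub>R (transpose Z - Z)"
    by (simp add: form_col up_lo_col P_def Q_def)
qed

lemma scaleR_mv: "(c *\<^sub>R A) *v x = c *\<^sub>R (A *v (x::complex^'n))"
  by (simp add: matrix_vector_mult_def vec_eq_iff scaleR_sum_right)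

text \<open>
  By \<open>psim_form_col\<close>, the form \<open>hpos Z\<close> vanishes at a vector in the kernel of the automorphy factor.
\<close>
lemma aut_factor_invertible:
  assumes "psim c M" "Z \<in> siegel_space"
  shows "invertible (aut_factor M Z)"
proof -
  let ?Q = "aut_factor M Z" let ?P = "upm (cm M ** colm Z)"
  have "x = 0" if "?Q *v x = 0" for x
  proof (rule ccontr)
    assume "x \<noteq> 0"
    then have h: "hpos Z x > 0" using assms(2) by (simp add: siegel_iff)
    have "cdot x ((ctr ?P ** ?Q - ctr ?Q ** ?P) *v x) = 0"
      by (simp add: matrix_vector_mult_diff_rdistrib matrix_vector_mul_assoc[symmetric] that cdot_arith cdot_ctr)
    then have "c *\<^sub>R cdot x ((ctr Z - Z) *v x) = 0"
      unfolding psim_form_col[OF assms(1)] by (simp add: scaleR_mv cdot_arith)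
    then show False using h psim_pos[OF assms(1)] unfolding hpos_diff by simp
  qed
  then show ?thesis by (simp add: invertible_left_inverse matrix_left_invertible_ker)
qed

lemma hpos_moves:
  assumes "psim c M" "moves M Z Z'"
  shows "hpos Z' (aut_factor M Z *v x) = c * hpos Z x"
proof -
  let ?Q = "aut_factor M Z" let ?P = "upm (cm M ** colm Z)"
  have P: "?P = Z' ** ?Q" using assms(2) by (simp add: up_lo_col moves_def)
  have "ctr ?P ** ?Q - ctr ?Q ** ?P = ctr ?Q ** (ctr Z' - Z') ** ?Q"
    by (simp add: P ctr_mult mmult_simps matrix_mul_assoc)
  then have "ctr ?Q ** (ctr Z' - Z') ** ?Q = c *\<^sub>R (ctr Z - Z)" by (simp add: psim_form_col[OF assms(1)])
  then have "cdot x ((ctr ?Q ** (ctr Z' - Z') ** ?Q) *v x) = c *\<^sub>R cdot x ((ctr Z - Z) *v x)"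
    by (simp add: scaleR_mv cdot_arith)
  moreover have "cdot x ((ctr ?Q ** (ctr Z' - Z') ** ?Q) *v x) = cdot (?Q *v x) ((ctr Z' - Z') *v (?Q *v x))"
    by (simp add: matrix_vector_mul_assoc[symmetric] cdot_ctr)
  ultimately show ?thesis unfolding hpos_diff by (simp add: complex_eq_iff)
qed

lemma matrix_inv_mult: assumes "invertible (A::complex^'n^'n)"
  shows "A ** matrix_inv A = mat 1" "matrix_inv A ** A = mat 1"
  using someI_ex[OF assms[unfolded invertible_def]] unfolding matrix_inv_def by blast+

lemma moves_siegel:
  assumes "psim c M" "Z \<in> siegel_space" "moves M Z Z'"
  shows "Z' \<in> siegel_space"
proof -
  let ?Q = "aut_factor M Z" let ?P = "upm (cm M ** colm Z)"
  note inv = matrix_inv_mult[OF aut_factor_invertible[OF assms(1,2)]]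
  have P: "?P = Z' ** ?Q" using assms(3) by (simp add: up_lo_col moves_def)
  have "transpose ?Q ** (transpose Z' - Z') ** ?Q = transpose ?P ** ?Q - transpose ?Q ** ?P"
    by (simp add: P matrix_transpose_mul mmult_simps matrix_mul_assoc)
  also have "\<dots> = 0" using assms(2) by (simp add: psim_form_col[OF assms(1)] siegel_iff)
  finally have "transpose ?Q ** (transpose Z' - Z') ** ?Q = 0" .
  then have "transpose (matrix_inv ?Q) ** (transpose ?Q ** (transpose Z' - Z') ** ?Q) ** matrix_inv ?Q = 0"
    by simp
  moreover have "transpose (matrix_inv ?Q) ** (transpose ?Q ** (transpose Z' - Z') ** ?Q) ** matrix_inv ?Q
     = transpose (?Q ** matrix_inv ?Q) ** (transpose Z' - Z') ** (?Q ** matrix_inv ?Q)"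
    by (simp add: matrix_transpose_mul matrix_mul_assoc)
  ultimately have "transpose Z' = Z'" using inv by simp
  moreover have "hpos Z' x > 0" if "x \<noteq> 0" for x
  proof -
    let ?y = "matrix_inv ?Q *v x"
    have x: "x = ?Q *v ?y" using inv by (simp add: matrix_vector_mul_assoc)
    have "?y \<noteq> 0" using that x by (metis matrix_vector_mult_0_right)
    then have "hpos Z ?y > 0" using assms(2) by (simp add: siegel_iff)
    then show ?thesis using hpos_moves[OF assms(1,3), of ?y] psim_pos[OF assms(1)]
      by (simp add: x[symmetric])
  qed
  ultimately show ?thesis by (simp add: siegel_iff)
qed

lemma moves_iff_act:
  assumes "psim c M" "Z \<in> siegel_space"
  shows "moves M Z Z' \<longleftrightarrow> Z' = siegel_act M Z"
proof -
  note inv = matrix_inv_mult[OF aut_factor_invertible[OF assms(1,2)]]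
  let ?Q = "aut_factor M Z"
  have "X = Z' ** ?Q \<longleftrightarrow> Z' = X ** matrix_inv ?Q" for X
  proof
    assume "X = Z' ** ?Q"
    then have "X ** matrix_inv ?Q = Z' ** (?Q ** matrix_inv ?Q)" by (simp add: matrix_mul_assoc)
    then show "Z' = X ** matrix_inv ?Q" by (simp add: inv)
  next
    assume "Z' = X ** matrix_inv ?Q"
    then have "Z' ** ?Q = X ** (matrix_inv ?Q ** ?Q)" by (simp add: matrix_mul_assoc)
    then show "X = Z' ** ?Q" by (simp add: inv)
  qed
  then show ?thesis by (simp add: moves_def siegel_act_def)
qed

lemma act_siegel: "psim c M \<Longrightarrow> Z \<in> siegel_space \<Longrightarrow> siegel_act M Z \<in> siegel_space"
  by (metis moves_iff_act moves_siegel)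

lemma act_moves: "psim c M \<Longrightarrow> Z \<in> siegel_space \<Longrightarrow> moves M Z (siegel_act M Z)"
  by (simp add: moves_iff_act)

lemma act_mult:
  assumes "psim c M" "psim d M'" "Z \<in> siegel_space"
  shows "siegel_act (M' ** M) Z = siegel_act M' (siegel_act M Z)"
  using moves_comp(1)[OF act_moves[OF assms(1,3)] act_moves[OF assms(2) act_siegel[OF assms(1,3)]]]
  unfolding moves_iff_act[OF psim_mult[OF assms(2,1)] assms(3)] by simp

lemma act_mat1 [simp]: "Z \<in> siegel_space \<Longrightarrow> siegel_act (mat 1) Z = Z"
  using moves_iff_act[OF psim_mat1, of Z Z] by simp

lemma act_scaleR: assumes "psim c M" "r \<noteq> 0" "Z \<in> siegel_space"
  shows "siegel_act (r *\<^sub>R M) Z = siegel_act M Z"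
  using moves_scaleR[OF assms(2), of M Z "siegel_act M Z"] act_moves[OF assms(1,3)]
    moves_iff_act[OF psim_scaleR[OF assms(1,2)] assms(3)] by simp

lemma act_adj: assumes "psim c M" "Z \<in> siegel_space"
  shows "siegel_act (adj M) (siegel_act M Z) = Z" "siegel_act M (siegel_act (adj M) Z) = Z"
proof -
  have c: "c \<noteq> 0" using psim_pos[OF assms(1)] by simp
  have "psim c (adj M)" using assms by simp
  note * = act_mult[OF assms(1) this assms(2)] act_mult[OF this assms(1) assms(2)]
  show "siegel_act (adj M) (siegel_act M Z) = Z" "siegel_act M (siegel_act (adj M) Z) = Z"
    using * assms c act_scaleR[OF psim_mat1 c assms(2)] by (simp_all add: psim_left psim_right)
qed

lemma moves_adj: assumes "psim c M" "Z \<in> siegel_space" "moves M Z Z'" shows "moves (adj M) Z' Z"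
  using assms act_adj[OF assms(1,2)] moves_siegel[OF assms] moves_iff_act[of c "adj M" Z' Z]
    moves_iff_act[OF assms(1,2), of Z']  by simp

section \<open>The ball quotient as a fixed locus\<close>

definition Jm :: "nat \<Rightarrow> rmat6" where
  "Jm \<Delta> = blocks 0 Emat (- (real \<Delta> *\<^sub>R Emat)) 0"

abbreviation Fm :: cmat3 where "Fm \<equiv> cblock Emat"

lemma Emat_nth: "Emat $ 1 $ 1 = 1" "Emat $ 2 $ 2 = 1" "Emat $ 3 $ 3 = -1"
  "Emat $ 1 $ 2 = 0" "Emat $ 1 $ 3 = 0" "Emat $ 2 $ 1 = 0" "Emat $ 2 $ 3 = 0" "Emat $ 3 $ 1 = 0" "Emat $ 3 $ 2 = 0"
  by (simp_all add: Emat_def)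
lemma Fm_nth: "Fm $ i $ j = complex_of_real (Emat $ i $ j)"
  by (simp add: cblock_def)

lemma Emat_square [simp]: "Emat ** Emat = mat 1" "X ** Emat ** Emat = X" "transpose Emat = Emat"
proof -
  show e: "Emat ** Emat = mat 1"
    by (simp add: vec_eq_iff matrix_matrix_mult_def sum_3 forall_3 Emat_nth mat_def)
  show "X ** Emat ** Emat = X" by (simp add: matrix_mul_assoc[symmetric] e)
  show "transpose Emat = Emat"
    by (simp add: vec_eq_iff transpose_def forall_3 Emat_nth)
qed

lemma Fm_square [simp]: "Fm ** Fm = mat 1" "X ** Fm ** Fm = X" "transpose Fm = Fm"
proof -
  show e: "Fm ** Fm = mat 1" by (simp add: cblock_def flip: cm_mult)
  show "X ** Fm ** Fm = X" by (simp add: matrix_mul_assoc[symmetric] e)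
  show "transpose Fm = Fm" unfolding cblock_def by (simp flip: cm_arith(7))
qed

lemma Jm_sel [simp]: "blockA (Jm \<Delta>) = 0" "blockB (Jm \<Delta>) = Emat"
  "blockC (Jm \<Delta>) = - (real \<Delta> *\<^sub>R Emat)" "blockD (Jm \<Delta>) = 0"
  by (simp_all add: Jm_def)

lemma adj_Jm: "adj (Jm \<Delta>) = - Jm \<Delta>"
  by (rule blocks_eqI) simp_all

lemma Jm_square: "Jm \<Delta> ** Jm \<Delta> = - (real \<Delta> *\<^sub>R mat 1)"
  by (rule blocks_eqI) (simp_all add: block_mult mmult_simps)

lemma psim_Jm: "\<Delta> > 0 \<Longrightarrow> psim (real \<Delta>) (Jm \<Delta>)"
  by (simp add: psim_def adj_Jm mmult_simps Jm_square)

lemma re_im_mult: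
  "map_matrix Re (A ** B) = map_matrix Re A ** map_matrix Re B - map_matrix Im A ** map_matrix Im B"
  "map_matrix Im (A ** B) = map_matrix Re A ** map_matrix Im B + map_matrix Im A ** map_matrix Re B"
  by (simp_all add: vec_eq_iff matrix_matrix_mult_def sum_subtractf sum.distrib)

lemma re_im_simps [simp]:
  "map_matrix Re (cm A) = A" "map_matrix Im (cm A) = 0"
  "map_matrix Re (transpose X) = transpose (map_matrix Re X)"
  "map_matrix Im (transpose X) = transpose (map_matrix Im X)"
  "map_matrix Re (map_matrix cnj X) = map_matrix Re X"
  "map_matrix Im (map_matrix cnj X) = - map_matrix Im X"
  "map_matrix Re (X + Y) = map_matrix Re X + map_matrix Re Y"
  "map_matrix Im (X + Y) = map_matrix Im X + map_matrix Im Y"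
  "map_matrix Re (r *\<^sub>R X) = r *\<^sub>R map_matrix Re X"
  "map_matrix Im (r *\<^sub>R X) = r *\<^sub>R map_matrix Im X"
  by (simp_all add: vec_eq_iff transpose_def)

lemma alpha_sqrt_neg:
  assumes "\<Delta> > 0" shows "alpha \<Delta> (mat (sqrt_neg \<Delta>)) = Jm \<Delta>"
proof -
  have "map_matrix Re (mat (sqrt_neg \<Delta>)) = (0::rmat3)"
    by (simp add: vec_eq_iff mat_def sqrt_neg_def)
  moreover have "(1 / sqrt (real \<Delta>)) *\<^sub>R map_matrix Im (mat (sqrt_neg \<Delta>)) = (mat 1::rmat3)"
    using assms by (simp add: vec_eq_iff mat_def sqrt_neg_def)
  ultimately show ?thesis by (simp add: alpha_def Jm_def Let_def)
qed

lemma alpha_psim: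
  assumes "\<Delta> > 0" "c > 0" "g ** Fm ** transpose (map_matrix cnj g) = c *\<^sub>R Fm"
  shows "psim c (alpha \<Delta> g)"
proof -
  define h where "h = map_matrix Re g"
  define k where "k = (1 / sqrt (real \<Delta>)) *\<^sub>R map_matrix Im g"
  have k: "map_matrix Im g = sqrt (real \<Delta>) *\<^sub>R k" using assms(1) by (simp add: k_def)
  have 1: "h ** Emat ** transpose h + real \<Delta> *\<^sub>R (k ** Emat ** transpose k) = c *\<^sub>R Emat"
    using arg_cong[OF assms(3), of "map_matrix Re"]
    by (simp add: re_im_mult cblock_def mmult_simps k flip: h_def)
  have 2: "k ** Emat ** transpose h = h ** Emat ** transpose k"
    using arg_cong[OF assms(3), of "map_matrix Im"] assms(1)
    by (simp add: re_im_mult cblock_def mmult_simps k flip: h_def)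
  have "alpha \<Delta> g ** adj (alpha \<Delta> g) = c *\<^sub>R mat 1"
  proof (rule blocks_eqI)
    have a: "blockA (alpha \<Delta> g) = h" "blockB (alpha \<Delta> g) = k ** Emat"
      "blockC (alpha \<Delta> g) = - (real \<Delta> *\<^sub>R (Emat ** k))" "blockD (alpha \<Delta> g) = Emat ** h ** Emat"
      by (simp_all add: alpha_def Let_def h_def k_def)
    have "(h ** Emat ** transpose h + real \<Delta> *\<^sub>R (k ** Emat ** transpose k)) ** Emat = c *\<^sub>R mat 1"
      by (simp add: 1 mmult_simps)
    then show "blockA (alpha \<Delta> g ** adj (alpha \<Delta> g)) = blockA (c *\<^sub>R mat 1)"
      by (simp add: block_mult a matrix_transpose_mul matrix_mul_assoc mmult_simps)
    show "blockB (alpha \<Delta> g ** adj (alpha \<Delta> g)) = blockB (c *\<^sub>R mat 1)"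
      by (simp add: block_mult a matrix_transpose_mul matrix_mul_assoc mmult_simps 2)
    show "blockC (alpha \<Delta> g ** adj (alpha \<Delta> g)) = blockC (c *\<^sub>R mat 1)"
      using arg_cong[OF 2, of "\<lambda>X. Emat ** X ** Emat"]
      by (simp add: block_mult a matrix_transpose_mul matrix_mul_assoc mmult_simps)
    have "Emat ** (h ** Emat ** transpose h + real \<Delta> *\<^sub>R (k ** Emat ** transpose k)) = c *\<^sub>R mat 1"
      by (simp add: 1 mmult_simps)
    then show "blockD (alpha \<Delta> g ** adj (alpha \<Delta> g)) = blockD (c *\<^sub>R mat 1)"
      by (simp add: block_mult a matrix_transpose_mul matrix_mul_assoc mmult_simps add.commute)
  qed
  then show ?thesis using assms(2) by (simp add: psim_def)
qed

lemma alpha_Jm: "alpha \<Delta> g ** Jm \<Delta> = Jm \<Delta> ** alpha \<Delta> g"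
  by (rule blocks_eqI) (simp_all add: block_mult alpha_def Let_def mmult_simps matrix_mul_assoc)

lemma cmod_sq: "(complex_of_real (cmod z))\<^sup>2 = z * cnj z"
  by (metis complex_norm_square of_real_power)

text \<open>
  The hermitian form of signature \<open>(2,1)\<close> on complex 3-space.
\<close>
definition hE :: "complex^3 \<Rightarrow> real" where
  "hE x = (cmod (x $ 1))\<^sup>2 + (cmod (x $ 2))\<^sup>2 - (cmod (x $ 3))\<^sup>2"

lemma cauchy2: "(cmod (a * b + c * d))\<^sup>2 \<le> ((cmod a)\<^sup>2 + (cmod c)\<^sup>2) * ((cmod b)\<^sup>2 + (cmod d)\<^sup>2)"
proof -
  have "cmod (a * b + c * d) \<le> cmod a * cmod b + cmod c * cmod d"
    by (metis norm_mult norm_triangle_ineq)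
  then have "(cmod (a * b + c * d))\<^sup>2 \<le> (cmod a * cmod b + cmod c * cmod d)\<^sup>2"
    by (simp add: power_mono)
  also have "\<dots> = ((cmod a)\<^sup>2 + (cmod c)\<^sup>2) * ((cmod b)\<^sup>2 + (cmod d)\<^sup>2) - (cmod a * cmod d - cmod c * cmod b)\<^sup>2"
    by (simp add: power2_eq_square algebra_simps)
  finally show ?thesis using zero_le_power2[of "cmod a * cmod d - cmod c * cmod b"] by linarith
qed

text \<open>
  By the Cauchy-Schwarz inequality for the first two coordinates, the form is positive on the
  orthogonal complement of a negative vector.
\<close>
lemma hE_orth:
  fixes v y :: "complex^3"
  assumes "hE v < 0" "cnj (v $ 1) * y $ 1 + cnj (v $ 2) * y $ 2 - cnj (v $ 3) * y $ 3 = 0" "y \<noteq> 0"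
  shows "hE y > 0"
proof -
  let ?V = "(cmod (v $ 1))\<^sup>2 + (cmod (v $ 2))\<^sup>2" and ?Y = "(cmod (y $ 1))\<^sup>2 + (cmod (y $ 2))\<^sup>2"
  have V: "?V < (cmod (v $ 3))\<^sup>2" using assms(1) by (simp add: hE_def)
  have "cnj (v $ 3) * y $ 3 = cnj (v $ 1) * y $ 1 + cnj (v $ 2) * y $ 2" using assms(2) by simp
  then have "(cmod (cnj (v $ 3) * y $ 3))\<^sup>2 \<le> ?V * ?Y"
    using cauchy2[of "cnj (v $ 1)" "y $ 1" "cnj (v $ 2)" "y $ 2"] by simp
  then have le: "(cmod (v $ 3))\<^sup>2 * (cmod (y $ 3))\<^sup>2 \<le> ?V * ?Y" by (simp add: norm_mult power_mult_distrib)
  have v3: "(cmod (v $ 3))\<^sup>2 > 0" using V by (smt (verit) zero_le_power2)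
  have "?Y > 0"
  proof (rule ccontr)
    assume "\<not> ?Y > 0"
    then have Y: "?Y = 0" by (smt (verit) zero_le_power2)
    then have "y $ 1 = 0" "y $ 2 = 0" by (simp_all add: sum_power2_eq_zero_iff)
    moreover have "y $ 3 = 0" using le v3 Y by (simp add: zero_less_power2 mult_le_0_iff)
    ultimately show False using assms(3) by (simp add: vec_eq_iff forall_3)
  qed
  then have "?V * ?Y < (cmod (v $ 3))\<^sup>2 * ?Y" using V by simp
  then have "(cmod (v $ 3))\<^sup>2 * (cmod (y $ 3))\<^sup>2 < (cmod (v $ 3))\<^sup>2 * ?Y" using le by linarith
  then show ?thesis using v3 by (simp add: hE_def)
qed

text \<open>
  With a negative multiplier, the first two rows of \<open>g\<close> would be orthogonal negative vectors.
\<close>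
lemma GV_real_pos:
  assumes "g \<in> GV_real"
  obtains c where "c > 0" "g ** Fm ** transpose (map_matrix cnj g) = c *\<^sub>R Fm"
proof -
  obtain c where c: "c \<noteq> 0" and e: "g ** Fm ** transpose (map_matrix cnj g) = c *\<^sub>R Fm"
    using assms by (auto simp: GV_real_def)
  have e': "(g ** Fm ** transpose (map_matrix cnj g)) $ i $ j =
     g $ i $ 1 * cnj (g $ j $ 1) + g $ i $ 2 * cnj (g $ j $ 2) - g $ i $ 3 * cnj (g $ j $ 3)" for i j
    by (simp add: matrix_matrix_mult_def sum_3 transpose_def Fm_nth Emat_nth)
  have d: "hE (g $ i) = c" if "i = 1 \<or> i = 2" for i
  proof -
    have "complex_of_real (hE (g $ i)) = (c *\<^sub>R Fm) $ i $ i"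
      unfolding e[symmetric] e' by (simp add: hE_def cmod_sq)
    also have "\<dots> = complex_of_real c"
      using that by (auto simp: Fm_nth Emat_nth scaleR_conv_of_real[where 'a=complex])
    finally have "complex_of_real (hE (g $ i)) = complex_of_real c" .
    then show ?thesis by (simp only: of_real_eq_iff)
  qed
  have o: "cnj (g $ 1 $ 1) * g $ 2 $ 1 + cnj (g $ 1 $ 2) * g $ 2 $ 2 - cnj (g $ 1 $ 3) * g $ 2 $ 3 = 0"
    using e'[of 2 1] by (simp add: e Fm_nth Emat_nth mult.commute)
  have "c > 0"
  proof (rule ccontr)
    assume "\<not> c > 0"
    then have "c < 0" using c by simp
    then have "hE (g $ 1) < 0" "hE (g $ 2) < 0" using d by simp_all
    moreover from this have "g $ 2 \<noteq> 0" by (auto simp: hE_def)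
    ultimately show False using hE_orth[OF _ o] by force
  qed
  then show ?thesis using that e by blast
qed

lemma cdot_self: "cdot x x = complex_of_real (\<Sum>i\<in>UNIV. (cmod (x $ i))\<^sup>2)"
  by (simp add: cdot_def cmod_sq mult.commute)

lemma cdot_Fm: "cdot x (Fm *v x) = complex_of_real (hE x)"
  by (simp add: cdot_def matrix_vector_mult_def sum_3 Fm_nth Emat_nth hE_def cmod_sq mult.commute)

lemma mat_mv: "mat c *v x = c *s (x::complex^'n)"
  by (simp add: vec_eq_iff matrix_vector_mult_def mat_def if_distrib[of "\<lambda>x. x * _"] cong: if_cong)

text \<open>
  The fixed point of the standard homomorphism.
\<close>
definition Z0 :: "nat \<Rightarrow> cmat3" where "Z0 \<Delta> = mat (\<i> / complex_of_real (sqrt (real \<Delta>)))"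

lemma Z0_siegel: assumes "\<Delta> > 0" shows "Z0 \<Delta> \<in> siegel_space"
proof -
  have "hpos (Z0 \<Delta>) x > 0" if x: "x \<noteq> 0" for x :: "complex^3"
  proof -
    obtain i where "x $ i \<noteq> 0" using x by (auto simp: vec_eq_iff)
    then have "(\<Sum>i\<in>UNIV. (cmod (x $ i))\<^sup>2) > 0"
      by (intro sum_pos2[of UNIV i]) auto
    then show ?thesis using assms by (simp add: hpos_def Z0_def mat_mv cdot_arith cdot_self)
  qed
  moreover have "transpose (Z0 \<Delta>) = Z0 \<Delta>" unfolding Z0_def by (rule transpose_mat)
  ultimately show ?thesis unfolding siegel_iff by blast
qed

text \<open>
  The points of the Siegel space at which \<open>J\<close> is an endomorphism; they turn out to be \<open>hV \<Delta>\<close>.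
\<close>
definition Vset :: "nat \<Rightarrow> cmat3 set" where
  "Vset \<Delta> = {Z \<in> siegel_space. moves (Jm \<Delta>) Z Z}"

lemma aut_Jm: "aut_factor (Jm \<Delta>) Z = - (real \<Delta> *\<^sub>R (Fm ** Z))"
  by (simp add: aut_factor_def cblock_def mmult_simps)

lemma moves_Jm: assumes "\<Delta> > 0"
  shows "moves (Jm \<Delta>) Z Z' \<longleftrightarrow> Z' ** Fm ** Z = - ((1 / real \<Delta>) *\<^sub>R Fm)"
proof -
  have "moves (Jm \<Delta>) Z Z' \<longleftrightarrow> Fm = - (real \<Delta> *\<^sub>R (Z' ** Fm ** Z))"
    by (simp add: moves_def aut_Jm mmult_simps matrix_mul_assoc cblock_def)
  moreover have "Fm = - (real \<Delta> *\<^sub>R X) \<longleftrightarrow> X = - ((1 / real \<Delta>) *\<^sub>R Fm)" for X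
    using assms by (metis (no_types, lifting) divide_self_if less_numeral_extra(3) of_nat_0_less_iff scaleR_minus_right scaleR_one scaleR_scaleR minus_minus times_divide_eq_left mult_1 mult.commute)
  ultimately show ?thesis by simp
qed

lemma Z0_Vset: "\<Delta> > 0 \<Longrightarrow> Z0 \<Delta> \<in> Vset \<Delta>"
  unfolding Vset_def mem_Collect_eq moves_Jm
  by (intro conjI Z0_siegel) (simp_all add: moves_Jm Z0_def vec_eq_iff matrix_matrix_mult_def sum_3 mat_def forall_3 Fm_nth Emat_nth
     scaleR_conv_of_real[where 'a=complex] flip: of_real_mult)

lemma fix_conj:
  assumes "psim c g" "Z \<in> siegel_space"
  shows "moves (g ** x ** adj g) (siegel_act g Z) (siegel_act g Z) \<longleftrightarrow> moves x Z Z"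
proof -
  let ?Z = "siegel_act g Z"
  have m: "moves g Z ?Z" "moves (adj g) ?Z Z"
    using act_moves[OF assms] moves_adj[OF assms] by auto
  have c: "c \<noteq> 0" using psim_pos[OF assms(1)] by simp
  show ?thesis
  proof
    assume "moves x Z Z"
    with m show "moves (g ** x ** adj g) ?Z ?Z" by (meson moves_comp(1))
  next
    assume "moves (g ** x ** adj g) ?Z ?Z"
    with m have "moves (adj g ** (g ** x ** adj g) ** g) Z Z" by (meson moves_comp(1))
    moreover have "adj g ** (g ** x ** adj g) ** g = (adj g ** g) ** x ** (adj g ** g)"
      by (simp add: matrix_mul_assoc)
    ultimately show "moves x Z Z" using c
      by (simp add: psim_left[OF assms(1)] mmult_simps moves_scaleR)
  qed
qed

lemma Vset_commute:
  assumes "psim c g" "g ** Jm \<Delta> = Jm \<Delta> ** g" "Z \<in> siegel_space"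
  shows "siegel_act g Z \<in> Vset \<Delta> \<longleftrightarrow> Z \<in> Vset \<Delta>"
proof -
  have c: "c \<noteq> 0" using psim_pos[OF assms(1)] by simp
  have "g ** Jm \<Delta> ** adj g = c *\<^sub>R Jm \<Delta>"
    by (simp add: assms(2) matrix_mul_assoc[symmetric] psim_right[OF assms(1)] mmult_simps)
  then show ?thesis using fix_conj[OF assms(1,3), of "Jm \<Delta>"] act_siegel[OF assms(1,3)] assms(3) c
    by (simp add: Vset_def moves_scaleR)
qed

lemma hV_subset: assumes "\<Delta> > 0" shows "hV \<Delta> \<subseteq> Vset \<Delta>"
proof
  fix Z assume "Z \<in> hV \<Delta>"
  then obtain g where g: "g \<in> GV_real" "Z = siegel_act (alpha \<Delta> g) (Z0 \<Delta>)"
    by (auto simp: hV_def Z0_def)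
  obtain c where "c > 0" "g ** Fm ** transpose (map_matrix cnj g) = c *\<^sub>R Fm"
    using GV_real_pos[OF g(1)] .
  then show "Z \<in> Vset \<Delta>"
    using Vset_commute[OF alpha_psim[OF assms] alpha_Jm Z0_siegel[OF assms]] Z0_Vset[OF assms] g(2) by simp
qed

lemma transpose_sym: assumes "transpose Z = Z" shows "Z $ i $ j = Z $ j $ i"
  using arg_cong[OF assms, of "\<lambda>A. A $ j $ i"] by (simp add: transpose_def)

definition uvec :: "complex \<Rightarrow> complex \<Rightarrow> complex^3" where "uvec a b = vector [a, b, -1]"
definition vvec :: "complex \<Rightarrow> complex \<Rightarrow> complex^3" where "vvec a b = vector [a, b, 1]"

lemma uvec_nth [simp]: "uvec a b $ 1 = a" "uvec a b $ 2 = b" "uvec a b $ 3 = -1"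
  "vvec a b $ 1 = a" "vvec a b $ 2 = b" "vvec a b $ 3 = 1"
  by (simp_all add: uvec_def vvec_def vector_3)

text \<open>
  Up to a factor \<open>\<i> / sqrt \<Delta>\<close>, the product \<open>E Z\<close> is an involution for \<open>Z\<close> in \<open>Vset \<Delta>\<close>, with a
  one-dimensional eigenspace for \<open>-1\<close>.  The value at \<open>(a, b)\<close> is the point for which \<open>(a, b, 1)\<close> spans
  this eigenspace.
\<close>
definition vphi :: "nat \<Rightarrow> complex \<times> complex \<Rightarrow> cmat3" where
  "vphi \<Delta> z = (\<chi> i j. \<i> / complex_of_real (sqrt (real \<Delta>)) *
     (Fm $ i $ j - 2 / ((fst z)\<^sup>2 + (snd z)\<^sup>2 - 1) * uvec (fst z) (snd z) $ i * uvec (fst z) (snd z) $ j))"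

abbreviation sq :: "nat \<Rightarrow> complex" where "sq \<Delta> \<equiv> complex_of_real (sqrt (real \<Delta>))"

lemma sq_facts: assumes "\<Delta> > 0" shows "sq \<Delta> \<noteq> 0" "sq \<Delta> * sq \<Delta> = of_nat \<Delta>"
    "sq \<Delta> * (sq \<Delta> * x) = of_nat \<Delta> * x"
proof -
  show "sq \<Delta> \<noteq> 0" using assms by simp
  show *: "sq \<Delta> * sq \<Delta> = of_nat \<Delta>" using assms by (metis of_real_mult of_real_of_nat_eq of_nat_0_le_iff real_sqrt_mult_self abs_of_nonneg)
  show "sq \<Delta> * (sq \<Delta> * x) = of_nat \<Delta> * x" by (simp add: * flip: mult.assoc)
qed

lemma ball_iff: "z \<in> ball (0::complex\<times>complex) 1 \<longleftrightarrow> (cmod (fst z))\<^sup>2 + (cmod (snd z))\<^sup>2 < 1"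
  by (simp add: norm_prod_def real_less_lsqrt)

lemma ball_q: assumes "(cmod a)\<^sup>2 + (cmod b)\<^sup>2 < 1" shows "a\<^sup>2 + b\<^sup>2 - 1 \<noteq> 0"
proof
  assume "a\<^sup>2 + b\<^sup>2 - 1 = 0"
  then have "cmod (a\<^sup>2 + b\<^sup>2) = 1" by simp
  then show False using norm_triangle_ineq[of "a\<^sup>2" "b\<^sup>2"] assms by (simp add: norm_power)
qed

lemma hE_vvec: "hE (vvec a b) < 0 \<longleftrightarrow> (cmod a)\<^sup>2 + (cmod b)\<^sup>2 < 1"
  by (simp add: hE_def)

lemma mv_sum: "(A *v x) $ i = A $ i $ 1 * x $ 1 + A $ i $ 2 * x $ 2 + A $ i $ 3 * (x::complex^3) $ 3"
  by (simp add: matrix_vector_mult_def sum_3)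

lemma mm_sum: "((A::complex^3^3) ** B) $ i $ j = A $ i $ 1 * B $ 1 $ j + A $ i $ 2 * B $ 2 $ j + A $ i $ 3 * B $ 3 $ j"
  by (simp add: matrix_matrix_mult_def sum_3)

lemma vphi_fix:
  assumes "\<Delta> > 0" "a\<^sup>2 + b\<^sup>2 - 1 \<noteq> 0"
  shows "moves (Jm \<Delta>) (vphi \<Delta> (a, b)) (vphi \<Delta> (a, b))"
proof -
  define k where "k = 2 / (a\<^sup>2 + b\<^sup>2 - 1)"
  define s where "s = \<i> / sq \<Delta>"
  have k: "k * (a\<^sup>2 + b\<^sup>2 - 1) = 2"
    using k_def nonzero_eq_divide_eq[OF assms(2), of k 2] by blast
  have s: "s * s = - (1 / of_nat \<Delta>)" using sq_facts[OF assms(1)] by (simp add: s_def)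
  have e: "vphi \<Delta> (a, b) $ i $ j = s * (Fm $ i $ j - k * uvec a b $ i * uvec a b $ j)" for i j
    by (simp add: vphi_def k_def s_def)
  define Y where "Y = (\<chi> i j. Fm $ i $ j - k * uvec a b $ i * uvec a b $ j)"
  have "(Y ** Fm ** Y) $ i $ j - Fm $ i $ j = k * uvec a b $ i * uvec a b $ j * (k * (a\<^sup>2 + b\<^sup>2 - 1) - 2)" for i j
    using exhaust_3[of i] exhaust_3[of j]
    by (auto simp: mm_sum Y_def Fm_nth Emat_nth algebra_simps power2_eq_square)
  then have Y: "Y ** Fm ** Y = Fm" by (simp add: vec_eq_iff k)
  have "(vphi \<Delta> (a, b) ** Fm ** vphi \<Delta> (a, b)) $ i $ j = s * s * (Y ** Fm ** Y) $ i $ j" for i j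
    by (simp add: mm_sum e Y_def algebra_simps)
  then have "vphi \<Delta> (a, b) ** Fm ** vphi \<Delta> (a, b) = - ((1 / real \<Delta>) *\<^sub>R Fm)"
    by (simp add: vec_eq_iff Y s scaleR_conv_of_real[where 'a=complex])
  then show ?thesis by (simp add: moves_Jm[OF assms(1)])
qed

text \<open>
  Decomposing \<open>x = y + c v\<close> into eigenvectors of \<open>E Z\<close>, with \<open>v = (a, b, 1)\<close>, gives
  \<open>hpos Z x = (hE y - |c|\<^sup>2 hE v) / sqrt \<Delta>\<close>.  Here \<open>v\<close> is negative on the ball, and \<open>y\<close> is orthogonal
  to the conjugate of \<open>v\<close>, so that it is positive.
\<close>
lemma vphi_Vset:
  assumes "\<Delta> > 0" "(cmod a)\<^sup>2 + (cmod b)\<^sup>2 < 1"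
  shows "vphi \<Delta> (a, b) \<in> Vset \<Delta>"
proof -
  define q where "q = a\<^sup>2 + b\<^sup>2 - 1"
  have q: "q \<noteq> 0" using ball_q[OF assms(2)] by (simp add: q_def)
  have t: "transpose (vphi \<Delta> (a, b)) = vphi \<Delta> (a, b)"
    unfolding vec_eq_iff transpose_def vphi_def by (simp add: forall_3 Fm_nth Emat_nth)
  have "hpos (vphi \<Delta> (a, b)) x > 0" if x: "x \<noteq> 0" for x :: "complex^3"
  proof -
    define c where "c = (a * x $ 1 + b * x $ 2 - x $ 3) / q"
    define y where "y = x - c *s vvec a b"
    have c: "c * q = a * x $ 1 + b * x $ 2 - x $ 3" using q by (simp add: c_def)
    have x1: "x $ 1 = y $ 1 + c * a" "x $ 2 = y $ 2 + c * b" "x $ 3 = y $ 3 + c"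
      by (simp_all add: y_def)
    have y0: "a * y $ 1 + b * y $ 2 - y $ 3 = 0"
      using c by (simp add: y_def q_def power2_eq_square algebra_simps)
    have Zx: "vphi \<Delta> (a, b) *v x = (\<i> / sq \<Delta>) *s (Fm *v (y - c *s vvec a b))"
    proof -
      define k where "k = 2 / q"
      define s where "s = \<i> / sq \<Delta>"
      have e: "vphi \<Delta> (a, b) $ i $ j = s * (Fm $ i $ j - k * uvec a b $ i * uvec a b $ j)" for i j
        by (simp add: vphi_def k_def s_def q_def)
      have "(vphi \<Delta> (a, b) *v x) $ i = s * ((Fm *v x) $ i - k * uvec a b $ i * (c * q))" for i
        unfolding c by (simp add: mv_sum e algebra_simps)
      then have "(vphi \<Delta> (a, b) *v x) $ i = (\<i> / sq \<Delta>) * ((Fm *v x) $ i - 2 / q * uvec a b $ i * (c * q))" for i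
        by (simp add: k_def s_def)
      then have "(vphi \<Delta> (a, b) *v x) $ i = (\<i> / sq \<Delta>) * ((Fm *v x) $ i - 2 * c * uvec a b $ i)" for i
        using q by simp
      then show ?thesis
        unfolding vec_eq_iff forall_3 by (simp add: mv_sum Fm_nth Emat_nth x1)
    qed
    have hy: "y = 0 \<or> hE y > 0"
      using hE_orth[of "vvec (cnj a) (cnj b)" y] y0 assms(2) by (simp add: hE_vvec) blast
    have "cdot x (Fm *v (y - c *s vvec a b)) = complex_of_real (hE y - (cmod c)\<^sup>2 * hE (vvec a b)) +
      (let t = c * (cnj (y $ 1) * a + cnj (y $ 2) * b - cnj (y $ 3)) in cnj t - t)"
      by (simp add: cdot_def sum_3 mv_sum Fm_nth Emat_nth x1 hE_def cmod_sq Let_def algebra_simps)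
    then have "Re (cdot x (Fm *v (y - c *s vvec a b))) = hE y - (cmod c)\<^sup>2 * hE (vvec a b)"
      by (simp add: Let_def) (simp add: algebra_simps)
    then have h: "hpos (vphi \<Delta> (a, b)) x = (hE y - (cmod c)\<^sup>2 * hE (vvec a b)) / sqrt (real \<Delta>)"
      by (simp add: hpos_def Zx cdot_arith Im_divide power2_eq_square real_div_sqrt flip: times_divide_eq_right)
    have v: "hE (vvec a b) < 0" using assms(2) by (simp add: hE_vvec)
    show ?thesis
    proof (cases "y = 0")
      case True
      then have "c \<noteq> 0" using x by (auto simp: y_def)
      then have "(cmod c)\<^sup>2 * hE (vvec a b) < 0" using v by (simp add: mult_pos_neg)
      then show ?thesis using h True assms(1) by (simp add: hE_def divide_neg_pos)
    next
      case False
      then have "hE y > 0" using hy by blast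
      moreover have "(cmod c)\<^sup>2 * hE (vvec a b) \<le> 0" using v by (simp add: mult_nonneg_nonpos)
      ultimately show ?thesis using h assms(1) by simp
    qed
  qed
  then show ?thesis
    using vphi_fix[OF assms(1) ball_q[OF assms(2)]] t by (simp add: Vset_def siegel_iff)
qed

text \<open>
  On eigenvectors for this eigenvalue, \<open>hpos Z\<close> is a negative multiple of \<open>hE\<close>.
\<close>
lemma Vset_eigen_neg:
  assumes "\<Delta> > 0" "Z \<in> Vset \<Delta>" "Fm *v (Z *v v) = (- (\<i> / sq \<Delta>)) *s v" "v \<noteq> 0"
  shows "hE v < 0"
proof -
  have "Z *v v = Fm *v (Fm *v (Z *v v))" by (simp add: matrix_vector_mul_assoc matrix_mul_assoc)
  also have "\<dots> = (- (\<i> / sq \<Delta>)) *s (Fm *v v)"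
    unfolding assms(3) by (simp add: vec_eq_iff mv_sum algebra_simps)
  finally have "hpos Z v = - hE v / sqrt (real \<Delta>)"
    by (simp add: hpos_def cdot_arith cdot_Fm Im_divide power2_eq_square real_div_sqrt flip: times_divide_eq_right)
  moreover have "hpos Z v > 0" using assms(2,4) by (simp add: Vset_def siegel_iff)
  ultimately show ?thesis using assms(1) by (simp add: divide_less_0_iff)
qed

lemma Vset_involution:
  assumes D: "\<Delta> > 0" and Z: "Z \<in> Vset \<Delta>"
  shows "Fm *v (Z *v (Fm *v (Z *v y))) = (- (1 / of_nat \<Delta>)) *s y"
proof -
  have "Z ** Fm ** Z = - ((1 / real \<Delta>) *\<^sub>R Fm)" using Z D by (simp add: Vset_def moves_Jm)
  then have "Fm ** (Z ** Fm ** Z) = - ((1 / real \<Delta>) *\<^sub>R mat 1)" by (simp add: mmult_simps)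
  moreover have "Fm *v (Z *v (Fm *v (Z *v y))) = (Fm ** (Z ** Fm ** Z)) *v y"
    by (simp add: matrix_vector_mul_assoc matrix_mul_assoc)
  ultimately show ?thesis
    by (simp add: vec_eq_iff mv_sum forall_3 mat_def scaleR_conv_of_real[where 'a=complex])
qed

text \<open>
  The eigenspace contains the image of \<open>1 + \<i> sqrt \<Delta> E Z\<close>.  It has dimension one: two independent
  eigenvectors would combine to one with vanishing third coordinate, on which \<open>hE\<close> is not
  negative.  So \<open>E Z\<close> differs from a scalar by a matrix of rank one with column \<open>v\<close>, and the
  symmetry of \<open>Z\<close> determines its row.
\<close>
lemma Vset_eigen:
  assumes D: "\<Delta> > 0" and Z: "Z \<in> Vset \<Delta>"
    and v: "Fm *v (Z *v v) = (- (\<i> / sq \<Delta>)) *s v" "v $ 3 = 1"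
  shows "Z = vphi \<Delta> (v $ 1, v $ 2)" "(cmod (v $ 1))\<^sup>2 + (cmod (v $ 2))\<^sup>2 < 1"
proof -
  let ?s = "sq \<Delta>"
  have s: "?s \<noteq> 0" "?s * ?s = of_nat \<Delta>" using sq_facts[OF D] by auto
  have v0: "v \<noteq> 0" using v(2) by auto
  show vb: "(cmod (v $ 1))\<^sup>2 + (cmod (v $ 2))\<^sup>2 < 1"
    using Vset_eigen_neg[OF D Z v(1) v0] v(2) by (simp add: hE_def)
  have q: "(v $ 1)\<^sup>2 + (v $ 2)\<^sup>2 - 1 \<noteq> 0" by (rule ball_q[OF vb])
  define T where "T y = y + (\<i> * ?s) *s (Fm *v (Z *v y))" for y
  have "transpose Z = Z" using Z by (simp add: Vset_def siegel_iff)
  then have sym: "Z $ i $ j = Z $ j $ i" for i j by (rule transpose_sym)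
  note FZ = Vset_involution[OF D Z]
  have eT: "Fm *v (Z *v T y) = (- (\<i> / ?s)) *s T y" for y
  proof -
    have "Fm *v (Z *v T y) = Fm *v (Z *v y) + (\<i> * ?s) *s (Fm *v (Z *v (Fm *v (Z *v y))))"
      by (simp add: T_def vec_eq_iff mv_sum algebra_simps)
    also have "\<dots> = (- (\<i> / ?s)) *s T y"
      unfolding FZ using s D by (simp add: T_def vec_eq_iff field_simps)
    finally show ?thesis .
  qed
  have Tv: "T y = T y $ 3 *s v" for y
  proof (rule ccontr)
    define u where "u = T y - T y $ 3 *s v"
    assume "T y \<noteq> T y $ 3 *s v"
    then have "u \<noteq> 0" by (simp add: u_def)
    moreover have "Fm *v (Z *v u) = Fm *v (Z *v T y) - T y $ 3 *s (Fm *v (Z *v v))"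
      by (simp add: u_def vec_eq_iff mv_sum algebra_simps)
    then have "Fm *v (Z *v u) = (- (\<i> / ?s)) *s u"
      unfolding eT v(1) by (simp add: u_def vec_eq_iff algebra_simps)
    ultimately have "hE u < 0" using Vset_eigen_neg[OF D Z] by blast
    moreover have "u $ 3 = 0" using v(2) by (simp add: u_def)
    ultimately show False by (simp add: hE_def) (smt (verit) zero_le_power2)
  qed
  define l where "l j = T (axis j 1) $ 3" for j
  have FT: "Fm *v (Fm *v x) = x" for x by (simp add: matrix_vector_mul_assoc)
  have ent: "Fm $ i $ j + \<i> * ?s * Z $ i $ j = Fm $ i $ i * v $ i * l j" for i j
  proof -
    have a: "T (axis j 1) = l j *s v" using Tv unfolding l_def .
    have "Fm *v T (axis j 1) = Fm *v axis j 1 + (\<i> * ?s) *s (Fm *v (Fm *v (Z *v axis j 1)))"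
      by (simp add: T_def vec_eq_iff mv_sum algebra_simps)
    then have "Fm *v axis j 1 + (\<i> * ?s) *s (Z *v axis j 1) = l j *s (Fm *v v)"
      unfolding FT a by (simp add: vec_eq_iff mv_sum algebra_simps)
    from arg_cong[OF this, of "\<lambda>x. x $ i"] have "Fm $ i $ j + \<i> * ?s * Z $ i $ j = l j * (Fm *v v) $ i"
      by (simp add: matrix_vector_mul_component axis_def matrix_vector_mult_def if_distrib[of "\<lambda>x. _ * x"] cong: if_cong)
    then show ?thesis using exhaust_3[of i] by (auto simp: mv_sum Fm_nth Emat_nth)
  qed
  have l12: "l 1 = - (v $ 1) * l 3" "l 2 = - (v $ 2) * l 3"
    using ent[of 1 3] ent[of 3 1] ent[of 2 3] ent[of 3 2] sym[of 1 3] sym[of 2 3] v(2)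
    by (simp_all add: Fm_nth Emat_nth)
  have "T v = 2 *s v" unfolding T_def v(1) using s by (simp add: vec_eq_iff field_simps)
  then have T3: "T v $ 3 = 2" using v(2) by simp
  have "T v $ 3 = l 1 * v $ 1 + l 2 * v $ 2 + l 3 * v $ 3"
    by (simp add: l_def T_def mv_sum axis_def algebra_simps)
  then have l3: "l 3 = - (2 / ((v $ 1)\<^sup>2 + (v $ 2)\<^sup>2 - 1))"
    using T3 q v(2) unfolding l12 by (simp add: field_simps power2_eq_square) algebra
  have "Z $ i $ j = vphi \<Delta> (v $ 1, v $ 2) $ i $ j" for i j
  proof -
    have "Z $ i $ j = (\<i> / ?s) * (Fm $ i $ j - Fm $ i $ i * v $ i * l j)"
      unfolding ent[symmetric] using s by (simp add: field_simps)
    then show ?thesis using exhaust_3[of i] exhaust_3[of j] l12 v(2)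
      by (auto simp: vphi_def Fm_nth Emat_nth l3)
  qed
  then show "Z = vphi \<Delta> (v $ 1, v $ 2)" by (simp add: vec_eq_iff)
qed

text \<open>
  It remains to find an eigenvector.  The vector \<open>(1 + \<i> sqrt \<Delta> E Z) e\<^sub>3\<close> is nonzero, as the last
  diagonal entry of \<open>Z\<close> has positive imaginary part; being negative for \<open>hE\<close>, it can be scaled to have
  third coordinate 1.
\<close>
lemma Vset_vphi: assumes D: "\<Delta> > 0" shows "Vset \<Delta> = vphi \<Delta> ` ball 0 1"
proof
  show "vphi \<Delta> ` ball 0 1 \<subseteq> Vset \<Delta>"
    using vphi_Vset[OF D] ball_iff by auto
  show "Vset \<Delta> \<subseteq> vphi \<Delta> ` ball 0 1"
  proof
    fix Z assume Z: "Z \<in> Vset \<Delta>"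
    let ?s = "sq \<Delta>"
    have s: "?s \<noteq> 0" "?s * ?s = of_nat \<Delta>" using sq_facts[OF D] by auto
    define w where "w = axis 3 1 + (\<i> * ?s) *s (Fm *v (Z *v axis 3 1))"
    note FZ = Vset_involution[OF D Z]
    have ew: "Fm *v (Z *v w) = (- (\<i> / ?s)) *s w"
    proof -
      have "Fm *v (Z *v w) = Fm *v (Z *v axis 3 1) + (\<i> * ?s) *s (Fm *v (Z *v (Fm *v (Z *v axis 3 1))))"
        by (simp add: w_def vec_eq_iff mv_sum algebra_simps)
      also have "\<dots> = (- (\<i> / ?s)) *s w"
        unfolding FZ using s D by (simp add: w_def vec_eq_iff field_simps)
      finally show ?thesis .
    qed
    have "w \<noteq> 0"
    proof
      assume "w = 0"
      then have "w $ 3 = 0" by simp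
      then have "\<i> * ?s * Z $ 3 $ 3 = 1"
        by (simp add: w_def mv_sum axis_def Fm_nth Emat_nth)
      then have "\<i> * (\<i> * (?s * Z $ 3 $ 3)) = \<i>" by (simp add: mult.assoc)
      then have "?s * Z $ 3 $ 3 = - \<i>" by (simp add: minus_equation_iff[of _ "\<i>"] flip: mult.assoc)
      then have "Z $ 3 $ 3 = - (\<i> / ?s)" using s by (simp add: field_simps)
      moreover have "hpos Z (axis 3 1) > 0" using Z by (simp add: Vset_def siegel_iff axis_eq_0_iff)
      ultimately show False using D by (simp add: hpos_def cdot_def sum_3 mv_sum axis_def Im_divide power2_eq_square)
        (smt (verit) divide_nonneg_nonneg of_nat_0_le_iff real_sqrt_ge_zero)
    qed
    then have hw: "hE w < 0" using Vset_eigen_neg[OF D Z ew] by blast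
    have w3: "w $ 3 \<noteq> 0"
    proof
      assume "w $ 3 = 0"
      then show False using hw unfolding hE_def by simp (smt (verit) zero_le_power2)
    qed
    define v where "v = (1 / w $ 3) *s w"
    have "Fm *v (Z *v v) = (1 / w $ 3) *s (Fm *v (Z *v w))"
      by (simp add: v_def vec_eq_iff mv_sum algebra_simps add_divide_distrib)
    then have "Fm *v (Z *v v) = (- (\<i> / ?s)) *s v" unfolding ew by (simp add: v_def vec_eq_iff)
    moreover have "v $ 3 = 1" using w3 by (simp add: v_def)
    ultimately show "Z \<in> vphi \<Delta> ` ball 0 1"
      using Vset_eigen[OF D Z] ball_iff[of "(v $ 1, v $ 2)"] by (metis fst_conv image_eqI snd_conv)
  qed
qed

lemma aut_commute:
  assumes "moves g W Z" "moves (Jm \<Delta>) W W" "moves (Jm \<Delta>) Z Z" "g ** Jm \<Delta> = e *\<^sub>R (Jm \<Delta> ** g)"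
  shows "aut_factor g W ** aut_factor (Jm \<Delta>) W = e *\<^sub>R (aut_factor (Jm \<Delta>) Z ** aut_factor g W)"
  using moves_comp(2)[OF assms(2,1)] moves_comp(2)[OF assms(1,3)] assms(4)
  by (simp add: aut_factor_scaleR)

text \<open>
  Transitivity of the unitary group on the ball: a unitary reflection maps the negative line of the
  base point to any other negative line.
\<close>
lemma hV_eq: assumes D: "\<Delta> > 0" shows "hV \<Delta> = Vset \<Delta>"
proof
  show "hV \<Delta> \<subseteq> Vset \<Delta>" by (rule hV_subset[OF D])
  show "Vset \<Delta> \<subseteq> hV \<Delta>"
  proof
    fix Z assume "Z \<in> Vset \<Delta>"
    then obtain a b where Z: "Z = vphi \<Delta> (a, b)" and ab: "(cmod a)\<^sup>2 + (cmod b)\<^sup>2 < 1"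
      unfolding Vset_vphi[OF D] using ball_iff by auto
    let ?s = "sq \<Delta>"
    have s: "?s \<noteq> 0" "?s * ?s = of_nat \<Delta>" using sq_facts[OF D] by auto
    define m where "m = 1 - (cmod a)\<^sup>2 - (cmod b)\<^sup>2"
    define r where "r = 1 / sqrt m"
    have m: "m > 0" using ab by (simp add: m_def)
    have r: "r > 0" "r * r * m = 1" using m by (simp_all add: r_def)
    (* the reflection g along n maps the third unit vector to r (a, b, -1); here
       r is chosen so that both vectors have the same norm *)
    define n :: "complex^3" where "n = vector [- (of_real r * a), - (of_real r * b), 1 + of_real r]"
    have n: "n $ 1 = - (of_real r * a)" "n $ 2 = - (of_real r * b)" "n $ 3 = 1 + of_real r"
      by (simp_all add: n_def vector_3)
    define k where "k = - (1 / (1 + r))"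
    have k: "k * (1 + r) = -1" using r by (simp add: k_def)
    define g :: cmat3 where "g = (\<chi> i j. mat 1 $ i $ j - of_real k * n $ i * cnj (n $ j) * Fm $ j $ j)"
    have ck: "complex_of_real k * (1 + of_real r) = -1"
      using k by (metis of_real_1 of_real_add of_real_minus of_real_mult)
    have cm: "of_real r * of_real r * (1 - a * cnj a - b * cnj b) = (1::complex)"
    proof -
      have "complex_of_real m = 1 - a * cnj a - b * cnj b" by (simp add: m_def cmod_sq)
      then show ?thesis using r(2) by (metis of_real_1 of_real_mult)
    qed
    have g3: "g $ i $ 3 = of_real r * uvec a b $ i" for i
    proof -
      have "g $ i $ 3 = mat 1 $ i $ 3 + of_real k * (1 + of_real r) * n $ i"
        by (simp add: g_def n Fm_nth Emat_nth)
      then show ?thesis unfolding ck using exhaust_3[of i] by (auto simp: n mat_def)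
    qed
    have h: "of_real k * (n $ 1 * cnj (n $ 1) + n $ 2 * cnj (n $ 2) - n $ 3 * cnj (n $ 3)) = 2"
    proof -
      have "n $ 1 * cnj (n $ 1) + n $ 2 * cnj (n $ 2) - n $ 3 * cnj (n $ 3)
         = of_real r * of_real r - of_real r * of_real r * (1 - a * cnj a - b * cnj b) - (1 + of_real r) * (1 + of_real r)"
        by (simp add: n algebra_simps)
      also have "\<dots> = - 2 * (1 + of_real r)" unfolding cm by (simp add: algebra_simps)
      finally have "of_real k * (n $ 1 * cnj (n $ 1) + n $ 2 * cnj (n $ 2) - n $ 3 * cnj (n $ 3))
        = of_real k * (- 2 * (1 + of_real r))" by (rule arg_cong)
      also have "\<dots> = - 2 * (of_real k * (1 + of_real r))" by (simp only: mult.left_commute)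
      finally have "of_real k * (n $ 1 * cnj (n $ 1) + n $ 2 * cnj (n $ 2) - n $ 3 * cnj (n $ 3))
        = - 2 * (of_real k * (1 + of_real r))" .
      then show ?thesis unfolding ck by simp
    qed
    have "(g ** Fm ** transpose (map_matrix cnj g)) $ i $ j - Fm $ i $ j = of_real k * n $ i * cnj (n $ j) *
        (of_real k * (n $ 1 * cnj (n $ 1) + n $ 2 * cnj (n $ 2) - n $ 3 * cnj (n $ 3)) - 2)" for i j
      unfolding mm_sum transpose_def using exhaust_3[of i] exhaust_3[of j]
      by (auto simp: g_def mat_def Fm_nth Emat_nth algebra_simps)
    then have "(g ** Fm ** transpose (map_matrix cnj g)) $ i $ j = Fm $ i $ j" for i j
      unfolding h by simp
    then have gE: "g ** Fm ** transpose (map_matrix cnj g) = 1 *\<^sub>R Fm"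
      by (simp add: vec_eq_iff)
    then have gV: "g \<in> GV_real" unfolding GV_real_def by (intro CollectI exI[of _ 1]) simp
    define Z1 where "Z1 = siegel_act (alpha \<Delta> g) (Z0 \<Delta>)"
    have Z1h: "Z1 \<in> hV \<Delta>" using gV by (auto simp: hV_def Z1_def Z0_def)
    then have Z1V: "Z1 \<in> Vset \<Delta>" using hV_subset[OF D] by blast
    define Q where "Q = aut_factor (alpha \<Delta> g) (Z0 \<Delta>)"
    have com: "Q ** aut_factor (Jm \<Delta>) (Z0 \<Delta>) = aut_factor (Jm \<Delta>) Z1 ** Q"
      using aut_commute[of "alpha \<Delta> g" "Z0 \<Delta>" Z1 \<Delta> 1] alpha_Jm Z1V Z0_Vset[OF D]
        act_moves[OF alpha_psim[OF D _ gE] Z0_siegel[OF D]]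
      by (simp add: Q_def Vset_def Z1_def)
    have jZ0: "aut_factor (Jm \<Delta>) (Z0 \<Delta>) *v axis 3 1 = (\<i> * ?s) *s axis 3 1"
      using s unfolding vec_eq_iff forall_3 aut_Jm mv_sum
      by (simp add: mm_sum Z0_def mat_def axis_def Fm_nth Emat_nth scaleR_conv_of_real[where 'a=complex] field_simps)
    have Q3: "Q *v axis 3 1 = (- of_real r) *s vvec a b"
    proof -
      have "Q $ i $ 3 = - (Fm *v (\<chi> i. g $ i $ 3)) $ i" for i
      proof -
        have "Q $ i $ 3 = - (Fm *v (\<chi> i. complex_of_real (Re (g $ i $ 3)) + \<i> * complex_of_real (Im (g $ i $ 3)))) $ i"
          unfolding Q_def aut_factor_def alpha_def Let_def blocks_sel Z0_def
          using s D by (simp add: mm_sum mv_sum cblock_def mat_def mmult_simps matrix_matrix_mult_def sum_3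
             Emat_nth scaleR_conv_of_real[where 'a=complex] field_simps)
        then show ?thesis by (simp add: complex_eq[symmetric])
      qed
      then have "(Q *v axis 3 1) $ i = - (Fm *v (\<chi> i. g $ i $ 3)) $ i" for i
        by (simp add: mv_sum axis_def)
      then show ?thesis unfolding vec_eq_iff forall_3 g3 by (simp add: mv_sum Fm_nth Emat_nth)
    qed
    have "aut_factor (Jm \<Delta>) Z1 *v (Q *v axis 3 1) = Q *v (aut_factor (Jm \<Delta>) (Z0 \<Delta>) *v axis 3 1)"
      by (simp add: matrix_vector_mul_assoc com)
    also have "\<dots> = (\<i> * ?s) *s (Q *v axis 3 1)"
      unfolding jZ0 by (simp add: vec_eq_iff mv_sum algebra_simps)
    finally have e1: "(aut_factor (Jm \<Delta>) Z1 *v ((- of_real r) *s vvec a b)) $ i = ((\<i> * ?s) *s ((- of_real r) *s vvec a b)) $ i" for i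
      by (simp add: Q3)
    have e2: "(aut_factor (Jm \<Delta>) Z1 *v (c *s vvec a b)) $ i = - c * of_nat \<Delta> * (Fm *v (Z1 *v vvec a b)) $ i" for c i
      unfolding aut_Jm by (simp add: mv_sum mm_sum scaleR_conv_of_real[where 'a=complex] algebra_simps)
    have "(Fm *v (Z1 *v vvec a b)) $ i = ((- (\<i> / ?s)) *s vvec a b) $ i" for i
    proof -
      have "- (- of_real r) * of_nat \<Delta> * (Fm *v (Z1 *v vvec a b)) $ i = - (\<i> * ?s * of_real r) * vvec a b $ i"
        using e1[of i] unfolding e2 by simp
      then have "of_real r * ?s * (?s * (Fm *v (Z1 *v vvec a b)) $ i + \<i> * vvec a b $ i) = 0"
        unfolding s(2)[symmetric] by (simp add: algebra_simps)
      then have "?s * (Fm *v (Z1 *v vvec a b)) $ i = - \<i> * vvec a b $ i"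
        using r(1) s(1) by (simp add: add_eq_0_iff2)
      then show ?thesis using s(1) by (simp add: field_simps)
    qed
    then have "Fm *v (Z1 *v vvec a b) = (- (\<i> / ?s)) *s vvec a b" by (simp add: vec_eq_iff)
    (* the image of the base point has the same negative eigenvector as Z *)
    from Vset_eigen(1)[OF D Z1V this] have "Z1 = Z" by (simp add: Z)
    then show "Z \<in> hV \<Delta>" using Z1h by simp
  qed
qed

section \<open>Matrices fixing the ball pointwise\<close>

text \<open>
  Three points with purely imaginary entries suffice: at such a point the real and imaginary parts of
  the equation are linear in the blocks of \<open>x\<close>.
\<close>
lemma fix_test_points:
  fixes x :: rmat6
  assumes D: "\<Delta> > 0" and f: "\<And>Z. Z \<in> Vset \<Delta> \<Longrightarrow> moves x Z Z"
  obtains l m where "x = l *\<^sub>R mat 1 + m *\<^sub>R Jm \<Delta>"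
proof -
  let ?s = "sqrt (real \<Delta>)"
  have s: "?s > 0" "?s * ?s = real \<Delta>" using D by auto
  define A B C E where "A = blockA x" and "B = blockB x" and "C = blockC x" and "E = blockD x"
  (* real and imaginary part of the equation for Z = i Y / sqrt Delta *)
  have key: "A ** Y = Y ** E \<and> real \<Delta> *\<^sub>R B = - (Y ** C ** Y)"
    if Z: "Z = (\<chi> i j. \<i> / sq \<Delta> * complex_of_real (Y $ i $ j))" "Z \<in> Vset \<Delta>" for Z Y
  proof -
    have m: "cm A ** Z + cm B = Z ** (cm C ** Z + cm E)"
      using f[OF Z(2)] by (simp add: moves_def aut_factor_def cblock_def A_def B_def C_def E_def)
    have "?s / real \<Delta> = 1 / ?s" using s by (simp add: field_simps)
    then have R: "map_matrix Re Z = 0" "map_matrix Im Z = (1 / ?s) *\<^sub>R Y"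
      using s by (simp_all add: Z(1) vec_eq_iff Im_divide Re_divide power2_eq_square flip: times_divide_eq_right) simp_all
    have "B = - ((1 / ?s) *\<^sub>R (Y ** ((1 / ?s) *\<^sub>R (C ** Y))))"
      using arg_cong[OF m, of "map_matrix Re"] by (simp add: re_im_mult R mmult_simps)
    then have "real \<Delta> *\<^sub>R B = - ((real \<Delta> / (?s * ?s)) *\<^sub>R (Y ** C ** Y))"
      by (simp add: mmult_simps matrix_mul_assoc)
    moreover have "(1 / ?s) *\<^sub>R (A ** Y) = (1 / ?s) *\<^sub>R (Y ** E)"
      using arg_cong[OF m, of "map_matrix Im"] by (simp add: re_im_mult R mmult_simps)
    ultimately show ?thesis using s D by simp
  qed
  define Y where "Y a b = (\<chi> i j. Emat $ i $ j - 2 / (a\<^sup>2 + b\<^sup>2 - 1) *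
     (vector [a, b, -1] :: real^3) $ i * (vector [a, b, -1] :: real^3) $ j)" for a b
  have Yk: "A ** Y a b = Y a b ** E \<and> real \<Delta> *\<^sub>R B = - (Y a b ** C ** Y a b)" if "a\<^sup>2 + b\<^sup>2 < 1" for a b :: real
  proof (rule key)
    show "vphi \<Delta> (of_real a, of_real b) = (\<chi> i j. \<i> / sq \<Delta> * complex_of_real (Y a b $ i $ j))"
      unfolding vec_eq_iff forall_3 by (simp add: vphi_def Y_def vector_3 Fm_nth)
    show "vphi \<Delta> (of_real a, of_real b) \<in> Vset \<Delta>" using that by (intro vphi_Vset[OF D]) simp
  qed
  have y0: "Y 0 0 = mat 1" unfolding vec_eq_iff forall_3 by (simp add: Y_def vector_3 Emat_nth mat_def)
  have k0: "A = E" "real \<Delta> *\<^sub>R B = - C" using Yk[of 0 0] by (simp_all add: y0)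
  (* the test points are (0, 0), (1/2, 0) and (0, 1/2) *)
  have k1: "A ** Y (1/2) 0 = Y (1/2) 0 ** A" "C = Y (1/2) 0 ** C ** Y (1/2) 0"
    using Yk[of "1/2" 0] k0 by (simp_all add: power2_eq_square)
  have k2: "A ** Y 0 (1/2) = Y 0 (1/2) ** A" "C = Y 0 (1/2) ** C ** Y 0 (1/2)"
    using Yk[of 0 "1/2"] k0 by (simp_all add: power2_eq_square)
  have r: "(X ** W) $ i $ j = X $ i $ 1 * W $ 1 $ j + X $ i $ 2 * W $ 2 $ j + X $ i $ 3 * W $ 3 $ j"
    for X W :: rmat3 and i j by (simp add: matrix_matrix_mult_def sum_3)
  have y1: "Y (1/2) 0 $ 1 $ 1 = 5/3" "Y (1/2) 0 $ 1 $ 2 = 0" "Y (1/2) 0 $ 1 $ 3 = -4/3"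
    "Y (1/2) 0 $ 2 $ 1 = 0" "Y (1/2) 0 $ 2 $ 2 = 1" "Y (1/2) 0 $ 2 $ 3 = 0"
    "Y (1/2) 0 $ 3 $ 1 = -4/3" "Y (1/2) 0 $ 3 $ 2 = 0" "Y (1/2) 0 $ 3 $ 3 = 5/3"
    by (simp_all add: Y_def Emat_nth vector_3 power2_eq_square)
  have y2: "Y 0 (1/2) $ 1 $ 1 = 1" "Y 0 (1/2) $ 1 $ 2 = 0" "Y 0 (1/2) $ 1 $ 3 = 0"
    "Y 0 (1/2) $ 2 $ 1 = 0" "Y 0 (1/2) $ 2 $ 2 = 5/3" "Y 0 (1/2) $ 2 $ 3 = -4/3"
    "Y 0 (1/2) $ 3 $ 1 = 0" "Y 0 (1/2) $ 3 $ 2 = -4/3" "Y 0 (1/2) $ 3 $ 3 = 5/3"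
    by (simp_all add: Y_def Emat_nth vector_3 power2_eq_square)
  have a1: "(A ** Y (1/2) 0) $ i $ j = (Y (1/2) 0 ** A) $ i $ j" "(A ** Y 0 (1/2)) $ i $ j = (Y 0 (1/2) ** A) $ i $ j" for i j
    using k1 k2 by simp_all
  have c1: "C $ i $ j = (Y (1/2) 0 ** C ** Y (1/2) 0) $ i $ j" "C $ i $ j = (Y 0 (1/2) ** C ** Y 0 (1/2)) $ i $ j" for i j
    using k1 k2 by simp_all
  have A: "A = A $ 3 $ 3 *\<^sub>R mat 1"
    unfolding vec_eq_iff forall_3 using a1[of 1 1] a1[of 1 2] a1[of 1 3] a1[of 2 1] a1[of 2 2] a1[of 2 3] a1[of 3 1] a1[of 3 2] a1[of 3 3]
    by (simp add: r y1 y2 mat_def)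
  note c1s = c1[unfolded r]
  have "C $ 2 $ 1 = 0" "C $ 3 $ 1 = 0" using c1s(2)[of 2 1] c1s(2)[of 3 1] by (simp_all add: y1 y2)
  moreover have "C $ 1 $ 2 = 0" "C $ 1 $ 3 = 0" using c1s(2)[of 1 2] c1s(2)[of 1 3] by (simp_all add: y1 y2)
  moreover have "C $ 3 $ 2 = 0" using c1s(1)[of 1 2] c1s(1)[of 3 2] by (simp add: y1 y2)
  moreover have "C $ 2 $ 3 = 0" using c1s(1)[of 2 1] c1s(1)[of 2 3] by (simp add: y1 y2)
  ultimately have c0: "C $ 1 $ 2 = 0" "C $ 2 $ 1 = 0" "C $ 1 $ 3 = 0" "C $ 3 $ 1 = 0" "C $ 2 $ 3 = 0" "C $ 3 $ 2 = 0"
    by simp_all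
  have "C $ 1 $ 1 = - C $ 3 $ 3" using c1s(1)[of 3 1] by (simp add: c0 y1 y2)
  moreover have "C $ 2 $ 2 = - C $ 3 $ 3" using c1s(2)[of 3 2] by (simp add: c0 y1 y2)
  ultimately have C: "C = - (C $ 3 $ 3) *\<^sub>R Emat"
    unfolding vec_eq_iff forall_3 by (simp add: Emat_nth c0)
  have "x = (A $ 3 $ 3) *\<^sub>R mat 1 + (C $ 3 $ 3 / real \<Delta>) *\<^sub>R Jm \<Delta>"
  proof (rule blocks_eqI)
    have "B = (1 / real \<Delta>) *\<^sub>R (real \<Delta> *\<^sub>R B)" using D by simp
    also have "\<dots> = (C $ 3 $ 3 / real \<Delta>) *\<^sub>R Emat" unfolding k0(2) by (subst C) simp
    finally show "blockB x = blockB ((A $ 3 $ 3) *\<^sub>R mat 1 + (C $ 3 $ 3 / real \<Delta>) *\<^sub>R Jm \<Delta>)"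
      by (simp add: B_def)
    show "blockA x = blockA ((A $ 3 $ 3) *\<^sub>R mat 1 + (C $ 3 $ 3 / real \<Delta>) *\<^sub>R Jm \<Delta>)"
      "blockD x = blockD ((A $ 3 $ 3) *\<^sub>R mat 1 + (C $ 3 $ 3 / real \<Delta>) *\<^sub>R Jm \<Delta>)"
      "blockC x = blockC ((A $ 3 $ 3) *\<^sub>R mat 1 + (C $ 3 $ 3 / real \<Delta>) *\<^sub>R Jm \<Delta>)"
      using A C k0(1) D by (simp_all flip: A_def C_def E_def)
  qed
  then show ?thesis by (rule that)
qed

text \<open>
  The automorphy factor of \<open>J\<close> describes the action of \<open>sqrt(-\<Delta>)\<close> on the tangent space.  Its trace is
  constant on the ball and, the signature being \<open>(2,1)\<close>, nonzero.
\<close>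
lemma trace_aut_Jm:
  assumes D: "\<Delta> > 0" and "Z \<in> Vset \<Delta>"
  shows "trace (aut_factor (Jm \<Delta>) Z) = - (\<i> * sq \<Delta>)"
proof -
  obtain a b where Z: "Z = vphi \<Delta> (a, b)" and ab: "(cmod a)\<^sup>2 + (cmod b)\<^sup>2 < 1"
    using assms(2) unfolding Vset_vphi[OF D] using ball_iff by auto
  define k where "k = 2 / (a\<^sup>2 + b\<^sup>2 - 1)"
  have k: "k * (a\<^sup>2 + b\<^sup>2 - 1) = 2"
    using k_def nonzero_eq_divide_eq[OF ball_q[OF ab], of k 2] by blast
  have e: "Z $ i $ j = \<i> / sq \<Delta> * (Fm $ i $ j - k * uvec a b $ i * uvec a b $ j)" for i j
    by (simp add: Z vphi_def k_def)
  have "trace (Fm ** Z) = \<i> / sq \<Delta> * (3 - k * (a\<^sup>2 + b\<^sup>2 - 1))"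
    by (simp add: trace_def sum_3 mm_sum e Fm_nth Emat_nth power2_eq_square algebra_simps add_divide_distrib diff_divide_distrib)
  then have "trace (Fm ** Z) = \<i> / sq \<Delta>" unfolding k by simp
  moreover have "trace (aut_factor (Jm \<Delta>) Z) = - (of_nat \<Delta> * trace (Fm ** Z))"
    by (simp add: aut_Jm trace_def sum_negf scaleR_conv_of_real[where 'a=complex] flip: sum_distrib_left)
  ultimately have "trace (aut_factor (Jm \<Delta>) Z) = - (sq \<Delta> * (sq \<Delta> * (\<i> / sq \<Delta>)))"
    unfolding sq_facts(3)[OF D] by simp
  then show ?thesis using sq_facts(1)[OF D] by simp
qed

text \<open>
  By \<open>fix_test_points\<close> the conjugate of \<open>J\<close> is a combination of 1 and \<open>J\<close>, and it has the same square as
  \<open>J\<close>; so it is \<open>J\<close> or \<open>-J\<close>.  The second case would change the sign of the trace on the tangent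
  space.
\<close>
lemma normalizer_commutes:
  assumes D: "\<Delta> > 0" and g: "psim c g"
    and f: "\<And>Z. Z \<in> Vset \<Delta> \<Longrightarrow> moves (g ** Jm \<Delta> ** adj g) Z Z"
  shows "g ** Jm \<Delta> = Jm \<Delta> ** g"
proof -
  have c: "c > 0" using psim_pos[OF g] .
  obtain l m where x: "g ** Jm \<Delta> ** adj g = l *\<^sub>R mat 1 + m *\<^sub>R Jm \<Delta>"
    using fix_test_points[OF D f] by blast
  let ?x = "g ** Jm \<Delta> ** adj g"
  have "?x ** ?x = g ** Jm \<Delta> ** (adj g ** g) ** Jm \<Delta> ** adj g" by (simp add: matrix_mul_assoc)
  also have "\<dots> = c *\<^sub>R (g ** (Jm \<Delta> ** Jm \<Delta>) ** adj g)"
    by (simp add: psim_left[OF g] mmult_simps matrix_mul_assoc)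
  also have "\<dots> = - ((c * c * real \<Delta>) *\<^sub>R mat 1)"
    by (simp add: Jm_square mmult_simps psim_right[OF g])
  finally have xx: "?x ** ?x = - ((c * c * real \<Delta>) *\<^sub>R mat 1)" .
  have xx': "?x ** ?x = (l * l - m * m * real \<Delta>) *\<^sub>R mat 1 + (l * m + l * m) *\<^sub>R Jm \<Delta>"
    unfolding x
    by (simp add: mmult_simps Jm_square) (simp add: vec_eq_iff algebra_simps)
  have e: "(l * l - m * m * real \<Delta>) = - (c * c * real \<Delta>)" "l * m = 0"
    using arg_cong[OF xx'[unfolded xx], of "\<lambda>M. blockA M $ 1 $ 1"]
      arg_cong[OF xx'[unfolded xx], of "\<lambda>M. blockB M $ 1 $ 1"]
    unfolding block_arith Jm_sel vector_add_component vector_scaleR_component vector_uminus_component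
    by (simp_all add: mat_def Emat_nth)
  have "l = 0"
  proof (rule ccontr)
    assume "l \<noteq> 0"
    then have "m = 0" using e(2) by simp
    then have "l * l = - (c * c * real \<Delta>)" using e(1) by simp
    moreover have "l * l > 0" "c * c * real \<Delta> > 0"
      using \<open>l \<noteq> 0\<close> c D by (auto simp: zero_less_mult_iff)
    ultimately show False by linarith
  qed
  then have "(m - c) * (m + c) * real \<Delta> = 0" using e(1) by (simp add: algebra_simps)
  then have mc: "m = c \<or> m = - c" using D by auto
  have "?x ** g = c *\<^sub>R (g ** Jm \<Delta>)"
    by (simp add: matrix_mul_assoc[symmetric] psim_left[OF g] mmult_simps)
  then have gJ: "c *\<^sub>R (g ** Jm \<Delta>) = m *\<^sub>R (Jm \<Delta> ** g)"
    unfolding x using \<open>l = 0\<close> by (simp add: mmult_simps)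
  have "m \<noteq> - c"
  proof
    assume "m = - c"
    then have "c *\<^sub>R (g ** Jm \<Delta>) = c *\<^sub>R ((-1) *\<^sub>R (Jm \<Delta> ** g))" using gJ by simp
    then have n: "g ** Jm \<Delta> = (-1) *\<^sub>R (Jm \<Delta> ** g)" using c by (simp only: scaleR_cancel_left) simp
    define Z where "Z = Z0 \<Delta>"
    have Z: "Z \<in> Vset \<Delta>" "Z \<in> siegel_space" using Z0_Vset[OF D] by (simp_all add: Z_def Vset_def)
    define W where "W = siegel_act (adj g) Z"
    have W: "W \<in> siegel_space" "siegel_act g W = Z"
      using Z(2) g act_siegel act_adj(2)[OF g Z(2)] by (simp_all add: W_def)
    have WV: "moves (Jm \<Delta>) W W" using fix_conj[OF g W(1), of "Jm \<Delta>"] f[OF Z(1)] W(2) by simp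
    have gW: "moves g W Z" using act_moves[OF g W(1)] W(2) by simp
    let ?Q = "aut_factor g W"
    note inv = matrix_inv_mult[OF aut_factor_invertible[OF g W(1)]]
    have q: "?Q ** aut_factor (Jm \<Delta>) W = (-1) *\<^sub>R (aut_factor (Jm \<Delta>) Z ** ?Q)"
      using aut_commute[OF gW WV _ n] Z(1) by (simp add: Vset_def)
    have "trace (aut_factor (Jm \<Delta>) W) = trace (matrix_inv ?Q ** (?Q ** aut_factor (Jm \<Delta>) W))"
      by (simp add: matrix_mul_assoc inv)
    also have "\<dots> = - trace (matrix_inv ?Q ** (aut_factor (Jm \<Delta>) Z ** ?Q))"
      unfolding q by (simp add: mmult_simps trace_def sum_negf)
    also have "\<dots> = - trace ((aut_factor (Jm \<Delta>) Z ** ?Q) ** matrix_inv ?Q)"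
      by (subst trace_mul_sym) simp
    also have "\<dots> = - trace (aut_factor (Jm \<Delta>) Z)" by (simp add: matrix_mul_assoc[symmetric] inv)
    finally show False
      using trace_aut_Jm[OF D, of W] trace_aut_Jm[OF D Z(1)] W(1) WV D by (simp add: Vset_def)
  qed
  then show ?thesis using mc gJ c by simp
qed

section \<open>Analytic subsets\<close>

lemma holomorphic_several_mono: "holomorphic_several f U \<Longrightarrow> V \<subseteq> U \<Longrightarrow> holomorphic_several f V"
  by (auto simp: holomorphic_several_def)

lemma holomorphic_several_const: "holomorphic_several (\<lambda>z. c) U"
  unfolding holomorphic_several_def by (intro ballI exI[of _ "\<lambda>v. 0"]) auto

lemma holomorphic_several_add:
  assumes "holomorphic_several f U" "holomorphic_several g U"
  shows "holomorphic_several (\<lambda>z. f z + g z) U"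
  unfolding holomorphic_several_def
proof
  fix z assume z: "z \<in> U"
  obtain D where D: "(f has_derivative D) (at z)" "\<And>c v. D (cscale c v) = c * D v"
    using assms(1) z unfolding holomorphic_several_def by blast
  obtain E where E: "(g has_derivative E) (at z)" "\<And>c v. E (cscale c v) = c * E v"
    using assms(2) z unfolding holomorphic_several_def by blast
  show "\<exists>D. ((\<lambda>z. f z + g z) has_derivative D) (at z) \<and> (\<forall>c v. D (cscale c v) = c * D v)"
    using has_derivative_add[OF D(1) E(1)] D(2) E(2)
    by (intro exI[of _ "\<lambda>v. D v + E v"]) (simp add: algebra_simps)
qed

lemma holomorphic_several_mult:
  assumes "holomorphic_several f U" "holomorphic_several g U"
  shows "holomorphic_several (\<lambda>z. f z * g z) U"
  unfolding holomorphic_several_def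
proof
  fix z assume z: "z \<in> U"
  obtain D where D: "(f has_derivative D) (at z)" "\<And>c v. D (cscale c v) = c * D v"
    using assms(1) z unfolding holomorphic_several_def by blast
  obtain E where E: "(g has_derivative E) (at z)" "\<And>c v. E (cscale c v) = c * E v"
    using assms(2) z unfolding holomorphic_several_def by blast
  show "\<exists>D. ((\<lambda>z. f z * g z) has_derivative D) (at z) \<and> (\<forall>c v. D (cscale c v) = c * D v)"
    using has_derivative_mult[OF D(1) E(1)] D(2) E(2)
    by (intro exI[of _ "\<lambda>v. f z * E v + D v * g z"]) (simp add: algebra_simps)
qed

lemma holomorphic_several_sum:
  assumes "\<And>i. i \<in> I \<Longrightarrow> holomorphic_several (f i) U"
  shows "holomorphic_several (\<lambda>z. \<Sum>i\<in>I. f i z) U"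
  using assms by (induction I rule: infinite_finite_induct)
    (auto intro: holomorphic_several_const holomorphic_several_add)

lemma holomorphic_several_diff:
  assumes "holomorphic_several f U" "holomorphic_several g U"
  shows "holomorphic_several (\<lambda>z. f z - g z) U"
  using holomorphic_several_add[OF assms(1) holomorphic_several_mult[OF holomorphic_several_const[of "-1"] assms(2)]]
  by simp

lemma holomorphic_several_linear:
  assumes "bounded_linear f" "\<And>c v. f (cscale c v) = c * f v"
  shows "holomorphic_several f U"
  using assms bounded_linear_imp_has_derivative unfolding holomorphic_several_def by blast

lemma bounded_linear_entry: "bounded_linear (\<lambda>Z::cmat3. Z $ i $ j)"
  by (rule bounded_linear_compose[OF bounded_linear_vec_nth bounded_linear_vec_nth])

lemma holomorphic_several_entry: "holomorphic_several (\<lambda>Z::cmat3. Z $ i $ j) U"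
  by (rule holomorphic_several_linear[OF bounded_linear_entry])
    (simp add: cscale_vec_def cscale_complex_def)

lemma holomorphic_several_entry_fst: "holomorphic_several (\<lambda>Z::cmat3\<times>cmat3. fst Z $ i $ j) U"
  by (rule holomorphic_several_linear[OF bounded_linear_compose[OF bounded_linear_entry bounded_linear_fst]])
    (simp add: cscale_vec_def cscale_complex_def cscale_prod_def)

lemma holomorphic_several_entry_snd: "holomorphic_several (\<lambda>Z::cmat3\<times>cmat3. snd Z $ i $ j) U"
  by (rule holomorphic_several_linear[OF bounded_linear_compose[OF bounded_linear_entry bounded_linear_snd]])
    (simp add: cscale_vec_def cscale_complex_def cscale_prod_def)

lemmas holomorphic_several_intros = holomorphic_several_const holomorphic_several_add holomorphic_several_mult
  holomorphic_several_sum holomorphic_several_diff holomorphic_several_entry holomorphic_several_entry_fst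
  holomorphic_several_entry_snd

lemma holomorphic_several_continuous:
  assumes "holomorphic_several f U" shows "continuous_on U f"
proof (rule continuous_at_imp_continuous_on, rule ballI)
  fix z assume "z \<in> U"
  then obtain D where "(f has_derivative D) (at z)" using assms unfolding holomorphic_several_def by blast
  then show "continuous (at z) f" by (rule has_derivative_continuous)
qed

lemma analytic_subsetI_global:
  assumes "finite F" "\<And>f. f \<in> F \<Longrightarrow> holomorphic_several f UNIV" "A = {w \<in> M. \<forall>f\<in>F. f w = 0}"
  shows "analytic_subset M A"
  unfolding analytic_subset_def using assms by (auto intro!: exI[of _ UNIV] exI[of _ F])

lemma analytic_local:
  assumes "analytic_subset M A" "z \<in> M"
  obtains U F where "open U" "z \<in> U" "finite F" "\<forall>f\<in>F. holomorphic_several f U"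
    "A \<inter> U = {w \<in> M \<inter> U. \<forall>f\<in>F. f w = 0}"
  using assms unfolding analytic_subset_def by blast

lemma analytic_empty: "analytic_subset M {}"
  by (rule analytic_subsetI_global[of "{\<lambda>z. 1}"]) (auto intro: holomorphic_several_const)

lemma analytic_Int:
  assumes "analytic_subset M A" "analytic_subset M B" shows "analytic_subset M (A \<inter> B)"
  unfolding analytic_subset_def
proof (intro conjI ballI)
  show "A \<inter> B \<subseteq> M" using assms by (auto simp: analytic_subset_def)
  fix z assume z: "z \<in> M"
  obtain U F where U: "open U" "z \<in> U" "finite F" "\<forall>f\<in>F. holomorphic_several f U" "A \<inter> U = {w \<in> M \<inter> U. \<forall>f\<in>F. f w = 0}"
    by (rule analytic_local[OF assms(1) z])
  obtain V G where V: "open V" "z \<in> V" "finite G" "\<forall>f\<in>G. holomorphic_several f V" "B \<inter> V = {w \<in> M \<inter> V. \<forall>f\<in>G. f w = 0}"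
    by (rule analytic_local[OF assms(2) z])
  have "(A \<inter> B) \<inter> (U \<inter> V) = (A \<inter> U) \<inter> (B \<inter> V)" by blast
  also have "\<dots> = {w \<in> M \<inter> (U \<inter> V). \<forall>f\<in>F \<union> G. f w = 0}" unfolding U(5) V(5) by blast
  finally have e: "(A \<inter> B) \<inter> (U \<inter> V) = {w \<in> M \<inter> (U \<inter> V). \<forall>f\<in>F \<union> G. f w = 0}" .
  show "\<exists>U F. open U \<and> z \<in> U \<and> finite F \<and> (\<forall>f\<in>F. holomorphic_several f U) \<and>
        A \<inter> B \<inter> U = {w \<in> M \<inter> U. \<forall>f\<in>F. f w = 0}"
    by (rule exI[of _ "U \<inter> V"], rule exI[of _ "F \<union> G"])
      (use U V e in \<open>auto intro: holomorphic_several_mono\<close>)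
qed

lemma analytic_Un:
  assumes "analytic_subset M A" "analytic_subset M B" shows "analytic_subset M (A \<union> B)"
  unfolding analytic_subset_def
proof (intro conjI ballI)
  show "A \<union> B \<subseteq> M" using assms by (auto simp: analytic_subset_def)
  fix z assume z: "z \<in> M"
  obtain U F where U: "open U" "z \<in> U" "finite F" "\<forall>f\<in>F. holomorphic_several f U" "A \<inter> U = {w \<in> M \<inter> U. \<forall>f\<in>F. f w = 0}"
    by (rule analytic_local[OF assms(1) z])
  obtain V G where V: "open V" "z \<in> V" "finite G" "\<forall>f\<in>G. holomorphic_several f V" "B \<inter> V = {w \<in> M \<inter> V. \<forall>f\<in>G. f w = 0}"
    by (rule analytic_local[OF assms(2) z])
  define H where "H = (\<lambda>(f, g) w. f w * g w) ` (F \<times> G)"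
  have "(A \<union> B) \<inter> (U \<inter> V) = ((A \<inter> U) \<union> (B \<inter> V)) \<inter> (U \<inter> V)" by blast
  also have "\<dots> = {w \<in> M \<inter> (U \<inter> V). \<forall>f\<in>H. f w = 0}" unfolding U(5) V(5) H_def by force
  finally have e: "(A \<union> B) \<inter> (U \<inter> V) = {w \<in> M \<inter> (U \<inter> V). \<forall>f\<in>H. f w = 0}" .
  have "holomorphic_several h (U \<inter> V)" if "h \<in> H" for h
    using that U(4) V(4) holomorphic_several_mono[of _ U "U \<inter> V"] holomorphic_several_mono[of _ V "U \<inter> V"]
    by (auto simp: H_def intro!: holomorphic_several_mult)
  moreover have "finite H" using U(3) V(3) by (simp add: H_def)
  ultimately show "\<exists>U F. open U \<and> z \<in> U \<and> finite F \<and> (\<forall>f\<in>F. holomorphic_several f U) \<and>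
        (A \<union> B) \<inter> U = {w \<in> M \<inter> U. \<forall>f\<in>F. f w = 0}"
    by (intro exI[of _ "U \<inter> V"] exI[of _ H]) (use U V e in auto)
qed

lemma analytic_UN_finite:
  assumes "finite I" "\<And>i. i \<in> I \<Longrightarrow> analytic_subset M (A i)"
  shows "analytic_subset M (\<Union>i\<in>I. A i)"
  using assms by (induction I) (auto intro: analytic_empty analytic_Un)

definition locally_finite_in :: "'a::topological_space set \<Rightarrow> 'i set \<Rightarrow> ('i \<Rightarrow> 'a set) \<Rightarrow> bool" where
  "locally_finite_in M I A \<longleftrightarrow> (\<forall>z\<in>M. \<exists>U. open U \<and> z \<in> U \<and> finite {i \<in> I. A i \<inter> U \<noteq> {}})"

lemma analytic_UN_locally_finite:
  assumes "locally_finite_in M I A" "\<And>i. i \<in> I \<Longrightarrow> analytic_subset M (A i)"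
  shows "analytic_subset M (\<Union>i\<in>I. A i)"
  unfolding analytic_subset_def
proof (intro conjI ballI)
  show "(\<Union>i\<in>I. A i) \<subseteq> M" using assms(2) by (auto simp: analytic_subset_def)
  fix z assume z: "z \<in> M"
  obtain U where U: "open U" "z \<in> U" "finite {i \<in> I. A i \<inter> U \<noteq> {}}"
    using assms(1) z unfolding locally_finite_in_def by blast
  let ?J = "{i \<in> I. A i \<inter> U \<noteq> {}}"
  have "analytic_subset M (\<Union>i\<in>?J. A i)" by (rule analytic_UN_finite[OF U(3)]) (use assms(2) in auto)
  from this z obtain V F where V: "open V" "z \<in> V" "finite F" "\<forall>f\<in>F. holomorphic_several f V"
    "(\<Union>i\<in>?J. A i) \<inter> V = {w \<in> M \<inter> V. \<forall>f\<in>F. f w = 0}"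
    by (rule analytic_local)
  have "(\<Union>i\<in>I. A i) \<inter> (V \<inter> U) = ((\<Union>i\<in>?J. A i) \<inter> V) \<inter> U" by blast
  also have "\<dots> = {w \<in> M \<inter> (V \<inter> U). \<forall>f\<in>F. f w = 0}" unfolding V(5) by blast
  finally show "\<exists>U F. open U \<and> z \<in> U \<and> finite F \<and> (\<forall>f\<in>F. holomorphic_several f U) \<and>
        (\<Union>i\<in>I. A i) \<inter> U = {w \<in> M \<inter> U. \<forall>f\<in>F. f w = 0}"
    by (intro exI[of _ "V \<inter> U"] exI[of _ F]) (use U V in \<open>auto intro: holomorphic_several_mono\<close>)
qed

lemma analytic_closed:
  assumes "analytic_subset M A" "z \<in> M" "z \<notin> A"
  shows "\<exists>V. open V \<and> z \<in> V \<and> V \<inter> A = {}"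
proof -
  obtain U F where "open U" "z \<in> U" "finite F" "\<forall>f\<in>F. holomorphic_several f U" "A \<inter> U = {w \<in> M \<inter> U. \<forall>f\<in>F. f w = 0}"
    by (rule analytic_local[OF assms(1,2)])
  note U = this(1,2,4,5)
  then obtain f where f: "f \<in> F" "f z \<noteq> 0" using assms(2,3) by blast
  have "open (U \<inter> f -` (- {0}))"
    by (rule continuous_open_preimage[OF holomorphic_several_continuous U(1)]) (use U f in auto)
  then show ?thesis using U f by (intro exI[of _ "U \<inter> f -` (- {0})"]) auto
qed

section \<open>The identity theorem for maps from the ball\<close>

abbreviation B2 :: "(complex \<times> complex) set" where "B2 \<equiv> ball 0 1"

definition cline :: "complex \<times> complex \<Rightarrow> complex \<times> complex \<Rightarrow> complex \<Rightarrow> complex \<times> complex" where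
  "cline z w t = (fst z + t * (fst w - fst z), snd z + t * (snd w - snd z))"

definition cdom :: "complex \<times> complex \<Rightarrow> complex \<times> complex \<Rightarrow> complex set" where
  "cdom z w = {t. cline z w t \<in> B2}"

lemma cline_cont: "continuous_on UNIV (cline z w)"
  unfolding cline_def by (intro continuous_intros)

lemma cdom_open: "open (cdom z w)"
proof -
  have "cdom z w = cline z w -` B2" by (auto simp: cdom_def)
  then show ?thesis by (simp only: open_vimage[OF open_ball cline_cont])
qed

lemma cdom_connected: "connected (cdom z w)"
proof -
  have "convex (cdom z w)"
    unfolding convex_def
  proof (intro ballI allI impI)
    fix x y and u v :: real assume a: "x \<in> cdom z w" "y \<in> cdom z w" "0 \<le> u" "0 \<le> v" "u + v = 1"
    have v: "v = 1 - u" using a by simp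
    have "cline z w (u *\<^sub>R x + v *\<^sub>R y) = u *\<^sub>R cline z w x + v *\<^sub>R cline z w y"
      unfolding v cline_def by (simp add: scaleR_conv_of_real algebra_simps)
    moreover have "u *\<^sub>R cline z w x + v *\<^sub>R cline z w y \<in> B2"
      using a convexD[OF convex_ball] by (simp only: cdom_def mem_Collect_eq)
    ultimately show "u *\<^sub>R x + v *\<^sub>R y \<in> cdom z w" by (simp only: cdom_def mem_Collect_eq)
  qed
  then show ?thesis by (rule convex_connected)
qed

lemma cline_01 [simp]: "cline z w 0 = z" "cline z w 1 = w"
  by (simp_all add: cline_def)

text \<open>
  Analyticity is required along complex lines only.  This suffices for the identity theorem, which
  thereby reduces to functions of one variable.
\<close>
definition analytic_disc :: "(complex \<times> complex \<Rightarrow> 'a::{real_normed_vector,cscale}) \<Rightarrow> 'a set \<Rightarrow> bool" where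
  "analytic_disc \<phi> M \<longleftrightarrow> \<phi> ` B2 \<subseteq> M \<and> continuous_on B2 \<phi> \<and>
     (\<forall>z w t. t \<in> cdom z w \<longrightarrow> (\<exists>D. ((\<lambda>t. \<phi> (cline z w t)) has_derivative D) (at t) \<and> (\<forall>u. D u = cscale u (D 1))))"

text \<open>
  On the complex line from a point of \<open>U\<close> to a given point of the ball, the interior of the set of
  parameters at which the curve lies in \<open>A\<close> is nonempty, and it is closed by the identity theorem
  for the local equations of \<open>A\<close>.  The parameter domain is connected.
\<close>
lemma analytic_disc_identity:
  assumes \<phi>: "analytic_disc \<phi> M" and A: "analytic_subset M A"
    and U: "open U" "U \<noteq> {}" "U \<subseteq> B2" "\<phi> ` U \<subseteq> A"
  shows "\<phi> ` B2 \<subseteq> A"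
proof
  fix y assume "y \<in> \<phi> ` B2"
  then obtain w where w: "w \<in> B2" "y = \<phi> w" by blast
  obtain z where z: "z \<in> U" using U(2) by blast
  define c where "c t = \<phi> (cline z w t)" for t
  define T where "T = {t \<in> cdom z w. c t \<in> A}"
  have der: "\<exists>D. (c has_derivative D) (at t) \<and> (\<forall>u. D u = cscale u (D 1))" if "t \<in> cdom z w" for t
    using \<phi> that unfolding analytic_disc_def c_def by blast
  have cM: "c t \<in> M" if "t \<in> cdom z w" for t
    using \<phi> that unfolding analytic_disc_def c_def cdom_def by blast
  have cc: "continuous_on (cdom z w) c"
  proof (rule continuous_at_imp_continuous_on, rule ballI)
    fix t assume "t \<in> cdom z w"
    then obtain D where "(c has_derivative D) (at t)" using der by blast
    then show "continuous (at t) c" by (rule has_derivative_continuous)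
  qed
  have key: "t \<in> interior T" if t: "t \<in> cdom z w" "t \<in> closure (interior T)" for t
  proof -
    obtain V F where "open V" "c t \<in> V" "finite F" "\<forall>f\<in>F. holomorphic_several f V" "A \<inter> V = {w \<in> M \<inter> V. \<forall>f\<in>F. f w = 0}"
      by (rule analytic_local[OF A cM[OF t(1)]])
    note V = this(1,2,4,5)
    have "open (cdom z w \<inter> c -` V)" by (rule continuous_open_preimage[OF cc cdom_open V(1)])
    then obtain e where e: "e > 0" "ball t e \<subseteq> cdom z w \<inter> c -` V"
      using t(1) V(2) openE[of "cdom z w \<inter> c -` V" t] by auto
    have "ball t e \<inter> interior T \<noteq> {}" using t(2) e(1)
      by (metis Int_commute centre_in_ball open_ball open_Int_closure_eq_empty disjoint_iff)
    then have ne: "ball t e \<inter> interior T \<noteq> {}" .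
    have "f (c s) = 0" if f: "f \<in> F" and s: "s \<in> ball t e" for f s
    proof -
      have "(\<lambda>s. f (c s)) holomorphic_on ball t e"
        unfolding holomorphic_on_open[OF open_ball]
      proof
        fix s assume s: "s \<in> ball t e"
        then have "c s \<in> V" "s \<in> cdom z w" using e by auto
        then obtain D E where D: "(c has_derivative D) (at s)" "\<And>u. D u = cscale u (D 1)"
          and E: "(f has_derivative E) (at (c s))" "\<And>u v. E (cscale u v) = u * E v"
          using der V(3) f unfolding holomorphic_several_def by meson
        have "((\<lambda>s. f (c s)) has_derivative (\<lambda>u. E (D u))) (at s)"
          using has_derivative_compose[OF D(1) E(1)] .
        moreover have "(\<lambda>u. E (D u)) = (*) (E (D 1))"
        proof
          fix u
          have "E (D u) = E (cscale u (D 1))" by (subst D(2)) (rule refl)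
          then show "E (D u) = E (D 1) * u" by (simp add: E(2))
        qed
        ultimately show "\<exists>f'. ((\<lambda>s. f (c s)) has_field_derivative f') (at s)"
          unfolding has_field_derivative_def by metis
      qed
      moreover have "f (c r) = 0" if "r \<in> ball t e \<inter> interior T" for r
      proof -
        have "r \<in> T" using that interior_subset by blast
        then have "c r \<in> A \<inter> V" using that e by (auto simp: T_def)
        then show ?thesis using V(4) f by blast
      qed
      ultimately show ?thesis
        using analytic_continuation_open[of "ball t e \<inter> interior T" "ball t e" "\<lambda>s. f (c s)" "\<lambda>_. 0" s] ne s
        by auto
    qed
    then have "ball t e \<subseteq> T"
      using e V(4) cM unfolding T_def by blast
    then show ?thesis using e(1) by (metis centre_in_ball interior_maximal open_ball subsetD)
  qed
  have "open (cdom z w \<inter> cline z w -` U)"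
    by (intro open_Int cdom_open open_vimage[OF U(1) cline_cont])
  moreover have "cdom z w \<inter> cline z w -` U \<subseteq> T" using U(4) by (auto simp: T_def c_def)
  moreover have "0 \<in> cdom z w \<inter> cline z w -` U" using z U(3) by (auto simp: cdom_def)
  ultimately have 0: "0 \<in> interior T" by (metis interior_maximal subsetD)
  have sub: "interior T \<subseteq> cdom z w" using interior_subset[of T] by (auto simp: T_def)
  have "interior T = cdom z w"
  proof -
    have "closedin (top_of_set (cdom z w)) (interior T)"
      unfolding closedin_closed by (rule exI[of _ "closure (interior T)"])
        (use key sub closure_subset in blast)
    moreover have "openin (top_of_set (cdom z w)) (interior T)"
      using sub by (simp add: openin_open_eq cdom_open)
    ultimately show ?thesis using cdom_connected[of z w] 0 unfolding connected_clopen by blast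
  qed
  moreover have "1 \<in> cdom z w" using w by (simp add: cdom_def)
  ultimately have "1 \<in> T" using interior_subset by blast
  then show "y \<in> A" using w by (simp add: T_def c_def)
qed

text \<open>
  If the first set does not contain the image of \<open>U\<close>, then removing its preimage leaves a nonempty open
  set whose image is covered by the other sets.
\<close>
lemma analytic_disc_finite:
  assumes \<phi>: "analytic_disc \<phi> M" and "finite I"
    and A: "\<And>i. i \<in> I \<Longrightarrow> analytic_subset M (A i)"
    and U: "open U" "U \<noteq> {}" "U \<subseteq> B2" "\<phi> ` U \<subseteq> (\<Union>i\<in>I. A i)"
  shows "\<exists>i\<in>I. \<phi> ` B2 \<subseteq> A i"
  using assms(2) A U
proof (induction I arbitrary: U)
  case empty then show ?case by simp
next
  case (insert i I)
  show ?case
  proof (cases "\<phi> ` U \<subseteq> A i")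
    case True
    then show ?thesis using analytic_disc_identity[OF \<phi> _ insert.prems(2,3,4)] insert.prems(1) by blast
  next
    case False
    define U' where "U' = {z \<in> U. \<phi> z \<notin> A i}"
    have c: "continuous_on U \<phi>" using \<phi> insert.prems(4) continuous_on_subset unfolding analytic_disc_def by blast
    have "open U'"
      unfolding open_subopen[of U']
    proof
      fix z assume z: "z \<in> U'"
      then have "\<phi> z \<in> M" using \<phi> insert.prems(4) unfolding analytic_disc_def U'_def by blast
      then obtain V where V: "open V" "\<phi> z \<in> V" "V \<inter> A i = {}"
        using analytic_closed[of M "A i" "\<phi> z"] insert.prems(1) z unfolding U'_def by blast
      have "open (U \<inter> \<phi> -` V)" by (rule continuous_open_preimage[OF c insert.prems(2) V(1)])
      then show "\<exists>T. open T \<and> z \<in> T \<and> T \<subseteq> U'"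
        using V z by (intro exI[of _ "U \<inter> \<phi> -` V"]) (auto simp: U'_def)
    qed
    moreover have "U' \<noteq> {}" "U' \<subseteq> B2" "\<phi> ` U' \<subseteq> (\<Union>i\<in>I. A i)"
      using False insert.prems by (auto simp: U'_def)
    ultimately show ?thesis using insert.IH[of U'] insert.prems(1) by blast
  qed
qed

text \<open>
  Near the centre of the ball only finitely many of the sets matter.
\<close>
lemma analytic_disc_locally_finite:
  assumes \<phi>: "analytic_disc \<phi> M" and lf: "locally_finite_in M I A"
    and A: "\<And>i. i \<in> I \<Longrightarrow> analytic_subset M (A i)"
    and sub: "\<phi> ` B2 \<subseteq> (\<Union>i\<in>I. A i)"
  shows "\<exists>i\<in>I. \<phi> ` B2 \<subseteq> A i"
proof -
  have 0: "(0, 0) \<in> B2" by (simp add: zero_prod_def[symmetric])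
  then have "\<phi> (0, 0) \<in> M" using \<phi> unfolding analytic_disc_def by blast
  then obtain V where V: "open V" "\<phi> (0, 0) \<in> V" "finite {i \<in> I. A i \<inter> V \<noteq> {}}"
    using lf unfolding locally_finite_in_def by blast
  have "open (B2 \<inter> \<phi> -` V)"
    by (rule continuous_open_preimage[OF _ open_ball V(1)]) (use \<phi> in \<open>simp add: analytic_disc_def\<close>)
  moreover have "\<phi> ` (B2 \<inter> \<phi> -` V) \<subseteq> (\<Union>i\<in>{i \<in> I. A i \<inter> V \<noteq> {}}. A i)" using sub by blast
  ultimately show ?thesis
    using analytic_disc_finite[OF \<phi> V(3), of A "B2 \<inter> \<phi> -` V"] A 0 V(2) by blast
qed

section \<open>Analytic families of matrices\<close>

definition ball_holo :: "(complex \<times> complex \<Rightarrow> complex) \<Rightarrow> bool" where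
  "ball_holo f \<longleftrightarrow> continuous_on B2 f \<and> (\<forall>z w. (\<lambda>t. f (cline z w t)) holomorphic_on cdom z w)"

lemma ball_holo_intros:
  "ball_holo (\<lambda>z. c)" "ball_holo fst" "ball_holo snd"
  "ball_holo f \<Longrightarrow> ball_holo g \<Longrightarrow> ball_holo (\<lambda>z. f z + g z)"
  "ball_holo f \<Longrightarrow> ball_holo g \<Longrightarrow> ball_holo (\<lambda>z. f z - g z)"
  "ball_holo f \<Longrightarrow> ball_holo g \<Longrightarrow> ball_holo (\<lambda>z. f z * g z)"
  "ball_holo f \<Longrightarrow> ball_holo g \<Longrightarrow> (\<And>z. z \<in> B2 \<Longrightarrow> g z \<noteq> 0) \<Longrightarrow> ball_holo (\<lambda>z. f z / g z)"
  unfolding ball_holo_def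
  by (auto intro!: continuous_intros holomorphic_intros simp: cline_def cdom_def)

lemma ball_holo_sum: "(\<And>i. i \<in> I \<Longrightarrow> ball_holo (f i)) \<Longrightarrow> ball_holo (\<lambda>z. \<Sum>i\<in>I. f i z)"
  by (induction I rule: infinite_finite_induct) (auto intro: ball_holo_intros)

lemma ball_holo_power2: "ball_holo f \<Longrightarrow> ball_holo (\<lambda>z. (f z)\<^sup>2)"
  by (simp add: power2_eq_square ball_holo_intros)

lemma has_derivative_vec:
  fixes f :: "complex \<Rightarrow> 'a::real_normed_vector^'n"
  assumes "\<And>i. ((\<lambda>t. f t $ i) has_derivative D i) (at x)"
  shows "(f has_derivative (\<lambda>h. \<chi> i. D i h)) (at x)"
proof -
  have "linear (\<lambda>h. \<chi> i. D i h)"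
    using linear_add[OF has_derivative_linear[OF assms]] linear_scale[OF has_derivative_linear[OF assms]]
    by (intro linearI) (simp_all add: vec_eq_iff)
  then have "bounded_linear (\<lambda>h. \<chi> i. D i h)" by (simp add: linear_conv_bounded_linear)
  moreover have "((\<lambda>y. ((f y - f x) - (\<chi> i. D i (y - x))) /\<^sub>R norm (y - x)) \<longlongrightarrow> 0) (at x)"
    using assms by (intro vec_tendstoI) (simp add: has_derivative_def)
  ultimately show ?thesis
    unfolding has_derivative_def by (simp add: netlimit_at)
qed

lemma ball_holo_curve:
  fixes \<phi> :: "complex \<times> complex \<Rightarrow> cmat3"
  assumes "\<And>i j. ball_holo (\<lambda>z. \<phi> z $ i $ j)"
  shows "continuous_on B2 \<phi>"
    "t \<in> cdom z w \<Longrightarrow> \<exists>D. ((\<lambda>t. \<phi> (cline z w t)) has_derivative D) (at t) \<and> (\<forall>u. D u = cscale u (D 1))"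
proof -
  show "continuous_on B2 \<phi>"
    using assms unfolding ball_holo_def continuous_on_def by (auto intro!: vec_tendstoI)
  assume t: "t \<in> cdom z w"
  have "\<exists>d. ((\<lambda>t. \<phi> (cline z w t) $ i $ j) has_field_derivative d) (at t)" for i j
    using assms t unfolding ball_holo_def holomorphic_on_open[OF cdom_open] by blast
  then obtain d where d: "\<And>i j. ((\<lambda>t. \<phi> (cline z w t) $ i $ j) has_field_derivative d i j) (at t)"
    by metis
  have "((\<lambda>t. \<phi> (cline z w t)) has_derivative (\<lambda>h. \<chi> i. \<chi> j. d i j * h)) (at t)"
    by (intro has_derivative_vec) (use d in \<open>simp add: has_field_derivative_def\<close>)
  then show "\<exists>D. ((\<lambda>t. \<phi> (cline z w t)) has_derivative D) (at t) \<and> (\<forall>u. D u = cscale u (D 1))"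
    by (rule exI[of _ "\<lambda>h. \<chi> i. \<chi> j. d i j * h", OF conjI])
      (simp add: cscale_vec_def cscale_complex_def mult.commute)
qed

lemma analytic_disc_mat:
  fixes \<phi> :: "complex \<times> complex \<Rightarrow> cmat3"
  assumes "\<And>i j. ball_holo (\<lambda>z. \<phi> z $ i $ j)" "\<phi> ` B2 \<subseteq> M"
  shows "analytic_disc \<phi> M"
  unfolding analytic_disc_def using ball_holo_curve[OF assms(1)] assms(2) by blast

lemma analytic_disc_pair:
  fixes \<phi> \<psi> :: "complex \<times> complex \<Rightarrow> cmat3"
  assumes "\<And>i j. ball_holo (\<lambda>z. \<phi> z $ i $ j)" "\<phi> ` B2 \<subseteq> M"
    "\<And>i j. ball_holo (\<lambda>z. \<psi> z $ i $ j)" "\<psi> ` B2 \<subseteq> M'"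
  shows "analytic_disc (\<lambda>z. (\<phi> z, \<psi> z)) (M \<times> M')"
  unfolding analytic_disc_def
proof (intro conjI allI impI)
  show "(\<lambda>z. (\<phi> z, \<psi> z)) ` B2 \<subseteq> M \<times> M'" using assms by blast
  show "continuous_on B2 (\<lambda>z. (\<phi> z, \<psi> z))"
    by (intro continuous_on_Pair ball_holo_curve(1) assms)
  fix z w t assume "t \<in> cdom z w"
  then obtain D E where "((\<lambda>t. \<phi> (cline z w t)) has_derivative D) (at t)" "\<forall>u. D u = cscale u (D 1)"
    "((\<lambda>t. \<psi> (cline z w t)) has_derivative E) (at t)" "\<forall>u. E u = cscale u (E 1)"
    using ball_holo_curve(2)[of \<phi>] ball_holo_curve(2)[of \<psi>] assms by meson
  note DE = this
  have "((\<lambda>t. (\<phi> (cline z w t), \<psi> (cline z w t))) has_derivative (\<lambda>u. (D u, E u))) (at t)"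
    by (rule has_derivative_Pair[OF DE(1,3)])
  moreover have "(D u, E u) = cscale u (D 1, E 1)" for u
    unfolding cscale_prod_def fst_conv snd_conv using DE(2)[rule_format, of u] DE(4)[rule_format, of u] by (rule arg_cong2)
  ultimately show "\<exists>D. ((\<lambda>t. (\<phi> (cline z w t), \<psi> (cline z w t))) has_derivative D) (at t) \<and> (\<forall>u. D u = cscale u (D 1))"
    by (intro exI[of _ "\<lambda>u. (D u, E u)"]) blast
qed

lemma ball_holo_det:
  fixes A :: "complex \<times> complex \<Rightarrow> cmat3"
  assumes "\<And>i j. ball_holo (\<lambda>z. A z $ i $ j)"
  shows "ball_holo (\<lambda>z. det (A z))"
  unfolding det_3 by (intro ball_holo_intros assms)

lemma ball_holo_act:
  assumes \<phi>: "\<And>i j. ball_holo (\<lambda>z. \<phi> z $ i $ j)" "\<And>z. z \<in> B2 \<Longrightarrow> \<phi> z \<in> siegel_space" and M: "psim c M"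
  shows "ball_holo (\<lambda>z. siegel_act M (\<phi> z) $ i $ j)"
proof -
  define P where "P z = cblock (blockA M) ** \<phi> z + cblock (blockB M)" for z
  define Q where "Q z = aut_factor M (\<phi> z)" for z
  have hP: "ball_holo (\<lambda>z. P z $ i $ j)" for i j
    unfolding P_def by (simp add: matrix_matrix_mult_def) (intro ball_holo_intros ball_holo_sum \<phi>(1))
  have hQ: "ball_holo (\<lambda>z. Q z $ i $ j)" for i j
    unfolding Q_def aut_factor_def by (simp add: matrix_matrix_mult_def) (intro ball_holo_intros ball_holo_sum \<phi>(1))
  define f where "f z = det (\<chi> r s. if s = j then P z $ i $ r else Q z $ s $ r) / det (transpose (Q z))" for z
  have dQ: "det (transpose (Q z)) \<noteq> 0" if "z \<in> B2" for z
    using aut_factor_invertible[OF M \<phi>(2)[OF that]] by (simp add: det_transpose Q_def invertible_det_nz)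
  have "ball_holo f"
    unfolding f_def
  proof (intro ball_holo_intros ball_holo_det dQ)
    fix r s :: 3
    show "ball_holo (\<lambda>z. (\<chi> r s. if s = j then P z $ i $ r else Q z $ s $ r) $ r $ s)"
      by (cases "s = j") (simp_all add: hP hQ)
    show "ball_holo (\<lambda>z. transpose (Q z) $ r $ s)" by (simp add: transpose_def hQ)
  qed
  moreover have e: "siegel_act M (\<phi> z) $ i $ j = f z" if z: "z \<in> B2" for z
  proof -
    let ?X = "siegel_act M (\<phi> z)"
    have "P z = ?X ** Q z" using act_moves[OF M \<phi>(2)[OF z]] by (simp add: moves_def P_def Q_def)
    then have "transpose (Q z) *v (?X $ i) = P z $ i"
      by (simp add: vec_eq_iff matrix_vector_mult_def matrix_matrix_mult_def transpose_def mult.commute)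
    from cramer[OF dQ[OF z], of "?X $ i" "P z $ i", THEN iffD1, OF this]
    have "?X $ i $ j = (\<chi> k. det (\<chi> r s. if s = k then P z $ i $ r else transpose (Q z) $ r $ s) / det (transpose (Q z))) $ j"
      by (rule arg_cong)
    then show ?thesis by (simp add: f_def transpose_def cong: if_cong)
  qed
  moreover have "continuous_on B2 (\<lambda>z. siegel_act M (\<phi> z) $ i $ j) = continuous_on B2 f"
    by (rule continuous_on_cong[OF refl e])
  moreover have "(\<lambda>t. siegel_act M (\<phi> (cline z w t)) $ i $ j) holomorphic_on cdom z w \<longleftrightarrow>
      (\<lambda>t. f (cline z w t)) holomorphic_on cdom z w" for z w
    by (rule holomorphic_cong[OF refl]) (rule e, simp only: cdom_def mem_Collect_eq)
  ultimately show ?thesis unfolding ball_holo_def by simp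
qed

lemma vphi_holo: "ball_holo (\<lambda>z. vphi \<Delta> z $ i $ j)"
proof -
  have u: "ball_holo (\<lambda>z. uvec (fst z) (snd z) $ i)" for i
    using exhaust_3[of i] by (auto intro: ball_holo_intros)
  show ?thesis unfolding vphi_def vec_lambda_beta
    by (intro ball_holo_intros ball_holo_power2 u) (use ball_q ball_iff in blast)
qed

lemma vphi_disc:
  assumes "\<Delta> > 0" "psim c M"
  shows "analytic_disc (\<lambda>z. siegel_act M (vphi \<Delta> z)) siegel_space"
    "analytic_disc (\<lambda>z. (vphi \<Delta> z, siegel_act M (vphi \<Delta> z))) (siegel_space \<times> siegel_space)"
proof -
  have s: "vphi \<Delta> z \<in> siegel_space" if "z \<in> B2" for z
    using Vset_vphi[OF assms(1)] that by (auto simp: Vset_def)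
  note h = ball_holo_act[OF vphi_holo s assms(2)]
  show "analytic_disc (\<lambda>z. siegel_act M (vphi \<Delta> z)) siegel_space"
    by (rule analytic_disc_mat[OF h]) (use s act_siegel[OF assms(2)] in auto)
  show "analytic_disc (\<lambda>z. (vphi \<Delta> z, siegel_act M (vphi \<Delta> z))) (siegel_space \<times> siegel_space)"
    by (rule analytic_disc_pair[OF vphi_holo _ h]) (use s act_siegel[OF assms(2)] in auto)
qed

section \<open>Irreducible components of finite unions\<close>

text \<open>
  Intersecting with one member at a time splits \<open>S\<close> into two closed parts, one of which is \<open>S\<close>.
\<close>
lemma irreducible_in_finite_union:
  assumes cl: "\<And>A B. cl A \<Longrightarrow> cl B \<Longrightarrow> cl (A \<union> B)" "\<And>A B. cl A \<Longrightarrow> cl B \<Longrightarrow> cl (A \<inter> B)" "cl {}"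
    and "finite I" "irreducible_set cl S" "\<And>i. i \<in> I \<Longrightarrow> cl (T i)" "S \<subseteq> (\<Union>i\<in>I. T i)"
  shows "\<exists>i\<in>I. S \<subseteq> T i"
  using assms(4-)
proof (induction I)
  case empty then show ?case by (simp add: irreducible_set_def)
next
  case (insert i I)
  have "cl (\<Union>i\<in>I. T i)"
    using insert(1) insert.prems(2) by (induction I) (auto intro: cl)
  then have "cl (S \<inter> T i)" "cl (S \<inter> (\<Union>i\<in>I. T i))"
    using cl(2) insert.prems by (auto simp: irreducible_set_def)
  moreover have "S = (S \<inter> T i) \<union> (S \<inter> (\<Union>i\<in>I. T i))" using insert.prems(3) by blast
  ultimately have "S = S \<inter> T i \<or> S = S \<inter> (\<Union>i\<in>I. T i)"
    using insert.prems(1) unfolding irreducible_set_def by blast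
  then show ?case using insert by blast
qed

lemma components_of_finite_union:
  assumes cl: "\<And>A B. cl A \<Longrightarrow> cl B \<Longrightarrow> cl (A \<union> B)" "\<And>A B. cl A \<Longrightarrow> cl B \<Longrightarrow> cl (A \<inter> B)" "cl {}"
    and "finite I" "\<And>i. i \<in> I \<Longrightarrow> irreducible_set cl (T i)"
  shows "irreducible_component cl (\<Union>i\<in>I. T i) S \<Longrightarrow> \<exists>i\<in>I. S = T i"
    and "i \<in> I \<Longrightarrow> (\<And>j. j \<in> I \<Longrightarrow> T i \<subseteq> T j \<Longrightarrow> T j = T i) \<Longrightarrow> irreducible_component cl (\<Union>i\<in>I. T i) (T i)"
proof -
  have clT: "cl (T i)" if "i \<in> I" for i using assms(5)[OF that] by (simp add: irreducible_set_def)
  have sub: "\<exists>i\<in>I. S \<subseteq> T i" if "irreducible_set cl S" "S \<subseteq> (\<Union>i\<in>I. T i)" for S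
    by (rule irreducible_in_finite_union[OF cl assms(4) that(1) clT that(2)])
  show "\<exists>i\<in>I. S = T i" if S: "irreducible_component cl (\<Union>i\<in>I. T i) S"
  proof -
    have "irreducible_set cl S" "S \<subseteq> (\<Union>i\<in>I. T i)" using S by (simp_all add: irreducible_component_def)
    then have "\<exists>i\<in>I. S \<subseteq> T i" by (rule sub)
    then obtain i where i: "i \<in> I" "S \<subseteq> T i" by blast
    moreover have "T i \<subseteq> (\<Union>i\<in>I. T i)" using i by blast
    ultimately have "T i = S" using S assms(5)[OF i(1)] by (simp add: irreducible_component_def)
    then show ?thesis using i by blast
  qed
  show "irreducible_component cl (\<Union>i\<in>I. T i) (T i)"
    if i: "i \<in> I" "\<And>j. j \<in> I \<Longrightarrow> T i \<subseteq> T j \<Longrightarrow> T j = T i"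
    unfolding irreducible_component_def
  proof (intro conjI allI impI)
    fix S' assume S': "irreducible_set cl S'" "T i \<subseteq> S'" "S' \<subseteq> (\<Union>i\<in>I. T i)"
    obtain j where j: "j \<in> I" "S' \<subseteq> T j" using sub[OF S'(1) S'(3)] by blast
    then have "T j = T i" using i(2) S'(2) by blast
    then show "S' = T i" using j S'(2) by blast
  next
    show "T i \<subseteq> (\<Union>i\<in>I. T i)" using i(1) by blast
    show "irreducible_set cl (T i)" by (rule assms(5)[OF i(1)])
  qed
qed

text \<open>
  Finitely many distinct pieces suffice, and since none is properly contained in another, all of them
  are maximal.
\<close>
lemma components_of_incomparable_pieces:
  assumes cl: "\<And>A B. cl A \<Longrightarrow> cl B \<Longrightarrow> cl (A \<union> B)" "\<And>A B. cl A \<Longrightarrow> cl B \<Longrightarrow> cl (A \<inter> B)" "cl {}"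
    and R: "finite R" "R \<subseteq> H" "\<And>M. M \<in> H \<Longrightarrow> \<exists>M'\<in>R. F M = F M'"
    and irr: "\<And>M. M \<in> H \<Longrightarrow> irreducible_set cl (F M)"
    and sub: "\<And>M M'. M \<in> H \<Longrightarrow> M' \<in> H \<Longrightarrow> F M \<subseteq> F M' \<Longrightarrow> F M' = F M"
  shows "irreducible_component cl (\<Union>M\<in>H. F M) Y \<longleftrightarrow> (\<exists>M\<in>H. Y = F M)"
proof -
  have e: "(\<Union>M\<in>H. F M) = (\<Union>M\<in>R. F M)" using R(2,3) by blast
  have irrR: "\<And>M. M \<in> R \<Longrightarrow> irreducible_set cl (F M)" using irr R(2) by blast
  show ?thesis
  proof
    assume "irreducible_component cl (\<Union>M\<in>H. F M) Y"
    then have "\<exists>M\<in>R. Y = F M" 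
      using components_of_finite_union(1)[where cl = cl and I = R and T = F and S = Y, OF cl R(1) irrR] unfolding e by blast
    then show "\<exists>M\<in>H. Y = F M" using R(2) by blast
  next
    assume "\<exists>M\<in>H. Y = F M"
    then obtain M where M: "M \<in> R" "Y = F M" using R(3) by metis
    have "F M' = F M" if "M' \<in> R" "F M \<subseteq> F M'" for M' using sub M(1) that R(2) by blast
    then show "irreducible_component cl (\<Union>M\<in>H. F M) Y"
      using components_of_finite_union(2)[where cl = cl and I = R and T = F and i = M, OF cl R(1) irrR M(1)]
      unfolding e M(2) by blast
  qed
qed

section \<open>Proper discontinuity\<close>

text \<open>
  Subsets of the Siegel space on which finiteness holds uniformly, and whose relative interiors cover it
  (\<open>siegel_box_nbhd\<close>).
\<close>
definition siegel_box :: "real \<Rightarrow> real \<Rightarrow> cmat3 set" where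
  "siegel_box m R = {Z \<in> siegel_space. (\<forall>x. m * (norm x)\<^sup>2 \<le> hpos Z x) \<and> (\<forall>i j. cmod (Z $ i $ j) \<le> R)}"

lemma hpos_scaleR: "hpos Z (r *\<^sub>R x) = r\<^sup>2 * hpos Z x"
  by (simp add: hpos_def cdot_def sum_3 mv_sum power2_eq_square algebra_simps)

lemma hpos_diff_bound: "\<bar>hpos Z x - hpos Z' x\<bar> \<le> 9 * norm (Z - Z') * (norm x)\<^sup>2"
proof -
  have n: "cmod (x $ i) \<le> norm x" for i by (rule Finite_Cartesian_Product.norm_nth_le)
  have d: "cmod ((Z - Z') $ i $ j) \<le> norm (Z - Z')" for i j
    by (rule order_trans[OF Finite_Cartesian_Product.norm_nth_le Finite_Cartesian_Product.norm_nth_le])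
  have t: "cmod (cnj (x $ i) * ((Z - Z') $ i $ j * x $ j)) \<le> norm (Z - Z') * (norm x)\<^sup>2" for i j
  proof -
    have "cmod (cnj (x $ i) * ((Z - Z') $ i $ j * x $ j)) = cmod (x $ i) * (cmod ((Z - Z') $ i $ j) * cmod (x $ j))"
      by (simp add: norm_mult)
    also have "\<dots> \<le> norm x * (norm (Z - Z') * norm x)"
      by (intro mult_mono n d) auto
    finally show ?thesis by (simp add: power2_eq_square algebra_simps)
  qed
  have "hpos Z x - hpos Z' x = Im (\<Sum>i\<in>UNIV. \<Sum>j\<in>UNIV. cnj (x $ i) * ((Z - Z') $ i $ j * x $ j))"
    by (simp add: hpos_def cdot_def matrix_vector_mult_def sum_distrib_left algebra_simps sum_subtractf)
  also have "\<bar>\<dots>\<bar> \<le> cmod (\<Sum>i\<in>UNIV. \<Sum>j\<in>UNIV. cnj (x $ i) * ((Z - Z') $ i $ j * x $ j))"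
    by (rule abs_Im_le_cmod)
  also have "\<dots> \<le> (\<Sum>i\<in>(UNIV::3 set). \<Sum>j\<in>(UNIV::3 set). norm (Z - Z') * (norm x)\<^sup>2)"
    by (intro sum_norm_le t)
  also have "\<dots> = 9 * norm (Z - Z') * (norm x)\<^sup>2" by simp
  finally show ?thesis .
qed

lemma siegel_box_nbhd:
  assumes "Z \<in> siegel_space"
  obtains U m R where "open U" "Z \<in> U" "m > 0" "U \<inter> siegel_space \<subseteq> siegel_box m R"
proof -
  have "continuous_on (sphere 0 1) (hpos Z)"
    unfolding hpos_def cdot_def matrix_vector_mult_def vec_lambda_beta by (intro continuous_intros)
  moreover have "axis 1 1 \<in> sphere (0::complex^3) 1" by simp
  ultimately obtain y where y: "y \<in> sphere 0 1" "\<And>x. x \<in> sphere 0 1 \<Longrightarrow> hpos Z y \<le> hpos Z x"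
    using continuous_attains_inf[OF compact_sphere, of "0::complex^3" 1 "hpos Z"] by (metis empty_iff)
  define m where "m = hpos Z y"
  have "y \<noteq> 0" using y(1) by auto
  then have m: "m > 0" using assms by (simp add: siegel_iff m_def)
  have low: "m * (norm x)\<^sup>2 \<le> hpos Z x" for x
  proof (cases "x = 0")
    case False
    then have "m \<le> hpos Z ((1 / norm x) *\<^sub>R x)" unfolding m_def by (intro y(2)) simp
    also have "\<dots> = hpos Z x / (norm x)\<^sup>2" unfolding hpos_scaleR by (simp add: power_divide)
    finally show ?thesis using False by (simp add: field_simps)
  qed (simp add: hpos_def cdot_def)
  define U where "U = ball Z (m / 18)"
  have "W \<in> siegel_box (m / 2) (norm Z + m / 18)" if "W \<in> U \<inter> siegel_space" for W
  proof -
    have d: "norm (Z - W) < m / 18" using that by (simp add: U_def dist_norm)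
    have "m / 2 * (norm x)\<^sup>2 \<le> hpos W x" for x
    proof -
      have "9 * norm (Z - W) * (norm x)\<^sup>2 \<le> 9 * (m / 18) * (norm x)\<^sup>2"
        using d by (intro mult_right_mono) auto
      then show ?thesis using hpos_diff_bound[of Z x W] low[of x] by (simp add: field_simps)
    qed
    moreover have "cmod (W $ i $ j) \<le> norm Z + m / 18" for i j
    proof -
      have "cmod (W $ i $ j) \<le> norm W" by (rule order_trans[OF Finite_Cartesian_Product.norm_nth_le Finite_Cartesian_Product.norm_nth_le])
      also have "\<dots> \<le> norm Z + norm (Z - W)" by (metis norm_minus_commute norm_triangle_sub)
      finally show ?thesis using d by simp
    qed
    ultimately show ?thesis using that by (simp add: siegel_box_def)
  qed
  then have "U \<inter> siegel_space \<subseteq> siegel_box (m / 2) (norm Z + m / 18)" by blast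
  moreover have "open U" "Z \<in> U" "m / 2 > 0" using m by (simp_all add: U_def)
  ultimately show ?thesis using that by blast
qed

text \<open>
  The imaginary part of \<open>a Z + b\<close> bounds \<open>a\<close>, because the imaginary part of \<open>Z\<close> is bounded below.  The
  real part then bounds \<open>b\<close>.
\<close>
lemma row_bound:
  assumes Z: "Z \<in> siegel_box m R" and m: "m > 0"
    and s: "\<And>j. cmod ((\<Sum>k\<in>UNIV. complex_of_real (a $ k) * Z $ k $ j) + complex_of_real (b $ j)) \<le> s"
  shows "\<bar>a $ k\<bar> \<le> 3 * s / m" "\<bar>(b::real^3) $ j\<bar> \<le> s + 9 * s / m * R"
proof -
  define v where "v j = (\<Sum>k\<in>UNIV. a $ k * Im (Z $ k $ j))" for j
  have "Im ((\<Sum>k\<in>UNIV. complex_of_real (a $ k) * Z $ k $ j) + complex_of_real (b $ j)) = v j" for j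
    by (simp add: v_def)
  then have v: "\<bar>v j\<bar> \<le> s" for j using order_trans[OF abs_Im_le_cmod s[of j]] by simp
  have s0: "s \<ge> 0" using v[of 1] by linarith
  have t: "transpose Z = Z" using Z by (simp add: siegel_box_def siegel_iff)
  define y where "y = (\<chi> i. complex_of_real (a $ i))"
  have ny: "norm y = norm a" by (simp add: norm_vec_def y_def)
  have "hpos Z y = (\<Sum>j\<in>UNIV. v j * a $ j)"
    unfolding hpos_def cdot_def v_def y_def
    by (simp add: sum_3 mv_sum transpose_sym[OF t, of 2 1] transpose_sym[OF t, of 3 1] transpose_sym[OF t, of 3 2] algebra_simps)
  also have "\<dots> \<le> (\<Sum>j\<in>(UNIV::3 set). s * norm a)"
  proof (rule sum_mono)
    fix j
    have "v j * a $ j \<le> \<bar>v j\<bar> * \<bar>a $ j\<bar>" by (metis abs_ge_self abs_mult)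
    also have "\<dots> \<le> s * norm a" using Finite_Cartesian_Product.norm_nth_le[of a j] v s0 by (intro mult_mono) auto
    finally show "v j * a $ j \<le> s * norm a" .
  qed
  finally have "hpos Z y \<le> 3 * s * norm a" by simp
  moreover have "m * (norm y)\<^sup>2 \<le> hpos Z y" using Z by (simp add: siegel_box_def)
  ultimately have "m * (norm a)\<^sup>2 \<le> 3 * s * norm a" unfolding ny by linarith
  then have "norm a = 0 \<or> m * norm a \<le> 3 * s"
    using mult_le_cancel_right_pos[of "norm a" "m * norm a" "3 * s"]
    by (cases "norm a = 0") (simp_all add: power2_eq_square mult.assoc)
  then have na: "norm a \<le> 3 * s / m" using m s0 by (auto simp: field_simps)
  then show a: "\<bar>a $ k\<bar> \<le> 3 * s / m" for k using Finite_Cartesian_Product.norm_nth_le[of a k] by simp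
  have "\<bar>Re ((\<Sum>k\<in>UNIV. complex_of_real (a $ k) * Z $ k $ j) + complex_of_real (b $ j))\<bar> \<le> s"
    using s[of j] abs_Re_le_cmod order_trans by blast
  then have "\<bar>b $ j\<bar> \<le> s + \<bar>\<Sum>k\<in>UNIV. a $ k * Re (Z $ k $ j)\<bar>" by simp
  also have "\<bar>\<Sum>k\<in>UNIV. a $ k * Re (Z $ k $ j)\<bar> \<le> (\<Sum>k\<in>(UNIV::3 set). 3 * s / m * R)"
  proof (rule order_trans[OF sum_abs], rule sum_mono)
    fix k
    have "\<bar>a $ k * Re (Z $ k $ j)\<bar> = \<bar>a $ k\<bar> * \<bar>Re (Z $ k $ j)\<bar>" by (rule abs_mult)
    also have "\<dots> \<le> 3 * s / m * R"
      using a[of k] m s0 order_trans[OF abs_Re_le_cmod] Z by (intro mult_mono) (auto simp: siegel_box_def)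
    finally show "\<bar>a $ k * Re (Z $ k $ j)\<bar> \<le> 3 * s / m * R" .
  qed
  finally show "\<bar>b $ j\<bar> \<le> s + 9 * s / m * R" by simp
qed

text \<open>
  Integral similitudes with bounded multiplier.  Bounds of this kind survive products and adjoints, and
  they make all families of fixed loci below locally finite.
\<close>
definition int_sim :: "real \<Rightarrow> rmat6 set" where
  "int_sim k = {M. (\<forall>i j. M $ i $ j \<in> \<int>) \<and> (\<exists>c\<le>k. psim c M)}"

lemma finite_vec: assumes "finite S" shows "finite {x::'a^'n. \<forall>i. x $ i \<in> S}"
proof -
  have "finite (PiE (UNIV::'n set) (\<lambda>_. S))" using assms by (intro finite_PiE) auto
  then have "finite (vec_lambda ` PiE (UNIV::'n set) (\<lambda>_. S))" by (rule finite_imageI)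
  moreover have "{x::'a^'n. \<forall>i. x $ i \<in> S} \<subseteq> vec_lambda ` PiE (UNIV::'n set) (\<lambda>_. S)"
  proof
    fix x :: "'a^'n" assume "x \<in> {x. \<forall>i. x $ i \<in> S}"
    then have "vec_nth x \<in> PiE UNIV (\<lambda>_. S)" by auto
    then show "x \<in> vec_lambda ` PiE UNIV (\<lambda>_. S)" by (metis image_eqI vec_nth_inverse)
  qed
  ultimately show ?thesis by (rule rev_finite_subset)
qed

lemma finite_int_matrices: "finite {M::real^'n^'m. \<forall>i j. M $ i $ j \<in> \<int> \<and> \<bar>M $ i $ j\<bar> \<le> T}"
proof -
  have "finite {x::real^'n. \<forall>j. x $ j \<in> {k \<in> \<int>. \<bar>k\<bar> \<le> T}}"
    by (rule finite_vec) (rule finite_abs_int_segment)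
  from finite_vec[OF this, where 'n='m] show ?thesis by (simp add: Collect_conj_eq)
qed

lemma aut_factor_row: "aut_factor M Z $ i $ j = (\<Sum>k\<in>UNIV. complex_of_real (blockC M $ i $ k) * Z $ k $ j) + complex_of_real (blockD M $ i $ j)"
  by (simp add: aut_factor_def cblock_def matrix_matrix_mult_def)

text \<open>
  The relation between \<open>hpos Z\<close> and \<open>hpos Z'\<close> bounds the automorphy factor \<open>C Z + D\<close>, hence also
  \<open>A Z + B = Z' (C Z + D)\<close>.  By \<open>row_bound\<close> the entries of \<open>M\<close> are bounded.
\<close>
lemma proper_discontinuity:
  assumes m: "m > 0"
  shows "finite {M \<in> int_sim k. \<exists>Z\<in>siegel_box m R. \<exists>Z'\<in>siegel_box m R. moves M Z Z'}"
proof -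
  define S where "S = sqrt (9 * max k 0 * max R 0 / m)"
  define S' where "S' = max S (3 * (max R 0 * S))"
  define T where "T = max (3 * S' / m) (S' + 9 * S' / m * max R 0)"
  have "\<bar>M $ i $ j\<bar> \<le> T" if M: "M \<in> int_sim k" and Z: "Z \<in> siegel_box m R" and Z': "Z' \<in> siegel_box m R"
    and mv: "moves M Z Z'" for M Z Z' i j
  proof -
    obtain c where c: "c \<le> k" "psim c M" using M by (auto simp: int_sim_def)
    have c0: "c > 0" using psim_pos[OF c(2)] .
    have "cmod (Z $ 1 $ 1) \<le> R" using Z by (simp add: siegel_box_def)
    then have R0: "R \<ge> 0" by (rule order_trans[OF norm_ge_zero])
    have ZR: "Z \<in> siegel_box m (max R 0)" using Z R0 by (simp add: max_def)
    (* hpos_moves bounds each column of the automorphy factor *)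
    have q: "cmod (aut_factor M Z $ i $ j) \<le> S" for i j
    proof -
      define w where "w = aut_factor M Z *v axis j 1"
      have wi: "w $ i = aut_factor M Z $ i $ j"
        by (simp add: w_def matrix_vector_mult_def axis_def if_distrib[of "\<lambda>x. _ * x"] cong: if_cong)
      have "m * (norm w)\<^sup>2 \<le> hpos Z' w" using Z' by (simp add: siegel_box_def)
      also have "\<dots> = c * hpos Z (axis j 1)" unfolding w_def by (rule hpos_moves[OF c(2) mv])
      also have "hpos Z (axis j 1) = Im (Z $ j $ j)"
        using exhaust_3[of j] by (auto simp: hpos_def cdot_def sum_3 mv_sum axis_def)
      also have "c * Im (Z $ j $ j) \<le> k * R"
      proof (intro mult_mono)
        have "Im (Z $ j $ j) \<le> cmod (Z $ j $ j)" by (rule order_trans[OF abs_ge_self abs_Im_le_cmod])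
        then show "Im (Z $ j $ j) \<le> R" using Z by (auto simp: siegel_box_def intro: order_trans)
        have "m * (norm (axis j 1 :: complex^3))\<^sup>2 \<le> hpos Z (axis j 1)" using Z unfolding siegel_box_def by blast
        also have "\<dots> = Im (Z $ j $ j)"
          using exhaust_3[of j] by (auto simp: hpos_def cdot_def sum_3 mv_sum axis_def)
        finally show "0 \<le> Im (Z $ j $ j)" using m by simp
      qed (use c c0 in auto)
      also have "\<dots> \<le> 9 * max k 0 * max R 0" using c c0 R0 by (simp add: max_def)
      finally have "(norm w)\<^sup>2 \<le> 9 * max k 0 * max R 0 / m" using m by (simp add: field_simps)
      then have "norm w \<le> S" unfolding S_def by (rule real_le_rsqrt)
      then show ?thesis using Finite_Cartesian_Product.norm_nth_le[of w i] wi by simp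
    qed
    have q': "cmod ((\<Sum>k\<in>UNIV. complex_of_real (blockA M $ i $ k) * Z $ k $ j) + complex_of_real (blockB M $ i $ j)) \<le> 3 * (max R 0 * S)" for i j
    proof -
      have "(\<Sum>k\<in>UNIV. complex_of_real (blockA M $ i $ k) * Z $ k $ j) + complex_of_real (blockB M $ i $ j)
        = (\<Sum>k\<in>UNIV. Z' $ i $ k * aut_factor M Z $ k $ j)"
        using arg_cong[OF mv[unfolded moves_def], of "\<lambda>X. X $ i $ j"]
        by (simp add: cblock_def matrix_matrix_mult_def)
      also have "cmod \<dots> \<le> (\<Sum>k\<in>(UNIV::3 set). max R 0 * S)"
      proof (rule sum_norm_le)
        fix l
        have "cmod (Z' $ i $ l) \<le> max R 0" using Z' R0 by (simp add: siegel_box_def)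
        then show "cmod (Z' $ i $ l * aut_factor M Z $ l $ j) \<le> max R 0 * S"
          unfolding norm_mult by (intro mult_mono q) auto
      qed
      finally show ?thesis by simp
    qed
    have T: "3 * S' / m \<le> T" "S' + 9 * S' / m * max R 0 \<le> T" by (simp_all add: T_def)
    have sA: "cmod ((\<Sum>k\<in>UNIV. complex_of_real (blockA M $ i $ k) * Z $ k $ j) + complex_of_real (blockB M $ i $ j)) \<le> S'" for i j
      by (rule order_trans[OF q']) (simp add: S'_def)
    have sC: "cmod ((\<Sum>k\<in>UNIV. complex_of_real (blockC M $ i $ k) * Z $ k $ j) + complex_of_real (blockD M $ i $ j)) \<le> S'" for i j
      unfolding aut_factor_row[symmetric] by (rule order_trans[OF q]) (simp add: S'_def)
    have A: "\<bar>blockA M $ i $ k\<bar> \<le> T" "\<bar>blockB M $ i $ k\<bar> \<le> T" for i k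
      using row_bound[OF ZR m sA[of i]] T by (auto intro: order_trans)
    have C: "\<bar>blockC M $ i $ k\<bar> \<le> T" "\<bar>blockD M $ i $ k\<bar> \<le> T" for i k
      using row_bound[OF ZR m sC[of i]] T by (auto intro: order_trans)
    show "\<bar>M $ i $ j\<bar> \<le> T"
      using A C by (cases i; cases j) (simp_all add: blockA_def blockB_def blockC_def blockD_def)
  qed
  moreover have "M $ i $ j \<in> \<int>" if "M \<in> int_sim k" for M i j using that by (simp add: int_sim_def)
  ultimately have "{M \<in> int_sim k. \<exists>Z\<in>siegel_box m R. \<exists>Z'\<in>siegel_box m R. moves M Z Z'} \<subseteq>
     {M. \<forall>i j. M $ i $ j \<in> \<int> \<and> \<bar>M $ i $ j\<bar> \<le> T}" by blast
  then show ?thesis by (rule finite_subset[OF _ finite_int_matrices])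
qed

lemma siegel_box_mono: "m' \<le> m \<Longrightarrow> R \<le> R' \<Longrightarrow> siegel_box m R \<subseteq> siegel_box m' R'"
  unfolding siegel_box_def
  by (auto intro: order_trans) (meson mult_right_mono order_trans zero_le_power2)

lemma holomorphic_several_mult_entry:
  assumes "\<And>k. holomorphic_several (\<lambda>Z. f Z $ i $ k) U" "\<And>k. holomorphic_several (\<lambda>Z. g Z $ k $ j) U"
  shows "holomorphic_several (\<lambda>Z. ((f Z :: cmat3) ** g Z) $ i $ j) U"
  unfolding matrix_matrix_mult_def vec_lambda_beta
  by (intro holomorphic_several_intros assms)

lemma holomorphic_several_moves:
  assumes f: "\<And>i j. holomorphic_several (\<lambda>Z. f Z $ i $ j) U" and g: "\<And>i j. holomorphic_several (\<lambda>Z. g Z $ i $ j) U"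
  shows "holomorphic_several (\<lambda>Z. (cblock (blockA M) ** f Z + cblock (blockB M) - g Z ** aut_factor M (f Z)) $ i $ j) U"
  unfolding aut_factor_def vector_minus_component vector_add_component
  by (intro holomorphic_several_diff holomorphic_several_add holomorphic_several_mult_entry)
    (simp_all only: vector_add_component, (intro holomorphic_several_intros holomorphic_several_mult_entry f g)+)

definition moves_eqs :: "rmat6 \<Rightarrow> ('a \<Rightarrow> cmat3) \<Rightarrow> ('a \<Rightarrow> cmat3) \<Rightarrow> ('a \<Rightarrow> complex) set" where
  "moves_eqs M f g = range (\<lambda>(i, j) Z. (cblock (blockA M) ** f Z + cblock (blockB M) - g Z ** aut_factor M (f Z)) $ i $ j)"

lemma moves_eqs: "(\<forall>h\<in>moves_eqs M f g. h Z = 0) \<longleftrightarrow> moves M (f Z) (g Z)"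
  by (auto simp: moves_eqs_def moves_def vec_eq_iff)

lemma holomorphic_several_moves_eqs:
  assumes "\<And>i j. holomorphic_several (\<lambda>Z. f Z $ i $ j) U" "\<And>i j. holomorphic_several (\<lambda>Z. g Z $ i $ j) U"
    "h \<in> moves_eqs M f g"
  shows "holomorphic_several h U"
proof -
  obtain i j where "h = (\<lambda>Z. (cblock (blockA M) ** f Z + cblock (blockB M) - g Z ** aut_factor M (f Z)) $ i $ j)"
    using assms(3) unfolding moves_eqs_def by auto
  then show ?thesis using holomorphic_several_moves[OF assms(1,2)] by simp
qed

lemma finite_moves_eqs [simp]: "finite (moves_eqs M f g)"
  by (simp add: moves_eqs_def)

lemma analytic_moves:
  fixes f g f' g' :: "'a::{real_normed_vector,cscale} \<Rightarrow> cmat3"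
  assumes "\<And>i j. holomorphic_several (\<lambda>Z. f Z $ i $ j) UNIV" "\<And>i j. holomorphic_several (\<lambda>Z. g Z $ i $ j) UNIV"
    "\<And>i j. holomorphic_several (\<lambda>Z. f' Z $ i $ j) UNIV" "\<And>i j. holomorphic_several (\<lambda>Z. g' Z $ i $ j) UNIV"
  shows "analytic_subset M {Z \<in> M. moves x (f Z) (g Z) \<and> moves y (f' Z) (g' Z)}"
proof (rule analytic_subsetI_global[of "moves_eqs x f g \<union> moves_eqs y f' g'"])
  show "holomorphic_several h UNIV" if "h \<in> moves_eqs x f g \<union> moves_eqs y f' g'" for h
    using that holomorphic_several_moves_eqs[OF assms(1,2), of h x]
      holomorphic_several_moves_eqs[OF assms(3,4), of h y] by blast
qed (auto simp: moves_eqs ball_Un)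

text \<open>
  Two conditions, because a point of a piece is subject to two: it lies on a translate of the ball,
  and it may have an additional endomorphism.
\<close>
definition fix_set :: "rmat6 \<times> rmat6 \<Rightarrow> cmat3 set" where
  "fix_set P = {Z \<in> siegel_space. moves (fst P) Z Z \<and> moves (snd P) Z Z}"

text \<open>
  The first condition places \<open>Z\<close> on a translate of the ball, the second one places \<open>(Z, Z')\<close> on the
  graph of a Hecke matrix.
\<close>
definition graph_set :: "rmat6 \<times> rmat6 \<Rightarrow> (cmat3 \<times> cmat3) set" where
  "graph_set P = {Z \<in> siegel_space \<times> siegel_space. moves (fst P) (fst Z) (fst Z) \<and> moves (snd P) (fst Z) (snd Z)}"

lemma fix_set_analytic: "analytic_subset siegel_space (fix_set P)"
  unfolding fix_set_def by (intro analytic_moves holomorphic_several_entry)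

lemma graph_set_analytic: "analytic_subset (siegel_space \<times> siegel_space) (graph_set P)"
  unfolding graph_set_def
  by (intro analytic_moves holomorphic_several_entry_fst holomorphic_several_entry_snd)

lemma fix_set_locally_finite:
  assumes "P \<subseteq> int_sim k \<times> int_sim k" shows "locally_finite_in siegel_space P fix_set"
  unfolding locally_finite_in_def
proof
  fix Z assume "Z \<in> siegel_space"
  then obtain U m R where U: "open U" "Z \<in> U" "m > 0" "U \<inter> siegel_space \<subseteq> siegel_box m R"
    using siegel_box_nbhd by blast
  define F where "F = {M \<in> int_sim k. \<exists>Z\<in>siegel_box m R. \<exists>Z'\<in>siegel_box m R. moves M Z Z'}"
  have "finite (F \<times> F)" using proper_discontinuity[OF U(3)] by (simp add: F_def)
  moreover have "{p \<in> P. fix_set p \<inter> U \<noteq> {}} \<subseteq> F \<times> F"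
    using assms U(4) unfolding F_def fix_set_def by fastforce
  ultimately have "finite {p \<in> P. fix_set p \<inter> U \<noteq> {}}" by (rule rev_finite_subset)
  then show "\<exists>U. open U \<and> Z \<in> U \<and> finite {i \<in> P. fix_set i \<inter> U \<noteq> {}}" using U by blast
qed

lemma graph_set_locally_finite:
  assumes "P \<subseteq> int_sim k \<times> int_sim k" shows "locally_finite_in (siegel_space \<times> siegel_space) P graph_set"
  unfolding locally_finite_in_def
proof
  fix Z assume "Z \<in> siegel_space \<times> siegel_space"
  then have Z: "fst Z \<in> siegel_space" "snd Z \<in> siegel_space" by auto
  obtain U m R where U: "open U" "fst Z \<in> U" "m > 0" "U \<inter> siegel_space \<subseteq> siegel_box m R"
    using siegel_box_nbhd[OF Z(1)] by blast
  obtain U' m' R' where U': "open U'" "snd Z \<in> U'" "m' > 0" "U' \<inter> siegel_space \<subseteq> siegel_box m' R'"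
    using siegel_box_nbhd[OF Z(2)] by blast
  define n where "n = min m m'" define S where "S = max R R'"
  have n: "n > 0" using U U' by (simp add: n_def)
  have sub: "U \<inter> siegel_space \<subseteq> siegel_box n S" "U' \<inter> siegel_space \<subseteq> siegel_box n S"
    using U(4) U'(4) siegel_box_mono[of n m R S] siegel_box_mono[of n m' R' S] by (auto simp: n_def S_def)
  define F where "F = {M \<in> int_sim k. \<exists>Z\<in>siegel_box n S. \<exists>Z'\<in>siegel_box n S. moves M Z Z'}"
  have "finite (F \<times> F)" using proper_discontinuity[OF n] by (simp add: F_def)
  moreover have "{p \<in> P. graph_set p \<inter> (U \<times> U') \<noteq> {}} \<subseteq> F \<times> F"
  proof
    fix p assume "p \<in> {p \<in> P. graph_set p \<inter> (U \<times> U') \<noteq> {}}"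
    then obtain q where q: "p \<in> P" "q \<in> graph_set p" "q \<in> U \<times> U'" by blast
    define W W' where "W = fst q" and "W' = snd q"
    have W: "p \<in> P" "W \<in> U \<inter> siegel_space" "W' \<in> U' \<inter> siegel_space"
      "moves (fst p) W W" "moves (snd p) W W'" using q by (auto simp: graph_set_def W_def W'_def)
    have "fst p \<in> int_sim k" "snd p \<in> int_sim k" using W(1) assms by auto
    moreover have "W \<in> siegel_box n S" "W' \<in> siegel_box n S" using W(2,3) sub by auto
    ultimately have "fst p \<in> F" "snd p \<in> F" using W(4,5) unfolding F_def by blast+
    then show "p \<in> F \<times> F" by (simp add: mem_Times_iff)
  qed
  ultimately have "finite {p \<in> P. graph_set p \<inter> (U \<times> U') \<noteq> {}}" by (rule rev_finite_subset)
  then show "\<exists>U. open U \<and> Z \<in> U \<and> finite {i \<in> P. graph_set i \<inter> U \<noteq> {}}"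
    using U U' by (intro exI[of _ "U \<times> U'"]) (auto simp: open_Times mem_Times_iff)
qed

section \<open>The congruence group and its quotient\<close>

text \<open>
  Similitudes are not required here: besides \<open>Gamma0 N\<close>, the Hecke matrices and some scalar multiples
  of group elements have this form.
\<close>
definition int_level :: "nat \<Rightarrow> rmat6 set" where
  "int_level N = {M. (\<forall>i j. M $ i $ j \<in> \<int>) \<and> (\<forall>i j. \<exists>c::int. blockC M $ i $ j = of_nat N * of_int c)}"

definition level_mult :: "nat \<Rightarrow> real set" where
  "level_mult N = {x. \<exists>c::int. x = of_nat N * of_int c}"

lemma level_mult_closed:
  "0 \<in> level_mult N" "x \<in> level_mult N \<Longrightarrow> y \<in> level_mult N \<Longrightarrow> x + y \<in> level_mult N"
  "x \<in> level_mult N \<Longrightarrow> - x \<in> level_mult N"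
  "x \<in> level_mult N \<Longrightarrow> a \<in> \<int> \<Longrightarrow> x * a \<in> level_mult N"
  "x \<in> level_mult N \<Longrightarrow> a \<in> \<int> \<Longrightarrow> a * x \<in> level_mult N"
  "a \<in> \<int> \<Longrightarrow> of_nat N * a \<in> level_mult N"
proof -
  show "0 \<in> level_mult N" by (auto simp: level_mult_def intro: exI[of _ 0])
  show "x + y \<in> level_mult N" if xy: "x \<in> level_mult N" "y \<in> level_mult N"
  proof -
    obtain c d :: int where "x = of_nat N * of_int c" "y = of_nat N * of_int d"
      using xy by (auto simp: level_mult_def)
    then have "x + y = of_nat N * of_int (c + d)" by (simp add: algebra_simps)
    then show ?thesis unfolding level_mult_def by blast
  qed
  show "- x \<in> level_mult N" if x: "x \<in> level_mult N"
  proof -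
    obtain c :: int where "x = of_nat N * of_int c" using x by (auto simp: level_mult_def)
    then have "- x = of_nat N * of_int (- c)" by simp
    then show ?thesis unfolding level_mult_def by blast
  qed
  show *: "a * x \<in> level_mult N" if x: "x \<in> level_mult N" "a \<in> \<int>"
  proof -
    obtain c d :: int where "x = of_nat N * of_int c" "a = of_int d" using x by (auto simp: level_mult_def Ints_def)
    then have "a * x = of_nat N * of_int (d * c)" by simp
    then show ?thesis unfolding level_mult_def by blast
  qed
  show "x * a \<in> level_mult N" if "x \<in> level_mult N" "a \<in> \<int>"
    using *[OF that] by (simp add: mult.commute)
  show "of_nat N * a \<in> level_mult N" if "a \<in> \<int>" using that unfolding level_mult_def Ints_def by auto
qed

lemma level_mult_sum: "(\<And>i. i \<in> I \<Longrightarrow> f i \<in> level_mult N) \<Longrightarrow> sum f I \<in> level_mult N"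
  by (induction I rule: infinite_finite_induct) (auto intro: level_mult_closed)

lemma int_level_iff: "M \<in> int_level N \<longleftrightarrow> (\<forall>i j. M $ i $ j \<in> \<int>) \<and> (\<forall>i j. blockC M $ i $ j \<in> level_mult N)"
  by (simp add: int_level_def level_mult_def)

lemma int_entry_mult:
  fixes M M' :: "real^'n^'n"
  assumes "\<And>i j. M $ i $ j \<in> \<int>" "\<And>i j. M' $ i $ j \<in> \<int>" shows "(M ** M') $ i $ j \<in> \<int>"
  unfolding matrix_matrix_mult_def vec_lambda_beta by (intro Ints_sum Ints_mult assms)

lemma block_ints:
  assumes "\<forall>i j. M $ i $ j \<in> \<int>"
  shows "blockA M $ i $ j \<in> \<int>" "blockB M $ i $ j \<in> \<int>" "blockC M $ i $ j \<in> \<int>" "blockD M $ i $ j \<in> \<int>"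
  using assms by (simp_all add: blockA_def blockB_def blockC_def blockD_def)

lemma int_level_mult: assumes "M \<in> int_level N" "M' \<in> int_level N" shows "M ** M' \<in> int_level N"
proof -
  have i: "\<forall>i j. M $ i $ j \<in> \<int>" "\<forall>i j. M' $ i $ j \<in> \<int>" using assms by (auto simp: int_level_iff)
  have p: "(X ** Y) $ i $ j \<in> level_mult N"
    if "\<And>i k. X $ i $ k \<in> level_mult N \<and> Y $ k $ j \<in> \<int> \<or> X $ i $ k \<in> \<int> \<and> Y $ k $ j \<in> level_mult N" for X Y :: rmat3 and i j
    unfolding matrix_matrix_mult_def vec_lambda_beta
    using that level_mult_closed(4,5) by (intro level_mult_sum) blast
  have "blockC (M ** M') $ i $ j \<in> level_mult N" for i j
    unfolding block_mult vector_add_component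
    using assms block_ints[OF i(1)] block_ints[OF i(2)]
    by (intro level_mult_closed(2) p) (auto simp: int_level_iff)
  then show ?thesis using i by (simp add: int_level_iff int_entry_mult)
qed

lemma adj_ints: assumes "\<forall>i j. M $ i $ j \<in> \<int>" shows "adj M $ i $ j \<in> \<int>"
  using block_ints[OF assms] by (cases i; cases j) (simp_all add: adj_def transpose_def)

lemma int_level_adj: assumes "M \<in> int_level N" shows "adj M \<in> int_level N"
  using assms adj_ints[of M] by (auto simp: int_level_iff transpose_def intro: level_mult_closed)

lemma Gamma0_iff: "M \<in> Gamma0 N \<longleftrightarrow> M \<in> int_level N \<and> psim 1 M"
  using GSp_mult_psim[of 1 M] by (auto simp: Gamma0_def int_level_def)

lemma mat1_int_level: "mat 1 \<in> int_level N"
proof -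
  have "(mat 1 :: rmat6) $ i $ j \<in> \<int>" for i j by (simp add: mat_def)
  moreover have "blockC (mat 1) $ i $ j \<in> level_mult N" for i j by (simp add: level_mult_closed)
  ultimately show ?thesis unfolding int_level_iff by blast
qed

lemma Gamma0_one [simp]: "mat 1 \<in> Gamma0 N" by (simp add: Gamma0_iff mat1_int_level)
lemma Gamma0_mult: "M \<in> Gamma0 N \<Longrightarrow> M' \<in> Gamma0 N \<Longrightarrow> M ** M' \<in> Gamma0 N"
  using psim_mult[of 1 M 1 M'] by (simp add: Gamma0_iff int_level_mult)
lemma Gamma0_adj: "M \<in> Gamma0 N \<Longrightarrow> adj M \<in> Gamma0 N"
  by (simp add: Gamma0_iff int_level_adj)
lemma Gamma0_psim: "M \<in> Gamma0 N \<Longrightarrow> psim 1 M"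
  by (simp add: Gamma0_iff)

lemma siegel_pt_act:
  assumes "\<gamma> \<in> Gamma0 N" "Z \<in> siegel_space" shows "siegel_pt N (siegel_act \<gamma> Z) = siegel_pt N Z"
proof -
  note g = Gamma0_psim[OF assms(1)]
  have 1: "siegel_act M (siegel_act \<gamma> Z) \<in> siegel_pt N Z" if "M \<in> Gamma0 N" for M
    unfolding siegel_pt_def act_mult[OF g Gamma0_psim[OF that] assms(2), symmetric]
    by (rule imageI) (rule Gamma0_mult[OF that assms(1)])
  have 2: "siegel_act M Z \<in> siegel_pt N (siegel_act \<gamma> Z)" if "M \<in> Gamma0 N" for M
  proof -
    have M': "M ** adj \<gamma> \<in> Gamma0 N" using that assms(1) by (intro Gamma0_mult Gamma0_adj)
    have "siegel_act (M ** adj \<gamma>) (siegel_act \<gamma> Z) = siegel_act ((M ** adj \<gamma>) ** \<gamma>) Z"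
      using act_mult[OF g Gamma0_psim[OF M'] assms(2)] by simp
    also have "(M ** adj \<gamma>) ** \<gamma> = M" by (simp add: matrix_mul_assoc[symmetric] psim_left[OF g])
    finally show ?thesis unfolding siegel_pt_def by (intro image_eqI[OF _ M']) simp
  qed
  show ?thesis using 1 2 by (auto simp: siegel_pt_def[of N Z] siegel_pt_def[of N "siegel_act \<gamma> Z"])
qed

lemma siegel_pt_eq:
  assumes "Z \<in> siegel_space" "W \<in> siegel_space"
  shows "siegel_pt N Z = siegel_pt N W \<longleftrightarrow> (\<exists>\<gamma>\<in>Gamma0 N. W = siegel_act \<gamma> Z)"
proof
  assume "siegel_pt N Z = siegel_pt N W"
  moreover have "W \<in> siegel_pt N W" unfolding siegel_pt_def
    by (rule image_eqI[of _ _ "mat 1"]) (simp_all add: assms)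
  ultimately show "\<exists>\<gamma>\<in>Gamma0 N. W = siegel_act \<gamma> Z" by (auto simp: siegel_pt_def)
next
  assume "\<exists>\<gamma>\<in>Gamma0 N. W = siegel_act \<gamma> Z"
  then show "siegel_pt N Z = siegel_pt N W" using siegel_pt_act assms(1) by metis
qed

section \<open>Analytic subsets of the quotient\<close>

definition pre_pt :: "nat \<Rightarrow> cmat3 set set \<Rightarrow> cmat3 set" where
  "pre_pt N S = {Z \<in> siegel_space. siegel_pt N Z \<in> S}"

lemma analytic_X_closed:
  "analytic_X N A \<Longrightarrow> analytic_X N B \<Longrightarrow> analytic_X N (A \<union> B)"
  "analytic_X N A \<Longrightarrow> analytic_X N B \<Longrightarrow> analytic_X N (A \<inter> B)" "analytic_X N {}"
proof -
  assume a: "analytic_X N A" "analytic_X N B"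
  have e: "{Z \<in> siegel_space. siegel_pt N Z \<in> A \<union> B} = {Z \<in> siegel_space. siegel_pt N Z \<in> A} \<union> {Z \<in> siegel_space. siegel_pt N Z \<in> B}"
   "{Z \<in> siegel_space. siegel_pt N Z \<in> A \<inter> B} = {Z \<in> siegel_space. siegel_pt N Z \<in> A} \<inter> {Z \<in> siegel_space. siegel_pt N Z \<in> B}" by auto
  show "analytic_X N (A \<union> B)" "analytic_X N (A \<inter> B)"
    using a analytic_Un analytic_Int unfolding analytic_X_def e by auto
qed (simp add: analytic_X_def analytic_empty)

lemma analytic_XX_closed:
  "analytic_XX N A \<Longrightarrow> analytic_XX N B \<Longrightarrow> analytic_XX N (A \<union> B)"
  "analytic_XX N A \<Longrightarrow> analytic_XX N B \<Longrightarrow> analytic_XX N (A \<inter> B)" "analytic_XX N {}"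
proof -
  assume a: "analytic_XX N A" "analytic_XX N B"
  define h where "h S = {(Z, Z'). Z \<in> siegel_space \<and> Z' \<in> siegel_space \<and> (siegel_pt N Z, siegel_pt N Z') \<in> S}" for S
  have d: "analytic_XX N S \<longleftrightarrow> S \<subseteq> siegel_var N \<times> siegel_var N \<and> analytic_subset (siegel_space \<times> siegel_space) (h S)" for S
    by (simp add: analytic_XX_def h_def)
  have e: "h (A \<union> B) = h A \<union> h B" "h (A \<inter> B) = h A \<inter> h B" by (auto simp: h_def)
  show "analytic_XX N (A \<union> B)" "analytic_XX N (A \<inter> B)"
    using a analytic_Un analytic_Int unfolding d e by auto
qed (simp add: analytic_XX_def analytic_empty)

lemma int_sim_mult:
  assumes "M \<in> int_sim a" "M' \<in> int_sim b" shows "M ** M' \<in> int_sim (a * b)"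
proof -
  obtain c d where c: "c \<le> a" "psim c M" "d \<le> b" "psim d M'" using assms by (auto simp: int_sim_def)
  have "0 < c" "0 < d" using c psim_pos by blast+
  then have "c * d \<le> a * b" using c by (intro mult_mono) auto
  then show ?thesis using assms psim_mult[OF c(2,4)] by (auto simp: int_sim_def int_entry_mult)
qed

lemma int_sim_adj: "M \<in> int_sim a \<Longrightarrow> adj M \<in> int_sim a"
  by (auto simp: int_sim_def adj_ints)

lemma int_sim_mono: "a \<le> b \<Longrightarrow> M \<in> int_sim a \<Longrightarrow> M \<in> int_sim b"
  unfolding int_sim_def by (blast intro: order_trans)

lemma int_sim_Gamma0: "M \<in> Gamma0 N \<Longrightarrow> M \<in> int_sim 1"
  by (auto simp: Gamma0_iff int_level_iff int_sim_def)

lemma int_sim_Jm: assumes "\<Delta> > 0" shows "Jm \<Delta> \<in> int_sim (real \<Delta>)"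
proof -
  have "Emat $ i $ j \<in> \<int>" for i j by (simp add: Emat_def)
  then have "Jm \<Delta> $ i $ j \<in> \<int>" for i j by (cases i; cases j) (simp_all add: Jm_def)
  then show ?thesis using psim_Jm[OF assms] by (auto simp: int_sim_def)
qed

lemma int_sim_I: "M \<in> int_level N \<Longrightarrow> psim c M \<Longrightarrow> M \<in> int_sim c"
  by (auto simp: int_sim_def int_level_iff)

text \<open>
  For general \<open>X\<close>, the image under \<open>M\<close> of the points of the ball with an additional
  endomorphism in \<open>X\<close>; for \<open>X = {mat 1}\<close>, of the whole ball.
\<close>
definition piece :: "nat \<Rightarrow> nat \<Rightarrow> rmat6 \<Rightarrow> rmat6 set \<Rightarrow> cmat3 set set" where
  "piece N \<Delta> M X = (\<lambda>Z. siegel_pt N (siegel_act M Z)) ` {Z \<in> Vset \<Delta>. \<exists>x\<in>X. moves x Z Z}"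

lemma Vset_siegel: "Z \<in> Vset \<Delta> \<Longrightarrow> Z \<in> siegel_space"
  by (simp add: Vset_def)

text \<open>
  The preimage in the Siegel space is the union of the fixed loci of the conjugates of \<open>J\<close> and \<open>x\<close> by
  the matrices \<open>\<gamma> M\<close>.  These conjugates are integral with bounded multiplier, so the union is locally
  finite.
\<close>
lemma piece_analytic:
  assumes D: "\<Delta> > 0" and M: "M \<in> int_sim m" "psim c M" and X: "X \<subseteq> int_sim k"
  shows "analytic_X N (piece N \<Delta> M X)"
proof -
  define P where "P = {(g ** Jm \<Delta> ** adj g, g ** x ** adj g) |g x. g \<in> (\<lambda>\<gamma>. \<gamma> ** M) ` Gamma0 N \<and> x \<in> X}"
  define K where "K = max (m * real \<Delta> * m) (m * k * m)"
  have gi: "g \<in> int_sim m \<and> psim c g" if "g \<in> (\<lambda>\<gamma>. \<gamma> ** M) ` Gamma0 N" for g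
    using that int_sim_mult[OF int_sim_Gamma0 M(1)] psim_mult[OF Gamma0_psim M(2)] by auto
  have P: "P \<subseteq> int_sim K \<times> int_sim K"
  proof
    fix q assume "q \<in> P"
    then obtain g x where q: "q = (g ** Jm \<Delta> ** adj g, g ** x ** adj g)" "g \<in> int_sim m" "x \<in> int_sim k"
      using gi X by (auto simp: P_def)
    have "g ** Jm \<Delta> ** adj g \<in> int_sim (m * real \<Delta> * m)" "g ** x ** adj g \<in> int_sim (m * k * m)"
      using q by (auto intro!: int_sim_mult int_sim_adj int_sim_Jm[OF D])
    then have "g ** Jm \<Delta> ** adj g \<in> int_sim K" "g ** x ** adj g \<in> int_sim K"
      unfolding K_def by (auto elim: int_sim_mono[rotated])
    then show "q \<in> int_sim K \<times> int_sim K" by (simp add: q(1))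
  qed
  have e: "{Z \<in> siegel_space. siegel_pt N Z \<in> piece N \<Delta> M X} = (\<Union>q\<in>P. fix_set q)"
  proof (intro equalityI subsetI)
    fix Z assume "Z \<in> {Z \<in> siegel_space. siegel_pt N Z \<in> piece N \<Delta> M X}"
    then obtain W x where Z: "Z \<in> siegel_space" and W: "W \<in> Vset \<Delta>" "x \<in> X" "moves x W W"
      and eq: "siegel_pt N (siegel_act M W) = siegel_pt N Z" by (auto simp: piece_def)
    note Ws = Vset_siegel[OF W(1)]
    obtain \<gamma> where g: "\<gamma> \<in> Gamma0 N" "Z = siegel_act \<gamma> (siegel_act M W)"
      using eq siegel_pt_eq[OF act_siegel[OF M(2) Ws] Z] by blast
    define g' where "g' = \<gamma> ** M"
    have pg: "psim c g'" using gi g by (auto simp: g'_def)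
    have Zg: "Z = siegel_act g' W" using g act_mult[OF M(2) Gamma0_psim[OF g(1)] Ws] by (simp add: g'_def)
    have "Z \<in> fix_set (g' ** Jm \<Delta> ** adj g', g' ** x ** adj g')"
      using Z W fix_conj[OF pg Ws] by (simp add: fix_set_def Zg[symmetric] Vset_def)
    then show "Z \<in> (\<Union>q\<in>P. fix_set q)" using g(1) W(2) unfolding P_def g'_def by blast
  next
    fix Z assume "Z \<in> (\<Union>q\<in>P. fix_set q)"
    then obtain \<gamma> x where g: "\<gamma> \<in> Gamma0 N" "x \<in> X"
      and Z: "Z \<in> fix_set ((\<gamma> ** M) ** Jm \<Delta> ** adj (\<gamma> ** M), (\<gamma> ** M) ** x ** adj (\<gamma> ** M))"
      by (auto simp: P_def)
    define g' where "g' = \<gamma> ** M"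
    have pg: "psim c g'" using gi g by (auto simp: g'_def)
    have Zs: "Z \<in> siegel_space" using Z by (simp add: fix_set_def)
    define W where "W = siegel_act (adj g') Z"
    have Ws: "W \<in> siegel_space" using act_siegel[of c "adj g'" Z] pg Zs by (simp add: W_def)
    have Zg: "Z = siegel_act g' W" using act_adj(2)[OF pg Zs] by (simp add: W_def)
    have "W \<in> Vset \<Delta>" "moves x W W"
      using Z fix_conj[OF pg Ws] Ws by (auto simp: fix_set_def Zg[symmetric] Vset_def g'_def[symmetric])
    moreover have "siegel_pt N Z = siegel_pt N (siegel_act M W)"
      using Zg act_mult[OF M(2) Gamma0_psim[OF g(1)] Ws] siegel_pt_act[OF g(1) act_siegel[OF M(2) Ws]]
      by (simp add: g'_def)
    ultimately show "Z \<in> {Z \<in> siegel_space. siegel_pt N Z \<in> piece N \<Delta> M X}"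
      using Zs g(2) by (auto simp: piece_def)
  qed
  have "piece N \<Delta> M X \<subseteq> siegel_var N"
    using act_siegel[OF M(2) Vset_siegel] by (auto simp: piece_def siegel_var_def)
  moreover have "analytic_subset siegel_space (\<Union>q\<in>P. fix_set q)"
    by (rule analytic_UN_locally_finite[OF fix_set_locally_finite[OF P] fix_set_analytic])
  ultimately show ?thesis by (simp add: analytic_X_def e)
qed

abbreviation full_piece :: "nat \<Rightarrow> nat \<Rightarrow> rmat6 \<Rightarrow> cmat3 set set" where
  "full_piece N \<Delta> M \<equiv> piece N \<Delta> M {mat 1}"

lemma full_piece_image: "full_piece N \<Delta> M = (\<lambda>Z. siegel_pt N (siegel_act M Z)) ` Vset \<Delta>"
  by (auto simp: piece_def)

lemma mat1_int_sim: "mat 1 \<in> int_sim 1"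
  using int_sim_Gamma0[OF Gamma0_one] .

lemma Vset_nonempty: "\<Delta> > 0 \<Longrightarrow> Vset \<Delta> \<noteq> {}"
  using Z0_Vset by blast

lemma full_piece_irreducible:
  assumes D: "\<Delta> > 0" and M: "M \<in> int_sim m" "psim c M"
  shows "irreducible_set (analytic_X N) (full_piece N \<Delta> M)"
  unfolding irreducible_set_def
proof (intro conjI allI impI)
  show "analytic_X N (full_piece N \<Delta> M)"
    by (rule piece_analytic[OF D M, of _ 1]) (simp add: mat1_int_sim)
  show "full_piece N \<Delta> M \<noteq> {}" using Vset_nonempty[OF D] by (simp add: full_piece_image)
  fix A B assume A: "analytic_X N A" "analytic_X N B" and e: "full_piece N \<Delta> M = A \<union> B"
  let ?\<phi> = "\<lambda>z. siegel_act M (vphi \<Delta> z)"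
  have "\<exists>S\<in>{A, B}. ?\<phi> ` B2 \<subseteq> pre_pt N S"
  proof (rule analytic_disc_finite[OF vphi_disc(1)[OF D M(2)]])
    show "analytic_subset siegel_space (pre_pt N S)" if "S \<in> {A, B}" for S
      using that A by (auto simp: analytic_X_def pre_pt_def)
    have "siegel_pt N (?\<phi> z) \<in> A \<union> B \<and> ?\<phi> z \<in> siegel_space" if "z \<in> B2" for z
    proof -
      have v: "vphi \<Delta> z \<in> Vset \<Delta>" using that by (simp only: Vset_vphi[OF D] imageI)
      then show ?thesis
        unfolding e[symmetric] full_piece_image by (intro conjI imageI act_siegel[OF M(2)] Vset_siegel[OF v])
    qed
    then show "?\<phi> ` B2 \<subseteq> (\<Union>S\<in>{A, B}. pre_pt N S)" unfolding pre_pt_def by blast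
  qed auto
  then have "full_piece N \<Delta> M \<subseteq> A \<or> full_piece N \<Delta> M \<subseteq> B"
    unfolding full_piece_image Vset_vphi[OF D] by (auto simp: pre_pt_def)
  then show "full_piece N \<Delta> M = A \<or> full_piece N \<Delta> M = B" using e by blast
qed

text \<open>
  The ball is irreducible, even for locally finite covers.
\<close>
lemma Vset_cover:
  assumes D: "\<Delta> > 0" and A: "analytic_subset siegel_space A" and P: "P \<subseteq> int_sim k \<times> int_sim k"
    and sub: "Vset \<Delta> \<subseteq> A \<union> (\<Union>q\<in>P. fix_set q)"
  shows "Vset \<Delta> \<subseteq> A \<or> (\<exists>q\<in>P. Vset \<Delta> \<subseteq> fix_set q)"
proof -
  define F where "F i = (case i of None \<Rightarrow> A | Some q \<Rightarrow> fix_set q)" for i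
  have e: "siegel_act (mat 1) (vphi \<Delta> z) = vphi \<Delta> z" if "z \<in> B2" for z
    using that Vset_siegel Vset_vphi[OF D] by (intro act_mat1) blast
  have "\<exists>i\<in>insert None (Some ` P). (\<lambda>z. siegel_act (mat 1) (vphi \<Delta> z)) ` B2 \<subseteq> F i"
  proof (rule analytic_disc_locally_finite[OF vphi_disc(1)[OF D psim_mat1]])
    show "locally_finite_in siegel_space (insert None (Some ` P)) F"
      unfolding locally_finite_in_def
    proof
      fix Z assume "Z \<in> siegel_space"
      then obtain U where U: "open U" "Z \<in> U" "finite {q \<in> P. fix_set q \<inter> U \<noteq> {}}"
        using fix_set_locally_finite[OF P] unfolding locally_finite_in_def by blast
      have "{i \<in> insert None (Some ` P). F i \<inter> U \<noteq> {}} \<subseteq> insert None (Some ` {q \<in> P. fix_set q \<inter> U \<noteq> {}})"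
        by (auto simp: F_def image_iff)
      then have "finite {i \<in> insert None (Some ` P). F i \<inter> U \<noteq> {}}"
        by (rule finite_subset) (use U(3) in simp)
      then show "\<exists>U. open U \<and> Z \<in> U \<and> finite {i \<in> insert None (Some ` P). F i \<inter> U \<noteq> {}}" using U by blast
    qed
    show "analytic_subset siegel_space (F i)" if "i \<in> insert None (Some ` P)" for i
      using that A fix_set_analytic by (auto simp: F_def)
    have "(\<lambda>z. siegel_act (mat 1) (vphi \<Delta> z)) ` B2 = Vset \<Delta>" unfolding Vset_vphi[OF D]
      by (rule image_cong[OF refl e])
    moreover have "(\<Union>i\<in>insert None (Some ` P). F i) = A \<union> (\<Union>q\<in>P. fix_set q)" by (auto simp: F_def)
    ultimately show "(\<lambda>z. siegel_act (mat 1) (vphi \<Delta> z)) ` B2 \<subseteq> (\<Union>i\<in>insert None (Some ` P). F i)" using sub by simp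
  qed
  moreover have "(\<lambda>z. siegel_act (mat 1) (vphi \<Delta> z)) ` B2 = Vset \<Delta>" unfolding Vset_vphi[OF D]
    by (rule image_cong[OF refl e])
  ultimately have "\<exists>i\<in>insert None (Some ` P). Vset \<Delta> \<subseteq> F i" by simp
  then show ?thesis by (auto simp: F_def)
qed

lemma Vset_sub_fix_commutes:
  assumes D: "\<Delta> > 0" and g: "psim c g" and sub: "Vset \<Delta> \<subseteq> fix_set (g ** Jm \<Delta> ** adj g, y)"
  shows "g ** Jm \<Delta> = Jm \<Delta> ** g"
  by (rule normalizer_commutes[OF D g]) (use sub in \<open>auto simp: fix_set_def\<close>)

text \<open>
  The similitude \<open>h\<close> maps the ball to itself, and \<open>M h\<close> is a scalar multiple of \<open>\<gamma> M'\<close>.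
\<close>
lemma full_piece_commute:
  assumes M: "psim c M" "psim d M'" and \<gamma>: "\<gamma> \<in> Gamma0 N"
    and h: "h = adj M ** \<gamma> ** M'" "h ** Jm \<Delta> = Jm \<Delta> ** h"
  shows "full_piece N \<Delta> M = full_piece N \<Delta> M'"
proof -
  have ph: "psim (c * 1 * d) h" unfolding h(1) by (intro psim_mult M Gamma0_psim[OF \<gamma>]) (simp add: M)
  have c: "c \<noteq> 0" using psim_pos[OF M(1)] by simp
  have Mh: "M ** h = c *\<^sub>R (\<gamma> ** M')"
    unfolding h(1) matrix_mul_assoc by (simp add: psim_right[OF M(1)] mmult_simps)
  have key: "siegel_act M (siegel_act h Z) = siegel_act \<gamma> (siegel_act M' Z)" if Z: "Z \<in> siegel_space" for Z
    using act_mult[OF ph M(1) Z] act_mult[OF M(2) Gamma0_psim[OF \<gamma>] Z]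
      act_scaleR[OF psim_mult[OF Gamma0_psim[OF \<gamma>] M(2)] c Z] by (simp add: Mh)
  have pt: "siegel_pt N (siegel_act M (siegel_act h Z)) = siegel_pt N (siegel_act M' Z)" if Z: "Z \<in> siegel_space" for Z
    using key[OF Z] siegel_pt_act[OF \<gamma> act_siegel[OF M(2) Z]] by simp
  have hV: "siegel_act h ` Vset \<Delta> = Vset \<Delta>"
  proof
    show "siegel_act h ` Vset \<Delta> \<subseteq> Vset \<Delta>" using Vset_commute[OF ph h(2)] Vset_siegel by auto
    show "Vset \<Delta> \<subseteq> siegel_act h ` Vset \<Delta>"
    proof
      fix Z assume Z: "Z \<in> Vset \<Delta>"
      note Zs = Vset_siegel[OF Z]
      have W: "siegel_act (adj h) Z \<in> siegel_space" using act_siegel[of "c * 1 * d" "adj h"] ph Zs by simp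
      have "siegel_act h (siegel_act (adj h) Z) = Z" by (rule act_adj(2)[OF ph Zs])
      then show "Z \<in> siegel_act h ` Vset \<Delta>" using Z Vset_commute[OF ph h(2) W] by (metis image_eqI)
    qed
  qed
  have "full_piece N \<Delta> M = (\<lambda>Z. siegel_pt N (siegel_act M Z)) ` siegel_act h ` Vset \<Delta>"
    by (simp add: full_piece_image hV)
  also have "\<dots> = full_piece N \<Delta> M'" unfolding full_piece_image image_image
    by (rule image_cong[OF refl pt[OF Vset_siegel]])
  finally show ?thesis .
qed

text \<open>
  The inclusion says that each \<open>Z\<close> in the ball is the image of some \<open>W\<close> in the ball under a matrix
  \<open>h = adj M ** \<gamma> ** M'\<close>, hence is fixed by the conjugate of \<open>J\<close> by \<open>h\<close>.  By \<open>Vset_cover\<close> a single \<open>\<gamma>\<close>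
  works for all \<open>Z\<close>.
\<close>
lemma full_piece_sub:
  assumes D: "\<Delta> > 0" and M: "M \<in> int_sim m" "psim c M" and M': "M' \<in> int_sim m'" "psim c' M'"
    and sub: "full_piece N \<Delta> M \<subseteq> full_piece N \<Delta> M'"
  obtains \<gamma> where "\<gamma> \<in> Gamma0 N" "(adj M ** \<gamma> ** M') ** Jm \<Delta> = Jm \<Delta> ** (adj M ** \<gamma> ** M')"
    "full_piece N \<Delta> M = full_piece N \<Delta> M'"
proof -
  define H where "H = (\<lambda>\<gamma>. adj M ** \<gamma> ** M') ` Gamma0 N"
  define P where "P = (\<lambda>h. (h ** Jm \<Delta> ** adj h, h ** Jm \<Delta> ** adj h)) ` H"
  have H: "h \<in> int_sim (m * 1 * m') \<and> psim (c * 1 * c') h" if hh: "h \<in> H" for h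
  proof -
    obtain \<gamma> where g: "\<gamma> \<in> Gamma0 N" and h: "h = adj M ** \<gamma> ** M'" using hh by (auto simp: H_def)
    have "psim c (adj M)" using M(2) by simp
    from psim_mult[OF psim_mult[OF this Gamma0_psim[OF g]] M'(2)]
      int_sim_mult[OF int_sim_mult[OF int_sim_adj[OF M(1)] int_sim_Gamma0[OF g]] M'(1)]
    show ?thesis unfolding h by blast
  qed
  define K where "K = (m * 1 * m') * real \<Delta> * (m * 1 * m')"
  have P: "P \<subseteq> int_sim K \<times> int_sim K"
    using H int_sim_Jm[OF D] unfolding P_def K_def by (auto intro!: int_sim_mult int_sim_adj)
  have "Vset \<Delta> \<subseteq> {} \<union> (\<Union>q\<in>P. fix_set q)"
  proof
    fix Z assume Z: "Z \<in> Vset \<Delta>"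
    note Zs = Vset_siegel[OF Z]
    obtain W where W: "W \<in> Vset \<Delta>" "siegel_pt N (siegel_act M Z) = siegel_pt N (siegel_act M' W)"
      using sub Z unfolding full_piece_image by blast
    note Ws = Vset_siegel[OF W(1)]
    obtain \<gamma> where g: "\<gamma> \<in> Gamma0 N" "siegel_act M Z = siegel_act \<gamma> (siegel_act M' W)"
      using W(2) siegel_pt_eq[OF act_siegel[OF M'(2) Ws] act_siegel[OF M(2) Zs]] by metis
    define h where "h = adj M ** \<gamma> ** M'"
    have hH: "h \<in> H" using g by (simp add: H_def h_def)
    have Mg: "psim (c * 1) (adj M ** \<gamma>)" using M(2) Gamma0_psim[OF g(1)] by (intro psim_mult) simp_all
    have "siegel_act h W = siegel_act (adj M) (siegel_act \<gamma> (siegel_act M' W))"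
      unfolding h_def using act_mult[OF M'(2) Mg Ws] act_mult[OF Gamma0_psim[OF g(1)], of c "adj M" "siegel_act M' W"]
        act_siegel[OF M'(2) Ws] M(2) by simp
    also have "\<dots> = Z" unfolding g(2)[symmetric] by (rule act_adj(1)[OF M(2) Zs])
    finally have "moves (h ** Jm \<Delta> ** adj h) Z Z"
      using fix_conj[OF conjunct2[OF H[OF hH]] Ws, of "Jm \<Delta>"] W(1) by (simp add: Vset_def)
    then show "Z \<in> {} \<union> (\<Union>q\<in>P. fix_set q)" using hH Zs by (auto simp: P_def fix_set_def)
  qed
  from Vset_cover[OF D analytic_empty P this] Vset_nonempty[OF D]
  obtain \<gamma> where g: "\<gamma> \<in> Gamma0 N"
    "Vset \<Delta> \<subseteq> fix_set ((adj M ** \<gamma> ** M') ** Jm \<Delta> ** adj (adj M ** \<gamma> ** M'), (adj M ** \<gamma> ** M') ** Jm \<Delta> ** adj (adj M ** \<gamma> ** M'))"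
    unfolding P_def H_def by blast
  have ph: "psim (c * 1 * c') (adj M ** \<gamma> ** M')" using H g(1) by (auto simp: H_def)
  have com: "(adj M ** \<gamma> ** M') ** Jm \<Delta> = Jm \<Delta> ** (adj M ** \<gamma> ** M')"
    by (rule Vset_sub_fix_commutes[OF D ph g(2)])
  show ?thesis using that[OF g(1) com full_piece_commute[OF M(2) M'(2) g(1) refl com]] .
qed

section \<open>The components of the Hecke image\<close>

lemma hecke_diag:
  assumes "p > 0"
  shows "blocks (mat 1) 0 0 (mat (real p)) \<in> int_level N" "psim (real p) (blocks (mat 1) 0 0 (mat (real p)))"
proof -
  let ?D = "blocks (mat 1) 0 0 (mat (real p))"
  have "?D $ i $ j \<in> \<int>" for i j
    by (cases i; cases j) (simp_all add: mat_def)
  then show "?D \<in> int_level N" by (simp add: int_level_iff level_mult_closed)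
  have e: "mat (real p) = real p *\<^sub>R (mat 1 :: rmat3)" by (simp add: vec_eq_iff mat_def)
  have "?D ** adj ?D = real p *\<^sub>R mat 1"
    unfolding e by (rule blocks_eqI) (simp_all add: block_mult mmult_simps)
  then show "psim (real p) ?D" using assms by (simp add: psim_def)
qed

lemma hecke_facts:
  assumes "p > 0" "M \<in> hecke_matrices N p"
  shows "M \<in> int_level N" "psim (real p) M" "M \<in> int_sim (real p)"
proof -
  obtain M1 M2 where M: "M = M1 ** blocks (mat 1) 0 0 (mat (real p)) ** M2" "M1 \<in> Gamma0 N" "M2 \<in> Gamma0 N"
    using assms(2) by (auto simp: hecke_matrices_def)
  show "M \<in> int_level N" unfolding M(1)
    by (rule int_level_mult[OF int_level_mult[OF _ hecke_diag(1)[OF assms(1)]]]) (use M(2,3) in \<open>simp_all add: Gamma0_iff\<close>)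
  have "psim (1 * real p * 1) M" unfolding M(1)
    by (rule psim_mult[OF psim_mult[OF Gamma0_psim[OF M(2)] hecke_diag(2)[OF assms(1)]] Gamma0_psim[OF M(3)]])
  then show "psim (real p) M" by simp
  then show "M \<in> int_sim (real p)" using \<open>M \<in> int_level N\<close> by (rule int_sim_I[rotated])
qed

lemma hecke_Gamma0:
  assumes "M \<in> hecke_matrices N p" "\<gamma> \<in> Gamma0 N"
  shows "\<gamma> ** M \<in> hecke_matrices N p" "M ** \<gamma> \<in> hecke_matrices N p"
proof -
  obtain M1 M2 where M: "M = M1 ** blocks (mat 1) 0 0 (mat (real p)) ** M2" "M1 \<in> Gamma0 N" "M2 \<in> Gamma0 N"
    using assms(1) by (auto simp: hecke_matrices_def)
  have "\<gamma> ** M = (\<gamma> ** M1) ** blocks (mat 1) 0 0 (mat (real p)) ** M2"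
    "M ** \<gamma> = M1 ** blocks (mat 1) 0 0 (mat (real p)) ** (M2 ** \<gamma>)"
    by (simp_all add: M(1) matrix_mul_assoc)
  then show "\<gamma> ** M \<in> hecke_matrices N p" "M ** \<gamma> \<in> hecke_matrices N p"
    using Gamma0_mult[OF assms(2) M(2)] Gamma0_mult[OF M(3) assms(2)] M(2,3)
    unfolding hecke_matrices_def by blast+
qed

text \<open>
  Since \<open>M'\<close> has inverse \<open>adj M' / p\<close>, the quotient of \<open>M\<close> by \<open>M'\<close> is congruent to 1 modulo \<open>N\<close>.
\<close>
lemma congruent_coset:
  assumes p: "p > 0" and N: "N > 0"
    and M: "M \<in> int_level N" "psim (real p) M" and M': "M' \<in> int_level N" "psim (real p) M'"
    and K: "\<forall>i j. K $ i $ j \<in> \<int>" "M = M' + (real p * real N) *\<^sub>R K"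
  shows "\<exists>\<gamma>\<in>Gamma0 N. M = \<gamma> ** M'"
proof -
  define \<gamma> where "\<gamma> = (1 / real p) *\<^sub>R (M ** adj M')"
  have e: "\<gamma> = mat 1 + real N *\<^sub>R (K ** adj M')"
    using p unfolding \<gamma>_def K(2) by (simp add: mmult_simps psim_right[OF M'(2)] scaleR_add_right)
  have M'i: "\<forall>i j. M' $ i $ j \<in> \<int>" using M' by (simp add: int_level_iff)
  have ki: "(K ** adj M') $ i $ j \<in> \<int>" for i j
    by (intro int_entry_mult) (use K adj_ints[OF M'i] in auto)
  have "\<gamma> $ i $ j \<in> \<int>" for i j
    unfolding e using ki[of i j] by (simp add: mat_def)
  moreover have "blockC \<gamma> $ i $ j \<in> level_mult N" for i j
    unfolding e using ki by (simp add: level_mult_closed block_ints)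
  moreover have "psim 1 \<gamma>"
  proof -
    have "psim ((1 / real p) * (1 / real p) * (real p * real p)) \<gamma>"
      unfolding \<gamma>_def using M(2) M'(2) p by (intro psim_scaleR psim_mult) simp_all
    then show ?thesis using p by simp
  qed
  ultimately have "\<gamma> \<in> Gamma0 N" by (simp add: Gamma0_iff int_level_iff)
  moreover have "\<gamma> ** M' = M"
    using p by (simp add: \<gamma>_def mmult_simps matrix_mul_assoc[symmetric] psim_left[OF M'(2)])
  ultimately show ?thesis by metis
qed

lemma hecke_finite_cosets:
  assumes p: "p > 0" and N: "N > 0"
  obtains R where "finite R" "R \<subseteq> hecke_matrices N p"
    "\<And>M. M \<in> hecke_matrices N p \<Longrightarrow> \<exists>M'\<in>R. \<exists>\<gamma>\<in>Gamma0 N. M = \<gamma> ** M'"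
proof -
  define m where "m = int (p * N)"
  have m: "m > 0" using p N by (simp add: m_def)
  define res :: "rmat6 \<Rightarrow> rmat6" where "res M = (\<chi> i j. of_int (\<lfloor>M $ i $ j\<rfloor> mod m))" for M
  have "res ` hecke_matrices N p \<subseteq> {M. \<forall>i j. M $ i $ j \<in> \<int> \<and> \<bar>M $ i $ j\<bar> \<le> of_int m}"
    using m pos_mod_bound[OF m] pos_mod_sign[OF m] by (auto simp: res_def less_imp_le)
  then have fin: "finite (res ` hecke_matrices N p)" by (rule finite_subset[OF _ finite_int_matrices])
  define pick where "pick r = (SOME M. M \<in> hecke_matrices N p \<and> res M = r)" for r
  have pick: "pick (res M) \<in> hecke_matrices N p \<and> res (pick (res M)) = res M" if "M \<in> hecke_matrices N p" for M
    unfolding pick_def by (rule someI[of _ M]) (simp add: that)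
  have "\<exists>\<gamma>\<in>Gamma0 N. M = \<gamma> ** pick (res M)" if M: "M \<in> hecke_matrices N p" for M
  proof -
    define M' where "M' = pick (res M)"
    have M': "M' \<in> hecke_matrices N p" "res M' = res M" using pick[OF M] by (simp_all add: M'_def)
    define K where "K = (1 / (real p * real N)) *\<^sub>R (M - M')"
    have "K $ i $ j \<in> \<int>" for i j
    proof -
      have i: "M $ i $ j \<in> \<int>" "M' $ i $ j \<in> \<int>"
        using hecke_facts(1)[OF p M] hecke_facts(1)[OF p M'(1)] by (auto simp: int_level_iff)
      have "of_int (\<lfloor>M $ i $ j\<rfloor> mod m) = (of_int (\<lfloor>M' $ i $ j\<rfloor> mod m) :: real)"
        using arg_cong[OF M'(2), of "\<lambda>X. X $ i $ j"] by (simp add: res_def)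
      then have "\<lfloor>M $ i $ j\<rfloor> mod m = \<lfloor>M' $ i $ j\<rfloor> mod m" by simp
      then have "m dvd \<lfloor>M $ i $ j\<rfloor> - \<lfloor>M' $ i $ j\<rfloor>" by (simp add: mod_eq_dvd_iff)
      then obtain k where "\<lfloor>M $ i $ j\<rfloor> - \<lfloor>M' $ i $ j\<rfloor> = m * k" by (auto simp: dvd_def)
      then have "of_int \<lfloor>M $ i $ j\<rfloor> - of_int \<lfloor>M' $ i $ j\<rfloor> = (of_int m * of_int k :: real)"
        by (metis of_int_diff of_int_mult)
      then have "M $ i $ j - M' $ i $ j = real p * real N * of_int k" using i by (simp add: m_def)
      then show ?thesis using p N by (simp add: K_def)
    qed
    moreover have "M = M' + (real p * real N) *\<^sub>R K" using p N by (simp add: K_def)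
    ultimately show ?thesis
      using congruent_coset[OF p N hecke_facts(1,2)[OF p M] hecke_facts(1,2)[OF p M'(1)], of K] by (simp add: M'_def)
  qed
  then show ?thesis using that[of "pick ` res ` hecke_matrices N p"] fin pick by blast
qed

lemma full_piece_Gamma0:
  assumes "\<gamma> \<in> Gamma0 N" "psim c M" shows "full_piece N \<Delta> (\<gamma> ** M) = full_piece N \<Delta> M"
  unfolding full_piece_image
  by (rule image_cong[OF refl])
    (simp add: act_mult[OF assms(2) Gamma0_psim[OF assms(1)] Vset_siegel]
      siegel_pt_act[OF assms(1) act_siegel[OF assms(2) Vset_siegel]])

definition graph_piece :: "nat \<Rightarrow> nat \<Rightarrow> rmat6 \<Rightarrow> (cmat3 set \<times> cmat3 set) set" where
  "graph_piece N \<Delta> M = (\<lambda>Z. (siegel_pt N Z, siegel_pt N (siegel_act M Z))) ` Vset \<Delta>"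

lemma graph_piece_Gamma0:
  assumes "\<gamma> \<in> Gamma0 N" "psim c M" shows "graph_piece N \<Delta> (\<gamma> ** M) = graph_piece N \<Delta> M"
  unfolding graph_piece_def
  by (rule image_cong[OF refl])
    (simp add: act_mult[OF assms(2) Gamma0_psim[OF assms(1)] Vset_siegel]
      siegel_pt_act[OF assms(1) act_siegel[OF assms(2) Vset_siegel]])

lemma snd_graph_piece: "snd ` graph_piece N \<Delta> M = full_piece N \<Delta> M"
  by (simp add: graph_piece_def full_piece_image image_image)

lemma hecke_T_pt:
  assumes p: "p > 0" and Z: "Z \<in> siegel_space"
  shows "hecke_T N p (siegel_pt N Z) = (\<lambda>M. siegel_pt N (siegel_act M Z)) ` hecke_matrices N p"
proof (intro equalityI subsetI)
  fix u assume "u \<in> hecke_T N p (siegel_pt N Z)"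
  then obtain M W where M: "M \<in> hecke_matrices N p" "W \<in> siegel_space" "siegel_pt N Z = siegel_pt N W"
    "u = siegel_pt N (siegel_act M W)" by (auto simp: hecke_T_def)
  obtain \<gamma> where g: "\<gamma> \<in> Gamma0 N" "W = siegel_act \<gamma> Z" using M siegel_pt_eq[OF Z M(2)] by blast
  have "u = siegel_pt N (siegel_act (M ** \<gamma>) Z)"
    using act_mult[OF Gamma0_psim[OF g(1)] hecke_facts(2)[OF p M(1)] Z] by (simp add: M(4) g(2))
  then show "u \<in> (\<lambda>M. siegel_pt N (siegel_act M Z)) ` hecke_matrices N p"
    using hecke_Gamma0(2)[OF M(1) g(1)] by blast
next
  fix u assume "u \<in> (\<lambda>M. siegel_pt N (siegel_act M Z)) ` hecke_matrices N p"
  then show "u \<in> hecke_T N p (siegel_pt N Z)" using Z by (auto simp: hecke_T_def)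
qed

lemma shimura_V_eq: "\<Delta> > 0 \<Longrightarrow> shimura_V N \<Delta> = siegel_pt N ` Vset \<Delta>"
  by (simp add: shimura_V_def hV_eq)

lemma hecke_image_pieces:
  assumes "\<Delta> > 0" "p > 0"
  shows "hecke_image_V N \<Delta> p = (\<Union>M\<in>hecke_matrices N p. full_piece N \<Delta> M)"
  unfolding hecke_image_V_def shimura_V_eq[OF assms(1)] full_piece_image
  by (auto simp: hecke_T_pt[OF assms(2) Vset_siegel])

lemma hecke_graph_pieces:
  assumes "\<Delta> > 0" "p > 0"
  shows "hecke_graph_V N \<Delta> p = (\<Union>M\<in>hecke_matrices N p. graph_piece N \<Delta> M)"
  unfolding hecke_graph_V_def shimura_V_eq[OF assms(1)] graph_piece_def
  by (auto simp: hecke_T_pt[OF assms(2) Vset_siegel]) blast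

text \<open>
  As for \<open>piece_analytic\<close>, with one group element for each factor.
\<close>
lemma graph_piece_analytic:
  assumes D: "\<Delta> > 0" and M: "M \<in> int_sim m" "psim c M"
  shows "analytic_XX N (graph_piece N \<Delta> M)"
proof -
  define P where "P = (\<lambda>(\<gamma>, \<gamma>'). (\<gamma> ** Jm \<Delta> ** adj \<gamma>, \<gamma>' ** M ** adj \<gamma>)) ` (Gamma0 N \<times> Gamma0 N)"
  define K where "K = max (1 * real \<Delta> * 1) (1 * m * 1)"
  have P: "P \<subseteq> int_sim K \<times> int_sim K"
  proof
    fix q assume "q \<in> P"
    then obtain \<gamma> \<gamma>' where g: "\<gamma> \<in> Gamma0 N" "\<gamma>' \<in> Gamma0 N" "q = (\<gamma> ** Jm \<Delta> ** adj \<gamma>, \<gamma>' ** M ** adj \<gamma>)"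
      by (auto simp: P_def)
    have "\<gamma> ** Jm \<Delta> ** adj \<gamma> \<in> int_sim (1 * real \<Delta> * 1)" "\<gamma>' ** M ** adj \<gamma> \<in> int_sim (1 * m * 1)"
      using g M by (intro int_sim_mult int_sim_adj int_sim_Jm[OF D] int_sim_Gamma0[of _ N]; simp)+
    then have "\<gamma> ** Jm \<Delta> ** adj \<gamma> \<in> int_sim K" "\<gamma>' ** M ** adj \<gamma> \<in> int_sim K"
      unfolding K_def by (auto elim: int_sim_mono[rotated])
    then show "q \<in> int_sim K \<times> int_sim K" by (simp add: g)
  qed
  have e: "{(Z, Z'). Z \<in> siegel_space \<and> Z' \<in> siegel_space \<and> (siegel_pt N Z, siegel_pt N Z') \<in> graph_piece N \<Delta> M}
     = (\<Union>q\<in>P. graph_set q)"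
  proof (intro equalityI subsetI)
    fix q assume "q \<in> {(Z, Z'). Z \<in> siegel_space \<and> Z' \<in> siegel_space \<and> (siegel_pt N Z, siegel_pt N Z') \<in> graph_piece N \<Delta> M}"
    then obtain Z Z' W where q: "q = (Z, Z')" and Z: "Z \<in> siegel_space" "Z' \<in> siegel_space" and W: "W \<in> Vset \<Delta>"
      and eq: "siegel_pt N W = siegel_pt N Z" "siegel_pt N (siegel_act M W) = siegel_pt N Z'"
      by (auto simp: graph_piece_def)
    note Ws = Vset_siegel[OF W]
    obtain \<gamma> where g: "\<gamma> \<in> Gamma0 N" "Z = siegel_act \<gamma> W" using siegel_pt_eq[OF Ws Z(1)] eq(1) by blast
    obtain \<gamma>' where g': "\<gamma>' \<in> Gamma0 N" "Z' = siegel_act \<gamma>' (siegel_act M W)"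
      using siegel_pt_eq[OF act_siegel[OF M(2) Ws] Z(2)] eq(2) by blast
    have "moves (\<gamma> ** Jm \<Delta> ** adj \<gamma>) Z Z"
      using fix_conj[OF Gamma0_psim[OF g(1)] Ws] W by (simp add: g(2) Vset_def)
    moreover have "moves (\<gamma>' ** M ** adj \<gamma>) Z Z'"
      using moves_comp(1)[OF moves_comp(1)[OF moves_adj[OF Gamma0_psim[OF g(1)] Ws] act_moves[OF M(2) Ws]]
        act_moves[OF Gamma0_psim[OF g'(1)] act_siegel[OF M(2) Ws]]] act_moves[OF Gamma0_psim[OF g(1)] Ws]
      by (simp add: g(2) g'(2) matrix_mul_assoc)
    ultimately have "q \<in> graph_set (\<gamma> ** Jm \<Delta> ** adj \<gamma>, \<gamma>' ** M ** adj \<gamma>)"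
      using Z by (simp add: graph_set_def q)
    then show "q \<in> (\<Union>q\<in>P. graph_set q)" using g(1) g'(1) unfolding P_def by blast
  next
    fix q assume "q \<in> (\<Union>q\<in>P. graph_set q)"
    then obtain \<gamma> \<gamma>' where g: "\<gamma> \<in> Gamma0 N" "\<gamma>' \<in> Gamma0 N" and q: "q \<in> graph_set (\<gamma> ** Jm \<Delta> ** adj \<gamma>, \<gamma>' ** M ** adj \<gamma>)"
      by (auto simp: P_def)
    define Z Z' where "Z = fst q" and "Z' = snd q"
    have Z: "Z \<in> siegel_space" "Z' \<in> siegel_space" "moves (\<gamma> ** Jm \<Delta> ** adj \<gamma>) Z Z" "moves (\<gamma>' ** M ** adj \<gamma>) Z Z'"
      using q by (auto simp: graph_set_def Z_def Z'_def)
    note pg = Gamma0_psim[OF g(1)] and pg' = Gamma0_psim[OF g(2)]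
    define W where "W = siegel_act (adj \<gamma>) Z"
    have Ws: "W \<in> siegel_space" using act_siegel[of 1 "adj \<gamma>" Z] pg Z(1) by (simp add: W_def)
    have Zg: "Z = siegel_act \<gamma> W" using act_adj(2)[OF pg Z(1)] by (simp add: W_def)
    have WV: "W \<in> Vset \<Delta>" using Z(3) fix_conj[OF pg Ws, of "Jm \<Delta>"] Ws by (simp add: Zg[symmetric] Vset_def)
    have "moves (\<gamma>' ** M) W Z'"
    proof -
      have "moves ((\<gamma>' ** M ** adj \<gamma>) ** \<gamma>) W Z'"
        using moves_comp(1)[OF act_moves[OF pg Ws]] Z(4) by (simp add: Zg)
      then show ?thesis by (simp add: matrix_mul_assoc[symmetric] psim_left[OF pg])
    qed
    then have "Z' = siegel_act (\<gamma>' ** M) W"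
      using moves_iff_act[OF psim_mult[OF pg' M(2)] Ws] by simp
    then have "Z' = siegel_act \<gamma>' (siegel_act M W)" using act_mult[OF M(2) pg' Ws] by simp
    then have "siegel_pt N Z' = siegel_pt N (siegel_act M W)"
      using siegel_pt_act[OF g(2) act_siegel[OF M(2) Ws]] by simp
    moreover have "siegel_pt N Z = siegel_pt N W" using siegel_pt_act[OF g(1) Ws] by (simp add: Zg)
    ultimately have "(siegel_pt N Z, siegel_pt N Z') \<in> graph_piece N \<Delta> M"
      using WV unfolding graph_piece_def by simp
    then show "q \<in> {(Z, Z'). Z \<in> siegel_space \<and> Z' \<in> siegel_space \<and> (siegel_pt N Z, siegel_pt N Z') \<in> graph_piece N \<Delta> M}"
      using Z by (simp add: Z_def Z'_def case_prod_beta)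
  qed
  have "graph_piece N \<Delta> M \<subseteq> siegel_var N \<times> siegel_var N"
    using act_siegel[OF M(2) Vset_siegel] Vset_siegel by (auto simp: graph_piece_def siegel_var_def)
  moreover have "analytic_subset (siegel_space \<times> siegel_space) (\<Union>q\<in>P. graph_set q)"
    by (rule analytic_UN_locally_finite[OF graph_set_locally_finite[OF P] graph_set_analytic])
  ultimately show ?thesis unfolding analytic_XX_def e by blast
qed

lemma graph_piece_irreducible:
  assumes D: "\<Delta> > 0" and M: "M \<in> int_sim m" "psim c M"
  shows "irreducible_set (analytic_XX N) (graph_piece N \<Delta> M)"
  unfolding irreducible_set_def
proof (intro conjI allI impI)
  show "analytic_XX N (graph_piece N \<Delta> M)" by (rule graph_piece_analytic[OF D M])
  show "graph_piece N \<Delta> M \<noteq> {}" using Vset_nonempty[OF D] by (simp add: graph_piece_def)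
  fix A B assume A: "analytic_XX N A" "analytic_XX N B" and e: "graph_piece N \<Delta> M = A \<union> B"
  define h where "h S = {(Z, Z'). Z \<in> siegel_space \<and> Z' \<in> siegel_space \<and> (siegel_pt N Z, siegel_pt N Z') \<in> S}" for S
  let ?\<phi> = "\<lambda>z. (vphi \<Delta> z, siegel_act M (vphi \<Delta> z))"
  have "\<exists>S\<in>{A, B}. ?\<phi> ` B2 \<subseteq> h S"
  proof (rule analytic_disc_finite[OF vphi_disc(2)[OF D M(2)]])
    show "analytic_subset (siegel_space \<times> siegel_space) (h S)" if "S \<in> {A, B}" for S
      using that A by (auto simp: analytic_XX_def h_def)
    show "?\<phi> ` B2 \<subseteq> (\<Union>S\<in>{A, B}. h S)"
    proof
      fix q assume "q \<in> ?\<phi> ` B2"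
      then obtain z where z: "z \<in> B2" "q = ?\<phi> z" by blast
      have v: "vphi \<Delta> z \<in> Vset \<Delta>" using z by (simp only: Vset_vphi[OF D] imageI)
      have "(siegel_pt N (vphi \<Delta> z), siegel_pt N (siegel_act M (vphi \<Delta> z))) \<in> A \<union> B"
        unfolding e[symmetric] graph_piece_def using v by blast
      then show "q \<in> (\<Union>S\<in>{A, B}. h S)"
        using Vset_siegel[OF v] act_siegel[OF M(2) Vset_siegel[OF v]] by (auto simp: h_def z(2))
    qed
  qed auto
  then have "graph_piece N \<Delta> M \<subseteq> A \<or> graph_piece N \<Delta> M \<subseteq> B"
    unfolding graph_piece_def Vset_vphi[OF D] by (auto simp: h_def)
  then show "graph_piece N \<Delta> M = A \<or> graph_piece N \<Delta> M = B" using e by blast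
qed

text \<open>
  As for \<open>full_piece_sub\<close>: one pair of group elements works for all points of the ball.
\<close>
lemma graph_piece_sub:
  assumes D: "\<Delta> > 0" and M: "M \<in> int_sim m" "psim c M" and M': "M' \<in> int_sim m'" "psim c' M'"
    and sub: "graph_piece N \<Delta> M \<subseteq> graph_piece N \<Delta> M'"
  shows "graph_piece N \<Delta> M' = graph_piece N \<Delta> M"
proof -
  define P where "P = (\<lambda>(\<gamma>, \<gamma>'). (\<gamma> ** Jm \<Delta> ** adj \<gamma>, adj M ** \<gamma>' ** M' ** adj \<gamma>)) ` (Gamma0 N \<times> Gamma0 N)"
  define K where "K = max (1 * real \<Delta> * 1) (m * 1 * m' * 1)"
  have P: "P \<subseteq> int_sim K \<times> int_sim K"
  proof
    fix q assume "q \<in> P"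
    then obtain \<gamma> \<gamma>' where g: "\<gamma> \<in> Gamma0 N" "\<gamma>' \<in> Gamma0 N" "q = (\<gamma> ** Jm \<Delta> ** adj \<gamma>, adj M ** \<gamma>' ** M' ** adj \<gamma>)"
      by (auto simp: P_def)
    have "\<gamma> ** Jm \<Delta> ** adj \<gamma> \<in> int_sim (1 * real \<Delta> * 1)" "adj M ** \<gamma>' ** M' ** adj \<gamma> \<in> int_sim (m * 1 * m' * 1)"
      using g M M' by (intro int_sim_mult int_sim_adj int_sim_Jm[OF D] int_sim_Gamma0[of _ N]; simp)+
    then have "\<gamma> ** Jm \<Delta> ** adj \<gamma> \<in> int_sim K" "adj M ** \<gamma>' ** M' ** adj \<gamma> \<in> int_sim K"
      unfolding K_def by (auto elim: int_sim_mono[rotated])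
    then show "q \<in> int_sim K \<times> int_sim K" by (simp add: g)
  qed
  have "Vset \<Delta> \<subseteq> {} \<union> (\<Union>q\<in>P. fix_set q)"
  proof
    fix Z assume Z: "Z \<in> Vset \<Delta>"
    note Zs = Vset_siegel[OF Z]
    obtain W where W: "W \<in> Vset \<Delta>" "siegel_pt N W = siegel_pt N Z"
        "siegel_pt N (siegel_act M' W) = siegel_pt N (siegel_act M Z)"
      using sub Z unfolding graph_piece_def by (auto simp: image_subset_iff image_iff)
    note Ws = Vset_siegel[OF W(1)]
    obtain \<gamma> where g: "\<gamma> \<in> Gamma0 N" "Z = siegel_act \<gamma> W" using siegel_pt_eq[OF Ws Zs] W(2) by blast
    obtain \<gamma>' where g': "\<gamma>' \<in> Gamma0 N" "siegel_act M Z = siegel_act \<gamma>' (siegel_act M' W)"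
      using siegel_pt_eq[OF act_siegel[OF M'(2) Ws] act_siegel[OF M(2) Zs]] W(3) by blast
    have "moves (\<gamma> ** Jm \<Delta> ** adj \<gamma>) Z Z"
      using fix_conj[OF Gamma0_psim[OF g(1)] Ws] W(1) by (simp add: g(2) Vset_def)
    moreover have "moves (adj M ** (\<gamma>' ** (M' ** adj \<gamma>))) Z Z"
    proof (rule moves_comp(1), rule moves_comp(1), rule moves_comp(1))
      show "moves (adj \<gamma>) Z W" using moves_adj[OF Gamma0_psim[OF g(1)] Ws] act_moves[OF Gamma0_psim[OF g(1)] Ws] g(2) by simp
      show "moves M' W (siegel_act M' W)" by (rule act_moves[OF M'(2) Ws])
      show "moves \<gamma>' (siegel_act M' W) (siegel_act M Z)"
        unfolding g'(2) by (rule act_moves[OF Gamma0_psim[OF g'(1)] act_siegel[OF M'(2) Ws]])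
      show "moves (adj M) (siegel_act M Z) Z" by (rule moves_adj[OF M(2) Zs act_moves[OF M(2) Zs]])
    qed
    ultimately have "Z \<in> fix_set (\<gamma> ** Jm \<Delta> ** adj \<gamma>, adj M ** \<gamma>' ** M' ** adj \<gamma>)"
      using Zs by (simp add: fix_set_def matrix_mul_assoc)
    then show "Z \<in> {} \<union> (\<Union>q\<in>P. fix_set q)" using g(1) g'(1) unfolding P_def by blast
  qed
  from Vset_cover[OF D analytic_empty P this] Vset_nonempty[OF D]
  obtain q where q: "q \<in> P" "Vset \<Delta> \<subseteq> fix_set q" by blast
  from q(1) obtain \<gamma> \<gamma>' where g': "\<gamma> \<in> Gamma0 N" "\<gamma>' \<in> Gamma0 N" "q = (\<gamma> ** Jm \<Delta> ** adj \<gamma>, adj M ** \<gamma>' ** M' ** adj \<gamma>)"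
    by (auto simp: P_def)
  note g = g'(1,2) q(2)[unfolded g'(3)]
  note pg = Gamma0_psim[OF g(1)] and pg' = Gamma0_psim[OF g(2)]
  have com: "\<gamma> ** Jm \<Delta> = Jm \<Delta> ** \<gamma>" by (rule Vset_sub_fix_commutes[OF D pg g(3)])
  have "graph_piece N \<Delta> M' \<subseteq> graph_piece N \<Delta> M"
  proof
    fix q assume "q \<in> graph_piece N \<Delta> M'"
    then obtain W where W: "W \<in> Vset \<Delta>" "q = (siegel_pt N W, siegel_pt N (siegel_act M' W))" by (auto simp: graph_piece_def)
    note Ws = Vset_siegel[OF W(1)]
    define Z where "Z = siegel_act \<gamma> W"
    have Z: "Z \<in> Vset \<Delta>" using Vset_commute[OF pg com Ws] W(1) by (simp add: Z_def)
    note Zs = Vset_siegel[OF Z]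
    have "moves (adj M ** \<gamma>' ** M' ** adj \<gamma>) Z Z" using g(3) Z by (auto simp: fix_set_def)
    from moves_comp(1)[OF act_moves[OF pg Ws], folded Z_def, OF this]
    have "moves (adj M ** (\<gamma>' ** M')) W Z"
      by (simp add: matrix_mul_assoc[symmetric] psim_left[OF pg])
    from moves_comp(1)[OF this act_moves[OF M(2) Zs]]
    have "moves (c *\<^sub>R (\<gamma>' ** M')) W (siegel_act M Z)"
      by (simp add: matrix_mul_assoc psim_right[OF M(2)] mmult_simps)
    then have "moves (\<gamma>' ** M') W (siegel_act M Z)" using psim_pos[OF M(2)] by (simp add: moves_scaleR)
    then have "siegel_act M Z = siegel_act \<gamma>' (siegel_act M' W)"
      using moves_iff_act[OF psim_mult[OF pg' M'(2)] Ws] act_mult[OF M'(2) pg' Ws] by simp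
    then have "siegel_pt N (siegel_act M Z) = siegel_pt N (siegel_act M' W)"
      using siegel_pt_act[OF g(2) act_siegel[OF M'(2) Ws]] by simp
    moreover have "siegel_pt N Z = siegel_pt N W" using siegel_pt_act[OF g(1) Ws] by (simp add: Z_def)
    ultimately show "q \<in> graph_piece N \<Delta> M" using Z W(2) unfolding graph_piece_def by (metis (mono_tags, lifting) image_eqI)
  qed
  with sub show ?thesis by blast
qed

lemma hecke_image_components:
  assumes D: "\<Delta> > 0" and p: "p > 0" and N: "N > 0"
  shows "irreducible_component (analytic_X N) (hecke_image_V N \<Delta> p) Y \<longleftrightarrow>
    (\<exists>M\<in>hecke_matrices N p. Y = full_piece N \<Delta> M)"
proof -
  obtain R where R: "finite R" "R \<subseteq> hecke_matrices N p"
    "\<And>M. M \<in> hecke_matrices N p \<Longrightarrow> \<exists>M'\<in>R. \<exists>\<gamma>\<in>Gamma0 N. M = \<gamma> ** M'"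
    using hecke_finite_cosets[OF p N] by metis
  show ?thesis unfolding hecke_image_pieces[OF D p]
  proof (rule components_of_incomparable_pieces[OF analytic_X_closed R(1,2)])
    fix M assume M: "M \<in> hecke_matrices N p"
    then obtain M' \<gamma> where "M' \<in> R" "\<gamma> \<in> Gamma0 N" "M = \<gamma> ** M'" using R(3) by blast
    then show "\<exists>M'\<in>R. full_piece N \<Delta> M = full_piece N \<Delta> M'"
      using full_piece_Gamma0 hecke_facts(2)[OF p] R(2) by blast
    show "irreducible_set (analytic_X N) (full_piece N \<Delta> M)"
      by (rule full_piece_irreducible[OF D hecke_facts(3,2)[OF p M]])
    fix M' assume "M' \<in> hecke_matrices N p" "full_piece N \<Delta> M \<subseteq> full_piece N \<Delta> M'"
    then show "full_piece N \<Delta> M' = full_piece N \<Delta> M"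
      using full_piece_sub[OF D hecke_facts(3,2)[OF p M] hecke_facts(3,2)[OF p]] by metis
  qed
qed

lemma hecke_graph_components:
  assumes D: "\<Delta> > 0" and p: "p > 0" and N: "N > 0"
  shows "irreducible_component (analytic_XX N) (hecke_graph_V N \<Delta> p) G \<longleftrightarrow>
    (\<exists>M\<in>hecke_matrices N p. G = graph_piece N \<Delta> M)"
proof -
  obtain R where R: "finite R" "R \<subseteq> hecke_matrices N p"
    "\<And>M. M \<in> hecke_matrices N p \<Longrightarrow> \<exists>M'\<in>R. \<exists>\<gamma>\<in>Gamma0 N. M = \<gamma> ** M'"
    using hecke_finite_cosets[OF p N] by metis
  show ?thesis unfolding hecke_graph_pieces[OF D p]
  proof (rule components_of_incomparable_pieces[OF analytic_XX_closed R(1,2)])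
    fix M assume M: "M \<in> hecke_matrices N p"
    then obtain M' \<gamma> where "M' \<in> R" "\<gamma> \<in> Gamma0 N" "M = \<gamma> ** M'" using R(3) by blast
    then show "\<exists>M'\<in>R. graph_piece N \<Delta> M = graph_piece N \<Delta> M'"
      using graph_piece_Gamma0 hecke_facts(2)[OF p] R(2) by blast
    show "irreducible_set (analytic_XX N) (graph_piece N \<Delta> M)"
      by (rule graph_piece_irreducible[OF D hecke_facts(3,2)[OF p M]])
    fix M' assume "M' \<in> hecke_matrices N p" "graph_piece N \<Delta> M \<subseteq> graph_piece N \<Delta> M'"
    then show "graph_piece N \<Delta> M' = graph_piece N \<Delta> M"
      using graph_piece_sub[OF D hecke_facts(3,2)[OF p M] hecke_facts(3,2)[OF p]] by metis
  qed
qed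

section \<open>The Riemann form on integral row vectors\<close>

type_synonym rvec6 = "real^(3 + 3)"

definition ivec :: "rvec6 set" where "ivec = {r. \<forall>i. r $ i \<in> \<int>}"

text \<open>
  The Riemann form.
\<close>
definition om :: "rvec6 \<Rightarrow> rvec6 \<Rightarrow> real" where
  "om r s = (\<Sum>i\<in>UNIV. r $ Inl i * s $ Inr i - r $ Inr i * s $ Inl i)"

lemma om_arith: "om (r + r') s = om r s + om r' s" "om r (s + s') = om r s + om r s'"
  "om (r - r') s = om r s - om r' s" "om r (s - s') = om r s - om r s'"
  "om (a *\<^sub>R r) s = a * om r s" "om r (a *\<^sub>R s) = a * om r s"
  "om (- r) s = - om r s" "om r (- s) = - om r s" "om 0 s = 0" "om r 0 = 0"
  by (simp_all add: om_def sum.distrib sum_subtractf sum_distrib_left sum_negf algebra_simps)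

lemma om_sum: "om (\<Sum>i\<in>I. f i) s = (\<Sum>i\<in>I. om (f i) s)"
  by (induction I rule: infinite_finite_induct) (auto simp: om_arith)

lemma om_anti: "om s r = - om r s"
  by (simp add: om_def sum_negf[symmetric] algebra_simps)

lemma om_self [simp]: "om r r = 0"
  by (simp add: om_def mult.commute)

lemma om_ints: "r \<in> ivec \<Longrightarrow> s \<in> ivec \<Longrightarrow> om r s \<in> \<int>"
  unfolding om_def ivec_def by (auto intro!: Ints_sum Ints_diff Ints_mult)

lemma ivec_arith: "0 \<in> ivec" "r \<in> ivec \<Longrightarrow> s \<in> ivec \<Longrightarrow> r + s \<in> ivec" "r \<in> ivec \<Longrightarrow> s \<in> ivec \<Longrightarrow> r - s \<in> ivec"
  "r \<in> ivec \<Longrightarrow> - r \<in> ivec" "a \<in> \<int> \<Longrightarrow> r \<in> ivec \<Longrightarrow> a *\<^sub>R r \<in> ivec"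
  by (auto simp: ivec_def)

lemma ivec_sum: "(\<And>i. i \<in> I \<Longrightarrow> f i \<in> ivec) \<Longrightarrow> sum f I \<in> ivec"
  by (induction I rule: infinite_finite_induct) (auto intro: ivec_arith)

lemma vm_ivec: assumes "r \<in> ivec" "\<forall>i j. M $ i $ j \<in> \<int>" shows "r v* M \<in> ivec"
  using assms unfolding ivec_def vector_matrix_mult_def by (auto intro!: Ints_sum Ints_mult)

lemma vm_arith: "(r + s) v* M = r v* M + s v* (M::rmat6)" "(r - s) v* M = r v* M - s v* M" "(a *\<^sub>R r) v* M = a *\<^sub>R (r v* M)"
  "r v* (M + M') = r v* M + r v* M'" "r v* (a *\<^sub>R M) = a *\<^sub>R (r v* M)" "(- r) v* M = - (r v* M)"
  "r v* mat a = a *\<^sub>R r"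
  by (simp_all add: vector_matrix_mult_def vec_eq_iff sum.distrib sum_subtractf sum_distrib_left sum_negf algebra_simps
     mat_def if_distrib[of "\<lambda>x. _ * x"] cong: if_cong)

lemma vm_blocks: "(r v* M) $ Inl j = (\<Sum>i\<in>UNIV. blockA M $ i $ j * r $ Inl i) + (\<Sum>i\<in>UNIV. blockC M $ i $ j * r $ Inr i)"
   "(r v* M) $ Inr j = (\<Sum>i\<in>UNIV. blockB M $ i $ j * r $ Inl i) + (\<Sum>i\<in>UNIV. blockD M $ i $ j * r $ Inr i)"
  by (simp_all add: vector_matrix_mult_def sum_UNIV_sum blockA_def blockB_def blockC_def blockD_def mult.commute)

lemma om_form: "om r s = r \<bullet> (symp_form *v s)"
proof -
  have "(symp_form *v s) $ Inl i = s $ Inr i" "(symp_form *v s) $ Inr i = - s $ Inl i" for i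
    by (simp_all add: matrix_vector_mult_def sum_UNIV_sum symp_form_def mat_def sum_negf
        if_distrib[of "\<lambda>x. x * _"] if_distrib[of uminus] cong: if_cong)
  then show ?thesis by (simp add: om_def inner_vec_def sum_UNIV_sum sum_subtractf sum_negf)
qed

lemma om_adj: "om (r v* M) s = om r (s v* adj M)"
proof -
  have t: "transpose symp_form = - symp_form" by (rule blocks_eqI) simp_all
  have "symp_form ** transpose (adj M) = - (symp_form ** symp_form) ** M ** symp_form"
    by (simp add: adj_conv_form matrix_transpose_mul t mmult_simps matrix_mul_assoc)
  then have e: "symp_form ** transpose (adj M) = M ** symp_form" by (simp add: symp_form_square)
  have "om (r v* M) s = r \<bullet> ((M ** symp_form) *v s)"
    by (simp add: om_form dot_lmul_matrix matrix_vector_mul_assoc)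
  also have "\<dots> = r \<bullet> (symp_form *v (transpose (adj M) *v s))"
    unfolding e[symmetric] by (simp only: matrix_vector_mul_assoc)
  finally show ?thesis by (simp only: om_form transpose_matrix_vector)
qed

lemma om_psim: "psim c M \<Longrightarrow> om (r v* M) (s v* M) = c * om r s"
  by (simp add: om_adj vector_matrix_mul_assoc psim_right vm_arith om_arith)

lemma om_Jm: "om (r v* Jm \<Delta>) s = - om r (s v* Jm \<Delta>)"
proof -
  have "- Jm \<Delta> = (-1) *\<^sub>R Jm \<Delta>" by simp
  then show ?thesis by (simp only: om_adj adj_Jm vm_arith om_arith)
qed

lemma vm_Jm_Jm: "r v* Jm \<Delta> v* Jm \<Delta> = - (real \<Delta> *\<^sub>R r)"
proof -
  have "- (real \<Delta> *\<^sub>R mat 1) = ((- real \<Delta>) *\<^sub>R mat 1 :: rmat6)" by simp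
  then show ?thesis by (simp only: vector_matrix_mul_assoc Jm_square vm_arith) simp
qed

lemma Jm_ints: "\<forall>i j. Jm \<Delta> $ i $ j \<in> \<int>"
proof (intro allI)
  have "Emat $ i $ j \<in> \<int>" for i j by (simp add: Emat_def)
  then show "Jm \<Delta> $ i $ j \<in> \<int>" for i j by (cases i; cases j) (simp_all add: Jm_def)
qed

lemma vm_Jm_ivec: "r \<in> ivec \<Longrightarrow> r v* Jm \<Delta> \<in> ivec"
  by (rule vm_ivec[OF _ Jm_ints])

text \<open>
  For a Hecke matrix \<open>M\<close> this lattice contains \<open>p\<close> times the integral vectors, and its quotient by them
  is the subspace \<open>W\<close> of the \<open>p\<close>-torsion (\<open>hecke_kernel_perm\<close>).
\<close>
definition lat :: "rmat6 \<Rightarrow> rvec6 set" where "lat M = (\<lambda>r. r v* M) ` ivec"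

lemma lat_arith: "0 \<in> lat M" "r \<in> lat M \<Longrightarrow> s \<in> lat M \<Longrightarrow> r + s \<in> lat M" "r \<in> lat M \<Longrightarrow> s \<in> lat M \<Longrightarrow> r - s \<in> lat M"
  "r \<in> lat M \<Longrightarrow> - r \<in> lat M" "a \<in> \<int> \<Longrightarrow> r \<in> lat M \<Longrightarrow> a *\<^sub>R r \<in> lat M"
proof -
  show "0 \<in> lat M" unfolding lat_def by (rule image_eqI[of _ _ 0]) (simp_all add: ivec_arith)
  show "r \<in> lat M \<Longrightarrow> s \<in> lat M \<Longrightarrow> r + s \<in> lat M" unfolding lat_def
    by (auto simp: vm_arith(1-3,6)[symmetric] intro!: imageI ivec_arith)
  show "r \<in> lat M \<Longrightarrow> s \<in> lat M \<Longrightarrow> r - s \<in> lat M" unfolding lat_def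
    by (auto simp: vm_arith(1-3,6)[symmetric] intro!: imageI ivec_arith)
  show "r \<in> lat M \<Longrightarrow> - r \<in> lat M" unfolding lat_def
    by (auto simp: vm_arith(1-3,6)[symmetric] intro!: imageI ivec_arith)
  show "a \<in> \<int> \<Longrightarrow> r \<in> lat M \<Longrightarrow> a *\<^sub>R r \<in> lat M" unfolding lat_def
    by (auto simp: vm_arith(1-3,6)[symmetric] intro!: imageI ivec_arith)
qed

lemma lat_ivec: "\<forall>i j. M $ i $ j \<in> \<int> \<Longrightarrow> lat M \<subseteq> ivec"
  by (auto simp: lat_def vm_ivec)

lemma lat_mult_ivec: assumes "psim c M" "\<forall>i j. M $ i $ j \<in> \<int>" "r \<in> ivec" shows "c *\<^sub>R r \<in> lat M"
proof -
  have "(r v* adj M) v* M = c *\<^sub>R r" by (simp add: vector_matrix_mul_assoc psim_left[OF assms(1)] vm_arith)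
  moreover have "r v* adj M \<in> ivec" by (rule vm_ivec[OF assms(3)]) (use adj_ints[OF assms(2)] in blast)
  ultimately show ?thesis unfolding lat_def by (metis image_eqI)
qed

text \<open>
  Up to scaling, the lattice of a similitude is its own dual.
\<close>
lemma lat_selfdual:
  assumes M: "psim c M" and y: "\<And>r. r \<in> ivec \<Longrightarrow> \<exists>k\<in>\<int>. om (r v* M) y = c * k"
  shows "y \<in> lat M"
proof -
  have c: "c \<noteq> 0" using psim_pos[OF M] by simp
  define z where "z = (1 / c) *\<^sub>R (y v* adj M)"
  have om_axis: "om (axis (Inl i) 1) s = s $ Inr i" "om (axis (Inr i) 1) s = - s $ Inl i" for i s
    by (simp_all add: om_def axis_def sum_subtractf if_distrib[of "\<lambda>x. x * _"] sum_negf cong: if_cong)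
  have "z \<in> ivec" unfolding ivec_def
  proof (intro CollectI allI)
    fix i
    have a: "axis j 1 \<in> ivec" for j :: "3 + 3" by (simp add: ivec_def axis_def)
    obtain i' :: 3 where i': "i = Inl i' \<or> i = Inr i'" by (cases i) auto
    obtain k l where kl: "k \<in> \<int>" "l \<in> \<int>" "om (axis (Inl i') 1 v* M) y = c * k" "om (axis (Inr i') 1 v* M) y = c * l"
      using y[OF a] by metis
    then have "(y v* adj M) $ Inr i' = c * k" "(y v* adj M) $ Inl i' = c * (- l)"
      unfolding om_adj om_axis by auto
    then show "z $ i \<in> \<int>" using i' kl c by (auto simp: z_def)
  qed
  moreover have "z v* M = y"
    using c by (simp add: z_def vm_arith vector_matrix_mul_assoc psim_left[OF M])
  ultimately show ?thesis unfolding lat_def by (metis image_eqI)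
qed

lemma om_lat: assumes "psim c M" "r \<in> lat M" "s \<in> lat M" shows "\<exists>k\<in>\<int>. om r s = c * k"
  using assms om_ints by (auto simp: lat_def om_psim)

section \<open>Period lattices and kernels\<close>

definition cvec :: "rvec6 \<Rightarrow> complex^(3+3)" where "cvec r = (\<chi> i. complex_of_real (r $ i))"

text \<open>
  The isomorphism of real row vectors with complex 3-space.  It maps integral vectors to the period
  lattice (\<open>period_lattice_perm\<close>), and the transposed automorphy factor of \<open>M\<close> corresponds to right
  multiplication by \<open>M\<close> (\<open>perm_moves\<close>).
\<close>
definition perm :: "cmat3 \<Rightarrow> rvec6 \<Rightarrow> complex^3" where "perm Z r = transpose (colm Z) *v cvec r"

lemma perm_nth: "perm Z r $ j = (\<Sum>i\<in>UNIV. Z $ i $ j * complex_of_real (r $ Inl i)) + complex_of_real (r $ Inr j)"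
  by (simp add: perm_def matrix_vector_mult_def transpose_def vector_matrix_mult_def sum_UNIV_sum colm_def cvec_def mat_def
      if_distrib[of "\<lambda>x. x * _"] if_distrib[of "\<lambda>x. _ * x"] mult.commute cong: if_cong)

lemma perm_arith: "perm Z (r + s) = perm Z r + perm Z s" "perm Z (r - s) = perm Z r - perm Z s"
  "perm Z (a *\<^sub>R r) = of_real a *s perm Z r" "perm Z 0 = 0"
  by (simp_all add: vec_eq_iff perm_nth sum.distrib sum_subtractf sum_distrib_left algebra_simps)

lemma perm_sum: "perm Z (\<Sum>i\<in>I. f i) = (\<Sum>i\<in>I. perm Z (f i))"
  by (induction I rule: infinite_finite_induct) (auto simp: perm_arith)

text \<open>
  For real vectors \<open>a\<close>, \<open>b\<close> with \<open>Z a + b = 0\<close> the value \<open>hpos Z a\<close> is zero.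
\<close>
lemma perm_inj: assumes "Z \<in> siegel_space" "perm Z r = perm Z s" shows "r = s"
proof -
  define t where "t = r - s"
  have t0: "perm Z t = 0" using assms(2) by (simp add: t_def perm_arith)
  have sy: "Z $ i $ j = Z $ j $ i" for i j using assms(1) by (intro transpose_sym) (simp add: siegel_iff)
  define a where "a = (\<chi> i. complex_of_real (t $ Inl i))"
  have Za: "(Z *v a) $ j = - complex_of_real (t $ Inr j)" for j
  proof -
    have "(Z *v a) $ j = perm Z t $ j - complex_of_real (t $ Inr j)"
      by (simp add: perm_nth matrix_vector_mult_def a_def sy[of j])
    then show ?thesis by (simp add: t0)
  qed
  have "hpos Z a = 0" unfolding hpos_def cdot_def Za by (simp add: a_def)
  then have "a = 0" using assms(1) unfolding siegel_iff by force
  then have l: "t $ Inl i = 0" for i by (metis a_def of_real_eq_0_iff vec_lambda_beta zero_index)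
  have "t $ Inr i = 0" for i using Za[of i] \<open>a = 0\<close> by simp
  then have "t = 0" using l by (simp add: vec_eq_iff sum_type_all)
  then show ?thesis by (simp add: t_def)
qed

lemma period_lattice_perm: assumes "Z \<in> siegel_space" shows "period_lattice Z = perm Z ` ivec"
proof -
  have sy: "Z $ i $ j = Z $ j $ i" for i j using assms by (intro transpose_sym) (simp add: siegel_iff)
  have e: "Z *v (\<chi> i. of_int (m $ i)) + (\<chi> i. of_int (n $ i)) =
     perm Z (\<chi> k. case k of Inl i \<Rightarrow> of_int (m $ i) | Inr i \<Rightarrow> of_int (n $ i))" for m n :: "int^3"
    by (simp add: vec_eq_iff perm_nth matrix_vector_mult_def) (intro allI sum.cong refl, simp add: sy)
  show ?thesis
  proof (intro equalityI subsetI)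
    fix x assume "x \<in> period_lattice Z"
    then obtain m n :: "int^3" where "x = Z *v (\<chi> i. of_int (m $ i)) + (\<chi> i. of_int (n $ i))"
      by (auto simp: period_lattice_def)
    then show "x \<in> perm Z ` ivec" unfolding e by (auto simp: ivec_def sum_type_all intro!: imageI)
  next
    fix x assume "x \<in> perm Z ` ivec"
    then obtain r where r: "r \<in> ivec" "x = perm Z r" by blast
    define m n where "m = (\<chi> i. \<lfloor>r $ Inl i\<rfloor>)" and "n = (\<chi> i. \<lfloor>r $ Inr i\<rfloor>)"
    have re: "r = (\<chi> k. case k of Inl i \<Rightarrow> of_int (m $ i) | Inr i \<Rightarrow> of_int (n $ i))"
      using r(1) by (simp add: vec_eq_iff ivec_def sum_type_all m_def n_def)
    have "x = Z *v (\<chi> i. of_int (m $ i)) + (\<chi> i. of_int (n $ i))"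
      unfolding e r(2) by (rule arg_cong[OF re])
    then show "x \<in> period_lattice Z" unfolding period_lattice_def by blast
  qed
qed

lemma perm_moves:
  assumes "moves M Z Z'" shows "transpose (aut_factor M Z) *v perm Z' r = perm Z (r v* M)"
proof -
  have "transpose (colm Z' ** aut_factor M Z) = transpose (cm M ** colm Z)"
    using assms by (simp add: moves_col)
  then have "transpose (aut_factor M Z) ** transpose (colm Z') = transpose (colm Z) ** cm (transpose M)"
    by (simp only: matrix_transpose_mul cm_arith)
  then have "transpose (aut_factor M Z) *v perm Z' r = transpose (colm Z) *v (cm (transpose M) *v cvec r)"
    unfolding perm_def by (simp only: matrix_vector_mul_assoc)
  also have "cm (transpose M) *v cvec r = cvec (r v* M)"
    by (simp add: vec_eq_iff cvec_def matrix_vector_mult_def vector_matrix_mult_def transpose_def mult.commute del: cm_arith)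
  finally show ?thesis by (simp only: perm_def)
qed

lemma hecke_kernel_perm:
  assumes M: "psim (real p) M" and Z: "Z \<in> siegel_space" and p: "p > 0"
  shows "hecke_kernel p M Z = perm Z ` {(1 / real p) *\<^sub>R l |l. l \<in> lat M}"
proof -
  define Q where "Q = transpose (aut_factor M Z)"
  define Z' where "Z' = siegel_act M Z"
  have Z': "Z' \<in> siegel_space" using act_siegel[OF M Z] by (simp add: Z'_def)
  have "invertible Q" using aut_factor_invertible[OF M Z] unfolding Q_def invertible_det_nz by (simp add: det_transpose)
  note inv = matrix_inv_mult[OF this]
  have pm: "Q *v perm Z' r = perm Z (r v* M)" for r
    unfolding Q_def by (rule perm_moves) (use act_moves[OF M Z] in \<open>simp add: Z'_def\<close>)
  have sc: "A *v (c *s x) = c *s (A *v x)" for A :: cmat3 and c x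
    by (simp add: vec_eq_iff mv_sum algebra_simps)
  have "of_nat p *s (matrix_inv Q *v x) = perm Z' r \<longleftrightarrow> x = perm Z ((1 / real p) *\<^sub>R (r v* M))" for x r
  proof
    assume "of_nat p *s (matrix_inv Q *v x) = perm Z' r"
    then have "Q *v (of_nat p *s (matrix_inv Q *v x)) = perm Z (r v* M)" by (simp only: pm)
    then have "of_nat p *s x = perm Z (r v* M)" by (simp add: sc matrix_vector_mul_assoc inv)
    then show "x = perm Z ((1 / real p) *\<^sub>R (r v* M))" using p by (simp add: perm_arith vec_eq_iff field_simps)
  next
    assume x: "x = perm Z ((1 / real p) *\<^sub>R (r v* M))"
    have "x = of_real (1 / real p) *s (Q *v perm Z' r)" unfolding x perm_arith pm ..
    then have "matrix_inv Q *v x = of_real (1 / real p) *s perm Z' r"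
      by (simp add: sc matrix_vector_mul_assoc inv)
    then show "of_nat p *s (matrix_inv Q *v x) = perm Z' r" using p by (simp add: vec_eq_iff)
  qed
  then show ?thesis
    unfolding hecke_kernel_def Q_def[symmetric] Z'_def[symmetric] period_lattice_perm[OF Z'] lat_def by blast
qed

definition lat_span :: "nat \<Rightarrow> rmat6 \<Rightarrow> rvec6 set" where
  "lat_span \<Delta> M = {l + l' v* Jm \<Delta> |l l'. l \<in> lat M \<and> l' \<in> lat M}"

lemma OK_span_perm:
  assumes D: "\<Delta> > 0" and M: "psim (real p) M" and Z: "Z \<in> Vset \<Delta>" and p: "p > 0"
  shows "OK_span \<Delta> Z (hecke_kernel p M Z) = perm Z ` {(1 / real p) *\<^sub>R v |v. v \<in> lat_span \<Delta> M}"
proof -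
  have J: "sqrt_neg_action \<Delta> Z (perm Z r) = perm Z (r v* Jm \<Delta>)" for r
    unfolding sqrt_neg_action_def alpha_sqrt_neg[OF D] by (rule perm_moves) (use Z in \<open>simp add: Vset_def\<close>)
  have e: "perm Z ((1 / real p) *\<^sub>R l) + sqrt_neg_action \<Delta> Z (perm Z ((1 / real p) *\<^sub>R l')) =
     perm Z ((1 / real p) *\<^sub>R (l + l' v* Jm \<Delta>))" for l l'
    unfolding J by (simp only: perm_arith vm_arith scaleR_add_right)
  show ?thesis
    unfolding OK_span_def hecke_kernel_perm[OF M Vset_siegel[OF Z] p] lat_span_def
    by (auto simp: e intro!: imageI) (metis (mono_tags, lifting) e image_eqI mem_Collect_eq)+
qed

section \<open>Stable vectors in the kernel of a bad isogeny\<close>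

text \<open>
  There are more vectors \<open>y\<close> modulo \<open>p\<close> than values, so two of them have the same value, and their
  difference is a solution.
\<close>
lemma small_system_solution:
  fixes c :: "'i \<Rightarrow> 'k \<Rightarrow> int" and p :: nat
  assumes "finite I" "finite K" "card K < card I" "p > 1"
  obtains y :: "'i \<Rightarrow> int" where "\<exists>i\<in>I. \<not> int p dvd y i" "\<And>k. k \<in> K \<Longrightarrow> int p dvd (\<Sum>i\<in>I. y i * c i k)"
proof -
  define A where "A = PiE I (\<lambda>_. {0..<int p})"
  define B where "B = PiE K (\<lambda>_. {0..<int p})"
  define f where "f y = (\<lambda>k\<in>K. (\<Sum>i\<in>I. y i * c i k) mod int p)" for y
  have "f ` A \<subseteq> B" using assms(4) by (auto simp: f_def B_def)
  moreover have "card B < card A" using assms by (simp add: A_def B_def card_PiE)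
  moreover have "finite B" using assms by (simp add: B_def finite_PiE)
  ultimately have "\<not> inj_on f A" using card_inj_on_le by (metis not_le)
  then obtain y z where yz: "y \<in> A" "z \<in> A" "f y = f z" "y \<noteq> z" unfolding inj_on_def by blast
  define d where "d i = y i - z i" for i
  obtain i where i: "i \<in> I" "y i \<noteq> z i" using yz PiE_ext unfolding A_def by metis
  have "y i \<in> {0..<int p}" "z i \<in> {0..<int p}" using yz(1,2) i(1) by (auto simp: A_def)
  then have "\<bar>d i\<bar> < int p" "d i \<noteq> 0" using i by (auto simp: d_def)
  then have "\<not> int p dvd d i" using zdvd_not_zless[of "\<bar>d i\<bar>" "int p"] by auto
  moreover have "int p dvd (\<Sum>i\<in>I. d i * c i k)" if "k \<in> K" for k
  proof -
    have "(\<Sum>i\<in>I. y i * c i k) mod int p = (\<Sum>i\<in>I. z i * c i k) mod int p"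
      using fun_cong[OF yz(3), of k] that by (simp add: f_def)
    then show ?thesis by (simp add: mod_eq_dvd_iff d_def left_diff_distrib sum_subtractf)
  qed
  ultimately show ?thesis using that[of d] i(1) by blast
qed

lemma int_of_ivec: "r \<in> ivec \<Longrightarrow> of_int \<lfloor>r $ i\<rfloor> = r $ i"
  by (simp add: ivec_def)

definition torsion_gen :: "cmat3 \<Rightarrow> (complex^3) set \<Rightarrow> (complex^3) set \<Rightarrow> bool" where
  "torsion_gen Z W S \<longleftrightarrow> finite S \<and> W = {l + (\<Sum>s\<in>S. of_int (c s) *s s) |l (c :: complex^3 \<Rightarrow> int). l \<in> period_lattice Z}"

lemma torsion_dim_gen: "torsion_dim Z W = (LEAST n. \<exists>S. torsion_gen Z W S \<and> card S = n)"
  unfolding torsion_dim_def torsion_gen_def by (rule arg_cong[of _ _ Least]) auto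

text \<open>
  Generators modulo the period lattice lift to integral row vectors generating \<open>L\<close> modulo \<open>p\<close>.
\<close>
lemma torsion_gen_lift:
  assumes Z: "Z \<in> siegel_space" and W: "W = perm Z ` {(1 / real p) *\<^sub>R v |v. v \<in> L}" and L: "L \<subseteq> ivec"
    and S: "torsion_gen Z W S" and p: "p > 0"
  obtains \<sigma> where "\<And>s. s \<in> S \<Longrightarrow> \<sigma> s \<in> ivec"
    "\<And>v. v \<in> L \<Longrightarrow> \<exists>k\<in>ivec. \<exists>c :: complex^3 \<Rightarrow> int. v = real p *\<^sub>R k + (\<Sum>s\<in>S. of_int (c s) *\<^sub>R \<sigma> s)"
proof -
  have fS: "finite S" and WS: "W = {l + (\<Sum>s\<in>S. of_int (c s) *s s) |l (c :: complex^3 \<Rightarrow> int). l \<in> period_lattice Z}"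
    using S by (auto simp: torsion_gen_def)
  note pl = period_lattice_perm[OF Z]
  have "s \<in> W" if s: "s \<in> S" for s
  proof -
    have "s = 0 + (\<Sum>t\<in>S. of_int (if t = s then 1 else 0) *s t)"
      using s fS by (simp add: if_distrib[of of_int] if_distrib[of "\<lambda>x. x *s _"] cong: if_cong)
    moreover have "0 \<in> period_lattice Z" unfolding pl by (rule image_eqI[of _ _ 0]) (simp_all add: perm_arith ivec_arith)
    ultimately show ?thesis unfolding WS
      by (intro CollectI exI[of _ 0] exI[of _ "\<lambda>t. if t = s then 1 else 0"] conjI)
  qed
  then have "\<exists>v\<in>L. s = perm Z ((1 / real p) *\<^sub>R v)" if "s \<in> S" for s using that unfolding W by blast
  then obtain \<sigma> where \<sigma>: "\<And>s. s \<in> S \<Longrightarrow> \<sigma> s \<in> L \<and> s = perm Z ((1 / real p) *\<^sub>R \<sigma> s)" by metis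
  show ?thesis
  proof (rule that[of \<sigma>])
    show "\<sigma> s \<in> ivec" if "s \<in> S" for s using \<sigma>[OF that] L by blast
    fix v assume "v \<in> L"
    then have "perm Z ((1 / real p) *\<^sub>R v) \<in> W" unfolding W by blast
    then obtain l and c :: "complex^3 \<Rightarrow> int" where lc: "l \<in> period_lattice Z" "perm Z ((1 / real p) *\<^sub>R v) = l + (\<Sum>s\<in>S. of_int (c s) *s s)"
      unfolding WS by blast
    obtain k where k: "k \<in> ivec" "l = perm Z k" using lc(1) unfolding pl by blast
    have "(\<Sum>s\<in>S. of_int (c s) *s s) = (\<Sum>s\<in>S. perm Z (of_int (c s) *\<^sub>R ((1 / real p) *\<^sub>R \<sigma> s)))"
    proof (rule sum.cong[OF refl])
      fix s assume "s \<in> S"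
      then have "s = perm Z ((1 / real p) *\<^sub>R \<sigma> s)" using \<sigma> by blast
      then show "of_int (c s) *s s = perm Z (of_int (c s) *\<^sub>R ((1 / real p) *\<^sub>R \<sigma> s))"
        by (metis perm_arith(3) of_real_of_int_eq)
    qed
    then have "perm Z ((1 / real p) *\<^sub>R v) = perm Z (k + (\<Sum>s\<in>S. of_int (c s) *\<^sub>R ((1 / real p) *\<^sub>R \<sigma> s)))"
      unfolding lc(2) k(2) by (simp only: perm_arith perm_sum)
    then have "(1 / real p) *\<^sub>R v = k + (\<Sum>s\<in>S. of_int (c s) *\<^sub>R ((1 / real p) *\<^sub>R \<sigma> s))"
      by (rule perm_inj[OF Z])
    then have "real p *\<^sub>R ((1 / real p) *\<^sub>R v) = real p *\<^sub>R k + (\<Sum>s\<in>S. real p *\<^sub>R (of_int (c s) *\<^sub>R ((1 / real p) *\<^sub>R \<sigma> s)))"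
      by (simp only: scaleR_add_right scaleR_sum_right)
    moreover have "real p *\<^sub>R (of_int (c s) *\<^sub>R ((1 / real p) *\<^sub>R \<sigma> s)) = of_int (c s) *\<^sub>R \<sigma> s" for s
      using p by simp
    moreover have "real p *\<^sub>R ((1 / real p) *\<^sub>R v) = v" using p by simp
    ultimately have "v = real p *\<^sub>R k + (\<Sum>s\<in>S. of_int (c s) *\<^sub>R \<sigma> s)" by (simp only:)
    with k(1) show "\<exists>k\<in>ivec. \<exists>c :: complex^3 \<Rightarrow> int. v = real p *\<^sub>R k + (\<Sum>s\<in>S. of_int (c s) *\<^sub>R \<sigma> s)" by blast
  qed
qed

text \<open>
  Ensures that the least number of generators is attained: the images of the finitely many vectors
  of \<open>L\<close> with entries bounded by \<open>p\<close> generate.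
\<close>
lemma torsion_gen_exists:
  assumes Z: "Z \<in> siegel_space" and W: "W = perm Z ` {(1 / real p) *\<^sub>R v |v. v \<in> L}" and L: "L \<subseteq> ivec"
    and p: "p > 0" and pL: "\<And>k. k \<in> ivec \<Longrightarrow> real p *\<^sub>R k \<in> L"
    and add: "\<And>u v. u \<in> L \<Longrightarrow> v \<in> L \<Longrightarrow> u + v \<in> L" "\<And>u a. u \<in> L \<Longrightarrow> a \<in> \<int> \<Longrightarrow> a *\<^sub>R u \<in> L"
  shows "\<exists>S. torsion_gen Z W S"
proof -
  note pl = period_lattice_perm[OF Z]
  define B where "B = {r::rvec6. \<forall>i. r $ i \<in> {k \<in> \<int>. \<bar>k\<bar> \<le> real p}}"
  have fB: "finite B" unfolding B_def by (rule finite_vec) (rule finite_abs_int_segment)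
  define S where "S = (\<lambda>v. perm Z ((1 / real p) *\<^sub>R v)) ` (B \<inter> L)"
  have fS: "finite S" using fB by (simp add: S_def)
  have "W = {l + (\<Sum>s\<in>S. of_int (c s) *s s) |l (c :: complex^3 \<Rightarrow> int). l \<in> period_lattice Z}" (is "W = ?R")
  proof (intro equalityI subsetI)
    fix w assume "w \<in> W"
    then obtain v where v: "v \<in> L" "w = perm Z ((1 / real p) *\<^sub>R v)" unfolding W by blast
    have vi: "v \<in> ivec" using v L by blast
    define k :: rvec6 where "k = (\<chi> i. of_int (\<lfloor>v $ i\<rfloor> div int p))"
    define u where "u = v - real p *\<^sub>R k"
    have ki: "k \<in> ivec" by (simp add: k_def ivec_def)
    have ui: "u $ i = of_int (\<lfloor>v $ i\<rfloor> mod int p)" for i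
    proof -
      have "u $ i = of_int \<lfloor>v $ i\<rfloor> - real p * of_int (\<lfloor>v $ i\<rfloor> div int p)"
        by (simp add: u_def k_def int_of_ivec[OF vi])
      also have "\<dots> = of_int (\<lfloor>v $ i\<rfloor> - int p * (\<lfloor>v $ i\<rfloor> div int p))" by simp
      finally show ?thesis by (simp only: minus_mult_div_eq_mod)
    qed
    have "real_of_int (x mod int p) \<le> real p" "0 \<le> real_of_int (x mod int p)" for x
    proof -
      have "x mod int p \<le> int p" "0 \<le> x mod int p" using p by (simp_all add: less_imp_le)
      then show "real_of_int (x mod int p) \<le> real p" "0 \<le> real_of_int (x mod int p)"
        by (metis of_int_le_iff of_int_of_nat_eq, metis of_int_0_le_iff)
    qed
    then have "u \<in> B" unfolding B_def by (simp add: ui)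
    moreover have "u \<in> L" unfolding u_def
      using add(1)[OF v(1), of "- (real p *\<^sub>R k)"] pL[of "- k"] ivec_arith(4)[OF ki] by simp
    ultimately have us: "perm Z ((1 / real p) *\<^sub>R u) \<in> S" by (simp add: S_def)
    have "w = perm Z k + perm Z ((1 / real p) *\<^sub>R u)"
      unfolding v(2) perm_arith(1)[symmetric] using p by (simp add: u_def scaleR_diff_right)
    also have "perm Z ((1 / real p) *\<^sub>R u) = (\<Sum>s\<in>S. of_int (if s = perm Z ((1 / real p) *\<^sub>R u) then 1 else 0) *s s)"
      using us fS by (simp add: if_distrib[of of_int] if_distrib[of "\<lambda>x. x *s _"] cong: if_cong)
    finally have "w = perm Z k + (\<Sum>s\<in>S. of_int (if s = perm Z ((1 / real p) *\<^sub>R u) then 1 else 0) *s s)" .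
    moreover have "perm Z k \<in> period_lattice Z" using ki pl by blast
    ultimately show "w \<in> ?R"
      by (intro CollectI exI[of _ "perm Z k"] exI[of _ "\<lambda>s. if s = perm Z ((1 / real p) *\<^sub>R u) then 1 else 0"] conjI)
  next
    fix w assume "w \<in> ?R"
    then obtain k and c :: "complex^3 \<Rightarrow> int" where w: "k \<in> ivec" "w = perm Z k + (\<Sum>s\<in>S. of_int (c s) *s s)"
      unfolding pl by blast
    have cl: "x + y \<in> W" if xy: "x \<in> W" "y \<in> W" for x y
    proof -
      obtain u v where "u \<in> L" "v \<in> L" "x = perm Z ((1 / real p) *\<^sub>R u)" "y = perm Z ((1 / real p) *\<^sub>R v)"
        using xy unfolding W by blast
      then show ?thesis unfolding W using add(1)[of u v]
        by (auto intro!: image_eqI[of _ _ "(1 / real p) *\<^sub>R (u + v)"] simp: perm_arith scaleR_add_right)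
    qed
    have sc: "of_int a *s x \<in> W" if x: "x \<in> W" for a x
    proof -
      obtain u where u: "u \<in> L" "x = perm Z ((1 / real p) *\<^sub>R u)" using x unfolding W by blast
      have "of_int a *s x = perm Z ((1 / real p) *\<^sub>R (of_int a *\<^sub>R u))"
        unfolding u(2) by (simp add: vec_eq_iff perm_arith)
      then show ?thesis unfolding W
        by (rule image_eqI) (use add(2)[OF u(1), of "of_int a"] in \<open>simp only: mem_Collect_eq, blast intro: Ints_of_int\<close>)
    qed
    have k: "perm Z k \<in> W" unfolding W
      using pL[OF w(1)] p by (intro image_eqI[of _ _ k] CollectI exI[of _ "real p *\<^sub>R k"] conjI) auto
    have SW: "S \<subseteq> W" unfolding S_def W by blast
    have "(\<Sum>s\<in>T. of_int (c s) *s s) \<in> W" if "finite T" "T \<subseteq> S" for T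
      using that
    proof (induction T)
      case empty
      have "0 = perm Z ((1 / real p) *\<^sub>R (real p *\<^sub>R 0))" by (simp add: perm_arith)
      then show ?case unfolding W using pL[OF ivec_arith(1)] by force
    next
      case (insert s T)
      then show ?case using SW by (auto intro!: cl sc)
    qed
    from cl[OF k this[OF fS]] show "w \<in> W" unfolding w(2) by simp
  qed
  then show ?thesis using fS unfolding torsion_gen_def by blast
qed

lemma lat_span_props:
  assumes M: "psim (real p) M" "\<forall>i j. M $ i $ j \<in> \<int>"
  shows "lat_span \<Delta> M \<subseteq> ivec" "k \<in> ivec \<Longrightarrow> real p *\<^sub>R k \<in> lat_span \<Delta> M"
    "u \<in> lat_span \<Delta> M \<Longrightarrow> v \<in> lat_span \<Delta> M \<Longrightarrow> u + v \<in> lat_span \<Delta> M"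
    "u \<in> lat_span \<Delta> M \<Longrightarrow> a \<in> \<int> \<Longrightarrow> a *\<^sub>R u \<in> lat_span \<Delta> M"
    "l \<in> lat M \<Longrightarrow> l \<in> lat_span \<Delta> M" "l \<in> lat M \<Longrightarrow> l v* Jm \<Delta> \<in> lat_span \<Delta> M"
proof -
  show "lat_span \<Delta> M \<subseteq> ivec"
    using lat_ivec[OF M(2)] by (auto simp: lat_span_def intro!: ivec_arith vm_Jm_ivec)
  have z: "0 v* Jm \<Delta> = 0" by simp
  show l: "l \<in> lat_span \<Delta> M" if "l \<in> lat M" for l
    unfolding lat_span_def using that lat_arith(1)[of M] z by (metis (mono_tags, lifting) add.right_neutral mem_Collect_eq)
  show "l v* Jm \<Delta> \<in> lat_span \<Delta> M" if "l \<in> lat M"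
    unfolding lat_span_def using that lat_arith(1)[of M] by (metis (mono_tags, lifting) add.left_neutral mem_Collect_eq)
  show "real p *\<^sub>R k \<in> lat_span \<Delta> M" if "k \<in> ivec" by (rule l[OF lat_mult_ivec[OF M that]])
  show "u + v \<in> lat_span \<Delta> M" if uv: "u \<in> lat_span \<Delta> M" "v \<in> lat_span \<Delta> M"
  proof -
    obtain a b c d where "a \<in> lat M" "b \<in> lat M" "c \<in> lat M" "d \<in> lat M" "u = a + b v* Jm \<Delta>" "v = c + d v* Jm \<Delta>"
      using uv unfolding lat_span_def by blast
    moreover from this have "u + v = (a + c) + (b + d) v* Jm \<Delta>" by (simp add: vm_arith)
    ultimately show ?thesis unfolding lat_span_def using lat_arith(2) by blast
  qed
  show "a *\<^sub>R u \<in> lat_span \<Delta> M" if uv: "u \<in> lat_span \<Delta> M" "a \<in> \<int>"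
  proof -
    obtain c d where "c \<in> lat M" "d \<in> lat M" "u = c + d v* Jm \<Delta>"
      using uv unfolding lat_span_def by blast
    moreover from this have "a *\<^sub>R u = (a *\<^sub>R c) + (a *\<^sub>R d) v* Jm \<Delta>" by (simp add: vm_arith scaleR_add_right)
    ultimately show ?thesis unfolding lat_span_def using lat_arith(5)[OF uv(2)] by blast
  qed
qed

text \<open>
  A nonzero vector of \<open>W\<close> whose image under \<open>sqrt(-\<Delta>)\<close> lies in \<open>W\<close> again.
\<close>
definition stable_vector :: "nat \<Rightarrow> nat \<Rightarrow> rmat6 \<Rightarrow> rvec6 \<Rightarrow> bool" where
  "stable_vector \<Delta> p M y \<longleftrightarrow> y \<in> ivec \<and> (1 / real p) *\<^sub>R y \<notin> ivec \<and> y \<in> lat M \<and> y v* Jm \<Delta> \<in> lat M"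

text \<open>
  As the span of \<open>W\<close> has four generators, some \<open>y\<close> that is nonzero modulo \<open>p\<close> is orthogonal to it
  modulo \<open>p\<close>.  The span contains \<open>lat M\<close> and \<open>(lat M) J\<close>; since \<open>lat M\<close> is its own dual up to scaling,
  \<open>y\<close> and \<open>y v* J\<close> lie in \<open>lat M\<close>.
\<close>
lemma bad_stable_vector:
  assumes D: "\<Delta> > 0" and p: "prime p" and M: "psim (real p) M" "\<forall>i j. M $ i $ j \<in> \<int>" and Z: "Z \<in> Vset \<Delta>"
    and dim: "torsion_dim Z (OK_span \<Delta> Z (hecke_kernel p M Z)) = 4"
  shows "\<exists>y. stable_vector \<Delta> p M y"
proof -
  have p1: "p > 1" and p0: "p > 0" using prime_gt_1_nat[OF p] by auto
  define W where "W = OK_span \<Delta> Z (hecke_kernel p M Z)"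
  define L where "L = lat_span \<Delta> M"
  note Zs = Vset_siegel[OF Z]
  have W: "W = perm Z ` {(1 / real p) *\<^sub>R v |v. v \<in> L}"
    unfolding W_def L_def by (rule OK_span_perm[OF D M(1) Z p0])
  have "\<exists>S. torsion_gen Z W S \<and> card S = 4"
  proof -
    obtain S0 where "torsion_gen Z W S0"
      using torsion_gen_exists[OF Zs W lat_span_props(1)[OF M, of \<Delta>, folded L_def] p0]
        lat_span_props(2-4)[OF M, of _ \<Delta>, folded L_def] by blast
    then have "\<exists>n S. torsion_gen Z W S \<and> card S = n" by blast
    from LeastI_ex[OF this] show ?thesis using dim unfolding W_def[symmetric] torsion_dim_gen by simp
  qed
  then obtain S where S: "torsion_gen Z W S" "card S = 4" by blast
  then have fS: "finite S" by (simp add: torsion_gen_def)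
  obtain \<sigma> where \<sigma>: "\<And>s. s \<in> S \<Longrightarrow> \<sigma> s \<in> ivec"
    "\<And>v. v \<in> L \<Longrightarrow> \<exists>k\<in>ivec. \<exists>c :: complex^3 \<Rightarrow> int. v = real p *\<^sub>R k + (\<Sum>s\<in>S. of_int (c s) *\<^sub>R \<sigma> s)"
    using torsion_gen_lift[OF Zs W lat_span_props(1)[OF M, of \<Delta>, folded L_def] S(1) p0] by blast
  define c where "c i s = \<lfloor>om (\<sigma> s) (axis i 1)\<rfloor>" for i :: "3 + 3" and s
  have ai: "axis i 1 \<in> ivec" for i by (simp add: ivec_def axis_def)
  have ci: "of_int (c i s) = om (\<sigma> s) (axis i 1)" if "s \<in> S" for i s
    using om_ints[OF \<sigma>(1)[OF that] ai] by (simp add: c_def)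
  have "card S < card (UNIV :: (3 + 3) set)" using S(2) by simp
  note cc = this
  have "\<exists>f. (\<exists>i. \<not> int p dvd f i) \<and> (\<forall>s\<in>S. int p dvd (\<Sum>i\<in>UNIV. f i * c i s))"
    by (rule small_system_solution[OF finite fS cc p1, of c]) blast
  then obtain f :: "3 + 3 \<Rightarrow> int"
    where f': "(\<exists>i. \<not> int p dvd f i) \<and> (\<forall>s\<in>S. int p dvd (\<Sum>i\<in>UNIV. f i * c i s))" by (rule exE)
  note f = conjunct1[OF f'] bspec[OF conjunct2[OF f']]
  define y :: rvec6 where "y = (\<chi> i. of_int (f i))"
  have yi: "y \<in> ivec" by (simp add: y_def ivec_def)
  have ys: "y = (\<Sum>i\<in>UNIV. of_int (f i) *\<^sub>R axis i 1)"
    by (simp add: vec_eq_iff y_def axis_def if_distrib[of "\<lambda>x. _ * x"] cong: if_cong)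
  have omy: "om (\<sigma> s) y = of_int (\<Sum>i\<in>UNIV. f i * c i s)" if "s \<in> S" for s
  proof -
    have "om (\<sigma> s) y = - om y (\<sigma> s)" by (rule om_anti)
    also have "\<dots> = (\<Sum>i\<in>UNIV. of_int (f i) * om (\<sigma> s) (axis i 1))"
      unfolding ys om_sum om_arith using om_anti[of "\<sigma> s"] by (simp add: sum_negf)
    finally show ?thesis by (simp add: ci[OF that])
  qed
  have key: "\<exists>k\<in>\<int>. om v y = real p * k" if vL: "v \<in> L" for v
  proof -
    obtain k and a :: "complex^3 \<Rightarrow> int" where k: "k \<in> ivec" "v = real p *\<^sub>R k + (\<Sum>s\<in>S. of_int (a s) *\<^sub>R \<sigma> s)"
      using \<sigma>(2)[OF vL] by blast
    have "\<exists>n::int. om (\<sigma> s) y = real p * of_int n" if s: "s \<in> S" for s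
    proof -
      obtain n where "(\<Sum>i\<in>UNIV. f i * c i s) = int p * n" using f(2)[OF s] by (auto simp: dvd_def)
      then have "om (\<sigma> s) y = real p * of_int n" unfolding omy[OF s] by simp
      then show ?thesis by blast
    qed
    then obtain n :: "complex^3 \<Rightarrow> int" where n: "\<And>s. s \<in> S \<Longrightarrow> om (\<sigma> s) y = real p * of_int (n s)" by metis
    have "om v y = real p * (om k y + (\<Sum>s\<in>S. of_int (a s) * of_int (n s)))"
      unfolding k(2) om_arith om_sum by (simp add: n sum_distrib_left algebra_simps)
    then show ?thesis using om_ints[OF k(1) yi] by (auto intro!: bexI Ints_add Ints_sum)
  qed
  have "y \<in> lat M"
  proof (rule lat_selfdual[OF M(1)])
    fix r assume "r \<in> ivec"
    then have "r v* M \<in> L" unfolding L_def by (intro lat_span_props(5)[OF M]) (simp add: lat_def)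
    then show "\<exists>k\<in>\<int>. om (r v* M) y = real p * k" by (rule key)
  qed
  moreover have "y v* Jm \<Delta> \<in> lat M"
  proof (rule lat_selfdual[OF M(1)])
    fix r assume "r \<in> ivec"
    then have "(r v* M) v* Jm \<Delta> \<in> L" unfolding L_def by (intro lat_span_props(6)[OF M]) (simp add: lat_def)
    then obtain k where k: "k \<in> \<int>" "om ((r v* M) v* Jm \<Delta>) y = real p * k" using key by blast
    then have "om (r v* M) (y v* Jm \<Delta>) = real p * (- k)" by (simp add: om_Jm)
    then show "\<exists>k\<in>\<int>. om (r v* M) (y v* Jm \<Delta>) = real p * k" using k(1) by (meson Ints_minus)
  qed
  moreover have "(1 / real p) *\<^sub>R y \<notin> ivec"
  proof
    assume a: "(1 / real p) *\<^sub>R y \<in> ivec"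
    obtain i where i: "\<not> int p dvd f i" using f(1) by blast
    have "of_int (f i) / real p \<in> \<int>" using a by (simp add: ivec_def y_def)
    then obtain k where "of_int (f i) / real p = of_int k" by (auto simp: Ints_def)
    then have "of_int (f i) = (of_int (int p * k) :: real)" using p0 by (simp add: field_simps)
    then have "f i = int p * k" by (simp only: of_int_eq_iff)
    then show False using i by simp
  qed
  ultimately show ?thesis using yi unfolding stable_vector_def by blast
qed

section \<open>A hyperbolic pair for the hermitian form\<close>

text \<open>
  The multiples of \<open>p\<close> as real numbers, for congruences between entries of real vectors.
\<close>
abbreviation PZ :: "nat \<Rightarrow> real set" where "PZ p \<equiv> level_mult p"

lemma PZ_iff: "p > 0 \<Longrightarrow> x \<in> PZ p \<longleftrightarrow> x / real p \<in> \<int>"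
  by (auto simp: level_mult_def Ints_def field_simps)

lemma PZ_diff: "x \<in> PZ p \<Longrightarrow> y \<in> PZ p \<Longrightarrow> x - y \<in> PZ p"
  using level_mult_closed(2)[of x p "- y"] level_mult_closed(3)[of y p] by simp

lemma PZ_of_int: "real_of_int a \<in> PZ p \<longleftrightarrow> int p dvd a"
proof
  assume "real_of_int a \<in> PZ p"
  then obtain c where "real_of_int a = real_of_int (int p * c)" by (auto simp: level_mult_def)
  then show "int p dvd a" by (simp only: of_int_eq_iff) simp
next
  assume "int p dvd a"
  then obtain c where "a = int p * c" by (auto simp: dvd_def)
  then have "real_of_int a = of_nat p * of_int c" by simp
  then show "real_of_int a \<in> PZ p" unfolding level_mult_def by blast
qed

text \<open>
  Inertness in the form in which it is used: the norm form of \<open>K\<close> is anisotropic modulo \<open>p\<close>.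
\<close>
definition inert_prime :: "nat \<Rightarrow> nat \<Rightarrow> bool" where
  "inert_prime \<Delta> p \<longleftrightarrow> \<Delta> > 0 \<and> prime p \<and> odd p \<and>
     (\<forall>a b::int. int p dvd a * a + int \<Delta> * (b * b) \<longrightarrow> int p dvd a \<and> int p dvd b)"

lemma inert_primeD:
  assumes "inert_prime \<Delta> p"
  shows "\<Delta> > 0" "prime p" "odd p" "p > 0" "p > 1"
    and inert_form: "a \<in> \<int> \<Longrightarrow> b \<in> \<int> \<Longrightarrow> a * a + real \<Delta> * (b * b) \<in> PZ p \<Longrightarrow> a \<in> PZ p \<and> b \<in> PZ p"
    and PZ_prime: "a \<in> \<int> \<Longrightarrow> b \<in> \<int> \<Longrightarrow> a * b \<in> PZ p \<Longrightarrow> a \<in> PZ p \<or> b \<in> PZ p"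
    and PZ_inverse: "a \<in> \<int> \<Longrightarrow> a \<notin> PZ p \<Longrightarrow> \<exists>h\<in>\<int>. h * a - 1 \<in> PZ p"
    and two_PZ: "2 \<notin> PZ p" and Delta_PZ: "real \<Delta> \<notin> PZ p"
proof -
  show "\<Delta> > 0" "prime p" "odd p" using assms by (auto simp: inert_prime_def)
  then show "p > 0" "p > 1" using prime_gt_0_nat prime_gt_1_nat by blast+
  have pi: "prime (int p)" using \<open>prime p\<close> by simp
  have one: "\<not> int p dvd 1" using \<open>p > 1\<close> by (simp add: zdvd1_eq)
  show "a \<in> PZ p \<and> b \<in> PZ p" if hy: "a \<in> \<int>" "b \<in> \<int>" "a * a + real \<Delta> * (b * b) \<in> PZ p"
  proof -
    obtain a' b' where ab: "a = of_int a'" "b = of_int b'" using hy(1,2) by (auto simp: Ints_def)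
    have "real_of_int (a' * a' + int \<Delta> * (b' * b')) \<in> PZ p" using hy(3) by (simp add: ab)
    then show ?thesis using assms unfolding ab PZ_of_int inert_prime_def by blast
  qed
  show "a \<in> PZ p \<or> b \<in> PZ p" if hy: "a \<in> \<int>" "b \<in> \<int>" "a * b \<in> PZ p"
  proof -
    obtain a' b' where ab: "a = of_int a'" "b = of_int b'" using hy(1,2) by (auto simp: Ints_def)
    have "real_of_int (a' * b') \<in> PZ p" using hy(3) by (simp add: ab)
    then show ?thesis unfolding ab PZ_of_int using prime_dvd_mult_iff[OF pi] by blast
  qed
  show "\<exists>h\<in>\<int>. h * a - 1 \<in> PZ p" if hy: "a \<in> \<int>" "a \<notin> PZ p"
  proof -
    obtain a' where a: "a = of_int a'" using hy(1) by (auto simp: Ints_def)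
    have "coprime (int p) a'" using hy(2) prime_imp_coprime[OF pi] unfolding a PZ_of_int by blast
    then obtain u v where "u * int p + v * a' = 1" by (metis bezout_int coprime_iff_gcd_eq_1)
    then have "v * a' - 1 = int p * (- u)" by (simp add: algebra_simps)
    then have "int p dvd v * a' - 1" by simp
    then have "real_of_int (v * a' - 1) \<in> PZ p" by (simp only: PZ_of_int)
    then show ?thesis by (intro bexI[of _ "of_int v"]) (simp_all add: a)
  qed
  show "2 \<notin> PZ p"
  proof
    assume "2 \<in> PZ p"
    then have "int p dvd 2" using PZ_of_int[of 2 p] by simp
    then have "p dvd 2" by presburger
    then have "p \<le> 2" by (rule dvd_imp_le) simp
    then show False using \<open>p > 1\<close> \<open>odd p\<close> by (cases "p = 2") auto
  qed
  show "real \<Delta> \<notin> PZ p"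
  proof
    assume "real \<Delta> \<in> PZ p"
    then have "int p dvd 0 * 0 + int \<Delta> * (1 * 1)" using PZ_of_int[of "int \<Delta>" p] by simp
    then have "int p dvd 1" using assms unfolding inert_prime_def by blast
    then show False using one by blast
  qed
qed

lemma ivec_PZ: assumes "p > 0" shows "(1 / real p) *\<^sub>R r \<in> ivec \<longleftrightarrow> (\<forall>i. r $ i \<in> PZ p)"
  using assms by (simp add: ivec_def PZ_iff)

definition mkvec :: "real \<Rightarrow> real \<Rightarrow> real \<Rightarrow> real \<Rightarrow> real \<Rightarrow> real \<Rightarrow> rvec6" where
  "mkvec a1 a2 a3 b1 b2 b3 = (\<chi> k. case k of Inl i \<Rightarrow> (vector [a1, a2, a3] :: real^3) $ i | Inr i \<Rightarrow> (vector [b1, b2, b3] :: real^3) $ i)"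

lemma mkvec_nth [simp]: "mkvec a1 a2 a3 b1 b2 b3 $ Inl 1 = a1" "mkvec a1 a2 a3 b1 b2 b3 $ Inl 2 = a2"
  "mkvec a1 a2 a3 b1 b2 b3 $ Inl 3 = a3" "mkvec a1 a2 a3 b1 b2 b3 $ Inr 1 = b1" "mkvec a1 a2 a3 b1 b2 b3 $ Inr 2 = b2"
  "mkvec a1 a2 a3 b1 b2 b3 $ Inr 3 = b3"
  by (simp_all add: mkvec_def vector_3)

lemma six_all: "(\<forall>k::3+3. P k) \<longleftrightarrow> P (Inl 1) \<and> P (Inl 2) \<and> P (Inl 3) \<and> P (Inr 1) \<and> P (Inr 2) \<and> P (Inr 3)"
  by (simp add: sum_type_all forall_3 conj_assoc)

lemma vJ_nth: "(r v* Jm \<Delta>) $ Inl 1 = - (real \<Delta> * r $ Inr 1)" "(r v* Jm \<Delta>) $ Inl 2 = - (real \<Delta> * r $ Inr 2)"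
  "(r v* Jm \<Delta>) $ Inl 3 = real \<Delta> * r $ Inr 3" "(r v* Jm \<Delta>) $ Inr 1 = r $ Inl 1" "(r v* Jm \<Delta>) $ Inr 2 = r $ Inl 2"
  "(r v* Jm \<Delta>) $ Inr 3 = - r $ Inl 3"
  by (simp_all add: vm_blocks sum_3 Emat_nth)

lemma om_J_explicit: "om r (s v* Jm \<Delta>) = r $ Inl 1 * s $ Inl 1 + r $ Inl 2 * s $ Inl 2 - r $ Inl 3 * s $ Inl 3
   + real \<Delta> * (r $ Inr 1 * s $ Inr 1 + r $ Inr 2 * s $ Inr 2 - r $ Inr 3 * s $ Inr 3)"
  by (simp add: om_def sum_3 vJ_nth algebra_simps)

lemma om_J_sym: "om r (s v* Jm \<Delta>) = om s (r v* Jm \<Delta>)"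
  by (simp add: om_J_explicit algebra_simps)

lemma om_JJ: "om (r v* Jm \<Delta>) (s v* Jm \<Delta>) = real \<Delta> * om r s"
  by (simp add: om_Jm vm_Jm_Jm om_arith)

definition stable_part :: "nat \<Rightarrow> rmat6 \<Rightarrow> rvec6 set" where
  "stable_part \<Delta> M = {x \<in> lat M. x v* Jm \<Delta> \<in> lat M}"

lemma stable_part_arith:
  "x \<in> stable_part \<Delta> M \<Longrightarrow> y \<in> stable_part \<Delta> M \<Longrightarrow> x + y \<in> stable_part \<Delta> M"
  "x \<in> stable_part \<Delta> M \<Longrightarrow> y \<in> stable_part \<Delta> M \<Longrightarrow> x - y \<in> stable_part \<Delta> M"
  "a \<in> \<int> \<Longrightarrow> x \<in> stable_part \<Delta> M \<Longrightarrow> a *\<^sub>R x \<in> stable_part \<Delta> M"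
  "x \<in> stable_part \<Delta> M \<Longrightarrow> x v* Jm \<Delta> \<in> stable_part \<Delta> M"
proof -
  show "x \<in> stable_part \<Delta> M \<Longrightarrow> y \<in> stable_part \<Delta> M \<Longrightarrow> x + y \<in> stable_part \<Delta> M"
    "x \<in> stable_part \<Delta> M \<Longrightarrow> y \<in> stable_part \<Delta> M \<Longrightarrow> x - y \<in> stable_part \<Delta> M"
    "a \<in> \<int> \<Longrightarrow> x \<in> stable_part \<Delta> M \<Longrightarrow> a *\<^sub>R x \<in> stable_part \<Delta> M"
    by (simp_all add: stable_part_def vm_arith lat_arith)
  assume x: "x \<in> stable_part \<Delta> M"
  have "- (real \<Delta> *\<^sub>R x) \<in> lat M" using x by (intro lat_arith) (auto simp: stable_part_def)
  then show "x v* Jm \<Delta> \<in> stable_part \<Delta> M" using x by (simp add: stable_part_def vm_Jm_Jm)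
qed

lemma stable_part_mult_ivec:
  assumes "psim (real p) M" "\<forall>i j. M $ i $ j \<in> \<int>" "k \<in> ivec"
  shows "real p *\<^sub>R k \<in> stable_part \<Delta> M"
  using lat_mult_ivec[OF assms] lat_mult_ivec[OF assms(1,2) vm_Jm_ivec[OF assms(3)], of \<Delta>]
  by (simp add: stable_part_def vm_arith)

text \<open>
  The stable part contains \<open>p\<close> times all integral vectors.
\<close>
lemma stable_part_congruent:
  assumes M: "psim (real p) M" "\<forall>i j. M $ i $ j \<in> \<int>" and p: "p > 0"
    and x: "x \<in> stable_part \<Delta> M" "\<And>i. x $ i - y $ i \<in> PZ p"
  shows "y \<in> stable_part \<Delta> M"
proof -
  have "(1 / real p) *\<^sub>R (x - y) \<in> ivec" unfolding ivec_PZ[OF p] using x(2) by simp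
  from stable_part_mult_ivec[OF M this] have "x - y \<in> stable_part \<Delta> M" using p by simp
  from stable_part_arith(2)[OF x(1) this] show ?thesis by simp
qed

text \<open>
  The vectors \<open>e\<close>, \<open>f\<close> form a hyperbolic pair for the hermitian form with components \<open>om x y\<close> and
  \<open>om x (y v* J)\<close>, and \<open>e\<close> generates the stable part modulo \<open>p\<close> over the integers of \<open>K\<close>.  The equations
  hold exactly, not only modulo \<open>p\<close>, so that transvections along \<open>e\<close> and \<open>f\<close> are symplectic.
\<close>
definition adapted :: "nat \<Rightarrow> nat \<Rightarrow> rmat6 \<Rightarrow> rvec6 \<Rightarrow> rvec6 \<Rightarrow> bool" where
  "adapted \<Delta> p M e f \<longleftrightarrow> e \<in> ivec \<and> f \<in> ivec \<and> e \<in> stable_part \<Delta> M \<and>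
     om e (e v* Jm \<Delta>) = 0 \<and> om f (f v* Jm \<Delta>) = 0 \<and> om e (f v* Jm \<Delta>) = 2 \<and> om e f = 0 \<and>
     (\<forall>x\<in>stable_part \<Delta> M. \<exists>u\<in>\<int>. \<exists>v\<in>\<int>. \<exists>k\<in>ivec. x = u *\<^sub>R e + v *\<^sub>R (e v* Jm \<Delta>) + real p *\<^sub>R k)"

text \<open>
  All vectors involved lie in \<open>lat M\<close>, on which the form is divisible by \<open>p\<close>.
\<close>
lemma stable_part_isotropic:
  assumes "psim (real p) M" "x \<in> stable_part \<Delta> M" "y \<in> stable_part \<Delta> M"
  shows "om x y \<in> PZ p"
proof -
  obtain k where "k \<in> \<int>" "om x y = real p * k" using om_lat[OF assms(1), of x y] assms(2,3) by (auto simp: stable_part_def)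
  then show ?thesis by (simp add: level_mult_closed(6))
qed

lemma PZ_cancel: assumes "inert_prime \<Delta> p" "a \<in> \<int>" "b \<in> \<int>" "a * b \<in> PZ p" "a \<notin> PZ p" shows "b \<in> PZ p"
  using PZ_prime[OF assms(1-4)] assms(5) by blast

text \<open>
  Subtracting multiples of \<open>e\<close> and \<open>e v* J\<close> makes \<open>x\<close> orthogonal to \<open>f\<close> modulo \<open>p\<close>.  It is also orthogonal
  to \<open>e\<close> and isotropic, as a vector of the stable part; so the norm formed from its middle
  coordinates is zero modulo \<open>p\<close>.  As \<open>p\<close> is inert, these coordinates are divisible by \<open>p\<close>, and then so
  are the others.
\<close>
lemma adapted_decomposition:
  assumes ip: "inert_prime \<Delta> p" and M: "psim (real p) M" "\<forall>i j. M $ i $ j \<in> \<int>"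
    and e: "e \<in> ivec" "e \<in> stable_part \<Delta> M" "om e (f v* Jm \<Delta>) = 2" "om e f = 0"
    and f: "f = mkvec 1 0 t 0 0 0" and t: "t * t = 1" "t \<in> \<int>"
    and x: "x \<in> stable_part \<Delta> M"
  shows "\<exists>u\<in>\<int>. \<exists>v\<in>\<int>. \<exists>k\<in>ivec. x = u *\<^sub>R e + v *\<^sub>R (e v* Jm \<Delta>) + real p *\<^sub>R k"
proof -
  note D = inert_primeD[OF ip]
  have xi: "x \<in> ivec" using x lat_ivec[OF M(2)] by (auto simp: stable_part_def)
  have fi: "f \<in> ivec" unfolding f ivec_def using t by (auto simp: six_all)
  obtain h where h: "h \<in> \<int>" "h * 2 - 1 \<in> PZ p" using PZ_inverse[OF ip, of 2] two_PZ[OF ip] by auto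
  define u where "u = h * om x (f v* Jm \<Delta>)"
  define v where "v = - (h * om x f)"
  have uv: "u \<in> \<int>" "v \<in> \<int>"
    using h om_ints[OF xi fi] om_ints[OF xi vm_Jm_ivec[OF fi]] by (auto simp: u_def v_def)
  define y where "y = x - u *\<^sub>R e - v *\<^sub>R (e v* Jm \<Delta>)"
  have y: "y \<in> stable_part \<Delta> M" unfolding y_def
    by (intro stable_part_arith uv x e)
  have yi: "y \<in> ivec" using y lat_ivec[OF M(2)] by (auto simp: stable_part_def)
  have yint: "y $ i \<in> \<int>" for i using yi by (simp add: ivec_def)
  have eJ: "om (e v* Jm \<Delta>) f = - 2" "om (e v* Jm \<Delta>) (f v* Jm \<Delta>) = 0"
    using e(3,4) by (simp_all add: om_Jm[of e] om_JJ)
  have "om y (f v* Jm \<Delta>) = - ((h * 2 - 1) * om x (f v* Jm \<Delta>))"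
    by (simp add: y_def om_arith e(3) eJ u_def algebra_simps)
  then have y1: "om y (f v* Jm \<Delta>) \<in> PZ p"
    using level_mult_closed(3)[OF level_mult_closed(4)[OF h(2) om_ints[OF xi vm_Jm_ivec[OF fi]]]] by simp
  have "om y f = - ((h * 2 - 1) * om x f)"
    by (simp add: y_def om_arith e(4) eJ v_def algebra_simps)
  then have y2: "om y f \<in> PZ p"
    using level_mult_closed(3)[OF level_mult_closed(4)[OF h(2) om_ints[OF xi fi]]] by simp
  have 1: "y $ Inl 1 - t * y $ Inl 3 \<in> PZ p" using y1 by (simp add: om_J_explicit f mult.commute)
  have "- (y $ Inr 1 + t * y $ Inr 3) \<in> PZ p" using y2 by (simp add: om_def sum_3 f algebra_simps)
  from level_mult_closed(3)[OF this] have 2: "y $ Inr 1 + t * y $ Inr 3 \<in> PZ p" by (simp add: add.commute)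
  have yy: "om y (y v* Jm \<Delta>) \<in> PZ p" by (rule stable_part_isotropic[OF M(1) y stable_part_arith(4)[OF y]])
  have "y $ Inl 2 * y $ Inl 2 + real \<Delta> * (y $ Inr 2 * y $ Inr 2) = om y (y v* Jm \<Delta>)
     - (y $ Inl 1 - t * y $ Inl 3) * (y $ Inl 1 + t * y $ Inl 3) - (y $ Inr 1 + t * y $ Inr 3) * (real \<Delta> * (y $ Inr 1 - t * y $ Inr 3))"
  proof -
    have eqs: "(y $ Inl 1 - t * y $ Inl 3) * (y $ Inl 1 + t * y $ Inl 3) = y $ Inl 1 * y $ Inl 1 - (t * t) * (y $ Inl 3 * y $ Inl 3)"
      "(y $ Inr 1 + t * y $ Inr 3) * (real \<Delta> * (y $ Inr 1 - t * y $ Inr 3)) = real \<Delta> * (y $ Inr 1 * y $ Inr 1 - (t * t) * (y $ Inr 3 * y $ Inr 3))"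
      by (simp_all add: algebra_simps)
    show ?thesis unfolding eqs t(1) by (simp add: om_J_explicit algebra_simps)
  qed
  then have "y $ Inl 2 * y $ Inl 2 + real \<Delta> * (y $ Inr 2 * y $ Inr 2) \<in> PZ p"
    using PZ_diff[OF PZ_diff[OF yy level_mult_closed(4)[OF 1]] level_mult_closed(4)[OF 2]] yint t(2) by simp
  then have 3: "y $ Inl 2 \<in> PZ p" "y $ Inr 2 \<in> PZ p" using inert_form[OF ip yint yint] by blast+
  have ye: "om y (e v* Jm \<Delta>) \<in> PZ p" "om y e \<in> PZ p"
    using stable_part_isotropic[OF M(1) y stable_part_arith(4)[OF e(2)]] stable_part_isotropic[OF M(1) y e(2)] by auto
  have ei: "e $ i \<in> \<int>" for i using e(1) by (simp add: ivec_def)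
  have ef: "e $ Inl 1 - t * e $ Inl 3 = 2" using e(3) by (simp add: om_J_explicit f mult.commute)
  have ef2: "e $ Inr 1 = - (t * e $ Inr 3)" using e(4) by (simp add: om_def sum_3 f algebra_simps)
  have y3: "y $ Inl 3 \<in> PZ p"
  proof -
    have E0: "om y (e v* Jm \<Delta>) = (y $ Inl 1 - t * y $ Inl 3) * e $ Inl 1 + y $ Inl 2 * e $ Inl 2 + y $ Inr 2 * (real \<Delta> * e $ Inr 2)
       + (y $ Inr 1 + t * y $ Inr 3) * (real \<Delta> * e $ Inr 1) + y $ Inl 3 * (t * e $ Inl 1 - e $ Inl 3) - real \<Delta> * (y $ Inr 3 * (t * e $ Inr 1 + e $ Inr 3))"
      by (simp add: om_J_explicit algebra_simps)
    have E1: "t * e $ Inl 1 - e $ Inl 3 = t * 2"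
    proof -
      have "t * (e $ Inl 1 - t * e $ Inl 3) = t * e $ Inl 1 - (t * t) * e $ Inl 3" by (simp add: algebra_simps)
      then show ?thesis unfolding ef t by simp
    qed
    have E2: "t * e $ Inr 1 + e $ Inr 3 = 0"
    proof -
      have "t * e $ Inr 1 = - ((t * t) * e $ Inr 3)" unfolding ef2 by (simp add: algebra_simps)
      then show ?thesis unfolding t by simp
    qed
    from E0[unfolded E1 E2] have eq: "(2 * t) * y $ Inl 3 = om y (e v* Jm \<Delta>) - (y $ Inl 1 - t * y $ Inl 3) * e $ Inl 1 - y $ Inl 2 * e $ Inl 2
       - y $ Inr 2 * (real \<Delta> * e $ Inr 2) - (y $ Inr 1 + t * y $ Inr 3) * (real \<Delta> * e $ Inr 1)"
      by (simp add: algebra_simps)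
    have "(2 * t) * y $ Inl 3 \<in> PZ p" unfolding eq
      by (intro PZ_diff ye level_mult_closed(4) 1 2 3 Ints_mult ei Ints_of_nat)
    moreover have "2 * t \<notin> PZ p"
    proof
      assume "2 * t \<in> PZ p"
      then have "2 * t * t \<in> PZ p" using t(2) by (rule level_mult_closed(4))
      then show False using two_PZ[OF ip] t(1) by (simp add: mult.assoc)
    qed
    ultimately show ?thesis using PZ_cancel[OF ip _ yint] t(2) by (metis Ints_mult Ints_numeral)
  qed
  have y3': "y $ Inr 3 \<in> PZ p"
  proof -
    have E0: "om y e = (y $ Inl 1 - t * y $ Inl 3) * e $ Inr 1 + y $ Inl 2 * e $ Inr 2 - y $ Inr 2 * e $ Inl 2
       - (y $ Inr 1 + t * y $ Inr 3) * e $ Inl 1 + y $ Inl 3 * (t * e $ Inr 1 + e $ Inr 3) + y $ Inr 3 * (t * e $ Inl 1 - e $ Inl 3)"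
      by (simp add: om_def sum_3 algebra_simps)
    have E1: "t * e $ Inl 1 - e $ Inl 3 = t * 2"
    proof -
      have "t * (e $ Inl 1 - t * e $ Inl 3) = t * e $ Inl 1 - (t * t) * e $ Inl 3" by (simp add: algebra_simps)
      then show ?thesis unfolding ef t by simp
    qed
    have E2: "t * e $ Inr 1 + e $ Inr 3 = 0"
    proof -
      have "t * e $ Inr 1 = - ((t * t) * e $ Inr 3)" unfolding ef2 by (simp add: algebra_simps)
      then show ?thesis unfolding t by simp
    qed
    from E0[unfolded E1 E2] have eq: "(2 * t) * y $ Inr 3 = om y e - (y $ Inl 1 - t * y $ Inl 3) * e $ Inr 1 - y $ Inl 2 * e $ Inr 2
       + y $ Inr 2 * e $ Inl 2 + (y $ Inr 1 + t * y $ Inr 3) * e $ Inl 1"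
      by (simp add: algebra_simps)
    have "(2 * t) * y $ Inr 3 \<in> PZ p" unfolding eq
      by (intro PZ_diff ye level_mult_closed(2) level_mult_closed(4) 1 2 3 Ints_mult ei)
    moreover have "2 * t \<notin> PZ p"
    proof
      assume "2 * t \<in> PZ p"
      then have "2 * t * t \<in> PZ p" using t(2) by (rule level_mult_closed(4))
      then show False using two_PZ[OF ip] t(1) by (simp add: mult.assoc)
    qed
    ultimately show ?thesis using PZ_cancel[OF ip _ yint] t(2) by (metis Ints_mult Ints_numeral)
  qed
  have "y $ Inl 1 \<in> PZ p" using level_mult_closed(2)[OF 1 level_mult_closed(5)[OF y3 t(2)]] by simp
  moreover have "y $ Inr 1 \<in> PZ p" using PZ_diff[OF 2 level_mult_closed(5)[OF y3' t(2)]] by simp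
  ultimately have "(1 / real p) *\<^sub>R y \<in> ivec" using 3 y3 y3' unfolding ivec_PZ[OF D(4)] six_all by blast
  moreover have "x = u *\<^sub>R e + v *\<^sub>R (e v* Jm \<Delta>) + real p *\<^sub>R ((1 / real p) *\<^sub>R y)"
    using D(4) by (simp add: y_def)
  ultimately show ?thesis using uv by blast
qed

text \<open>
  A stable vector is isotropic modulo \<open>p\<close>.  Its multiples by \<open>a + b J\<close> remain in the stable part, as do
  all vectors congruent to it modulo \<open>p\<close>; one of these lies on an integral parametrization of the cone
  of isotropic vectors.
\<close>
lemma adapted_exists:
  assumes ip: "inert_prime \<Delta> p" and M: "psim (real p) M" "\<forall>i j. M $ i $ j \<in> \<int>"
    and y: "stable_vector \<Delta> p M y"
  shows "\<exists>e f. adapted \<Delta> p M e f"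
proof -
  note D = inert_primeD[OF ip]
  have yi: "y $ i \<in> \<int>" for i using y by (simp add: stable_vector_def ivec_def)
  have ys: "y \<in> stable_part \<Delta> M" using y by (simp add: stable_vector_def stable_part_def)
  have yn: "\<not> (\<forall>i. y $ i \<in> PZ p)" using y ivec_PZ[OF D(4)] by (simp add: stable_vector_def)
  (* up to sign, the components of the hermitian product of y with (1, 0, -1) *)
  define sr si where "sr = y $ Inl 1 + y $ Inl 3" and "si = y $ Inr 1 - y $ Inr 3"
  have si: "sr \<in> \<int>" "si \<in> \<int>" using yi by (simp_all add: sr_def si_def)
  have yy: "om y (y v* Jm \<Delta>) \<in> PZ p"
    by (rule stable_part_isotropic[OF M(1) ys stable_part_arith(4)[OF ys]])
  show ?thesis
  proof (cases "sr \<in> PZ p \<and> si \<in> PZ p")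
    case True
    have "y $ Inl 2 * y $ Inl 2 + real \<Delta> * (y $ Inr 2 * y $ Inr 2) = om y (y v* Jm \<Delta>)
      - sr * (y $ Inl 1 - y $ Inl 3) - si * (real \<Delta> * (y $ Inr 1 + y $ Inr 3))"
      by (simp add: om_J_explicit sr_def si_def algebra_simps)
    also have "\<dots> \<in> PZ p" using True yi by (intro PZ_diff yy level_mult_closed(4)) auto
    finally have y2: "y $ Inl 2 \<in> PZ p" "y $ Inr 2 \<in> PZ p" using inert_form[OF ip yi yi] by blast+
    define n where "n = y $ Inl 1 * y $ Inl 1 + real \<Delta> * (y $ Inr 1 * y $ Inr 1)"
    have ni: "n \<in> \<int>" using yi by (simp add: n_def)
    have "n \<notin> PZ p"
    proof
      assume "n \<in> PZ p"
      then have 1: "y $ Inl 1 \<in> PZ p" "y $ Inr 1 \<in> PZ p" using inert_form[OF ip yi yi] by (auto simp: n_def)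
      have "y $ Inl 3 \<in> PZ p" "y $ Inr 3 \<in> PZ p"
        using PZ_diff[of sr p "y $ Inl 1"] PZ_diff[of "y $ Inr 1" p si] 1 True by (simp_all add: sr_def si_def)
      then show False using yn 1 y2 unfolding six_all by blast
    qed
    then obtain h where h: "h \<in> \<int>" "h * n - 1 \<in> PZ p" using PZ_inverse[OF ip ni] by blast
    define e where "e = mkvec 1 0 (-1) 0 0 0"
    define f where "f = mkvec 1 0 1 0 0 0"
    (* the conjugate of the first coordinate of y, divided by its norm, scales
       that coordinate to 1 modulo p *)
    define z where "z = (h * y $ Inl 1) *\<^sub>R y - (h * y $ Inr 1) *\<^sub>R (y v* Jm \<Delta>)"
    have zs: "z \<in> stable_part \<Delta> M" unfolding z_def using h yi by (intro stable_part_arith ys) auto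
    have "z $ i - e $ i \<in> PZ p" for i
    proof -
      have "z $ Inl 1 - e $ Inl 1 = h * n - 1" by (simp add: z_def e_def vJ_nth n_def algebra_simps)
      moreover have "z $ Inl 2 - e $ Inl 2 = (h * y $ Inl 1) * y $ Inl 2 + (h * y $ Inr 1 * real \<Delta>) * y $ Inr 2"
        by (simp add: z_def e_def vJ_nth)
      moreover have "z $ Inl 3 - e $ Inl 3 = h * y $ Inl 1 * sr + h * y $ Inr 1 * real \<Delta> * si - (h * n - 1)"
        by (simp add: z_def e_def vJ_nth n_def sr_def si_def algebra_simps)
      moreover have "z $ Inr 1 - e $ Inr 1 = 0" by (simp add: z_def e_def vJ_nth)
      moreover have "z $ Inr 2 - e $ Inr 2 = (h * y $ Inl 1) * y $ Inr 2 - (h * y $ Inr 1) * y $ Inl 2"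
        by (simp add: z_def e_def vJ_nth)
      moreover have "z $ Inr 3 - e $ Inr 3 = h * y $ Inr 1 * sr - h * y $ Inl 1 * si"
        by (simp add: z_def e_def vJ_nth sr_def si_def algebra_simps)
      ultimately have "\<forall>i. z $ i - e $ i \<in> PZ p" unfolding six_all
        using h True y2 yi by (auto intro!: level_mult_closed(2,5) PZ_diff level_mult_closed(1))
      then show ?thesis by blast
    qed
    then have es: "e \<in> stable_part \<Delta> M" by (rule stable_part_congruent[OF M D(4) zs])
    have ei: "e \<in> ivec" "f \<in> ivec" by (auto simp: e_def f_def ivec_def six_all)
    have o: "om e (e v* Jm \<Delta>) = 0" "om f (f v* Jm \<Delta>) = 0" "om e (f v* Jm \<Delta>) = 2" "om e f = 0"
      by (simp_all add: om_J_explicit e_def f_def om_def sum_3 vJ_nth)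
    have "adapted \<Delta> p M e f" unfolding adapted_def
      using ei es o adapted_decomposition[OF ip M ei(1) es o(3,4) f_def] by auto
    then show ?thesis by blast
  next
    case False
    define n where "n = sr * sr + real \<Delta> * (si * si)"
    have ni: "n \<in> \<int>" using si by (simp add: n_def)
    have "n \<notin> PZ p" using False inert_form[OF ip si] unfolding n_def by blast
    then obtain h where h: "h \<in> \<int>" "h * n - 1 \<in> PZ p" using PZ_inverse[OF ip ni] by blast
    obtain q where q: "q \<in> \<int>" "q * 2 - 1 \<in> PZ p" using PZ_inverse[OF ip, of 2] two_PZ[OF ip] by auto
    (* scaling y so that the sum of its first and third coordinates becomes 2 *)
    define z where "z = (2 * h * sr) *\<^sub>R y - (2 * h * si) *\<^sub>R (y v* Jm \<Delta>)"
    have zs: "z \<in> stable_part \<Delta> M" unfolding z_def using h si by (intro stable_part_arith ys) auto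
    have zi: "z $ i \<in> \<int>" for i using zs lat_ivec[OF M(2)] by (auto simp: stable_part_def ivec_def)
    have z1: "z $ Inl 1 + z $ Inl 3 - 2 \<in> PZ p"
    proof -
      have "z $ Inl 1 + z $ Inl 3 - 2 = 2 * (h * n - 1)" by (simp add: z_def vJ_nth n_def sr_def si_def algebra_simps)
      then show ?thesis using level_mult_closed(5)[OF h(2), of 2] by simp
    qed
    have z2: "z $ Inr 1 - z $ Inr 3 = 0" by (simp add: z_def vJ_nth sr_def si_def algebra_simps)
    have zz: "om z (z v* Jm \<Delta>) \<in> PZ p"
      by (rule stable_part_isotropic[OF M(1) zs stable_part_arith(4)[OF zs]])
    define wr wi m where "wr = q * z $ Inl 2" and "wi = q * z $ Inr 2" and "m = wr * wr + real \<Delta> * (wi * wi)"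
    have wi: "wr \<in> \<int>" "wi \<in> \<int>" "m \<in> \<int>" using q zi by (simp_all add: wr_def wi_def m_def)
    define b where "b = z $ Inr 1"
    (* the isotropic vector (1 - |w|^2, 2 w, 1 + |w|^2), up to the imaginary part b
       that the outer coordinates share *)
    define e where "e = mkvec (1 - m) (2 * wr) (1 + m) b (2 * wi) b"
    define f where "f = mkvec 1 0 (-1) 0 0 0"
    have w2: "2 * wr - z $ Inl 2 \<in> PZ p" "2 * wi - z $ Inr 2 \<in> PZ p"
      using level_mult_closed(4)[OF q(2) zi[of "Inl 2"]] level_mult_closed(4)[OF q(2) zi[of "Inr 2"]]
      by (simp_all add: wr_def wi_def algebra_simps)
    have d: "z $ Inl 1 - z $ Inl 3 + 2 * m \<in> PZ p"
    proof -
      have "2 * (z $ Inl 1 - z $ Inl 3 + 2 * m) = om z (z v* Jm \<Delta>) - (z $ Inl 1 + z $ Inl 3 - 2) * (z $ Inl 1 - z $ Inl 3)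
         + (2 * wr - z $ Inl 2) * (2 * wr + z $ Inl 2) + (2 * wi - z $ Inr 2) * (real \<Delta> * (2 * wi + z $ Inr 2))"
        using z2 by (simp add: om_J_explicit m_def algebra_simps)
      also have "\<dots> \<in> PZ p" using zi wi
        by (intro level_mult_closed(2) PZ_diff zz level_mult_closed(4) z1 w2) auto
      finally show ?thesis using PZ_cancel[OF ip _ _ _ two_PZ[OF ip]] zi wi by auto
    qed
    have "z $ i - e $ i \<in> PZ p" for i
    proof -
      have "2 * (z $ Inl 1 - e $ Inl 1) = (z $ Inl 1 + z $ Inl 3 - 2) + (z $ Inl 1 - z $ Inl 3 + 2 * m)"
        by (simp add: e_def)
      then have "2 * (z $ Inl 1 - e $ Inl 1) \<in> PZ p" by (simp only: level_mult_closed(2)[OF z1 d])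
      then have 1: "z $ Inl 1 - e $ Inl 1 \<in> PZ p" using PZ_cancel[OF ip _ _ _ two_PZ[OF ip]] zi wi by (auto simp: e_def)
      have "z $ Inl 3 - e $ Inl 3 = (z $ Inl 1 + z $ Inl 3 - 2) - (z $ Inl 1 - e $ Inl 1)" by (simp add: e_def)
      then have 3: "z $ Inl 3 - e $ Inl 3 \<in> PZ p" by (simp only: PZ_diff[OF z1 1])
      have 2: "z $ Inl 2 - e $ Inl 2 \<in> PZ p" "z $ Inr 2 - e $ Inr 2 \<in> PZ p"
        using level_mult_closed(3)[OF w2(1)] level_mult_closed(3)[OF w2(2)] by (simp_all add: e_def)
      have "z $ Inr 1 - e $ Inr 1 = 0" "z $ Inr 3 - e $ Inr 3 = 0" using z2 by (simp_all add: e_def b_def)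
      then have "\<forall>i. z $ i - e $ i \<in> PZ p" unfolding six_all using 1 2 3 level_mult_closed(1) by metis
      then show ?thesis by blast
    qed
    then have es: "e \<in> stable_part \<Delta> M" by (rule stable_part_congruent[OF M D(4) zs])
    have ei: "e \<in> ivec" "f \<in> ivec" using wi zi by (auto simp: e_def f_def ivec_def six_all b_def)
    have o: "om e (e v* Jm \<Delta>) = 0" "om f (f v* Jm \<Delta>) = 0" "om e (f v* Jm \<Delta>) = 2" "om e f = 0"
      by (simp_all add: om_J_explicit e_def f_def om_def sum_3 vJ_nth m_def algebra_simps)
    have "adapted \<Delta> p M e f" unfolding adapted_def
      using ei es o adapted_decomposition[OF ip M ei(1) es o(3,4) f_def] by auto
    then show ?thesis by blast
  qed
qed

section \<open>Counting the lattices of a fibre\<close>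

text \<open>
  The similitudes commuting with \<open>J\<close> that permute the points of the graph of \<open>M\<close> above a given point
  of its image; \<open>M g M\<inverse>\<close> lies in \<open>Gamma0 N\<close>.
\<close>
definition unit_group :: "nat \<Rightarrow> nat \<Rightarrow> nat \<Rightarrow> rmat6 \<Rightarrow> rmat6 set" where
  "unit_group N \<Delta> p M = {g. psim 1 g \<and> g ** Jm \<Delta> = Jm \<Delta> ** g \<and> (1 / real p) *\<^sub>R (M ** g ** adj M) \<in> Gamma0 N}"

lemma vm_axis_nth: "(axis i 1 v* X) $ j = (X :: rmat6) $ i $ j"
  by (simp add: vector_matrix_mult_def axis_def if_distrib[of "\<lambda>x. x * _"] if_distrib[of "\<lambda>x. _ * x"] cong: if_cong)

lemma ints_of_rows: assumes "\<And>i. axis i 1 v* X \<in> ivec" shows "\<forall>i j. (X :: rmat6) $ i $ j \<in> \<int>"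
  using assms by (simp add: ivec_def vm_axis_nth)

lemma axis_ivec: "axis i 1 \<in> ivec"
  by (simp add: ivec_def axis_def)

lemma vm_eqI: assumes "\<And>r. r v* A = r v* (B::rmat6)" shows "A = B"
proof -
  have "A $ i $ j = B $ i $ j" for i j
    using arg_cong[OF assms[of "axis i 1"], of "\<lambda>v. v $ j"] by (simp only: vm_axis_nth)
  then show ?thesis by (simp add: vec_eq_iff)
qed

text \<open>
  The coordinates of \<open>s\<close> are its pairings with the unit vectors, up to sign.
\<close>
lemma om_nondegenerate: assumes "\<And>r. om r s = om r s'" shows "s = s'"
proof -
  have "om (axis (Inl i) 1) s = s $ Inr i" "om (axis (Inr i) 1) s = - s $ Inl i" for i s
    by (simp_all add: om_def axis_def sum_subtractf if_distrib[of "\<lambda>x. x * _"] sum_negf cong: if_cong)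
  then have "s $ Inl i = s' $ Inl i" "s $ Inr i = s' $ Inr i" for i
    using assms by (metis neg_equal_iff_equal, metis)
  then show ?thesis by (simp add: vec_eq_iff sum_type_all)
qed

lemma psim1I: assumes "\<And>r s. om (r v* T) (s v* T) = om r s" shows "psim 1 T"
proof -
  have "s v* (T ** adj T) = s v* mat 1" for s
    by (rule om_nondegenerate) (use assms in \<open>simp add: om_adj vector_matrix_mul_assoc vm_arith\<close>)
  then have "T ** adj T = mat 1" by (rule vm_eqI)
  then show ?thesis by (simp add: psim_def)
qed

text \<open>
  A unitary transvection along \<open>v\<close>, for the hermitian form attached to \<open>om\<close> and \<open>J\<close>; see
  \<open>vm_transvection\<close>.
\<close>
definition transvection :: "nat \<Rightarrow> rvec6 \<Rightarrow> real \<Rightarrow> rmat6" where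
  "transvection \<Delta> v c = mat 1 + c *\<^sub>R (\<chi> i j. real \<Delta> * om (axis i 1) v * v $ j + om (axis i 1) (v v* Jm \<Delta>) * (v v* Jm \<Delta>) $ j)"

lemma vm_outer: "r v* (\<chi> i j. a * om (axis i 1) v * w $ j + om (axis i 1) v' * w' $ j) = (a * om r v) *\<^sub>R w + om r v' *\<^sub>R w'"
proof -
  have r: "r = (\<Sum>i\<in>UNIV. r $ i *\<^sub>R axis i 1)"
    by (simp add: vec_eq_iff axis_def if_distrib[of "\<lambda>x. _ * x"] cong: if_cong)
  have o: "om r u = (\<Sum>i\<in>UNIV. r $ i * om (axis i 1) u)" for u
    by (subst r) (simp only: om_sum om_arith)
  show ?thesis
    unfolding vec_eq_iff o
    by (simp add: vector_matrix_mult_def sum.distrib sum_distrib_left sum_distrib_right algebra_simps)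
qed

lemma vm_transvection: "r v* transvection \<Delta> v c = r + c *\<^sub>R ((real \<Delta> * om r v) *\<^sub>R v + om r (v v* Jm \<Delta>) *\<^sub>R (v v* Jm \<Delta>))"
  unfolding transvection_def vm_arith vm_outer by (simp add: vm_arith)

lemma transvection_psim:
  assumes "om v (v v* Jm \<Delta>) = 0" shows "psim 1 (transvection \<Delta> v c)"
proof (rule psim1I)
  fix r s
  let ?w = "v v* Jm \<Delta>"
  have w: "om ?w v = 0" using om_anti[of v ?w] assms by simp
  have a: "om v s = - om s v" "om ?w s = - om s ?w" by (rule om_anti)+
  show "om (r v* transvection \<Delta> v c) (s v* transvection \<Delta> v c) = om r s"
    unfolding vm_transvection by (simp add: om_arith assms w a algebra_simps)
qed

lemma transvection_commutes: "transvection \<Delta> v c ** Jm \<Delta> = Jm \<Delta> ** transvection \<Delta> v c"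
proof (rule vm_eqI)
  fix r
  have "(r v* transvection \<Delta> v c) v* Jm \<Delta> = (r v* Jm \<Delta>) v* transvection \<Delta> v c"
    unfolding vm_transvection by (simp add: vm_arith vm_Jm_Jm om_Jm om_arith algebra_simps)
  then show "r v* (transvection \<Delta> v c ** Jm \<Delta>) = r v* (Jm \<Delta> ** transvection \<Delta> v c)"
    by (simp only: vector_matrix_mul_assoc)
qed

lemma level_mult_coprime:
  assumes "coprime N p" "x \<in> \<int>" "real p * x \<in> level_mult N" shows "x \<in> level_mult N"
proof -
  obtain a where a: "x = of_int a" using assms(2) by (auto simp: Ints_def)
  have "real_of_int (int p * a) \<in> level_mult N" using assms(3) by (simp add: a)
  then have "int N dvd int p * a" by (simp only: PZ_of_int)
  moreover have "coprime (int N) (int p)" using assms(1) by simp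
  ultimately have "int N dvd a" by (simp add: coprime_dvd_mult_right_iff)
  then show ?thesis unfolding a PZ_of_int .
qed

lemma int_level_coprime:
  assumes "coprime N p" "\<forall>i j. M $ i $ j \<in> \<int>" "real p *\<^sub>R M \<in> int_level N" shows "M \<in> int_level N"
  using assms level_mult_coprime[OF assms(1) block_ints(3)[OF assms(2)]] by (simp add: int_level_iff)

text \<open>
  Away from \<open>p\<close>, the conjugate \<open>M g M\<inverse>\<close> inherits the congruence to 1 modulo \<open>N\<close> from \<open>g\<close>; since \<open>N\<close> is
  prime to \<open>p\<close>, the denominator \<open>p\<close> does no harm.  It remains to see that this
  conjugate is integral, which holds if \<open>g\<close> preserves \<open>lat M\<close>.
\<close>
lemma unit_groupI:
  assumes N: "coprime N p" and p: "p > 0" and M: "psim (real p) M" "M \<in> int_level N"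
    and g: "psim 1 g" "g ** Jm \<Delta> = Jm \<Delta> ** g"
    and X: "\<forall>i j. X $ i $ j \<in> \<int>" "g = mat 1 + (real N / real p) *\<^sub>R X"
    and lat: "\<And>x. x \<in> lat M \<Longrightarrow> x v* g \<in> lat M"
  shows "g \<in> unit_group N \<Delta> p M"
proof -
  define \<gamma> where "\<gamma> = (1 / real p) *\<^sub>R (M ** g ** adj M)"
  have Mi: "\<forall>i j. M $ i $ j \<in> \<int>" using M(2) by (simp add: int_level_iff)
  have ps: "psim 1 \<gamma>"
  proof -
    have "psim ((1 / real p) * (1 / real p) * (real p * 1 * real p)) \<gamma>"
      unfolding \<gamma>_def using M(1) g(1) p by (intro psim_scaleR psim_mult) simp_all
    then show ?thesis using p by simp
  qed
  have row: "axis i 1 v* \<gamma> \<in> ivec" for i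
  proof -
    have "(axis i 1 v* M) v* g \<in> lat M" by (intro lat) (simp add: lat_def axis_ivec)
    then obtain z where z: "z \<in> ivec" "(axis i 1 v* M) v* g = z v* M" by (auto simp: lat_def)
    have "axis i 1 v* \<gamma> = (1 / real p) *\<^sub>R ((axis i 1 v* M) v* g v* adj M)"
      by (simp add: \<gamma>_def vm_arith vector_matrix_mul_assoc)
    also have "\<dots> = z" unfolding z(2) using p by (simp add: vector_matrix_mul_assoc psim_right[OF M(1)] vm_arith)
    finally show ?thesis using z(1) by simp
  qed
  have \<gamma>i: "\<forall>i j. \<gamma> $ i $ j \<in> \<int>" by (rule ints_of_rows[OF row])
  have e: "real p *\<^sub>R (real p *\<^sub>R \<gamma>) = (real p * real p) *\<^sub>R mat 1 + real N *\<^sub>R (M ** X ** adj M)"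
    unfolding \<gamma>_def X(2) using p by (simp add: mmult_simps psim_right[OF M(1)] scaleR_add_right)
  have iX: "(M ** X ** adj M) $ i $ j \<in> \<int>" for i j
    using Mi X(1) adj_ints[OF Mi] by (intro int_entry_mult) auto
  have "blockC (real p *\<^sub>R (real p *\<^sub>R \<gamma>)) $ i $ j \<in> level_mult N" for i j
    unfolding e using iX by (simp add: level_mult_closed block_ints)
  moreover have "(real p *\<^sub>R (real p *\<^sub>R \<gamma>)) $ i $ j \<in> \<int>" for i j using \<gamma>i by simp
  ultimately have "real p *\<^sub>R (real p *\<^sub>R \<gamma>) \<in> int_level N" by (simp only: int_level_iff) blast
  then have "real p *\<^sub>R \<gamma> \<in> int_level N" by (rule int_level_coprime[OF N, rotated]) (use \<gamma>i in simp)
  then have "\<gamma> \<in> int_level N" by (rule int_level_coprime[OF N \<gamma>i])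
  then show ?thesis using ps g unfolding unit_group_def \<gamma>_def Gamma0_iff by blast
qed

lemma unit_group_mult:
  assumes "p > 0" "psim (real p) M" "g \<in> unit_group N \<Delta> p M" "h \<in> unit_group N \<Delta> p M"
  shows "g ** h \<in> unit_group N \<Delta> p M"
proof -
  have "(1 / real p) *\<^sub>R (M ** (g ** h) ** adj M) = ((1 / real p) *\<^sub>R (M ** g ** adj M)) ** ((1 / real p) *\<^sub>R (M ** h ** adj M))"
  proof -
    have "(M ** g ** adj M) ** (M ** h ** adj M) = M ** g ** (adj M ** M) ** h ** adj M" by (simp add: matrix_mul_assoc)
    also have "\<dots> = real p *\<^sub>R (M ** (g ** h) ** adj M)"
      by (simp add: psim_left[OF assms(2)] mmult_simps matrix_mul_assoc)
    finally show ?thesis using assms(1) by (simp add: mmult_simps)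
  qed
  moreover have "g ** h ** Jm \<Delta> = Jm \<Delta> ** (g ** h)"
  proof -
    have "g ** h ** Jm \<Delta> = g ** (h ** Jm \<Delta>)" by (simp only: matrix_mul_assoc)
    also have "\<dots> = (g ** Jm \<Delta>) ** h" using assms(4) by (simp add: unit_group_def matrix_mul_assoc)
    also have "\<dots> = Jm \<Delta> ** (g ** h)" using assms(3) by (simp add: unit_group_def matrix_mul_assoc)
    finally show ?thesis .
  qed
  ultimately show ?thesis using assms(3,4) psim_mult[of 1 g 1 h] Gamma0_mult by (simp add: unit_group_def)
qed

text \<open>
  If \<open>M g = \<gamma> M\<close>, then \<open>g\<close> permutes the integral combinations of the rows of \<open>M\<close>.
\<close>
lemma unit_group_lat:
  assumes p: "p > 0" and M: "psim (real p) M" "\<forall>i j. M $ i $ j \<in> \<int>" and g: "g \<in> unit_group N \<Delta> p M"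
  shows "x \<in> lat M \<Longrightarrow> x v* g \<in> lat M" "x \<in> lat M \<Longrightarrow> x v* adj g \<in> lat M"
proof -
  define \<gamma> where "\<gamma> = (1 / real p) *\<^sub>R (M ** g ** adj M)"
  have G: "\<gamma> \<in> Gamma0 N" using g by (simp add: unit_group_def \<gamma>_def)
  have Gi: "\<forall>i j. \<gamma> $ i $ j \<in> \<int>" "\<forall>i j. adj \<gamma> $ i $ j \<in> \<int>"
    using G Gamma0_adj[OF G] by (auto simp: Gamma0_iff int_level_iff)
  have e1: "\<gamma> ** M = M ** g" using p by (simp add: \<gamma>_def mmult_simps matrix_mul_assoc[symmetric] psim_left[OF M(1)])
  have "adj \<gamma> = (1 / real p) *\<^sub>R (M ** adj g ** adj M)" by (simp add: \<gamma>_def adj_mult matrix_mul_assoc)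
  then have e2: "adj \<gamma> ** M = M ** adj g" using p by (simp add: mmult_simps matrix_mul_assoc[symmetric] psim_left[OF M(1)])
  assume "x \<in> lat M"
  then obtain r where r: "r \<in> ivec" "x = r v* M" by (auto simp: lat_def)
  have "x v* g = (r v* \<gamma>) v* M" "x v* adj g = (r v* adj \<gamma>) v* M"
    by (simp_all add: r vector_matrix_mul_assoc e1 e2)
  then show "x v* g \<in> lat M" "x v* adj g \<in> lat M" using vm_ivec[OF r(1) Gi(1)] vm_ivec[OF r(1) Gi(2)] by (auto simp: lat_def)
qed

locale lattice_count =
  fixes N \<Delta> p :: nat and M :: rmat6 and e f :: rvec6
  assumes ip: "inert_prime \<Delta> p" and cop: "coprime N p" and pM: "psim (real p) M" and lM: "M \<in> int_level N"
    and ad: "adapted \<Delta> p M e f"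
begin

lemmas D = inert_primeD[OF ip]

lemma Mi: "\<forall>i j. M $ i $ j \<in> \<int>" using lM by (simp add: int_level_iff)

abbreviation "J \<equiv> Jm \<Delta>"
abbreviation "U \<equiv> unit_group N \<Delta> p M"

lemma ef: "e \<in> ivec" "f \<in> ivec" "e \<in> stable_part \<Delta> M" "e \<in> lat M" "e v* J \<in> lat M" "e v* J \<in> ivec" "f v* J \<in> ivec"
  and om_ef: "om e (e v* J) = 0" "om f (f v* J) = 0" "om e (f v* J) = 2" "om e f = 0"
    "om f (e v* J) = 2" "om f e = 0" "om (e v* J) f = -2" "om (e v* J) (f v* J) = 0" "om (f v* J) e = -2"
    "om (e v* J) e = 0" "om (f v* J) f = 0" "om (f v* J) (e v* J) = 0"
  and decomp: "x \<in> stable_part \<Delta> M \<Longrightarrow> \<exists>u\<in>\<int>. \<exists>v\<in>\<int>. \<exists>k\<in>ivec. x = u *\<^sub>R e + v *\<^sub>R (e v* J) + real p *\<^sub>R k"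
proof -
  show *: "e \<in> ivec" "f \<in> ivec" "e \<in> stable_part \<Delta> M"
    "om e (e v* J) = 0" "om f (f v* J) = 0" "om e (f v* J) = 2" "om e f = 0"
    "x \<in> stable_part \<Delta> M \<Longrightarrow> \<exists>u\<in>\<int>. \<exists>v\<in>\<int>. \<exists>k\<in>ivec. x = u *\<^sub>R e + v *\<^sub>R (e v* J) + real p *\<^sub>R k"
    using ad unfolding adapted_def by auto
  then show "e \<in> lat M" "e v* J \<in> lat M" "e v* J \<in> ivec" "f v* J \<in> ivec"
    by (auto simp: stable_part_def vm_Jm_ivec)
  show "om f (e v* J) = 2" using * om_J_sym[of f e] by simp
  then show "om (e v* J) f = -2" using om_anti[of "e v* J" f] by simp
  show "om f e = 0" using * om_anti[of e f] by simp
  show "om (e v* J) (f v* J) = 0" using * by (simp add: om_JJ)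
  then show "om (f v* J) (e v* J) = 0" using om_anti[of "e v* J" "f v* J"] by simp
  show "om (f v* J) e = -2" using * om_anti[of e "f v* J"] by simp
  show "om (e v* J) e = 0" "om (f v* J) f = 0" using * om_anti[of e "e v* J"] om_anti[of f "f v* J"] by simp_all
qed

definition between :: "rvec6 set \<Rightarrow> bool" where
  "between L \<longleftrightarrow> (\<forall>x\<in>L. \<forall>y\<in>L. x + y \<in> L \<and> om x y \<in> \<int> \<and> x v* J \<in> L) \<and> (\<forall>x\<in>L. \<forall>a\<in>\<int>. a *\<^sub>R x \<in> L) \<and>
     (\<forall>x. (\<forall>y\<in>L. om y x \<in> \<int>) \<longrightarrow> x \<in> L) \<and> lat M \<subseteq> L \<and>
     (\<forall>x\<in>L. real p *\<^sub>R x \<in> lat M)"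

lemma between_lat: assumes g: "g \<in> U" shows "between (lat g)"
proof -
  have pg: "psim 1 g" and cg: "g ** J = J ** g" using g by (auto simp: unit_group_def)
  note lg = unit_group_lat[OF D(4) pM Mi g]
  have a1: "x v* J \<in> lat g" if x: "x \<in> lat g" for x
  proof -
    obtain r where r: "r \<in> ivec" "x = r v* g" using x by (auto simp: lat_def)
    have "x v* J = (r v* J) v* g" by (simp add: r vector_matrix_mul_assoc cg)
    then show ?thesis using vm_Jm_ivec[OF r(1)] by (auto simp: lat_def)
  qed
  have a2: "om x y \<in> \<int>" if "x \<in> lat g" "y \<in> lat g" for x y
    using om_lat[OF pg that] by auto
  have a3: "x \<in> lat g" if "\<forall>y\<in>lat g. om y x \<in> \<int>" for x
    by (rule lat_selfdual[OF pg]) (use that in \<open>auto simp: lat_def\<close>)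
  have a4: "x \<in> lat g" if x: "x \<in> lat M" for x
  proof -
    have "x v* adj g \<in> ivec" using lg(2)[OF x] lat_ivec[OF Mi] by blast
    moreover have "x = (x v* adj g) v* g" by (simp add: vector_matrix_mul_assoc psim_left[OF pg] vm_arith)
    ultimately show ?thesis unfolding lat_def by blast
  qed
  have a5: "real p *\<^sub>R x \<in> lat M" if x: "x \<in> lat g" for x
  proof -
    obtain r where r: "r \<in> ivec" "x = r v* g" using x by (auto simp: lat_def)
    have "real p *\<^sub>R x = (real p *\<^sub>R r) v* g" by (simp add: r vm_arith)
    then show ?thesis using lg(1)[OF lat_mult_ivec[OF pM Mi r(1)]] by simp
  qed
  show ?thesis unfolding between_def
    by (intro conjI ballI allI impI subsetI) (rule lat_arith(2)[where M=g] lat_arith(5)[where M=g] a1 a2 a3 a4 a5; assumption)+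
qed

context
  fixes L assumes L: "between L"
begin

lemma bt: "x \<in> L \<Longrightarrow> y \<in> L \<Longrightarrow> x + y \<in> L" "x \<in> L \<Longrightarrow> y \<in> L \<Longrightarrow> om x y \<in> \<int>" "x \<in> L \<Longrightarrow> x v* J \<in> L"
  "x \<in> L \<Longrightarrow> a \<in> \<int> \<Longrightarrow> a *\<^sub>R x \<in> L" "(\<And>y. y \<in> L \<Longrightarrow> om y x \<in> \<int>) \<Longrightarrow> x \<in> L" "x \<in> lat M \<Longrightarrow> x \<in> L"
  "x \<in> L \<Longrightarrow> real p *\<^sub>R x \<in> lat M"
  using L unfolding between_def by blast+

lemma bt_diff: "x \<in> L \<Longrightarrow> y \<in> L \<Longrightarrow> x - y \<in> L"
  using bt(1)[of x "(-1) *\<^sub>R y"] bt(4)[of y "-1"] by simp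

lemma bt_e: "e \<in> L" "e v* J \<in> L" using bt(6) ef by auto

lemma bt_decomp: assumes "x \<in> L"
  obtains u v k where "u \<in> \<int>" "v \<in> \<int>" "k \<in> ivec" "x = k + (1 / real p) *\<^sub>R (u *\<^sub>R e + v *\<^sub>R (e v* J))"
proof -
  have "(real p *\<^sub>R x) v* J \<in> lat M" using bt(7)[OF bt(3)[OF assms]] by (simp add: vm_arith)
  then have "real p *\<^sub>R x \<in> stable_part \<Delta> M" using bt(7)[OF assms] by (simp add: stable_part_def)
  from decomp[OF this] obtain u v k where "u \<in> \<int>" "v \<in> \<int>" "k \<in> ivec"
    "real p *\<^sub>R x = u *\<^sub>R e + v *\<^sub>R (e v* J) + real p *\<^sub>R k" by blast
  moreover from this have "x = k + (1 / real p) *\<^sub>R (u *\<^sub>R e + v *\<^sub>R (e v* J))"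
  proof -
    have "x = (1 / real p) *\<^sub>R (real p *\<^sub>R x)" using D(4) by simp
    also have "\<dots> = k + (1 / real p) *\<^sub>R (u *\<^sub>R e + v *\<^sub>R (e v* J))"
      unfolding \<open>real p *\<^sub>R x = _\<close> using D(4) by (simp add: scaleR_add_right)
    finally show ?thesis .
  qed
  ultimately show ?thesis using that by blast
qed

lemma bt_dual: assumes z: "z \<in> ivec" "om z e \<in> PZ p" "om z (e v* J) \<in> PZ p" shows "z \<in> L"
proof (rule bt(5))
  fix y assume "y \<in> L"
  then obtain u v k where y: "u \<in> \<int>" "v \<in> \<int>" "k \<in> ivec" "y = k + (1 / real p) *\<^sub>R (u *\<^sub>R e + v *\<^sub>R (e v* J))"
    by (rule bt_decomp)
  have "om y z = om k z - (u * (om z e / real p) + v * (om z (e v* J) / real p))"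
    unfolding y(4) by (simp add: om_arith om_anti[of z e] om_anti[of z "e v* J"] algebra_simps add_divide_distrib)
  moreover have "om z e / real p \<in> \<int>" "om z (e v* J) / real p \<in> \<int>" using z(2,3) unfolding PZ_iff[OF D(4)] .
  ultimately show "om y z \<in> \<int>" using om_ints[OF y(3) z(1)] y(1,2) by (simp only: Ints_diff Ints_add Ints_mult)
qed

end

text \<open>
  A self-dual lattice is contained in no other.
\<close>
lemma between_eqI: assumes "between L" "between L'" "L \<subseteq> L'" shows "L = L'"
proof
  show "L' \<subseteq> L"
  proof
    fix y assume "y \<in> L'"
    then show "y \<in> L" using bt(5)[OF assms(1)] bt(2)[OF assms(2)] assms(3) by blast
  qed
qed fact

text \<open>
  The denominator \<open>p\<close> moves the standard lattice while \<open>lat M\<close>, on which \<open>om _ e\<close> is divisible by \<open>p\<close>, is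
  preserved.  The factor \<open>N\<close> makes the congruence condition hold.
\<close>
definition tau :: "real \<Rightarrow> rmat6" where "tau a = transvection \<Delta> e (a * real N / real p)"
text \<open>
  The vector \<open>f\<close> need not lie in \<open>lat M\<close>, but \<open>p f\<close> does; hence the factor \<open>p\<close>.
\<close>
definition tau' :: "real \<Rightarrow> rmat6" where "tau' b = transvection \<Delta> f (b * real N * real p)"

lemma transvection_decomp:
  assumes "v \<in> ivec" "c \<in> \<int>"
  shows "\<exists>X. (\<forall>i j. X $ i $ j \<in> \<int>) \<and> transvection \<Delta> v (c * real N / real p) = mat 1 + (real N / real p) *\<^sub>R X"
proof -
  define X :: rmat6 where "X = c *\<^sub>R (\<chi> i j. real \<Delta> * om (axis i 1) v * v $ j + om (axis i 1) (v v* Jm \<Delta>) * (v v* Jm \<Delta>) $ j)"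
  have a: "axis i 1 \<in> ivec" for i :: "3 + 3" by (simp add: ivec_def axis_def)
  note vJ = vm_Jm_ivec[OF assms(1), of \<Delta>]
  have "X $ i $ j \<in> \<int>" for i j
    using assms vJ om_ints[OF a assms(1)] om_ints[OF a vJ] by (simp add: X_def ivec_def)
  moreover have "transvection \<Delta> v (c * real N / real p) = mat 1 + (real N / real p) *\<^sub>R X"
    by (simp add: transvection_def X_def mult.commute)
  ultimately show ?thesis by blast
qed

lemma tau_U: assumes "a \<in> \<int>" shows "tau a \<in> U"
proof -
  obtain X where X: "\<forall>i j. X $ i $ j \<in> \<int>" "tau a = mat 1 + (real N / real p) *\<^sub>R X"
    using transvection_decomp[OF ef(1) assms] unfolding tau_def by blast
  show ?thesis
  proof (rule unit_groupI[OF cop D(4) pM lM _ _ X])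
    show "psim 1 (tau a)" unfolding tau_def by (rule transvection_psim[OF om_ef(1)])
    show "tau a ** J = J ** tau a" unfolding tau_def by (rule transvection_commutes)
    fix x assume x: "x \<in> lat M"
    obtain k where k: "k \<in> \<int>" "om x e = real p * k" using om_lat[OF pM x ef(4)] by blast
    obtain l where l: "l \<in> \<int>" "om x (e v* J) = real p * l" using om_lat[OF pM x ef(5)] by blast
    have "x v* tau a = x + ((a * real N * real \<Delta> * k) *\<^sub>R e + (a * real N * l) *\<^sub>R (e v* J))"
      unfolding tau_def vm_transvection k l using D(4) by (simp add: scaleR_add_right algebra_simps)
    moreover have "a * real N * real \<Delta> * k \<in> \<int>" "a * real N * l \<in> \<int>" using assms k l by auto
    ultimately show "x v* tau a \<in> lat M" using x ef(4,5) by (auto intro!: lat_arith)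
  qed
qed

lemma tau'_U: assumes "b \<in> \<int>" shows "tau' b \<in> U"
proof -
  have e: "tau' b = transvection \<Delta> f ((b * real p * real p) * real N / real p)"
    using D(4) by (simp add: tau'_def algebra_simps)
  obtain X where X: "\<forall>i j. X $ i $ j \<in> \<int>" "tau' b = mat 1 + (real N / real p) *\<^sub>R X"
    using transvection_decomp[OF ef(2), of "b * real p * real p"] assms unfolding e by auto
  show ?thesis
  proof (rule unit_groupI[OF cop D(4) pM lM _ _ X])
    show "psim 1 (tau' b)" unfolding tau'_def by (rule transvection_psim[OF om_ef(2)])
    show "tau' b ** J = J ** tau' b" unfolding tau'_def by (rule transvection_commutes)
    fix x assume x: "x \<in> lat M"
    then have xi: "x \<in> ivec" using lat_ivec[OF Mi] by blast
    have k: "om x f \<in> \<int>" "om x (f v* J) \<in> \<int>" using om_ints[OF xi ef(2)] om_ints[OF xi ef(7)] by auto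
    have "x v* tau' b = x + real p *\<^sub>R ((b * real N * real \<Delta> * om x f) *\<^sub>R f + (b * real N * om x (f v* J)) *\<^sub>R (f v* J))"
      unfolding tau'_def vm_transvection by (simp add: scaleR_add_right algebra_simps)
    moreover have "(b * real N * real \<Delta> * om x f) *\<^sub>R f + (b * real N * om x (f v* J)) *\<^sub>R (f v* J) \<in> ivec"
      using assms k ef by (intro ivec_arith) auto
    ultimately show "x v* tau' b \<in> lat M" using lat_arith(2)[OF x lat_mult_ivec[OF pM Mi]] by simp
  qed
qed

lemma f_tau: "f v* tau a = f + (2 * a * real N / real p) *\<^sub>R (e v* J)"
  unfolding tau_def vm_transvection by (simp add: om_ef mult.commute)

lemma h_two: obtains h where "h \<in> \<int>" "h * 2 - 1 \<in> PZ p"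
  using PZ_inverse[OF ip, of 2] two_PZ[OF ip] by auto

lemma N_PZ: "real N \<notin> PZ p"
proof
  assume "real N \<in> PZ p"
  then have "int p dvd int N" using PZ_of_int[of "int N" p] by simp
  then have "p dvd N" by simp
  then show False using cop D(5) by (metis coprime_common_divisor_nat dvd_refl less_irrefl)
qed

text \<open>
  Modulo the vectors that \<open>bt_dual\<close> places in every one of the lattices, each lattice of a transvection
  is generated over the integers of \<open>K\<close> by the image of \<open>f\<close>.
\<close>
lemma lat_tau_unique:
  assumes L: "between L" and a: "a \<in> \<int>" and fL: "f v* tau a \<in> L" shows "lat (tau a) = L"
proof (rule between_eqI[OF between_lat[OF tau_U[OF a]] L])
  obtain h where h: "h \<in> \<int>" "h * 2 - 1 \<in> PZ p" by (rule h_two)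
  show "lat (tau a) \<subseteq> L"
  proof
    fix z assume "z \<in> lat (tau a)"
    then obtain r where r: "r \<in> ivec" "z = r v* tau a" by (auto simp: lat_def)
    define m where "m = h * om r (e v* J)" define n where "n = - (h * om r e)"
    have ri: "om r e \<in> \<int>" "om r (e v* J) \<in> \<int>" using om_ints[OF r(1)] ef by auto
    have mn: "m \<in> \<int>" "n \<in> \<int>" using h ri by (simp_all add: m_def n_def)
    define s where "s = r - m *\<^sub>R f - n *\<^sub>R (f v* J)"
    have si: "s \<in> ivec" unfolding s_def by (intro ivec_arith r mn ef)
    have "om s (e v* J) = - ((h * 2 - 1) * om r (e v* J))" by (simp add: s_def om_arith om_ef m_def algebra_simps)
    then have s1: "om s (e v* J) \<in> PZ p" using level_mult_closed(3)[OF level_mult_closed(4)[OF h(2) ri(2)]] by simp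
    have "om s e = - ((h * 2 - 1) * om r e)" by (simp add: s_def om_arith om_ef n_def algebra_simps)
    then have s2: "om s e \<in> PZ p" using level_mult_closed(3)[OF level_mult_closed(4)[OF h(2) ri(1)]] by simp
    have sL: "s \<in> L" by (rule bt_dual[OF L si s2 s1])
    have "s v* tau a = s + ((a * real N * real \<Delta> * (om s e / real p)) *\<^sub>R e + (a * real N * (om s (e v* J) / real p)) *\<^sub>R (e v* J))"
      unfolding tau_def vm_transvection by (simp add: scaleR_add_right algebra_simps)
    moreover have "a * real N * real \<Delta> * (om s e / real p) \<in> \<int>" "a * real N * (om s (e v* J) / real p) \<in> \<int>"
      using a s1 s2 unfolding PZ_iff[OF D(4)] by (simp_all only: Ints_mult Ints_of_nat)
    ultimately have sT: "s v* tau a \<in> L" using sL bt_e[OF L] by (auto intro!: bt(1)[OF L] bt(4)[OF L])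
    have cJ: "(f v* J) v* tau a = (f v* tau a) v* J"
      by (simp add: vector_matrix_mul_assoc tau_def transvection_commutes)
    have "r = s + m *\<^sub>R f + n *\<^sub>R (f v* J)" by (simp add: s_def)
    then have "z = s v* tau a + m *\<^sub>R (f v* tau a) + n *\<^sub>R ((f v* tau a) v* J)"
      unfolding r(2) by (simp only: vm_arith cJ)
    then show "z \<in> L" using sT fL mn bt(3)[OF L fL] by (auto intro!: bt(1)[OF L] bt(4)[OF L])
  qed
qed

text \<open>
  This singles out the lattice given by the isotropic line of \<open>e\<close>: by \<open>degenerate_iff\<close> it contains
  \<open>e / p\<close>.
\<close>
definition degenerate :: "rvec6 set \<Rightarrow> bool" where
  "degenerate L \<longleftrightarrow> (\<forall>x\<in>L. om x e \<in> PZ p \<and> om x (e v* J) \<in> PZ p)"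

lemma degenerate_iff: assumes L: "between L"
  shows "degenerate L \<longleftrightarrow> (1 / real p) *\<^sub>R e \<in> L \<and> (1 / real p) *\<^sub>R (e v* J) \<in> L"
proof
  assume d: "degenerate L"
  have "om y ((1 / real p) *\<^sub>R e) \<in> \<int>" "om y ((1 / real p) *\<^sub>R (e v* J)) \<in> \<int>" if "y \<in> L" for y
    using d that unfolding degenerate_def PZ_iff[OF D(4)] by (auto simp: om_arith)
  then show "(1 / real p) *\<^sub>R e \<in> L \<and> (1 / real p) *\<^sub>R (e v* J) \<in> L" using bt(5)[OF L] by blast
next
  assume "(1 / real p) *\<^sub>R e \<in> L \<and> (1 / real p) *\<^sub>R (e v* J) \<in> L"
  then show "degenerate L" unfolding degenerate_def PZ_iff[OF D(4)]
    using bt(2)[OF L, of _ "(1 / real p) *\<^sub>R e"] bt(2)[OF L, of _ "(1 / real p) *\<^sub>R (e v* J)"] by (auto simp: om_arith)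
qed

lemma degenerate_unique:
  assumes L: "between L" "degenerate L" and L': "between L'" "degenerate L'" shows "L = L'"
proof (rule between_eqI[OF L(1) L'(1)], rule subsetI)
  fix x assume x: "x \<in> L"
  then obtain u v k where k: "u \<in> \<int>" "v \<in> \<int>" "k \<in> ivec" "x = k + (1 / real p) *\<^sub>R (u *\<^sub>R e + v *\<^sub>R (e v* J))"
    by (rule bt_decomp[OF L(1)])
  have "om x e = om k e" "om x (e v* J) = om k (e v* J)" unfolding k(4) by (simp_all add: om_arith om_ef)
  then have "k \<in> L'" using L(2) x by (intro bt_dual[OF L'(1) k(3)]) (auto simp: degenerate_def)
  moreover have "x = k + (u *\<^sub>R ((1 / real p) *\<^sub>R e) + v *\<^sub>R ((1 / real p) *\<^sub>R (e v* J)))"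
    unfolding k(4) by (simp add: scaleR_add_right mult.commute)
  ultimately show "x \<in> L'"
    using degenerate_iff[OF L'(1)] L'(2) k(1,2) by (simp only: bt(1)[OF L'(1)] bt(4)[OF L'(1)] simp_thms)
qed

text \<open>
  A linear congruence with invertible coefficient has a solution among the least residues.
\<close>
lemma residue_ex: assumes "v \<in> \<int>" "c \<in> \<int>" "c \<notin> PZ p" shows "\<exists>a<p. v - c * real a \<in> PZ p"
proof -
  obtain h where h: "h \<in> \<int>" "h * c - 1 \<in> PZ p" using PZ_inverse[OF ip assms(2,3)] by blast
  obtain w where w: "h * v = of_int w" using h assms by (metis Ints_cases Ints_mult)
  define a where "a = nat (w mod int p)"
  have a: "int a = w mod int p" using D(4) by (simp add: a_def)
  have "a < p" using D(4) a pos_mod_bound[of "int p" w] by linarith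
  have "int p dvd w - int a" unfolding a by (simp add: dvd_minus_mod)
  then have "real_of_int (w - int a) \<in> PZ p" by (simp only: PZ_of_int)
  then have "c * (h * v - real a) \<in> PZ p" using assms(2) unfolding w by (intro level_mult_closed(5)) simp_all
  moreover have "v - c * real a = c * (h * v - real a) - (h * c - 1) * v" by (simp add: algebra_simps)
  ultimately have "v - c * real a \<in> PZ p" using PZ_diff level_mult_closed(4)[OF h(2) assms(1)] by simp
  then show ?thesis using \<open>a < p\<close> by blast
qed

lemma two_N: "2 * real N \<in> \<int>" "2 * real N \<notin> PZ p"
  using PZ_prime[OF ip, of 2 "real N"] two_PZ[OF ip] N_PZ by auto

text \<open>
  The lattice contains a vector \<open>w = f + (u e + v e J) / p\<close>.  Isotropy of \<open>w\<close> forces \<open>p\<close> to divide \<open>u\<close>;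
  the residue of \<open>v\<close> modulo \<open>p\<close> is the parameter of the transvection.
\<close>
lemma nondegenerate:
  assumes L: "between L" "\<not> degenerate L" shows "\<exists>a<p. L = lat (tau (real a))"
proof -
  obtain x where x: "x \<in> L" "\<not> (om x e \<in> PZ p \<and> om x (e v* J) \<in> PZ p)" using L(2) by (auto simp: degenerate_def)
  define A B where "A = om x (e v* J)" and "B = om x e"
  have AB: "A \<in> \<int>" "B \<in> \<int>" using bt(2)[OF L(1) x(1)] bt_e[OF L(1)] by (auto simp: A_def B_def)
  define n where "n = A * A + real \<Delta> * (B * B)"
  have n: "n \<in> \<int>" "n \<notin> PZ p" using x(2) inert_form[OF ip AB] AB by (auto simp: n_def A_def B_def)
  obtain h where h: "h \<in> \<int>" "h * n - 1 \<in> PZ p" using PZ_inverse[OF ip n] by blast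
  (* a multiple of x by an element of K whose hermitian product with e is 2 modulo p *)
  define y where "y = (2 * h * A) *\<^sub>R x + (2 * h * B) *\<^sub>R (x v* J)"
  have yL: "y \<in> L" unfolding y_def using h AB x by (intro bt(1)[OF L(1)] bt(4)[OF L(1)] bt(3)[OF L(1)]) auto
  have xJ: "om (x v* J) e = - A" "om (x v* J) (e v* J) = real \<Delta> * B" by (simp_all add: om_Jm[of x] A_def B_def om_JJ)
  have y1: "om y e = 0" by (simp add: y_def om_arith xJ flip: B_def)
  have "om y (e v* J) = 2 * (h * n)" by (simp add: y_def om_arith xJ n_def algebra_simps flip: A_def)
  then have y2: "om y (e v* J) - 2 \<in> PZ p" using level_mult_closed(5)[OF h(2), of 2] by (simp add: algebra_simps)
  obtain u v k where k: "u \<in> \<int>" "v \<in> \<int>" "k \<in> ivec" "y = k + (1 / real p) *\<^sub>R (u *\<^sub>R e + v *\<^sub>R (e v* J))"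
    using bt_decomp[OF L(1) yL] by blast
  have ke: "om k e = om y e" "om k (e v* J) = om y (e v* J)" unfolding k(4) by (simp_all add: om_arith om_ef)
  have kf: "k - f \<in> L"
  proof (rule bt_dual[OF L(1)])
    show "k - f \<in> ivec" using k(3) ef(2) by (rule ivec_arith(3))
    show "om (k - f) e \<in> PZ p" by (simp add: om_arith ke y1 om_ef level_mult_closed(1))
    show "om (k - f) (e v* J) \<in> PZ p" using y2 by (simp add: om_arith ke om_ef)
  qed
  define w where "w = y - (k - f)"
  have wL: "w \<in> L" unfolding w_def by (rule bt_diff[OF L(1) yL kf])
  have we: "w = f + (1 / real p) *\<^sub>R (u *\<^sub>R e + v *\<^sub>R (e v* J))" by (simp add: w_def k(4))
  (* the value of the hermitian form at w, an integer *)
  have "om w (w v* J) = 4 * u / real p"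
    unfolding we by (simp add: om_arith vm_arith vm_Jm_Jm om_ef om_JJ algebra_simps)
  moreover have "om w (w v* J) \<in> \<int>" by (rule bt(2)[OF L(1) wL bt(3)[OF L(1) wL]])
  ultimately have "2 * (2 * u) \<in> PZ p" unfolding PZ_iff[OF D(4)] by simp
  then have "u \<in> PZ p" using PZ_cancel[OF ip _ _ _ two_PZ[OF ip]] k(1) by auto
  then have up: "u / real p \<in> \<int>" unfolding PZ_iff[OF D(4)] .
  obtain a where a: "a < p" "v - 2 * real N * real a \<in> PZ p" using residue_ex[OF k(2) two_N] by blast
  then have vp: "(v - 2 * real N * real a) / real p \<in> \<int>" unfolding PZ_iff[OF D(4)] by blast
  have "f v* tau (real a) = w - (u / real p) *\<^sub>R e - ((v - 2 * real N * real a) / real p) *\<^sub>R (e v* J)"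
    unfolding f_tau we by (simp add: scaleR_add_right diff_divide_distrib scaleR_diff_left algebra_simps)
  also have "\<dots> \<in> L" using bt_e[OF L(1)] up vp wL by (intro bt_diff[OF L(1)] bt(4)[OF L(1)])
  finally have "lat (tau (real a)) = L" by (rule lat_tau_unique[OF L(1) Ints_of_nat])
  then show ?thesis using a(1) by blast
qed

text \<open>
  In the hyperbolic plane, a transvection along \<open>e\<close> followed by a suitable one along \<open>f\<close> moves the line
  of \<open>f\<close> to that of \<open>e\<close>.
\<close>
lemma exists_degenerate: "\<exists>g\<in>U. degenerate (lat g)"
proof -
  have c: "4 * real N * real N * real \<Delta> \<in> \<int>" by simp
  have "4 * real N * real N * real \<Delta> \<notin> PZ p"
  proof
    assume "4 * real N * real N * real \<Delta> \<in> PZ p"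
    then have "(2 * real N) * ((2 * real N) * real \<Delta>) \<in> PZ p" by (simp add: algebra_simps)
    then have "(2 * real N) * real \<Delta> \<in> PZ p" using PZ_cancel[OF ip two_N(1) _ _ two_N(2)] by simp
    then have "real \<Delta> \<in> PZ p" using PZ_cancel[OF ip two_N(1) _ _ two_N(2)] by simp
    then show False using Delta_PZ[OF ip] by simp
  qed
  then obtain b where b: "b \<in> \<int>" "b * (4 * real N * real N * real \<Delta>) - 1 \<in> PZ p" using PZ_inverse[OF ip c] by blast
  (* b is the parameter for which the coefficient of f in its image is divisible by p *)
  define g where "g = tau 1 ** tau' b"
  have g: "g \<in> U" unfolding g_def by (intro unit_group_mult[OF D(4) pM] tau_U tau'_U b) simp
  note L = between_lat[OF g]
  define x where "x = f v* g"
  have xL: "x \<in> lat g" using ef(2) by (simp add: x_def lat_def)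
  have ft: "f v* tau' b = f" unfolding tau'_def vm_transvection by (simp add: om_ef)
  have et: "(e v* J) v* tau' b = e v* J - (2 * b * real N * real p * real \<Delta>) *\<^sub>R f"
    unfolding tau'_def vm_transvection by (simp add: om_ef)
  have "x = f v* tau' b + (2 * real N / real p) *\<^sub>R ((e v* J) v* tau' b)"
    unfolding x_def g_def vector_matrix_mul_assoc[symmetric] f_tau by (simp add: vm_arith)
  then have xe: "x = - ((b * (4 * real N * real N * real \<Delta>) - 1) *\<^sub>R f) + (2 * real N / real p) *\<^sub>R (e v* J)"
    unfolding ft et using D(4) by (simp add: scaleR_diff_right scaleR_diff_left algebra_simps)
  have "real p *\<^sub>R f \<in> lat g"
  proof (rule bt_dual[OF L])
    show "real p *\<^sub>R f \<in> ivec" using ef by (intro ivec_arith) auto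
    show "om (real p *\<^sub>R f) e \<in> PZ p" "om (real p *\<^sub>R f) (e v* J) \<in> PZ p"
      by (simp_all add: om_arith om_ef level_mult_closed)
  qed
  moreover have "(b * (4 * real N * real N * real \<Delta>) - 1) / real p \<in> \<int>" using b(2) unfolding PZ_iff[OF D(4)] .
  ultimately have "((b * (4 * real N * real N * real \<Delta>) - 1) / real p) *\<^sub>R (real p *\<^sub>R f) \<in> lat g" by (rule bt(4)[OF L])
  then have "(b * (4 * real N * real N * real \<Delta>) - 1) *\<^sub>R f \<in> lat g" using D(4) by simp
  from bt(1)[OF L xL this] have 1: "(2 * real N / real p) *\<^sub>R (e v* J) \<in> lat g" unfolding xe by simp
  have div: "(1 / real p) *\<^sub>R z \<in> lat g" if z: "z \<in> lat g" "(c / real p) *\<^sub>R z \<in> lat g" "c \<in> \<int>" "c \<notin> PZ p" for z c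
  proof -
    obtain h where h: "h \<in> \<int>" "h * c - 1 \<in> PZ p" using PZ_inverse[OF ip z(3,4)] by blast
    have hp: "(h * c - 1) / real p \<in> \<int>" using h(2) unfolding PZ_iff[OF D(4)] .
    have "h *\<^sub>R ((c / real p) *\<^sub>R z) - ((h * c - 1) / real p) *\<^sub>R z \<in> lat g"
      by (rule bt_diff[OF L bt(4)[OF L z(2) h(1)] bt(4)[OF L z(1) hp]])
    then show ?thesis by (simp add: diff_divide_distrib scaleR_diff_left)
  qed
  have 2: "(1 / real p) *\<^sub>R (e v* J) \<in> lat g" by (rule div[OF bt_e(2)[OF L] 1 two_N])
  from bt(3)[OF L 2] have "(- real \<Delta> / real p) *\<^sub>R e \<in> lat g" by (simp add: vm_arith vm_Jm_Jm)
  moreover have "- real \<Delta> \<notin> PZ p" using Delta_PZ[OF ip] level_mult_closed(3)[of "- real \<Delta>" p] by auto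
  ultimately have "(1 / real p) *\<^sub>R e \<in> lat g" by (intro div[OF bt_e(1)[OF L]]) auto
  then have "degenerate (lat g)" using 2 unfolding degenerate_iff[OF L] by blast
  then show ?thesis using g by blast
qed

text \<open>
  The \<open>p\<close> lattices of the transvections along \<open>e\<close> and the degenerate one.
\<close>
theorem card_lattices: "finite (lat ` U)" "card (lat ` U) = p + 1"
proof -
  obtain g where g: "g \<in> U" "degenerate (lat g)" using exists_degenerate by blast
  have tL: "between (lat (tau (real a)))" for a by (intro between_lat tau_U) simp
  have fL: "f v* tau a \<in> lat (tau a)" for a using ef(2) by (simp add: lat_def)
  have nd: "\<not> degenerate (lat (tau (real a)))" for a
  proof
    assume "degenerate (lat (tau (real a)))"
    then have "om (f v* tau (real a)) (e v* J) \<in> PZ p" using fL by (auto simp: degenerate_def)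
    then show False using two_PZ[OF ip] by (simp add: f_tau om_arith om_ef)
  qed
  have inj: "inj_on (\<lambda>a. lat (tau (real a))) {..<p}"
  proof (rule inj_onI)
    fix a b assume ab: "a \<in> {..<p}" "b \<in> {..<p}" "lat (tau (real a)) = lat (tau (real b))"
    have fa: "f v* tau (real a) \<in> lat (tau (real a))" "f v* tau (real b) \<in> lat (tau (real a))"
      using fL ab(3) by auto
    have "om (f v* tau (real a)) (f v* tau (real b)) \<in> \<int>" by (rule bt(2)[OF tL fa])
    then have "2 * (2 * real N * (real b - real a)) \<in> PZ p"
      unfolding PZ_iff[OF D(4)] by (simp add: f_tau om_arith om_ef diff_divide_distrib algebra_simps)
    then have "2 * real N * (real b - real a) \<in> PZ p" using PZ_cancel[OF ip _ _ _ two_PZ[OF ip]] by auto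
    then have "real b - real a \<in> PZ p" using PZ_cancel[OF ip two_N(1) _ _ two_N(2)] by auto
    then have "int p dvd int b - int a" using PZ_of_int[of "int b - int a" p] by simp
    then have "int b mod int p = int a mod int p" by (simp add: mod_eq_dvd_iff)
    then show "a = b" using ab(1,2) by simp
  qed
  have e: "lat ` U = insert (lat g) ((\<lambda>a. lat (tau (real a))) ` {..<p})"
  proof (intro equalityI subsetI)
    fix L assume "L \<in> lat ` U"
    then have L: "between L" using between_lat by blast
    show "L \<in> insert (lat g) ((\<lambda>a. lat (tau (real a))) ` {..<p})"
    proof (cases "degenerate L")
      case True
      then show ?thesis using degenerate_unique[OF L True between_lat[OF g(1)] g(2)] by simp
    next
      case False
      then show ?thesis using nondegenerate[OF L False] by auto
    qed
  next
    fix L assume "L \<in> insert (lat g) ((\<lambda>a. lat (tau (real a))) ` {..<p})"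
    then show "L \<in> lat ` U" using g(1) tau_U by auto
  qed
  show "finite (lat ` U)" unfolding e by simp
  have "lat g \<notin> (\<lambda>a. lat (tau (real a))) ` {..<p}" using g(2) nd by auto
  then show "card (lat ` U) = p + 1" unfolding e by (simp add: card_image[OF inj])
qed

end

section \<open>Fibres of the second projection\<close>

text \<open>
  The similitude \<open>g = M\<inverse> \<gamma> M'\<close> commutes with \<open>J\<close> and maps \<open>lat M\<close> to \<open>lat M'\<close>.  If the stable part for
  \<open>M'\<close> were \<open>p\<close> times the integral vectors, then \<open>g\<close> would be integral, hence invertible over the
  integers, and it would map the stable vector into \<open>p\<close> times the integral vectors.
\<close>
lemma stable_vector_transfer:
  assumes p: "p > 0" and M: "psim (real p) M" "\<forall>i j. M $ i $ j \<in> \<int>" and M': "psim (real p) M'" "\<forall>i j. M' $ i $ j \<in> \<int>"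
    and \<gamma>: "\<gamma> \<in> Gamma0 N" and com: "(adj M ** \<gamma> ** M') ** Jm \<Delta> = Jm \<Delta> ** (adj M ** \<gamma> ** M')"
    and y: "stable_vector \<Delta> p M y"
  shows "\<exists>z. stable_vector \<Delta> p M' z"
proof (rule ccontr)
  assume no: "\<not> ?thesis"
  define g where "g = (1 / real p) *\<^sub>R (adj M ** \<gamma> ** M')"
  have pg: "psim 1 g"
  proof -
    have "psim ((1 / real p) * (1 / real p) * (real p * 1 * real p)) g"
      unfolding g_def using M(1) M'(1) Gamma0_psim[OF \<gamma>] p by (intro psim_scaleR psim_mult) simp_all
    then show ?thesis using p by simp
  qed
  have Mg: "M ** g = \<gamma> ** M'"
    using p by (simp add: g_def mmult_simps matrix_mul_assoc psim_right[OF M(1)])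
  have "adj \<gamma> ** (M ** g) = M'" unfolding Mg by (simp add: matrix_mul_assoc psim_left[OF Gamma0_psim[OF \<gamma>]])
  have gJ: "g ** Jm \<Delta> = Jm \<Delta> ** g" using com by (simp add: g_def mmult_simps)
  have Gi: "\<forall>i j. \<gamma> $ i $ j \<in> \<int>" using \<gamma> by (auto simp: Gamma0_iff int_level_iff)
  have lat: "x v* g \<in> lat M'" if x: "x \<in> lat M" for x
  proof -
    obtain r where r: "r \<in> ivec" "x = r v* M" using x by (auto simp: lat_def)
    have "x v* g = (r v* \<gamma>) v* M'" by (simp add: r vector_matrix_mul_assoc Mg)
    then show ?thesis using vm_ivec[OF r(1) Gi] by (auto simp: lat_def)
  qed
  have key: "(1 / real p) *\<^sub>R (x v* g) \<in> ivec" if x: "x \<in> stable_part \<Delta> M" for x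
  proof (rule ccontr)
    assume n: "(1 / real p) *\<^sub>R (x v* g) \<notin> ivec"
    have "(x v* g) v* Jm \<Delta> = (x v* Jm \<Delta>) v* g" by (simp add: vector_matrix_mul_assoc gJ)
    then have "x v* g \<in> lat M'" "(x v* g) v* Jm \<Delta> \<in> lat M'" using lat x by (auto simp: stable_part_def)
    moreover have "x v* g \<in> ivec" using calculation(1) lat_ivec[OF M'(2)] by blast
    ultimately show False using no n unfolding stable_vector_def by blast
  qed
  have iv: "r v* g \<in> ivec" if r: "r \<in> ivec" for r
    using key[OF stable_part_mult_ivec[OF M r]] p by (simp add: vm_arith)
  have gint: "\<forall>i j. g $ i $ j \<in> \<int>" by (rule ints_of_rows[OF iv[OF axis_ivec]])
  have ys: "y \<in> stable_part \<Delta> M" using y by (simp add: stable_vector_def stable_part_def)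
  have "((1 / real p) *\<^sub>R (y v* g)) v* adj g \<in> ivec"
    by (rule vm_ivec[OF key[OF ys]]) (use adj_ints[OF gint] in blast)
  moreover have "((1 / real p) *\<^sub>R (y v* g)) v* adj g = (1 / real p) *\<^sub>R y"
    by (simp add: vm_arith vector_matrix_mul_assoc psim_right[OF pg])
  ultimately show False using y by (simp add: stable_vector_def)
qed

lemma unit_norm_integral:
  assumes ip: "inert_prime \<Delta> p" and a: "real p * a \<in> \<int>" "real p * b \<in> \<int>"
    and n: "a * a + real \<Delta> * (b * b) \<in> \<int>"
  shows "a \<in> \<int> \<and> b \<in> \<int>"
proof -
  note D = inert_primeD[OF ip]
  have "(real p * a) * (real p * a) + real \<Delta> * ((real p * b) * (real p * b)) = real p * (real p * (a * a + real \<Delta> * (b * b)))"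
    by (simp add: algebra_simps)
  also have "\<dots> \<in> PZ p" using n by (intro level_mult_closed(6)) simp
  finally have "real p * a \<in> PZ p \<and> real p * b \<in> PZ p" by (rule inert_form[OF ip a])
  then show ?thesis using D(4) by (simp add: PZ_iff)
qed

text \<open>
  A point of the ball fixed by none of these matrices counts as generic: its endomorphisms of bounded
  degree are those of the whole ball.
\<close>
definition special :: "nat \<Rightarrow> real \<Rightarrow> rmat6 set" where
  "special \<Delta> k = {x \<in> int_sim k. \<exists>Z\<in>Vset \<Delta>. \<not> moves x Z Z}"

text \<open>
  Otherwise the ball would be covered by the fixed loci of conjugates of special matrices, so by one
  of them.  The conjugating similitude then commutes with \<open>J\<close> and maps the ball to itself, and the
  special matrix would fix the ball pointwise.
\<close>
lemma special_piece_proper: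
  assumes D: "\<Delta> > 0" and M: "M \<in> int_sim m" "psim c M"
  shows "piece N \<Delta> M (special \<Delta> k) \<noteq> full_piece N \<Delta> M"
proof
  assume e: "piece N \<Delta> M (special \<Delta> k) = full_piece N \<Delta> M"
  define H where "H = (\<lambda>\<gamma>. adj M ** \<gamma> ** M) ` Gamma0 N"
  define P where "P = (\<lambda>(h, x). (h ** Jm \<Delta> ** adj h, h ** x ** adj h)) ` (H \<times> special \<Delta> k)"
  have H: "h \<in> int_sim (m * 1 * m) \<and> psim (c * 1 * c) h" if hh: "h \<in> H" for h
  proof -
    obtain \<gamma> where g: "\<gamma> \<in> Gamma0 N" and h: "h = adj M ** \<gamma> ** M" using hh by (auto simp: H_def)
    have "psim c (adj M)" using M(2) by simp
    from psim_mult[OF psim_mult[OF this Gamma0_psim[OF g]] M(2)]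
      int_sim_mult[OF int_sim_mult[OF int_sim_adj[OF M(1)] int_sim_Gamma0[OF g]] M(1)]
    show ?thesis unfolding h by blast
  qed
  define K where "K = max ((m * 1 * m) * real \<Delta> * (m * 1 * m)) ((m * 1 * m) * k * (m * 1 * m))"
  have P: "P \<subseteq> int_sim K \<times> int_sim K"
  proof
    fix q assume "q \<in> P"
    then obtain h x where q: "h \<in> H" "x \<in> special \<Delta> k" "q = (h ** Jm \<Delta> ** adj h, h ** x ** adj h)" by (auto simp: P_def)
    have xi: "x \<in> int_sim k" using q(2) by (simp add: special_def)
    have hi: "h \<in> int_sim (m * 1 * m)" using H[OF q(1)] by blast
    have "h ** Jm \<Delta> ** adj h \<in> int_sim ((m * 1 * m) * real \<Delta> * (m * 1 * m))"
      by (intro int_sim_mult int_sim_adj int_sim_Jm[OF D] hi)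
    moreover have "h ** x ** adj h \<in> int_sim ((m * 1 * m) * k * (m * 1 * m))"
      by (intro int_sim_mult int_sim_adj xi hi)
    ultimately have "h ** Jm \<Delta> ** adj h \<in> int_sim K" "h ** x ** adj h \<in> int_sim K"
      unfolding K_def by (auto elim: int_sim_mono[rotated])
    then show "q \<in> int_sim K \<times> int_sim K" by (simp add: q)
  qed
  have "Vset \<Delta> \<subseteq> {} \<union> (\<Union>q\<in>P. fix_set q)"
  proof
    fix Z assume Z: "Z \<in> Vset \<Delta>"
    note Zs = Vset_siegel[OF Z]
    have "siegel_pt N (siegel_act M Z) \<in> piece N \<Delta> M (special \<Delta> k)" unfolding e full_piece_image using Z by blast
    then obtain W x where W: "W \<in> Vset \<Delta>" "x \<in> special \<Delta> k" "moves x W W" "siegel_pt N (siegel_act M Z) = siegel_pt N (siegel_act M W)"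
      unfolding piece_def by blast
    note Ws = Vset_siegel[OF W(1)]
    obtain \<gamma> where g: "\<gamma> \<in> Gamma0 N" "siegel_act M Z = siegel_act \<gamma> (siegel_act M W)"
      using W(4) siegel_pt_eq[OF act_siegel[OF M(2) Ws] act_siegel[OF M(2) Zs]] by metis
    define h where "h = adj M ** \<gamma> ** M"
    have hH: "h \<in> H" using g by (simp add: H_def h_def)
    have "moves (adj M ** (\<gamma> ** M)) W Z"
    proof (rule moves_comp(1), rule moves_comp(1))
      show "moves M W (siegel_act M W)" by (rule act_moves[OF M(2) Ws])
      show "moves \<gamma> (siegel_act M W) (siegel_act M Z)"
        unfolding g(2) by (rule act_moves[OF Gamma0_psim[OF g(1)] act_siegel[OF M(2) Ws]])
      show "moves (adj M) (siegel_act M Z) Z" by (rule moves_adj[OF M(2) Zs act_moves[OF M(2) Zs]])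
    qed
    then have hW: "Z = siegel_act h W" using moves_iff_act[OF conjunct2[OF H[OF hH]] Ws] by (simp add: h_def matrix_mul_assoc)
    have "Z \<in> fix_set (h ** Jm \<Delta> ** adj h, h ** x ** adj h)"
      using fix_conj[OF conjunct2[OF H[OF hH]] Ws] W Zs by (simp add: fix_set_def hW[symmetric] Vset_def)
    then show "Z \<in> {} \<union> (\<Union>q\<in>P. fix_set q)" using hH W(2) unfolding P_def by blast
  qed
  from Vset_cover[OF D analytic_empty P this] Vset_nonempty[OF D]
  obtain q where q: "q \<in> P" "Vset \<Delta> \<subseteq> fix_set q" by blast
  from q(1) obtain h x where hx: "h \<in> H" "x \<in> special \<Delta> k" "q = (h ** Jm \<Delta> ** adj h, h ** x ** adj h)" by (auto simp: P_def)
  have ph: "psim (c * 1 * c) h" using H[OF hx(1)] by blast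
  have com: "h ** Jm \<Delta> = Jm \<Delta> ** h" by (rule Vset_sub_fix_commutes[OF D ph q(2)[unfolded hx(3)]])
  have "moves x W W" if W: "W \<in> Vset \<Delta>" for W
  proof -
    have "siegel_act h W \<in> Vset \<Delta>" using Vset_commute[OF ph com Vset_siegel[OF W]] W by simp
    then have "siegel_act h W \<in> fix_set (h ** Jm \<Delta> ** adj h, h ** x ** adj h)" using q(2) hx(3) by blast
    then show ?thesis using fix_conj[OF ph Vset_siegel[OF W], of x] by (simp add: fix_set_def)
  qed
  then show False using hx(2) by (simp add: special_def)
qed

lemma commutant_form:
  assumes D: "\<Delta> > 0" and x: "\<And>Z. Z \<in> Vset \<Delta> \<Longrightarrow> moves x Z Z"
  obtains l m where "x = l *\<^sub>R mat 1 + m *\<^sub>R Jm \<Delta>"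
  using fix_test_points[OF D x] by blast

text \<open>
  A point of the graph above the class of \<open>M Z\<close> comes from some \<open>W\<close> in the ball with \<open>M W\<close> and \<open>M Z\<close>
  equivalent, so that \<open>W = g Z\<close> with \<open>g = M\<inverse> \<gamma> M\<close>.  The conjugate of \<open>J\<close> by the inverse of \<open>g\<close> fixes
  \<open>Z\<close>; as \<open>Z\<close> is generic, it fixes the ball, and \<open>g\<close> commutes with \<open>J\<close>.  If \<open>g Z\<close> and \<open>g' Z\<close> are equivalent
  under \<open>c\<close>, then \<open>g'\<inverse> c g\<close> fixes the generic point \<open>Z\<close>; it is a combination \<open>a + b J\<close> of norm one, and
  integral by \<open>unit_norm_integral\<close>, so it does not change the lattice of \<open>g'\<close>.
\<close>
lemma fibre_description:
  assumes ip: "inert_prime \<Delta> p" and cop: "coprime N p" and pM: "psim (real p) M" and lM: "M \<in> int_level N"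
    and Z: "Z \<in> Vset \<Delta>" and gen: "\<And>x. x \<in> special \<Delta> k \<Longrightarrow> \<not> moves x Z Z"
    and k: "k \<ge> real p * real p * real \<Delta> * (real p * real p)" "k \<ge> real p * real p * (real p * real p)"
  shows "bij_betw (\<lambda>L. (siegel_pt N (siegel_act (SOME g. g \<in> unit_group N \<Delta> p M \<and> lat g = L) Z), siegel_pt N (siegel_act M Z)))
     (lat ` unit_group N \<Delta> p M) {x \<in> graph_piece N \<Delta> M. snd x = siegel_pt N (siegel_act M Z)}"
proof -
  note D = inert_primeD[OF ip]
  note Zs = Vset_siegel[OF Z]
  let ?U = "unit_group N \<Delta> p M"
  let ?u = "siegel_pt N (siegel_act M Z)"
  have Ms: "M \<in> int_sim (real p)" by (rule int_sim_I[OF lM pM])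
  have U: "psim 1 g" "g ** Jm \<Delta> = Jm \<Delta> ** g" "(1 / real p) *\<^sub>R (M ** g ** adj M) \<in> Gamma0 N" if "g \<in> ?U" for g
    using that by (auto simp: unit_group_def)
  have p_int: "real p *\<^sub>R g \<in> int_level N" if g: "g \<in> ?U" for g
  proof -
    define \<gamma> where "\<gamma> = (1 / real p) *\<^sub>R (M ** g ** adj M)"
    have "adj M ** \<gamma> ** M = (1 / real p) *\<^sub>R ((adj M ** M) ** g ** (adj M ** M))"
      unfolding \<gamma>_def by (simp add: mmult_simps matrix_mul_assoc)
    also have "\<dots> = real p *\<^sub>R g" using D(4) by (simp add: psim_left[OF pM] mmult_simps)
    finally have e: "real p *\<^sub>R g = adj M ** \<gamma> ** M" by simp
    show ?thesis unfolding e
      using U(3)[OF g] lM by (intro int_level_mult int_level_adj) (simp_all add: \<gamma>_def Gamma0_iff)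
  qed
  have inV: "siegel_act g Z \<in> Vset \<Delta>" if g: "g \<in> ?U" for g
    using Vset_commute[OF U(1,2)[OF g] Zs] Z by simp
  have fib: "siegel_pt N (siegel_act M (siegel_act g Z)) = ?u" if g: "g \<in> ?U" for g
  proof -
    define \<gamma> where "\<gamma> = (1 / real p) *\<^sub>R (M ** g ** adj M)"
    have G: "\<gamma> \<in> Gamma0 N" using U(3)[OF g] by (simp add: \<gamma>_def)
    have "\<gamma> ** M = M ** g" using D(4) by (simp add: \<gamma>_def mmult_simps matrix_mul_assoc[symmetric] psim_left[OF pM])
    then have "siegel_act M (siegel_act g Z) = siegel_act \<gamma> (siegel_act M Z)"
      using act_mult[OF U(1)[OF g] pM Zs] act_mult[OF pM Gamma0_psim[OF G] Zs] by simp
    then show ?thesis using siegel_pt_act[OF G act_siegel[OF pM Zs]] by simp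
  qed
  have same: "siegel_pt N (siegel_act g Z) = siegel_pt N (siegel_act g' Z) \<longleftrightarrow> lat g = lat g'" if g: "g \<in> ?U" "g' \<in> ?U" for g g'
  proof
    note pg = U(1)[OF g(1)] and pg' = U(1)[OF g(2)]
    have gs: "siegel_act g Z \<in> siegel_space" "siegel_act g' Z \<in> siegel_space" using inV g Vset_siegel by blast+
    assume eq: "lat g = lat g'"
    define c where "c = g' ** adj g"
    have pc: "psim 1 c" unfolding c_def using psim_mult[OF pg', of 1 "adj g"] pg by simp
    have ci: "\<forall>i j. c $ i $ j \<in> \<int>"
    proof (rule ints_of_rows)
      fix i
      have "axis i 1 v* g' \<in> lat g" unfolding eq using axis_ivec by (simp add: lat_def)
      then obtain r where r: "r \<in> ivec" "axis i 1 v* g' = r v* g" by (auto simp: lat_def)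
      have "axis i 1 v* c = (axis i 1 v* g') v* adj g" by (simp add: c_def vector_matrix_mul_assoc)
      also have "\<dots> = r" unfolding r(2) by (simp add: vector_matrix_mul_assoc psim_right[OF pg] vm_arith)
      finally show "axis i 1 v* c \<in> ivec" using r(1) by simp
    qed
    have "real p *\<^sub>R (real p *\<^sub>R c) = (real p *\<^sub>R g') ** adj (real p *\<^sub>R g)"
      by (simp add: c_def mmult_simps)
    also have "\<dots> \<in> int_level N" by (intro int_level_mult int_level_adj p_int g)
    finally have "real p *\<^sub>R c \<in> int_level N" by (rule int_level_coprime[OF cop, rotated]) (use ci in simp)
    then have "c \<in> int_level N" by (rule int_level_coprime[OF cop ci])
    then have cG: "c \<in> Gamma0 N" using pc by (simp add: Gamma0_iff)
    have "c ** g = g'" by (simp add: c_def matrix_mul_assoc[symmetric] psim_left[OF pg])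
    then have "siegel_act g' Z = siegel_act c (siegel_act g Z)" using act_mult[OF pg pc Zs] by simp
    then show "siegel_pt N (siegel_act g Z) = siegel_pt N (siegel_act g' Z)" using siegel_pt_act[OF cG gs(1)] by simp
  next
    note pg = U(1)[OF g(1)] and pg' = U(1)[OF g(2)]
    have gs: "siegel_act g Z \<in> siegel_space" "siegel_act g' Z \<in> siegel_space" using inV g Vset_siegel by blast+
    assume "siegel_pt N (siegel_act g Z) = siegel_pt N (siegel_act g' Z)"
    then obtain c where c: "c \<in> Gamma0 N" "siegel_act g' Z = siegel_act c (siegel_act g Z)" using siegel_pt_eq[OF gs] by blast
    note pc = Gamma0_psim[OF c(1)]
    (* d is the inverse of g' times c g *)
    define d where "d = adj g' ** (c ** g)"
    have pd: "psim (1 * (1 * 1)) d" unfolding d_def by (intro psim_mult pc pg) (simp add: pg')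
    have "moves d Z Z" unfolding d_def
    proof (rule moves_comp(1), rule moves_comp(1))
      show "moves g Z (siegel_act g Z)" by (rule act_moves[OF pg Zs])
      show "moves c (siegel_act g Z) (siegel_act g' Z)" unfolding c(2) by (rule act_moves[OF pc gs(1)])
      show "moves (adj g') (siegel_act g' Z) Z" by (rule moves_adj[OF pg' Zs act_moves[OF pg' Zs]])
    qed
    define x where "x = (real p * real p) *\<^sub>R d"
    have xm: "moves x Z Z" using \<open>moves d Z Z\<close> D(4) by (simp add: x_def moves_scaleR)
    have "x = adj (real p *\<^sub>R g') ** (c ** (real p *\<^sub>R g))" by (simp add: x_def d_def mmult_simps)
    also have "\<dots> \<in> int_level N" using c(1) by (intro int_level_mult int_level_adj p_int g) (simp add: Gamma0_iff)
    finally have xl: "x \<in> int_level N" .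
    have "psim (real p * real p * (real p * real p) * 1) x" unfolding x_def using psim_scaleR[OF pd, of "real p * real p"] D(4) by simp
    then have "x \<in> int_sim k" using int_sim_mono[OF k(2)] int_sim_I[OF xl] by simp
    then have "moves x W W" if "W \<in> Vset \<Delta>" for W using gen[of x] xm that by (auto simp: special_def)
    then obtain l m where lm: "x = l *\<^sub>R mat 1 + m *\<^sub>R Jm \<Delta>" using commutant_form[OF D(1)] by metis
    define a b where "a = l / (real p * real p)" and "b = m / (real p * real p)"
    have dx: "d = (1 / (real p * real p)) *\<^sub>R x" using D(4) by (simp add: x_def)
    have dab: "d = a *\<^sub>R mat 1 + b *\<^sub>R Jm \<Delta>" unfolding dx lm by (simp add: a_def b_def scaleR_add_right)
    have xe: "\<forall>i j. x $ i $ j \<in> \<int>" using xl by (simp add: int_level_iff)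
    have "blockA x = l *\<^sub>R mat 1" unfolding lm by simp
    then have "l = blockA x $ 1 $ 1" by (simp add: mat_def)
    then have "l \<in> \<int>" using block_ints(1)[OF xe] by simp
    have "m = blockB x $ 1 $ 1" unfolding lm by (simp add: Emat_nth)
    then have "m \<in> \<int>" using block_ints(2)[OF xe] by simp
    have n: "a * a + real \<Delta> * (b * b) = 1"
    proof -
      have "d ** adj d = (a * a + real \<Delta> * (b * b)) *\<^sub>R mat 1"
      proof -
        have ad: "adj d = a *\<^sub>R mat 1 - b *\<^sub>R Jm \<Delta>"
        proof -
          have "adj (X + Y) = adj X + adj Y" for X Y by (rule blocks_eqI) simp_all
          then show ?thesis unfolding dab by (simp add: adj_Jm)
        qed
        show ?thesis unfolding ad unfolding dab by (simp add: mmult_simps Jm_square) (simp add: vec_eq_iff algebra_simps)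
      qed
      moreover have "d ** adj d = 1 *\<^sub>R mat 1" using psim_right[OF pd] by simp
      ultimately have "(a * a + real \<Delta> * (b * b)) *\<^sub>R (mat 1 :: rmat6) = 1 *\<^sub>R mat 1" by simp
      from arg_cong[OF this, of "\<lambda>X. X $ Inl 1 $ Inl 1"] show ?thesis by (simp add: mat_def)
    qed
    have pab: "real p * (real p * a) \<in> \<int>" "real p * (real p * b) \<in> \<int>"
      using \<open>l \<in> \<int>\<close> \<open>m \<in> \<int>\<close> D(4) by (simp_all add: a_def b_def)
    have "(real p * a) * (real p * a) + real \<Delta> * ((real p * b) * (real p * b)) = real p * real p * (a * a + real \<Delta> * (b * b))"
      by (simp add: algebra_simps)
    then have "(real p * a) * (real p * a) + real \<Delta> * ((real p * b) * (real p * b)) \<in> \<int>" unfolding n by simp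
    from unit_norm_integral[OF ip pab this] have "a \<in> \<int> \<and> b \<in> \<int>"
      using unit_norm_integral[OF ip, of a b] n by simp
    then have di: "\<forall>i j. d $ i $ j \<in> \<int>" unfolding dab using Jm_ints by (simp add: mat_def)
    have dJ: "d ** g' = g' ** d" unfolding dab using U(2)[OF g(2)] by (simp add: mmult_simps)
    have cg: "c ** g = g' ** d" by (simp add: d_def matrix_mul_assoc psim_right[OF pg'])
    have uni: "lat (A ** B) = lat B" if A: "psim 1 A" "\<forall>i j. A $ i $ j \<in> \<int>" for A B
    proof (intro equalityI subsetI)
      fix v assume "v \<in> lat (A ** B)"
      then obtain r where "r \<in> ivec" "v = (r v* A) v* B" by (auto simp: lat_def vector_matrix_mul_assoc)
      then show "v \<in> lat B" using vm_ivec[OF _ A(2)] by (auto simp: lat_def)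
    next
      fix v assume "v \<in> lat B"
      then obtain r where r: "r \<in> ivec" "v = r v* B" by (auto simp: lat_def)
      have "v = (r v* adj A) v* (A ** B)"
        by (simp add: r(2) vector_matrix_mul_assoc matrix_mul_assoc[of "adj A"] psim_left[OF A(1)])
      moreover have "r v* adj A \<in> ivec" by (rule vm_ivec[OF r(1)]) (use adj_ints[OF A(2)] in blast)
      ultimately show "v \<in> lat (A ** B)" by (auto simp: lat_def)
    qed
    have "lat g = lat (c ** g)" using uni[OF pc] c(1) by (simp add: Gamma0_iff int_level_iff)
    also have "\<dots> = lat (d ** g')" unfolding cg dJ ..
    also have "\<dots> = lat g'" using uni[OF _ di] pd by simp
    finally show "lat g = lat g'" .
  qed
  have surj: "\<exists>g\<in>?U. siegel_pt N W = siegel_pt N (siegel_act g Z)" if W: "W \<in> Vset \<Delta>" "siegel_pt N (siegel_act M W) = ?u" for W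
  proof -
    note Ws = Vset_siegel[OF W(1)]
    obtain \<gamma> where G: "\<gamma> \<in> Gamma0 N" "siegel_act M W = siegel_act \<gamma> (siegel_act M Z)"
      using siegel_pt_eq[OF act_siegel[OF pM Zs] act_siegel[OF pM Ws]] W(2) by metis
    note pG = Gamma0_psim[OF G(1)]
    define h where "h = adj M ** (\<gamma> ** M)"
    have ph: "psim (real p * (1 * real p)) h" unfolding h_def by (intro psim_mult pG pM) (simp add: pM)
    have hi: "h \<in> int_sim (real p * (1 * real p))"
      unfolding h_def by (intro int_sim_mult int_sim_adj Ms int_sim_Gamma0[OF G(1)])
    have "moves h Z W" unfolding h_def
    proof (rule moves_comp(1), rule moves_comp(1))
      show "moves M Z (siegel_act M Z)" by (rule act_moves[OF pM Zs])
      show "moves \<gamma> (siegel_act M Z) (siegel_act M W)" unfolding G(2) by (rule act_moves[OF pG act_siegel[OF pM Zs]])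
      show "moves (adj M) (siegel_act M W) W" by (rule moves_adj[OF pM Ws act_moves[OF pM Ws]])
    qed
    then have hZ: "W = siegel_act h Z" using moves_iff_act[OF ph Zs] by simp
    have pah: "psim (real p * (1 * real p)) (adj h)" using ph by simp
    have "Z = siegel_act (adj h) W" unfolding hZ by (rule act_adj(1)[OF ph Zs, symmetric])
    then have xm: "moves (adj h ** Jm \<Delta> ** adj (adj h)) Z Z"
      using fix_conj[OF pah Ws, of "Jm \<Delta>"] W(1) by (simp add: Vset_def)
    have "adj h ** Jm \<Delta> ** adj (adj h) \<in> int_sim (real p * (1 * real p) * real \<Delta> * (real p * (1 * real p)))"
      by (intro int_sim_mult int_sim_adj hi int_sim_Jm[OF D(1)])
    then have "adj h ** Jm \<Delta> ** adj (adj h) \<in> int_sim k" by (rule int_sim_mono[rotated]) (use k in simp)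
    then have all: "moves (adj h ** Jm \<Delta> ** adj (adj h)) Z' Z'" if "Z' \<in> Vset \<Delta>" for Z'
      using gen[of "adj h ** Jm \<Delta> ** adj (adj h)"] xm that by (auto simp: special_def)
    have cadj: "adj h ** Jm \<Delta> = Jm \<Delta> ** adj h" by (rule normalizer_commutes[OF D(1) pah all])
    have ch: "h ** Jm \<Delta> = Jm \<Delta> ** h"
      using arg_cong[OF cadj, of adj] by (simp add: adj_mult adj_Jm mmult_simps)
    define g where "g = (1 / real p) *\<^sub>R h"
    have "g \<in> ?U" unfolding unit_group_def
    proof (intro CollectI conjI)
      have "psim ((1 / real p) * (1 / real p) * (real p * (1 * real p))) g" unfolding g_def using D(4) by (intro psim_scaleR ph) simp
      then show "psim 1 g" using D(4) by simp
      show "g ** Jm \<Delta> = Jm \<Delta> ** g" using ch by (simp add: g_def mmult_simps)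
      have "M ** g ** adj M = (1 / real p) *\<^sub>R ((M ** adj M) ** \<gamma> ** (M ** adj M))"
        by (simp add: g_def h_def mmult_simps matrix_mul_assoc)
      also have "\<dots> = real p *\<^sub>R \<gamma>" using D(4) by (simp add: psim_right[OF pM] mmult_simps)
      finally show "(1 / real p) *\<^sub>R (M ** g ** adj M) \<in> Gamma0 N" using G(1) D(4) by simp
    qed
    moreover have "siegel_act g Z = W" unfolding g_def hZ using D(4) by (intro act_scaleR[OF ph _ Zs]) simp
    ultimately show ?thesis by metis
  qed
  define pick where "pick L = (SOME g. g \<in> ?U \<and> lat g = L)" for L
  have pick: "pick L \<in> ?U \<and> lat (pick L) = L" if "L \<in> lat ` ?U" for L
    unfolding pick_def by (rule someI_ex) (use that in blast)
  show ?thesis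
    unfolding bij_betw_def pick_def[symmetric]
  proof
    show "inj_on (\<lambda>L. (siegel_pt N (siegel_act (pick L) Z), ?u)) (lat ` ?U)"
    proof (rule inj_onI)
      fix L L' assume L: "L \<in> lat ` ?U" "L' \<in> lat ` ?U"
        "(siegel_pt N (siegel_act (pick L) Z), ?u) = (siegel_pt N (siegel_act (pick L') Z), ?u)"
      then show "L = L'" using same pick[OF L(1)] pick[OF L(2)] by auto
    qed
    show "(\<lambda>L. (siegel_pt N (siegel_act (pick L) Z), ?u)) ` lat ` ?U = {x \<in> graph_piece N \<Delta> M. snd x = ?u}"
    proof (intro equalityI subsetI)
      fix x assume "x \<in> (\<lambda>L. (siegel_pt N (siegel_act (pick L) Z), ?u)) ` lat ` ?U"
      then obtain L where L: "L \<in> lat ` ?U" "x = (siegel_pt N (siegel_act (pick L) Z), ?u)" by blast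
      have gU: "pick L \<in> ?U" using pick[OF L(1)] by blast
      have "x = (siegel_pt N (siegel_act (pick L) Z), siegel_pt N (siegel_act M (siegel_act (pick L) Z)))"
        unfolding L(2) fib[OF gU] ..
      then have "x \<in> graph_piece N \<Delta> M" unfolding graph_piece_def using inV[OF gU] by blast
      then show "x \<in> {x \<in> graph_piece N \<Delta> M. snd x = ?u}" using L(2) by simp
    next
      fix x assume "x \<in> {x \<in> graph_piece N \<Delta> M. snd x = ?u}"
      then obtain W where W: "W \<in> Vset \<Delta>" "x = (siegel_pt N W, ?u)" "siegel_pt N (siegel_act M W) = ?u"
        by (auto simp: graph_piece_def)
      obtain g where g: "g \<in> ?U" "siegel_pt N W = siegel_pt N (siegel_act g Z)" using surj[OF W(1,3)] by blast
      have L: "lat g \<in> lat ` ?U" using g(1) by blast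
      have "siegel_pt N W = siegel_pt N (siegel_act (pick (lat g)) Z)"
        unfolding g(2) using same[OF g(1), of "pick (lat g)"] pick[OF L] by auto
      then have "x = (siegel_pt N (siegel_act (pick (lat g)) Z), ?u)" using W(2) by simp
      then show "x \<in> (\<lambda>L. (siegel_pt N (siegel_act (pick L) Z), ?u)) ` lat ` ?U" using L by blast
    qed
  qed
qed

text \<open>
  The fibres are as described outside the image of the points with special endomorphisms.
\<close>
lemma graph_piece_degree:
  assumes ip: "inert_prime \<Delta> p" and cop: "coprime N p" and pM: "psim (real p) M" and lM: "M \<in> int_level N"
    and y: "stable_vector \<Delta> p M y"
  shows "has_map_degree (analytic_X N) snd (graph_piece N \<Delta> M) (full_piece N \<Delta> M) (p + 1)"
  unfolding has_map_degree_def
proof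
  note D = inert_primeD[OF ip]
  show "snd ` graph_piece N \<Delta> M \<subseteq> full_piece N \<Delta> M" by (simp add: snd_graph_piece)
  have Mi: "\<forall>i j. M $ i $ j \<in> \<int>" using lM by (simp add: int_level_iff)
  have Ms: "M \<in> int_sim (real p)" by (rule int_sim_I[OF lM pM])
  obtain e f where ad: "adapted \<Delta> p M e f" using adapted_exists[OF ip pM Mi y] by blast
  interpret lattice_count N \<Delta> p M e f by unfold_locales (rule ip cop pM lM ad)+
  define k where "k = max (real p * real p * real \<Delta> * (real p * real p)) (real p * real p * (real p * real p))"
  define S where "S = piece N \<Delta> M (special \<Delta> k)"
  have Sa: "analytic_X N S" unfolding S_def by (rule piece_analytic[OF D(1) Ms pM, of _ k]) (auto simp: special_def)
  have Ss: "S \<subset> full_piece N \<Delta> M"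
    using special_piece_proper[OF D(1) Ms pM] by (auto simp: S_def piece_def)
  have "finite {x \<in> graph_piece N \<Delta> M. snd x = u} \<and> card {x \<in> graph_piece N \<Delta> M. snd x = u} = p + 1"
    if u: "u \<in> full_piece N \<Delta> M - S" for u
  proof -
    obtain Z where Z: "Z \<in> Vset \<Delta>" "u = siegel_pt N (siegel_act M Z)" using u by (auto simp: full_piece_image)
    have "\<not> moves x Z Z" if "x \<in> special \<Delta> k" for x
      using u Z that by (auto simp: S_def piece_def)
    from fibre_description[OF ip cop pM lM Z(1) this, of k] card_lattices
    show ?thesis unfolding Z(2) by (auto simp: k_def dest: bij_betw_finite bij_betw_same_card)
  qed
  then show "generically (analytic_X N) (full_piece N \<Delta> M)
     (\<lambda>y. finite {x \<in> graph_piece N \<Delta> M. snd x = y} \<and> card {x \<in> graph_piece N \<Delta> M. snd x = y} = p + 1)"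
    unfolding generically_def using Sa Ss by blast
qed

section \<open>Inert primes and the norm form\<close>

lemma sqrt_neg_square: "sqrt_neg \<Delta> * sqrt_neg \<Delta> = - of_nat \<Delta>"
proof -
  have "complex_of_real (sqrt (real \<Delta>)) * complex_of_real (sqrt (real \<Delta>)) = of_nat \<Delta>"
    by (simp flip: of_real_mult)
  moreover have "sqrt_neg \<Delta> * sqrt_neg \<Delta> = (\<i> * \<i>) * (complex_of_real (sqrt (real \<Delta>)) * complex_of_real (sqrt (real \<Delta>)))"
    by (simp only: sqrt_neg_def mult_ac)
  ultimately show ?thesis by simp
qed

lemma ring_of_integers_sel:
  "x \<in> carrier (ring_of_integers \<Delta>) \<longleftrightarrow> x \<in> imag_quad_field \<Delta> \<and> algebraic_int x"
  "x \<otimes>\<^bsub>ring_of_integers \<Delta>\<^esub> y = x * y" "x \<oplus>\<^bsub>ring_of_integers \<Delta>\<^esub> y = x + y"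
  by (simp_all add: ring_of_integers_def)

lemma int_in_ring_of_integers: "of_int a \<in> carrier (ring_of_integers \<Delta>)"
proof -
  have "of_int a = of_rat (of_int a) + of_rat 0 * sqrt_neg \<Delta>" by simp
  then have "of_int a \<in> imag_quad_field \<Delta>" unfolding imag_quad_field_def by blast
  then show ?thesis by (simp add: ring_of_integers_sel)
qed

lemma sqrt_neg_in_ring_of_integers: "sqrt_neg \<Delta> \<in> carrier (ring_of_integers \<Delta>)"
proof -
  have "sqrt_neg \<Delta> = of_rat 0 + of_rat 1 * sqrt_neg \<Delta>" by simp
  then have "sqrt_neg \<Delta> \<in> imag_quad_field \<Delta>" unfolding imag_quad_field_def by blast
  moreover have "algebraic_int (sqrt_neg \<Delta>)"
  proof (rule algebraic_int_root)
    show "algebraic_int (- of_nat \<Delta> :: complex)" by simp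
    show "poly (monom 1 2) (sqrt_neg \<Delta>) = - of_nat \<Delta>" by (simp add: poly_monom power2_eq_square sqrt_neg_square)
  qed (auto simp: degree_monom_eq)
  ultimately show ?thesis by (simp add: ring_of_integers_sel)
qed

lemma cnj_in_ring_of_integers:
  assumes "x \<in> carrier (ring_of_integers \<Delta>)" shows "cnj x \<in> carrier (ring_of_integers \<Delta>)"
proof -
  obtain a b where ab: "x = of_rat a + of_rat b * sqrt_neg \<Delta>" using assms by (auto simp: ring_of_integers_sel imag_quad_field_def)
  have r: "cnj (of_rat q) = of_rat q" for q by (cases q) (simp add: of_rat_rat)
  have "cnj x = of_rat a + of_rat (- b) * sqrt_neg \<Delta>" unfolding ab by (simp add: r sqrt_neg_def of_rat_minus)
  then have "cnj x \<in> imag_quad_field \<Delta>" unfolding imag_quad_field_def by blast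
  then show ?thesis using assms by (simp add: ring_of_integers_sel)
qed

text \<open>
  Rational algebraic integers are integers.
\<close>
lemma int_ratio_in_ring_of_integers:
  assumes p: "p > 0" and x: "x \<in> carrier (ring_of_integers \<Delta>)" "of_nat p * x = of_int m" shows "int p dvd m"
proof -
  have "x = of_int m / of_nat p" using x(2) p by (simp add: field_simps)
  then have "x \<in> \<rat>" by simp
  then have "x \<in> \<int>" using x(1) by (intro rational_algebraic_int_is_int) (simp_all add: ring_of_integers_sel)
  then obtain k where "x = of_int k" by (auto simp: Ints_def)
  then have "(of_int (int p * k) :: complex) = of_int m" using x(2) by simp
  then have "int p * k = m" by (simp only: of_int_eq_iff)
  then show ?thesis by auto
qed

text \<open>
  If \<open>p\<close> divides the norm of \<open>a + b sqrt(-\<Delta>)\<close>, then by primality it divides this element or its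
  conjugate in the ring of integers.  Trace and norm of the quotient are integers, so \<open>p\<close> divides \<open>2a\<close>
  and \<open>p\<^sup>2\<close> divides \<open>a\<^sup>2 + \<Delta> b\<^sup>2\<close>; as \<open>\<Delta>\<close> is squarefree, \<open>p\<close> divides \<open>b\<close>.
\<close>
lemma inert_in_inert_prime:
  assumes sf: "squarefree \<Delta>" and p: "prime p" "odd p" and inert: "inert_in \<Delta> p"
  shows "inert_prime \<Delta> p"
proof -
  let ?R = "ring_of_integers \<Delta>" and ?w = "sqrt_neg \<Delta>"
  interpret primeideal "cgenideal ?R (of_nat p)" ?R using inert by (simp add: inert_in_def)
  have D0: "\<Delta> > 0" using sf by (cases "\<Delta> = 0") auto
  have p0: "p > 0" using p(1) prime_gt_0_nat by blast
  note cl = m_closed[unfolded ring_of_integers_sel(2)] a_closed[unfolded ring_of_integers_sel(3)]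
  have key: "int p dvd a \<and> int p dvd b" if n: "int p dvd a * a + int \<Delta> * (b * b)" for a b
  proof -
    obtain m where m: "a * a + int \<Delta> * (b * b) = int p * m" using n by (auto simp: dvd_def)
    define z where "z s = of_int a + of_int (s * b) * ?w" for s :: int
    have zR: "z s \<in> carrier ?R" for s
      unfolding z_def by (intro cl int_in_ring_of_integers sqrt_neg_in_ring_of_integers)
    have "z 1 * z (-1) = of_int a * of_int a - of_int b * of_int b * (?w * ?w)" by (simp add: z_def algebra_simps)
    also have "\<dots> = of_int (a * a + int \<Delta> * (b * b))" unfolding sqrt_neg_square by (simp add: algebra_simps)
    also have "\<dots> = of_int m * of_nat p" unfolding m by simp
    finally have "z 1 * z (-1) = of_int m \<otimes>\<^bsub>?R\<^esub> of_nat p" by (simp add: ring_of_integers_sel)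
    then have "z 1 \<otimes>\<^bsub>?R\<^esub> z (-1) \<in> cgenideal ?R (of_nat p)"
      unfolding cgenideal_def using int_in_ring_of_integers[of m \<Delta>] by (auto simp: ring_of_integers_sel(2))
    then obtain s where s: "s = 1 \<or> s = -1" "z s \<in> cgenideal ?R (of_nat p)" using I_prime[OF zR zR] by blast
    then obtain x where x: "x \<in> carrier ?R" "z s = x * of_nat p"
      unfolding cgenideal_def ring_of_integers_sel(2) by blast
    note cx = cnj_in_ring_of_integers[OF x(1)]
    have cz: "cnj (z s) = of_int a - of_int (s * b) * ?w" by (simp add: z_def sqrt_neg_def)
    have "of_nat p * (x + cnj x) = z s + cnj (z s)" unfolding x(2) by (simp add: algebra_simps)
    also have "\<dots> = of_int (2 * a)" unfolding cz by (simp add: z_def)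
    finally have "int p dvd 2 * a" by (rule int_ratio_in_ring_of_integers[OF p0 cl(2)[OF x(1) cx]])
    moreover have "coprime (int p) 2" using p(2) by (simp add: coprime_commute)
    ultimately have pa: "int p dvd a" by (simp add: coprime_dvd_mult_right_iff)
    have "of_nat (p * p) * (x * cnj x) = z s * cnj (z s)" unfolding x(2) by (simp add: algebra_simps)
    also have "\<dots> = of_int a * of_int a - (of_int s * of_int s) * (of_int b * of_int b * (?w * ?w))"
      unfolding cz by (simp add: z_def algebra_simps)
    also have "\<dots> = of_int (a * a + int \<Delta> * (b * b))" unfolding sqrt_neg_square using s(1) by (auto simp: algebra_simps)
    finally have "int (p * p) dvd a * a + int \<Delta> * (b * b)"
      using p0 by (intro int_ratio_in_ring_of_integers[OF _ cl(1)[OF x(1) cx]]) simp_all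
    moreover have "int (p * p) dvd a * a" using mult_dvd_mono[OF pa pa] by simp
    ultimately have pp: "int (p * p) dvd int \<Delta> * (b * b)" using dvd_add_right_iff by blast
    have "int p dvd b"
    proof (rule ccontr)
      assume "\<not> int p dvd b"
      then have "coprime (int p) b" using p(1) by (simp add: prime_imp_coprime)
      then have "coprime (int (p * p)) (b * b)" by simp
      then have "int (p * p) dvd int \<Delta>" using pp by (simp add: coprime_dvd_mult_left_iff)
      then have "p\<^sup>2 dvd \<Delta>" by (simp only: power2_eq_square int_dvd_int_iff)
      then show False using squarefreeD[OF sf] p(1) by (metis not_prime_unit)
    qed
    then show ?thesis using pa by blast
  qed
  show ?thesis unfolding inert_prime_def using D0 p key by blast
qed

section \<open>Existence of bad components\<close>

text \<open>
  By \<open>small_system_solution\<close>, fewer than \<open>n\<close> generators cannot produce \<open>n\<close> vectors that are independent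
  modulo \<open>p\<close>.
\<close>
lemma torsion_dim_eq:
  fixes v :: "nat \<Rightarrow> rvec6"
  assumes Z: "Z \<in> siegel_space" and p: "prime p" and W: "W = perm Z ` {(1 / real p) *\<^sub>R w |w. w \<in> L}"
    and L: "L = {real p *\<^sub>R k + (\<Sum>i<n. of_int (c i) *\<^sub>R v i) |k c. k \<in> ivec}"
    and v: "\<And>i. i < n \<Longrightarrow> v i \<in> ivec"
    and ind: "\<And>c i. (1 / real p) *\<^sub>R (\<Sum>i<n. of_int (c i) *\<^sub>R v i) \<in> ivec \<Longrightarrow> i < n \<Longrightarrow> int p dvd c i"
  shows "torsion_dim Z W = n"
proof -
  have p0: "p > 0" "p > 1" using p prime_gt_0_nat prime_gt_1_nat by blast+
  define S where "S = (\<lambda>i. perm Z ((1 / real p) *\<^sub>R v i)) ` {..<n}"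
  have inj: "inj_on (\<lambda>i. perm Z ((1 / real p) *\<^sub>R v i)) {..<n}"
  proof (rule inj_onI)
    fix i j assume ij: "i \<in> {..<n}" "j \<in> {..<n}" "perm Z ((1 / real p) *\<^sub>R v i) = perm Z ((1 / real p) *\<^sub>R v j)"
    then have e: "v i = v j" using perm_inj[OF Z ij(3)] p0 by simp
    show "i = j"
    proof (rule ccontr)
      assume n: "i \<noteq> j"
      define c where "c k = (if k = i then 1 else 0) - (if k = j then 1 else (0::int))" for k
      have "(\<Sum>k<n. of_int (c k) *\<^sub>R v k) = v i - v j"
        using ij(1,2) by (simp add: c_def scaleR_diff_left sum_subtractf if_distrib[of real_of_int] if_distrib[of "\<lambda>x. x *\<^sub>R _"] cong: if_cong)
      then have "int p dvd c i" using ij(1) by (intro ind) (simp_all add: e ivec_arith)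
      then show False using n p0 by (simp add: c_def)
    qed
  qed
  have cS: "card S = n" "finite S" unfolding S_def using card_image[OF inj] by simp_all
  have lin: "perm Z ((1 / real p) *\<^sub>R (real p *\<^sub>R k + (\<Sum>i<n. of_int (c i) *\<^sub>R v i)))
      = perm Z k + (\<Sum>i<n. of_int (c i) *s perm Z ((1 / real p) *\<^sub>R v i))" for k c
  proof -
    have "(1 / real p) *\<^sub>R (real p *\<^sub>R k + (\<Sum>i<n. of_int (c i) *\<^sub>R v i)) = k + (\<Sum>i<n. of_int (c i) *\<^sub>R ((1 / real p) *\<^sub>R v i))"
      using p0 by (simp add: scaleR_add_right scaleR_sum_right mult.commute)
    then show ?thesis by (simp only: perm_arith(1) perm_sum) (simp only: perm_arith(3)[of Z "real_of_int _"] of_real_of_int_eq)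
  qed
  have gen: "torsion_gen Z W S" unfolding torsion_gen_def
  proof (intro conjI equalityI subsetI cS(2))
    fix x assume "x \<in> W"
    then obtain k c where k: "k \<in> ivec" "x = perm Z ((1 / real p) *\<^sub>R (real p *\<^sub>R k + (\<Sum>i<n. of_int (c i) *\<^sub>R v i)))"
      unfolding W L by blast
    define d where "d s = c (the_inv_into {..<n} (\<lambda>i. perm Z ((1 / real p) *\<^sub>R v i)) s)" for s
    have "(\<Sum>s\<in>S. of_int (d s) *s s) = (\<Sum>i<n. of_int (c i) *s perm Z ((1 / real p) *\<^sub>R v i))"
      unfolding S_def sum.reindex[OF inj] by (rule sum.cong) (simp_all add: d_def the_inv_into_f_f[OF inj])
    then have "x = perm Z k + (\<Sum>s\<in>S. of_int (d s) *s s)" unfolding k(2) lin by simp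
    then show "x \<in> {l + (\<Sum>s\<in>S. of_int (c s) *s s) |l c. l \<in> period_lattice Z}"
      using k(1) period_lattice_perm[OF Z] by blast
  next
    fix x assume "x \<in> {l + (\<Sum>s\<in>S. of_int (c s) *s s) |l c. l \<in> period_lattice Z}"
    then obtain l c where "l \<in> period_lattice Z" and x: "x = l + (\<Sum>s\<in>S. of_int (c s) *s s)" by blast
    then obtain k where k: "k \<in> ivec" "l = perm Z k" using period_lattice_perm[OF Z] by blast
    define d where "d i = c (perm Z ((1 / real p) *\<^sub>R v i))" for i
    have "(\<Sum>s\<in>S. of_int (c s) *s s) = (\<Sum>i<n. of_int (d i) *s perm Z ((1 / real p) *\<^sub>R v i))"
      unfolding S_def sum.reindex[OF inj] by (simp add: d_def)
    then have "x = perm Z ((1 / real p) *\<^sub>R (real p *\<^sub>R k + (\<Sum>i<n. of_int (d i) *\<^sub>R v i)))" unfolding x k(2) lin by simp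
    then show "x \<in> W" unfolding W L using k(1) by blast
  qed
  have Li: "L \<subseteq> ivec" unfolding L by (auto intro!: ivec_arith ivec_sum v)
  have vL: "v i \<in> L" if "i < n" for i
  proof -
    have e: "v i = real p *\<^sub>R 0 + (\<Sum>j<n. of_int (if j = i then 1 else 0) *\<^sub>R v j)"
      using that by (simp add: if_distrib[of real_of_int] if_distrib[of "\<lambda>x. x *\<^sub>R _"] cong: if_cong)
    show ?thesis unfolding L by (rule CollectI, intro exI conjI, rule e, rule ivec_arith(1))
  qed
  have low: "n \<le> card T" if T: "torsion_gen Z W T" for T
  proof (rule ccontr)
    assume "\<not> n \<le> card T"
    then have less: "card T < card {..<n}" by simp
    have fT: "finite T" using T by (simp add: torsion_gen_def)
    obtain \<sigma> where \<sigma>: "\<And>s. s \<in> T \<Longrightarrow> \<sigma> s \<in> ivec"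
      "\<And>w. w \<in> L \<Longrightarrow> \<exists>k\<in>ivec. \<exists>c :: complex^3 \<Rightarrow> int. w = real p *\<^sub>R k + (\<Sum>s\<in>T. of_int (c s) *\<^sub>R \<sigma> s)"
      using torsion_gen_lift[OF Z W Li T p0(1)] by blast
    have "\<forall>i. \<exists>kc. i < n \<longrightarrow> fst kc \<in> ivec \<and> v i = real p *\<^sub>R fst kc + (\<Sum>s\<in>T. of_int (snd kc s :: int) *\<^sub>R \<sigma> s)"
    proof
      fix i
      show "\<exists>kc. i < n \<longrightarrow> fst kc \<in> ivec \<and> v i = real p *\<^sub>R fst kc + (\<Sum>s\<in>T. of_int (snd kc s :: int) *\<^sub>R \<sigma> s)"
      proof (cases "i < n")
        case True
        obtain k c where "k \<in> ivec" "v i = real p *\<^sub>R k + (\<Sum>s\<in>T. of_int (c s :: int) *\<^sub>R \<sigma> s)"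
          using \<sigma>(2)[OF vL[OF True]] by blast
        then show ?thesis by (intro exI[of _ "(k, c)"]) simp
      qed simp
    qed
    from choice[OF this] obtain kc where kc0: "\<forall>i. i < n \<longrightarrow> fst (kc i) \<in> ivec \<and>
      v i = real p *\<^sub>R fst (kc i) + (\<Sum>s\<in>T. of_int (snd (kc i) s :: int) *\<^sub>R \<sigma> s)" by (rule exE)
    define k c where "k i = fst (kc i)" and "c i = snd (kc i)" for i
    have kc: "k i \<in> ivec \<and> v i = real p *\<^sub>R k i + (\<Sum>s\<in>T. of_int (c i s) *\<^sub>R \<sigma> s)" if "i < n" for i
      using kc0 that by (simp add: k_def c_def)
    obtain y where y: "\<exists>i\<in>{..<n}. \<not> int p dvd y i" "\<And>s. s \<in> T \<Longrightarrow> int p dvd (\<Sum>i\<in>{..<n}. y i * c i s)"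
      using small_system_solution[OF finite_lessThan fT less p0(2), of c] by blast
    obtain q where q: "\<And>s. s \<in> T \<Longrightarrow> (\<Sum>i<n. y i * c i s) = int p * q s" using y(2) unfolding dvd_def by metis
    have "(\<Sum>i<n. of_int (y i) *\<^sub>R v i) = (\<Sum>i<n. real p *\<^sub>R (of_int (y i) *\<^sub>R k i)) + (\<Sum>i<n. \<Sum>s\<in>T. of_int (y i * c i s) *\<^sub>R \<sigma> s)"
      unfolding sum.distrib[symmetric] by (rule sum.cong) (use kc in \<open>simp_all add: scaleR_add_right scaleR_sum_right mult.commute\<close>)
    also have "(\<Sum>i<n. \<Sum>s\<in>T. of_int (y i * c i s) *\<^sub>R \<sigma> s) = (\<Sum>s\<in>T. of_int (\<Sum>i<n. y i * c i s) *\<^sub>R \<sigma> s)"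
      unfolding of_int_sum scaleR_sum_left by (rule sum.swap)
    also have "\<dots> = (\<Sum>s\<in>T. real p *\<^sub>R (of_int (q s) *\<^sub>R \<sigma> s))" by (rule sum.cong) (simp_all add: q)
    finally have "(1 / real p) *\<^sub>R (\<Sum>i<n. of_int (y i) *\<^sub>R v i) = (\<Sum>i<n. of_int (y i) *\<^sub>R k i) + (\<Sum>s\<in>T. of_int (q s) *\<^sub>R \<sigma> s)"
      using p0(1) by (simp add: scaleR_sum_right scaleR_add_right)
    moreover have "\<dots> \<in> ivec" using kc \<sigma>(1) by (intro ivec_arith ivec_sum) auto
    ultimately show False using ind[of y] y(1) by auto
  qed
  show ?thesis unfolding torsion_dim_gen
  proof (rule Least_equality)
    show "\<exists>S. torsion_gen Z W S \<and> card S = n" using gen cS(1) by blast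
  qed (use low in blast)
qed

text \<open>
  Every odd integer is a difference of consecutive squares, and \<open>-1/\<Delta>\<close> has an odd representative
  modulo \<open>p\<close>.
\<close>
lemma split_norm_exists:
  assumes ip: "inert_prime \<Delta> p" shows "\<exists>x y m. int \<Delta> * (x * x - y * y) = - 1 + int p * m"
proof -
  note D = inert_primeD[OF ip]
  obtain h where h: "h \<in> \<int>" "h * real \<Delta> - 1 \<in> PZ p" using PZ_inverse[OF ip _ Delta_PZ[OF ip]] by auto
  then obtain d where d: "h = of_int d" by (auto simp: Ints_def)
  have "real_of_int (d * int \<Delta> - 1) \<in> PZ p" using h(2) d by simp
  then have dd: "int p dvd d * int \<Delta> - 1" by (simp only: PZ_of_int)
  (* adding the odd number p changes the parity *)
  define t where "t = (if odd d then - d else - d + int p)"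
  have "odd t" using D(3) by (simp add: t_def)
  then obtain s where s: "t = 2 * s + 1" by (auto elim: oddE)
  have "int \<Delta> * ((s + 1) * (s + 1) - s * s) + 1 = int \<Delta> * t + 1" unfolding s by (simp add: algebra_simps)
  also have "int p dvd \<dots>"
  proof -
    have e: "int \<Delta> * t + 1 = - (d * int \<Delta> - 1) + (if odd d then 0 else int p * int \<Delta>)" by (simp add: t_def algebra_simps)
    have "int p dvd - (d * int \<Delta> - 1)" using dd by (simp only: dvd_minus_iff)
    moreover have "int p dvd (if odd d then 0 else int p * int \<Delta>)" by simp
    ultimately show ?thesis unfolding e by (rule dvd_add)
  qed
  finally obtain m where "int \<Delta> * ((s + 1) * (s + 1) - s * s) + 1 = int p * m" by (auto simp: dvd_def)
  then have "int \<Delta> * ((s + 1) * (s + 1) - s * s) = - 1 + int p * m" by linarith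
  then show ?thesis by blast
qed

text \<open>
  With this upper right block, the first and the third row of the Hecke matrix span a plane modulo \<open>p\<close>
  that is stable under \<open>J\<close>, provided that \<open>\<Delta> (x\<^sup>2 - y\<^sup>2) = -1\<close> modulo \<open>p\<close>.
\<close>
definition bad_block :: "int \<Rightarrow> int \<Rightarrow> rmat3" where
  "bad_block x y = (\<chi> i j. if i = 2 \<or> j = 2 then 0 else if i = j then of_int x else of_int y)"

lemma bad_block_nth: "bad_block x y $ 1 $ 1 = of_int x" "bad_block x y $ 1 $ 2 = 0" "bad_block x y $ 1 $ 3 = of_int y"
  "bad_block x y $ 2 $ i = 0" "bad_block x y $ i $ 2 = 0" "bad_block x y $ 3 $ 1 = of_int y" "bad_block x y $ 3 $ 3 = of_int x"
  by (simp_all add: bad_block_def)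

lemma bad_matrix_hecke:
  assumes p: "p > 0" shows "blocks (mat 1) (bad_block x y) 0 (mat (real p)) \<in> hecke_matrices N p"
proof -
  let ?B = "bad_block x y" and ?D = "blocks (mat 1) 0 0 (mat (real p))"
  let ?T = "blocks (mat 1) ?B 0 (mat 1)"
  have tB: "transpose ?B = ?B" by (simp add: vec_eq_iff transpose_def bad_block_def)
  have "?T ** adj ?T = 1 *\<^sub>R mat 1" by (rule blocks_eqI) (simp_all add: block_mult tB)
  then have "psim 1 ?T" by (simp add: psim_def)
  moreover have "?T $ i $ j \<in> \<int>" for i j by (cases i; cases j) (simp_all add: mat_def bad_block_def)
  ultimately have "?T \<in> Gamma0 N" by (simp add: Gamma0_iff int_level_iff level_mult_closed)
  moreover have "blocks (mat 1) ?B 0 (mat (real p)) = mat 1 ** ?D ** ?T" by (simp add: blocks_mult)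
  ultimately show ?thesis unfolding hecke_matrices_def by (intro CollectI exI conjI) (assumption | rule Gamma0_one)+
qed

lemma six_eqI: "r $ Inl 1 = s $ Inl 1 \<Longrightarrow> r $ Inl 2 = s $ Inl 2 \<Longrightarrow> r $ Inl 3 = s $ Inl 3 \<Longrightarrow>
  r $ Inr 1 = s $ Inr 1 \<Longrightarrow> r $ Inr 2 = s $ Inr 2 \<Longrightarrow> r $ Inr 3 = s $ Inr 3 \<Longrightarrow> r = (s::rvec6)"
  by (simp add: vec_eq_iff six_all)

text \<open>
  By the congruence, the first and the third row of the matrix span a plane stable under \<open>J\<close> modulo
  \<open>p\<close>.  Together with the second row and its image under \<open>J\<close> they generate the span.
\<close>
lemma bad_matrix_dim:
  assumes ip: "inert_prime \<Delta> p" and Z: "Z \<in> Vset \<Delta>" and xy: "int \<Delta> * (x * x - y * y) = - 1 + int p * m"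
  shows "torsion_dim Z (OK_span \<Delta> Z (hecke_kernel p (blocks (mat 1) (bad_block x y) 0 (mat (real p))) Z)) = 4"
proof -
  note D = inert_primeD[OF ip]
  define M where "M = blocks (mat 1) (bad_block x y) 0 (mat (real p))"
  have hM: "M \<in> hecke_matrices 1 p" unfolding M_def by (rule bad_matrix_hecke[OF D(4)])
  have pM: "psim (real p) M" by (rule hecke_facts(2)[OF D(4) hM])
  have Mi: "\<forall>i j. M $ i $ j \<in> \<int>" using hecke_facts(1)[OF D(4) hM] by (simp add: int_level_iff)
  define v where "v i = [mkvec 1 0 0 x 0 y, mkvec 0 0 1 y 0 x, mkvec 0 1 0 0 0 0, mkvec 0 0 0 0 1 0] ! i" for i :: nat
  have four: "(\<Sum>i<4. c i *\<^sub>R v i) = c 0 *\<^sub>R mkvec 1 0 0 x 0 y + c 1 *\<^sub>R mkvec 0 0 1 y 0 x + c 2 *\<^sub>R mkvec 0 1 0 0 0 0 + c 3 *\<^sub>R mkvec 0 0 0 0 1 0"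
    for c by (simp add: v_def eval_nat_numeral)
  have xyr: "real \<Delta> * (x * x - y * y) = - 1 + real p * m"
  proof -
    have "real_of_int (int \<Delta> * (x * x - y * y)) = real_of_int (- 1 + int p * m)" by (simp only: xy)
    then show ?thesis by simp
  qed
  have Mn: "(r v* M) $ Inl 1 = r $ Inl 1" "(r v* M) $ Inl 2 = r $ Inl 2" "(r v* M) $ Inl 3 = r $ Inl 3"
    "(r v* M) $ Inr 1 = x * r $ Inl 1 + y * r $ Inl 3 + p * r $ Inr 1"
    "(r v* M) $ Inr 2 = p * r $ Inr 2" "(r v* M) $ Inr 3 = y * r $ Inl 1 + x * r $ Inl 3 + p * r $ Inr 3" for r
    by (simp_all add: vm_blocks M_def sum_3 bad_block_nth mat_def)
  have mkl: "r \<in> lat M" if "a \<in> ivec" "a v* M = r" for a r using that by (auto simp: lat_def)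
  have vl: "mkvec 1 0 0 x 0 y \<in> lat M" "mkvec 0 0 1 y 0 x \<in> lat M" "mkvec 0 1 0 0 0 0 \<in> lat M"
    by (rule mkl[of "mkvec 1 0 0 0 0 0"] mkl[of "mkvec 0 0 1 0 0 0"] mkl[of "mkvec 0 1 0 0 0 0"],
        simp add: ivec_def six_all, rule six_eqI; simp add: Mn)+
  have v4: "mkvec 0 0 0 0 1 0 = mkvec 0 1 0 0 0 0 v* Jm \<Delta>" by (rule six_eqI) (simp_all add: vJ_nth)
  have L: "lat_span \<Delta> M = {real p *\<^sub>R k + (\<Sum>i<4. of_int (c i) *\<^sub>R v i) |k c. k \<in> ivec}"
  proof (intro equalityI subsetI)
    fix w assume "w \<in> lat_span \<Delta> M"
    then obtain r s where rs: "r \<in> ivec" "s \<in> ivec" "w = r v* M + (s v* M) v* Jm \<Delta>"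
      by (auto simp: lat_span_def lat_def)
    define R where "R i = \<lfloor>r $ i\<rfloor>" for i
    define S where "S i = \<lfloor>s $ i\<rfloor>" for i
    have RS: "r $ i = of_int (R i)" "s $ i = of_int (S i)" for i
      unfolding R_def S_def by (rule int_of_ivec[OF rs(1), symmetric] int_of_ivec[OF rs(2), symmetric])+
    define c where "c i = [R (Inl 1) - int \<Delta> * (x * S (Inl 1) + y * S (Inl 3)),
       R (Inl 3) + int \<Delta> * (y * S (Inl 1) + x * S (Inl 3)), R (Inl 2), S (Inl 2)] ! i" for i :: nat
    define k where "k = mkvec (- real \<Delta> * s $ Inr 1) (- real \<Delta> * s $ Inr 2) (real \<Delta> * s $ Inr 3)
       (r $ Inr 1 + m * s $ Inl 1) (r $ Inr 2) (r $ Inr 3 - m * s $ Inl 3)"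
    have ki: "k \<in> ivec" using rs(1,2) by (simp add: k_def ivec_def six_all)
    have c4: "c 0 = R (Inl 1) - int \<Delta> * (x * S (Inl 1) + y * S (Inl 3))"
       "c 1 = R (Inl 3) + int \<Delta> * (y * S (Inl 1) + x * S (Inl 3))" "c 2 = R (Inl 2)" "c 3 = S (Inl 2)"
      by (simp_all add: c_def)
    have e4: "s $ Inl 1 * (real \<Delta> * (x * x - y * y)) = s $ Inl 1 * (- 1 + real p * m)"
      "s $ Inl 3 * (real \<Delta> * (x * x - y * y)) = s $ Inl 3 * (- 1 + real p * m)" unfolding xyr by simp_all
    have "w = real p *\<^sub>R k + (\<Sum>i<4. of_int (c i) *\<^sub>R v i)"
      unfolding four rs(3)
      by (rule six_eqI) (use e4 in \<open>simp_all add: Mn vJ_nth k_def c4 c4(2)[unfolded One_nat_def] RS[symmetric] algebra_simps\<close>)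
    then show "w \<in> {real p *\<^sub>R k + (\<Sum>i<4. of_int (c i) *\<^sub>R v i) |k c. k \<in> ivec}" using ki by blast
  next
    fix w assume "w \<in> {real p *\<^sub>R k + (\<Sum>i<4. of_int (c i) *\<^sub>R v i) |k c. k \<in> ivec}"
    then obtain k c where k: "k \<in> ivec" "w = real p *\<^sub>R k + (\<Sum>i<4. of_int (c i) *\<^sub>R v i)" by blast
    have m: "mkvec 1 0 0 x 0 y \<in> lat_span \<Delta> M" "mkvec 0 0 1 y 0 x \<in> lat_span \<Delta> M" "mkvec 0 1 0 0 0 0 \<in> lat_span \<Delta> M"
      "mkvec 0 0 0 0 1 0 \<in> lat_span \<Delta> M"
      using vl unfolding v4 by (simp_all only: lat_span_props(5,6)[OF pM Mi])
    note A = lat_span_props(3)[OF pM Mi] and B = lat_span_props(4)[OF pM Mi _ Ints_of_int]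
    show "w \<in> lat_span \<Delta> M" unfolding k(2) four
      by (rule A[OF lat_span_props(2)[OF pM Mi k(1)] A[OF A[OF A[OF B[OF m(1)] B[OF m(2)]] B[OF m(3)]] B[OF m(4)]]])
  qed
  have vi: "v i \<in> ivec" if "i < 4" for i
  proof -
    have "i = 0 \<or> i = 1 \<or> i = 2 \<or> i = 3" using that by auto
    then show ?thesis by (auto simp: v_def ivec_def six_all)
  qed
  have ind: "int p dvd c i" if c: "(1 / real p) *\<^sub>R (\<Sum>i<4. of_int (c i) *\<^sub>R v i) \<in> ivec" "i < 4" for c i
  proof -
    have "real_of_int (c 0) \<in> PZ p" "real_of_int (c 1) \<in> PZ p" "real_of_int (c 2) \<in> PZ p" "real_of_int (c 3) \<in> PZ p"
      using c(1) unfolding ivec_PZ[OF D(4)] six_all four by simp_all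
    then have "int p dvd c 0" "int p dvd c 1" "int p dvd c 2" "int p dvd c 3" by (simp_all only: PZ_of_int)
    moreover have "i = 0 \<or> i = 1 \<or> i = 2 \<or> i = 3" using c(2) by auto
    ultimately show ?thesis by auto
  qed
  show ?thesis
    unfolding M_def[symmetric]
    by (rule torsion_dim_eq[where v = v and L = "lat_span \<Delta> M", OF Vset_siegel[OF Z] D(2) OK_span_perm[OF D(1) pM Z D(4)] L])
      (use vi ind in blast)+
qed

lemma bad_component_exists:
  assumes ip: "inert_prime \<Delta> p" and N: "N > 0" shows "\<exists>Y. bad_component N \<Delta> p Y"
proof -
  note D = inert_primeD[OF ip]
  obtain x y m where xy: "int \<Delta> * (x * x - y * y) = - 1 + int p * m" using split_norm_exists[OF ip] by blast
  define M where "M = blocks (mat 1) (bad_block x y) 0 (mat (real p))"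
  have hM: "M \<in> hecke_matrices N p" unfolding M_def by (rule bad_matrix_hecke[OF D(4)])
  have "irreducible_component (analytic_X N) (hecke_image_V N \<Delta> p) (full_piece N \<Delta> M)"
    unfolding hecke_image_components[OF D(1,4) N] using hM by blast
  moreover have "generically (analytic_X N) (shimura_V N \<Delta>) (\<lambda>t. \<exists>u\<in>full_piece N \<Delta> M. bad_point N \<Delta> p t u)"
    unfolding generically_def
  proof (intro exI conjI ballI)
    show "analytic_X N {}" by (rule analytic_X_closed(3))
    show "{} \<subset> shimura_V N \<Delta>" using shimura_V_eq[OF D(1), of N] Vset_nonempty[OF D(1)] by auto
    fix t assume "t \<in> shimura_V N \<Delta> - {}"
    then obtain Z where Z: "Z \<in> Vset \<Delta>" "t = siegel_pt N Z" unfolding shimura_V_eq[OF D(1)] by blast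
    have "bad_point N \<Delta> p t (siegel_pt N (siegel_act M Z))"
      unfolding bad_point_def hV_eq[OF D(1)] using Z hM bad_matrix_dim[OF ip Z(1) xy] unfolding M_def by blast
    then show "\<exists>u\<in>full_piece N \<Delta> M. bad_point N \<Delta> p t u" unfolding full_piece_image using Z(1) by blast
  qed
  ultimately show ?thesis unfolding bad_component_def by blast
qed

section \<open>From bad components to stable vectors\<close>

text \<open>
  Let \<open>Y\<close> be the piece of \<open>M\<close>.  A generic point of the ball is related to a bad point on \<open>Y\<close> by some \<open>M'\<close>
  with a stable vector and by group elements; as for \<open>full_piece_sub\<close>, a single choice of these works
  for the whole ball, and the pieces of \<open>M\<close> and \<open>M'\<close> coincide.
\<close>
lemma bad_component_stable:
  assumes ip: "inert_prime \<Delta> p" and N: "N > 0" and Y: "bad_component N \<Delta> p Y"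
  shows "\<exists>M\<in>hecke_matrices N p. Y = full_piece N \<Delta> M \<and> (\<exists>y. stable_vector \<Delta> p M y)"
proof -
  note D = inert_primeD[OF ip]
  obtain M where M: "M \<in> hecke_matrices N p" "Y = full_piece N \<Delta> M"
    using Y unfolding bad_component_def hecke_image_components[OF D(1,4) N] by blast
  note fM = hecke_facts[OF D(4) M(1)]
  obtain S where S: "analytic_X N S" "S \<subset> shimura_V N \<Delta>" "\<And>t. t \<in> shimura_V N \<Delta> - S \<Longrightarrow> \<exists>u\<in>Y. bad_point N \<Delta> p t u"
    using Y unfolding bad_component_def generically_def by blast
  define Q where "Q = {(M', \<gamma>, \<gamma>'). M' \<in> hecke_matrices N p \<and> (\<exists>y. stable_vector \<Delta> p M' y) \<and> \<gamma> \<in> Gamma0 N \<and> \<gamma>' \<in> Gamma0 N}"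
  define mv :: "rmat6 \<times> rmat6 \<times> rmat6 \<Rightarrow> rmat6" where "mv q = (case q of (M', \<gamma>, \<gamma>') \<Rightarrow> adj M ** \<gamma>' ** M' ** \<gamma>)" for q
  define fx where "fx q = (adj (fst (snd q)) ** Jm \<Delta> ** adj (adj (fst (snd q))), adj (mv q) ** Jm \<Delta> ** adj (adj (mv q)))" for q
  have mvQ: "psim (real p * 1 * real p * 1) (mv q) \<and> mv q \<in> int_sim (real p * 1 * real p * 1)" if "q \<in> Q" for q
  proof -
    obtain M' \<gamma> \<gamma>' where qe: "q = (M', \<gamma>, \<gamma>')" by (rule prod_cases3)
    then have q: "q = (M', \<gamma>, \<gamma>')" "M' \<in> hecke_matrices N p" "\<gamma> \<in> Gamma0 N" "\<gamma>' \<in> Gamma0 N"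
      using that by (simp_all add: Q_def)
    note f' = hecke_facts[OF D(4) q(2)]
    have "mv q = adj M ** \<gamma>' ** M' ** \<gamma>" by (simp add: mv_def q(1))
    moreover have "psim (real p * 1 * real p * 1) (adj M ** \<gamma>' ** M' ** \<gamma>)"
      by (intro psim_mult f'(2) Gamma0_psim[OF q(3)] Gamma0_psim[OF q(4)]) (simp add: fM(2))
    moreover have "adj M ** \<gamma>' ** M' ** \<gamma> \<in> int_sim (real p * 1 * real p * 1)"
      by (intro int_sim_mult f'(3) int_sim_Gamma0[OF q(3)] int_sim_Gamma0[OF q(4)] int_sim_adj fM(3))
    ultimately show ?thesis by simp
  qed
  define K where "K = max (1 * real \<Delta> * 1) ((real p * 1 * real p * 1) * real \<Delta> * (real p * 1 * real p * 1))"
  have P: "fx ` Q \<subseteq> int_sim K \<times> int_sim K"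
  proof
    fix P assume "P \<in> fx ` Q"
    then obtain q where q: "q \<in> Q" "P = fx q" by blast
    have g: "fst (snd q) \<in> int_sim 1" using q(1) int_sim_Gamma0 by (auto simp: Q_def)
    have "adj (fst (snd q)) ** Jm \<Delta> ** adj (adj (fst (snd q))) \<in> int_sim (1 * real \<Delta> * 1)"
      by (intro int_sim_mult int_sim_adj int_sim_Jm[OF D(1)] g)
    moreover have "adj (mv q) ** Jm \<Delta> ** adj (adj (mv q)) \<in> int_sim ((real p * 1 * real p * 1) * real \<Delta> * (real p * 1 * real p * 1))"
      using mvQ[OF q(1)] by (intro int_sim_mult int_sim_adj int_sim_Jm[OF D(1)]) auto
    ultimately have "adj (fst (snd q)) ** Jm \<Delta> ** adj (adj (fst (snd q))) \<in> int_sim K"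
      "adj (mv q) ** Jm \<Delta> ** adj (adj (mv q)) \<in> int_sim K"
      unfolding K_def by (auto elim: int_sim_mono[rotated])
    then show "P \<in> int_sim K \<times> int_sim K" by (simp add: q(2) fx_def)
  qed
  have "Vset \<Delta> \<subseteq> pre_pt N S \<union> (\<Union>P\<in>fx ` Q. fix_set P)"
  proof
    fix Z assume Z: "Z \<in> Vset \<Delta>"
    note Zs = Vset_siegel[OF Z]
    show "Z \<in> pre_pt N S \<union> (\<Union>P\<in>fx ` Q. fix_set P)"
    proof (cases "siegel_pt N Z \<in> S")
      case True
      then show ?thesis using Zs by (simp add: pre_pt_def)
    next
      case False
      then have "siegel_pt N Z \<in> shimura_V N \<Delta> - S" using Z shimura_V_eq[OF D(1), of N] by blast
      then obtain u where u: "u \<in> Y" "bad_point N \<Delta> p (siegel_pt N Z) u" using S(3) by blast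
      obtain Z1 M' where Z1: "Z1 \<in> Vset \<Delta>" "M' \<in> hecke_matrices N p" "siegel_pt N Z1 = siegel_pt N Z"
        "siegel_pt N (siegel_act M' Z1) = u" "torsion_dim Z1 (OK_span \<Delta> Z1 (hecke_kernel p M' Z1)) = 4"
        using u(2) unfolding bad_point_def hV_eq[OF D(1)] by blast
      note f' = hecke_facts[OF D(4) Z1(2)] and Z1s = Vset_siegel[OF Z1(1)]
      have "\<forall>i j. M' $ i $ j \<in> \<int>" using f'(1) by (simp add: int_level_iff)
      then have st: "\<exists>y. stable_vector \<Delta> p M' y" by (rule bad_stable_vector[OF D(1,2) f'(2) _ Z1(1,5)])
      obtain W where W: "W \<in> Vset \<Delta>" "u = siegel_pt N (siegel_act M W)" using u(1) unfolding M(2) full_piece_image by blast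
      note Ws = Vset_siegel[OF W(1)]
      obtain \<gamma> where g: "\<gamma> \<in> Gamma0 N" "Z1 = siegel_act \<gamma> Z" using siegel_pt_eq[OF Zs Z1s] Z1(3) by metis
      obtain \<gamma>' where g': "\<gamma>' \<in> Gamma0 N" "siegel_act M W = siegel_act \<gamma>' (siegel_act M' Z1)"
        using siegel_pt_eq[OF act_siegel[OF f'(2) Z1s] act_siegel[OF fM(2) Ws]] Z1(4) W(2) by metis
      define q where "q = (M', \<gamma>, \<gamma>')"
      have q: "q \<in> Q" using Z1(2) st g(1) g'(1) by (simp add: Q_def q_def)
      note pq = conjunct1[OF mvQ[OF q]]
      have pg: "psim 1 \<gamma>" and pg': "psim 1 \<gamma>'" using g(1) g'(1) Gamma0_psim by blast+
      have "moves (adj M ** (\<gamma>' ** (M' ** \<gamma>))) Z W"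
      proof (rule moves_comp(1), rule moves_comp(1), rule moves_comp(1))
        show "moves \<gamma> Z Z1" unfolding g(2) by (rule act_moves[OF pg Zs])
        show "moves M' Z1 (siegel_act M' Z1)" by (rule act_moves[OF f'(2) Z1s])
        show "moves \<gamma>' (siegel_act M' Z1) (siegel_act M W)" unfolding g'(2) by (rule act_moves[OF pg' act_siegel[OF f'(2) Z1s]])
        show "moves (adj M) (siegel_act M W) W" by (rule moves_adj[OF fM(2) Ws act_moves[OF fM(2) Ws]])
      qed
      then have mZ: "moves (mv q) Z W" by (simp add: mv_def q_def matrix_mul_assoc)
      have "Z = siegel_act (adj (mv q)) W" using moves_adj[OF pq Zs mZ] moves_iff_act[of _ "adj (mv q)" W Z] pq Ws by simp
      then have 2: "moves (adj (mv q) ** Jm \<Delta> ** adj (adj (mv q))) Z Z"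
        using fix_conj[of _ "adj (mv q)" W "Jm \<Delta>"] pq Ws W(1) by (simp add: Vset_def)
      have "Z = siegel_act (adj \<gamma>) Z1" unfolding g(2) by (rule act_adj(1)[OF pg Zs, symmetric])
      then have "moves (adj \<gamma> ** Jm \<Delta> ** adj (adj \<gamma>)) Z Z"
        using fix_conj[of 1 "adj \<gamma>" Z1 "Jm \<Delta>"] pg Z1s Z1(1) by (simp add: Vset_def)
      then have "Z \<in> fix_set (fx q)" using 2 Zs by (simp add: fix_set_def fx_def q_def)
      then show ?thesis using q by blast
    qed
  qed
  moreover have "analytic_subset siegel_space (pre_pt N S)" using S(1) by (simp add: analytic_X_def pre_pt_def)
  moreover have "\<not> Vset \<Delta> \<subseteq> pre_pt N S" using S(2) unfolding shimura_V_eq[OF D(1)] pre_pt_def by blast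
  ultimately obtain q where q: "q \<in> Q" "Vset \<Delta> \<subseteq> fix_set (fx q)" using Vset_cover[OF D(1) _ P] by blast
  obtain M' \<gamma> \<gamma>' where qe: "q = (M', \<gamma>, \<gamma>')" by (rule prod_cases3)
  then have Q: "M' \<in> hecke_matrices N p" "\<exists>y. stable_vector \<Delta> p M' y"
    "\<gamma> \<in> Gamma0 N" "\<gamma>' \<in> Gamma0 N" using q(1) by (simp_all add: Q_def)
  note pg = Gamma0_psim[OF Q(3)]
  have adj_com: "h ** Jm \<Delta> = Jm \<Delta> ** h" if "adj h ** Jm \<Delta> = Jm \<Delta> ** adj h" for h
    using arg_cong[OF that, of adj] by (simp add: adj_mult adj_Jm mmult_simps)
  have c1: "adj \<gamma> ** Jm \<Delta> = Jm \<Delta> ** adj \<gamma>"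
    by (rule normalizer_commutes[OF D(1), of 1]) (use pg q(2) in \<open>auto simp: fix_set_def fx_def qe\<close>)
  have c2: "mv q ** Jm \<Delta> = Jm \<Delta> ** mv q"
    by (rule adj_com, rule normalizer_commutes[OF D(1), of "real p * 1 * real p * 1"])
      (use mvQ[OF q(1)] q(2) in \<open>auto simp: fix_set_def fx_def\<close>)
  define h where "h = adj M ** \<gamma>' ** M'"
  have "mv q ** adj \<gamma> = h ** (\<gamma> ** adj \<gamma>)" by (simp add: mv_def qe h_def matrix_mul_assoc)
  then have he: "h = mv q ** adj \<gamma>" by (simp add: psim_right[OF pg])
  have "h ** Jm \<Delta> = mv q ** (adj \<gamma> ** Jm \<Delta>)" by (simp only: he matrix_mul_assoc)
  also have "\<dots> = (mv q ** Jm \<Delta>) ** adj \<gamma>" by (simp only: c1 matrix_mul_assoc)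
  also have "\<dots> = Jm \<Delta> ** h" by (simp only: c2 he matrix_mul_assoc)
  finally have "full_piece N \<Delta> M = full_piece N \<Delta> M'"
    by (rule full_piece_commute[OF fM(2) hecke_facts(2)[OF D(4) Q(1)] Q(4) h_def])
  then show ?thesis using Q(1,2) M(2) by blast
qed

theorem proposition3p4p3:
  fixes \<Delta> p N :: nat
  assumes "squarefree \<Delta>"
    and "class_number \<Delta> = 1"
    and "prime p" and "odd p" and "inert_in \<Delta> p"
    and "N > 0" and "coprime N p"
    and "\<And>l. prime l \<Longrightarrow> l dvd N \<Longrightarrow> splits_in \<Delta> l"
  shows "(\<exists>Y. bad_component N \<Delta> p Y) \<and>
    (\<forall>Y. bad_component N \<Delta> p Y \<longrightarrow>
       (\<exists>G. graph_over N \<Delta> p Y G) \<and>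
       (\<forall>G. graph_over N \<Delta> p Y G \<longrightarrow> has_map_degree (analytic_X N) snd G Y (p + 1)))"
proof (intro conjI allI impI)
  have ip: "inert_prime \<Delta> p" by (rule inert_in_inert_prime[OF assms(1,3-5)])
  note D = inert_primeD[OF ip]
  show "\<exists>Y. bad_component N \<Delta> p Y" by (rule bad_component_exists[OF ip assms(6)])
  fix Y assume Y: "bad_component N \<Delta> p Y"
  obtain M y where M: "M \<in> hecke_matrices N p" "Y = full_piece N \<Delta> M" and y: "stable_vector \<Delta> p M y"
    using bad_component_stable[OF ip assms(6) Y] by blast
  note fM = hecke_facts[OF D(4) M(1)]
  show "\<exists>G. graph_over N \<Delta> p Y G"
    unfolding graph_over_def hecke_graph_components[OF D(1,4) assms(6)] using M snd_graph_piece by blast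
  fix G assume "graph_over N \<Delta> p Y G"
  then obtain M' where M': "M' \<in> hecke_matrices N p" "G = graph_piece N \<Delta> M'" "Y = full_piece N \<Delta> M'"
    unfolding graph_over_def hecke_graph_components[OF D(1,4) assms(6)] using snd_graph_piece by blast
  note fM' = hecke_facts[OF D(4) M'(1)]
  have ints: "\<forall>i j. M $ i $ j \<in> \<int>" "\<forall>i j. M' $ i $ j \<in> \<int>" using fM(1) fM'(1) by (simp_all add: int_level_iff)
  have "full_piece N \<Delta> M \<subseteq> full_piece N \<Delta> M'" using M(2) M'(3) by simp
  then obtain \<gamma> where g: "\<gamma> \<in> Gamma0 N" "(adj M ** \<gamma> ** M') ** Jm \<Delta> = Jm \<Delta> ** (adj M ** \<gamma> ** M')"
    by (rule full_piece_sub[OF D(1) fM(3,2) fM'(3,2)])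
  obtain y' where "stable_vector \<Delta> p M' y'"
    using stable_vector_transfer[OF D(4) fM(2) ints(1) fM'(2) ints(2) g y] by blast
  then show "has_map_degree (analytic_X N) snd G Y (p + 1)"
    unfolding M'(2,3) by (rule graph_piece_degree[OF ip assms(7) fM'(2,1)])
qed

end
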